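(* (a) For any $c\in(0,1]$ there exist $\overline{\rho}_*>\underline{\rho}_*(c)>0$, a function $\rho\mapsto\underline{\lambda}_{\rho,c}$ which is strictly decreasing on $(0,\underline{\rho}_*(c)]$ and a function $\rho\mapsto\overline{\lambda}_{\rho}$ which is strictly decreasing on $(0,\overline{\rho}_*]$, with $$\underline{\lambda}_{\underline{\rho}_*(c),c}=8\pi=\overline{\lambda}_{\overline{\rho}_*},\qquad \underline{\lambda}_{\rho,c}\simeq\frac{4\pi c}{(8-c)\rho},\quad \overline{\lambda}_\rho\simeq\frac{11\pi}{16\rho}\quad\text{as }\rho\to0^+,$$ such that the following holds. Let $\rho\in(0,\underline{\rho}_*(c)]$ and let $\Omega\subset\mathbb{R}^2$ be a simple domain with $$\{\rho^2x^2+y^2\le\beta_-^2\}\subset\Omega\subset\{\rho^2x^2+y^2\le\beta_+^2\},\qquad c=\frac{\beta_-^2}{\beta_+^2},$$ for some $\beta_\pm>0$. Then there is a number $\lambda_{\rho,c}$ with $\underline{\lambda}_{\rho,c}<\lambda_{\rho,c}<\overline{\lambda}_\rho$ such that for any $\lambda\le\lambda_{\rho,c}$ there exists a solution $u^{(\lambda)}$ of $P(\lambda,\Omega)$. (b) There exist $\bar N>4\pi$ and functions $N\mapsto\underline{\Lambda}_N$, $N\mapsto\overline{\Lambda}_N$, strictly increasing in $N\ge\bar N$, with $$\underline{\Lambda}_{\bar N}=8\pi,\qquad \underline{\Lambda}_N=\frac{\pi^2N}{496}+O(1),\quad \overline{\Lambda}_N=\frac{33\sqrt3\,N}{16\pi}+O(1)\quad\text{as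 }N\to+\infty,$$ such that if $\Omega\subset\mathbb{R}^2$ is an open, bounded and convex set (therefore simple) whose isoperimetric ratio $N\equiv N(\Omega)=\frac{L^2(\partial\Omega)}{A(\Omega)}$ satisfies $N\ge\bar N$, then there is a number $\lambda_N$ with $\underline{\Lambda}_N<\lambda_N<\overline{\Lambda}_N$ such that for any $\lambda\le\lambda_N$ there exists a solution $u^{(\lambda)}$ of $P(\lambda,\Omega)$.
   Context: A bounded, open, simply connected set $\Omega\subset\mathbb{R}^2$ is called simple if $\partial\Omega$ is the support of a simple and rectifiable Jordan curve. A simple domain is called regular if: (i) $\partial\Omega$ is the support of a continuous, piecewise $C^2$ curve $\gamma$ with bounded first derivative and at most finitely many corner-type points $p_1,\dots,p_m$, i.e. the inner angle $\theta_j$ formed by the limiting tangents at $p_j$ is well defined and $\theta_j\in(0,2\pi)\setminus\{\pi\}$; (ii) for each $p_j$ there is a conformal bijection from an open neighborhood $U$ of $p_j$ which maps $U\cap\partial\Omega$ onto a curve of class $C^2$. $A(\Omega)$ is the area of $\Omega$ and $L(\partial\Omega)$ is the length of its boundary. For $\lambda\in\mathbb{R}$, $P(\lambda,\Omega)$ is the problem $$-\Delta u=\lambda\frac{e^u}{\int_\Omega e^u}\ \text{ in }\Omega,\qquad u=0\ \text{ on }\partial\Omega.$$ If $\Omega$ is regular, a solution means an $H^1_0(\Omega)$ weak solution; if $\Omega$ is just assumed to be simple, a solution means a classical solution $u\in C^2(\Omega)\cap C^0(\overline\Omega)$. (On a regular domain any weak solution is also a classical $C^2(\Omega)\cap C^0(\overline\Omega)$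 solution.) The symbol $\simeq$ means asymptotic equivalence (ratio tending to $1$). *)

theory Defs
  imports "HOL-Complex_Analysis.Complex_Analysis" "HOL-Library.Landau_Symbols"
begin

text \<open>The plane \<open>\<real>\<^sup>2\<close> is the Euclidean space \<^typ>\<open>complex\<close>, with \<open>x = Re z\<close> and \<open>y = Im z\<close>.\<close>

subsection \<open>Derivatives\<close>

text \<open>Directional derivative; for \<open>i \<in> Basis\<close> this is the partial derivative, and for functions on
  \<^typ>\<open>real\<close> the direction \<open>1\<close> gives the ordinary derivative.\<close>

definition pd :: "'a \<Rightarrow> ('a::euclidean_space \<Rightarrow> 'b::real_normed_vector) \<Rightarrow> 'a \<Rightarrow> 'b" where
  "pd i u x = vector_derivative (\<lambda>t::real. u (x + t *\<^sub>R i)) (at 0)"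

text \<open>\<open>C\<^sup>k(S)\<close>, meant for open \<open>S\<close>; only the values of \<open>u\<close> on \<open>S\<close> matter then.\<close>

fun Ck_on :: "nat \<Rightarrow> 'a set \<Rightarrow> ('a::euclidean_space \<Rightarrow> 'b::real_normed_vector) \<Rightarrow> bool" where
  "Ck_on 0 S u \<longleftrightarrow> continuous_on S u"
| "Ck_on (Suc k) S u \<longleftrightarrow> continuous_on S u \<and>
     (\<forall>i\<in>Basis. (\<forall>x\<in>S. (\<lambda>t::real. u (x + t *\<^sub>R i)) differentiable (at 0)) \<and> Ck_on k S (pd i u))"

definition grad :: "('a::euclidean_space \<Rightarrow> real) \<Rightarrow> 'a \<Rightarrow> 'a" where
  "grad u x = (\<Sum>i\<in>Basis. pd i u x *\<^sub>R i)"

definition laplacian :: "('a::euclidean_space \<Rightarrow> real) \<Rightarrow> 'a \<Rightarrow> real" where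
  "laplacian u x = (\<Sum>i\<in>Basis. pd i (pd i u) x)"


subsection \<open>Simple domains\<close>

definition polygon_sums :: "(real \<Rightarrow> 'a::metric_space) \<Rightarrow> real set" where
  "polygon_sums \<gamma> = {(\<Sum>i<n. dist (\<gamma> (t i)) (\<gamma> (t (Suc i)))) | (n::nat) (t::nat \<Rightarrow> real).
      (\<forall>i\<le>n. t i \<in> {0..1}) \<and> (\<forall>i<n. t i \<le> t (Suc i))}"

definition rectifiable :: "(real \<Rightarrow> 'a::metric_space) \<Rightarrow> bool" where
  "rectifiable \<gamma> \<longleftrightarrow> bdd_above (polygon_sums \<gamma>)"

definition curve_length :: "(real \<Rightarrow> 'a::metric_space) \<Rightarrow> real" where
  "curve_length \<gamma> = Sup (polygon_sums \<gamma>)"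

definition rectifiable_jordan_curve :: "(real \<Rightarrow> complex) \<Rightarrow> bool" where
  "rectifiable_jordan_curve \<gamma> \<longleftrightarrow>
     simple_path \<gamma> \<and> pathfinish \<gamma> = pathstart \<gamma> \<and> rectifiable \<gamma>"

definition simple_domain :: "complex set \<Rightarrow> bool" where
  "simple_domain \<Omega> \<longleftrightarrow> bounded \<Omega> \<and> open \<Omega> \<and> simply_connected \<Omega> \<and>
     (\<exists>\<gamma>. rectifiable_jordan_curve \<gamma> \<and> path_image \<gamma> = frontier \<Omega>)"

definition area :: "complex set \<Rightarrow> real" where
  "area \<Omega> = measure lebesgue \<Omega>"

text \<open>The length does not depend on the Jordan parametrization chosen. The value is meaningful
  only if the boundary is a rectifiable Jordan curve.\<close>

definition boundary_length :: "complex set \<Rightarrow> real" where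
  "boundary_length \<Omega> =
     curve_length (SOME \<gamma>. rectifiable_jordan_curve \<gamma> \<and> path_image \<gamma> = frontier \<Omega>)"

definition isoperimetric_ratio :: "complex set \<Rightarrow> real" where
  "isoperimetric_ratio \<Omega> = (boundary_length \<Omega>)\<^sup>2 / area \<Omega>"


subsection \<open>Regular domains\<close>

text \<open>Boundary curves are parametrized by 1-periodic functions on the line, so that the base point
  of the loop plays no special role. With \<open>\<Omega>\<close> to the left of \<open>\<gamma>\<close>, the inner angle at \<open>\<gamma> s\<close> is swept
  counterclockwise from the outgoing tangent \<open>w\<close> to \<open>-v\<close>, where \<open>v\<close> is the incoming tangent.
  As \<^const>\<open>Arg2pi\<close> has values in \<open>[0, 2\<pi>)\<close>, both kinds of cusps (angles \<open>0\<close> and \<open>2\<pi>\<close>) give \<open>0\<close>.\<close>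

definition has_inner_angle :: "(real \<Rightarrow> complex) \<Rightarrow> real \<Rightarrow> real \<Rightarrow> bool" where
  "has_inner_angle \<gamma> s \<theta> \<longleftrightarrow> (\<exists>v w.
     ((\<lambda>t. sgn (vector_derivative \<gamma> (at t))) \<longlongrightarrow> v) (at_left s) \<and>
     ((\<lambda>t. sgn (vector_derivative \<gamma> (at t))) \<longlongrightarrow> w) (at_right s) \<and>
     \<theta> = Arg2pi (- v / w))"

definition C2_curve :: "complex set \<Rightarrow> bool" where
  "C2_curve C \<longleftrightarrow> (\<exists>(\<sigma>::real \<Rightarrow> complex) a b. a < b \<and> Ck_on 2 {a<..<b} \<sigma> \<and> inj_on \<sigma> {a<..<b} \<and>
     (\<forall>t\<in>{a<..<b}. vector_derivative \<sigma> (at t) \<noteq> 0) \<and> C = \<sigma> ` {a<..<b})"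

text \<open>A map conformal on a full neighborhood of a corner would preserve its angle. The straightening
  map is therefore conformal on the part of the neighborhood in \<open>\<Omega>\<close>, and continuous and injective
  up to the boundary.\<close>

definition conformally_straightenable :: "complex set \<Rightarrow> complex \<Rightarrow> bool" where
  "conformally_straightenable \<Omega> p \<longleftrightarrow> (\<exists>U f. open U \<and> p \<in> U \<and>
     f holomorphic_on (U \<inter> \<Omega>) \<and> continuous_on (U \<inter> closure \<Omega>) f \<and> inj_on f (U \<inter> closure \<Omega>) \<and>
     C2_curve (f ` (U \<inter> frontier \<Omega>)))"

text \<open>\<open>T\<close> is the set of parameters at which the pieces meet. The corners are the points where the
  angle differs from \<open>\<pi>\<close>; at the other break points the curve
  still has a tangent line, but its curvature may jump.\<close>

definition regular_domain :: "complex set \<Rightarrow> bool" where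
  "regular_domain \<Omega> \<longleftrightarrow> simple_domain \<Omega> \<and>
     (\<exists>(\<gamma>::real \<Rightarrow> complex) T B.
        continuous_on UNIV \<gamma> \<and> (\<forall>t. \<gamma> (t + 1) = \<gamma> t) \<and> inj_on \<gamma> {0..<1} \<and>
        \<gamma> ` {0..<1} = frontier \<Omega> \<and> (\<forall>z\<in>\<Omega>. winding_number \<gamma> z = 1) \<and>
        finite T \<and> T \<subseteq> {0..<1} \<and> Ck_on 2 {t. frac t \<notin> T} \<gamma> \<and>
        (\<forall>t. frac t \<notin> T \<longrightarrow> vector_derivative \<gamma> (at t) \<noteq> 0 \<and> norm (vector_derivative \<gamma> (at t)) \<le> B) \<and>
        (\<forall>s\<in>T. \<exists>\<theta>. has_inner_angle \<gamma> s \<theta> \<and> 0 < \<theta> \<and> \<theta> < 2 * pi \<and>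
           (\<theta> \<noteq> pi \<longrightarrow> conformally_straightenable \<Omega> (\<gamma> s))))"


subsection \<open>Solutions of the mean field problem\<close>

definition classical_solution :: "complex set \<Rightarrow> real \<Rightarrow> (complex \<Rightarrow> real) \<Rightarrow> bool" where
  "classical_solution \<Omega> lam u \<longleftrightarrow> Ck_on 2 \<Omega> u \<and> continuous_on (closure \<Omega>) u \<and>
     (\<forall>x\<in>\<Omega>. - laplacian u x = lam * (exp (u x) / (LINT y|lebesgue_on \<Omega>. exp (u y)))) \<and>
     (\<forall>x\<in>frontier \<Omega>. u x = 0)"

definition test_function :: "complex set \<Rightarrow> (complex \<Rightarrow> real) \<Rightarrow> bool" where
  "test_function \<Omega> \<phi> \<longleftrightarrow> (\<forall>k. Ck_on k UNIV \<phi>) \<and>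
     compact (closure {x. \<phi> x \<noteq> 0}) \<and> closure {x. \<phi> x \<noteq> 0} \<subseteq> \<Omega>"

definition L2_on :: "complex set \<Rightarrow> (complex \<Rightarrow> 'b::euclidean_space) \<Rightarrow> bool" where
  "L2_on \<Omega> f \<longleftrightarrow> f \<in> borel_measurable (lebesgue_on \<Omega>) \<and>
     integrable (lebesgue_on \<Omega>) (\<lambda>x. (norm (f x))\<^sup>2)"

text \<open>\<open>u \<in> H\<^sup>1\<^sub>0(\<Omega>)\<close>, the \<open>H\<^sup>1\<close>-closure of the test functions, with weak gradient \<open>g\<close>.\<close>

definition H10_with_grad :: "complex set \<Rightarrow> (complex \<Rightarrow> real) \<Rightarrow> (complex \<Rightarrow> complex) \<Rightarrow> bool" where
  "H10_with_grad \<Omega> u g \<longleftrightarrow> L2_on \<Omega> u \<and> L2_on \<Omega> g \<and>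
     (\<exists>\<phi>. (\<forall>n::nat. test_function \<Omega> (\<phi> n)) \<and>
        (\<lambda>n. LINT x|lebesgue_on \<Omega>. (\<phi> n x - u x)\<^sup>2) \<longlonglongrightarrow> 0 \<and>
        (\<lambda>n. LINT x|lebesgue_on \<Omega>. (norm (grad (\<phi> n) x - g x))\<^sup>2) \<longlonglongrightarrow> 0)"

definition weak_solution :: "complex set \<Rightarrow> real \<Rightarrow> (complex \<Rightarrow> real) \<Rightarrow> bool" where
  "weak_solution \<Omega> lam u \<longleftrightarrow> (\<exists>g. H10_with_grad \<Omega> u g \<and>
     integrable (lebesgue_on \<Omega>) (\<lambda>x. exp (u x)) \<and>
     (\<forall>v h. H10_with_grad \<Omega> v h \<longrightarrow>
        (LINT x|lebesgue_on \<Omega>. g x \<bullet> h x) =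
        lam * ((LINT x|lebesgue_on \<Omega>. exp (u x) * v x) / (LINT x|lebesgue_on \<Omega>. exp (u x)))))"

text \<open>On a simple domain a solution is classical, on a regular domain it is an \<open>H\<^sup>1\<^sub>0\<close> weak solution.
  Weak solutions on regular domains have a classical representative, and that representative is
  taken as the solution in the regular case.\<close>

definition mean_field_solution :: "complex set \<Rightarrow> real \<Rightarrow> (complex \<Rightarrow> real) \<Rightarrow> bool" where
  "mean_field_solution \<Omega> lam u \<longleftrightarrow>
     classical_solution \<Omega> lam u \<and> (regular_domain \<Omega> \<longrightarrow> weak_solution \<Omega> lam u)"

definition ellipse :: "real \<Rightarrow> real \<Rightarrow> complex set" where
  "ellipse \<rho> \<beta> = {z. \<rho>\<^sup>2 * (Re z)\<^sup>2 + (Im z)\<^sup>2 \<le> \<beta>\<^sup>2}"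

end

(* On a strip of half-width b the torsion function G1 (-Delta G1 = 1, zero boundary values) is at
   most b^2/2. Hence u = mu G(e^u) is solved by contraction among functions with values in [0,1] as
   long as mu e b^2/2 < 1. The solution depends continuously on mu, so lambda = mu int e^u takes all
   values from 0 up to 2|Omega|/(e b^2). For thin domains this number exceeds the required lower
   bounds, which are therefore taken as exact formulas. A negative lambda is reached by continuation
   in mu: the comparison principle gives solvability for all mu < 0, and Jensen's inequality shows
   lambda -> -infinity.

   The Green operator G comes from a Riemann map g of Omega. Schwarz's lemma bounds Green's function
   by log(D/|z-w|), and |g| -> 1 at the boundary makes G f continuous with zero boundary values on
   every bounded simply connected domain. Interior smoothness follows by splitting off the
   logarithmic potential of a cut-off density; the remaining kernels have the form log|Q| with Q
   holomorphic. *)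
theory Submission
  imports Defs
begin

subsection \<open>The classes \<open>C\<^sup>k\<close>\<close>

text \<open>The equation couples \<lambda> to the unknown mass, so neither branch can be solved for
  a prescribed \<lambda>: each gives a family indexed by \<mu>, and the intermediate value theorem
  picks the member with the right \<lambda>. Hence Lipschitz dependence on \<mu> is proved along
  with existence. The main obstacle is that the potential of a merely continuous source need not be
  C^2, while fixed points are found among continuous functions. Comparison is therefore proved by
  approximating the source, and smoothness is recovered afterwards by bootstrapping. The constants
  leave room. In an ellipse-like domain the reach is at least 2 \<pi> c / (e \<rho>), above 2 c /
  \<rho> because e < \<pi>, while 4 \<pi> / (8 - c) < 2 for c \<le> 1. In the convex case the
  estimates |\<Omega>| \<ge> d w / 2 and L \<le> 2 d + 4 w, with d the diameter and w the half-width
  of a strip along it, turn large N into small w / d. The thresholds are the points where the exact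
  formulas take the value 8 \<pi>.\<close>

lemma pd_eqI:
  assumes "((\<lambda>t. u (x + t *\<^sub>R i)) has_vector_derivative D) (at 0)"
  shows "pd i u x = D"
  unfolding pd_def by (rule vector_derivative_at[OF assms])

lemma has_pd:
  assumes "(\<lambda>t::real. u (x + t *\<^sub>R i)) differentiable (at 0)"
  shows "((\<lambda>t. u (x + t *\<^sub>R i)) has_vector_derivative pd i u x) (at 0)"
  unfolding pd_def using assms vector_derivative_works by blast

lemma line_eventually_in_open:
  fixes x :: "'a::real_normed_vector"
  assumes "open S" "x \<in> S"
  shows "eventually (\<lambda>t::real. x + t *\<^sub>R i \<in> S) (at 0)"
proof -
  have "((\<lambda>t::real. x + t *\<^sub>R i) \<longlongrightarrow> x + 0 *\<^sub>R i) (at 0)"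
    by (intro tendsto_intros)
  then show ?thesis
    using assms by (auto dest: topological_tendstoD)
qed

lemma has_pd_cong:
  fixes u v :: "'a::euclidean_space \<Rightarrow> 'b::real_normed_vector"
  assumes "open S" "x \<in> S" "\<And>y. y \<in> S \<Longrightarrow> u y = v y"
  shows "((\<lambda>t. u (x + t *\<^sub>R i)) has_vector_derivative D) (at 0) \<longleftrightarrow>
         ((\<lambda>t. v (x + t *\<^sub>R i)) has_vector_derivative D) (at 0)"
proof -
  have ev: "eventually (\<lambda>t::real. u (x + t *\<^sub>R i) = v (x + t *\<^sub>R i)) (at 0)"
    using line_eventually_in_open[OF assms(1,2), of i] by eventually_elim (rule assms(3))
  show ?thesis
    using assms(2,3)
    by (intro has_vector_derivative_cong_ev)
       (use ev in \<open>auto simp: eventually_at_filter elim: eventually_mono\<close>)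
qed

lemma pd_cong:
  fixes u v :: "'a::euclidean_space \<Rightarrow> 'b::real_normed_vector"
  assumes "open S" "x \<in> S" "\<And>y. y \<in> S \<Longrightarrow> u y = v y"
  shows "pd i u x = pd i v x"
  unfolding pd_def vector_derivative_def using has_pd_cong[of S x u v i, OF assms] by simp

text \<open>\<open>pd\<close> evaluates the function along whole lines, so openness of S is
  essential: near each of its points a short piece of every coordinate line stays in S.\<close>

lemma Ck_on_cong:
  fixes u v :: "'a::euclidean_space \<Rightarrow> 'b::real_normed_vector"
  assumes "open S" "\<And>y. y \<in> S \<Longrightarrow> u y = v y" "Ck_on k S u"
  shows "Ck_on k S v"
  using assms(2,3)
proof (induction k arbitrary: u v)
  case 0
  then show ?case by (simp cong: continuous_on_cong)
next
  case (Suc k)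
  have "(\<lambda>t. v (x + t *\<^sub>R i)) differentiable at 0" if "i \<in> Basis" "x \<in> S" for i x
  proof -
    have "((\<lambda>t. u (x + t *\<^sub>R i)) has_vector_derivative pd i u x) (at 0)"
      using Suc.prems(2) that by (intro has_pd) auto
    then show ?thesis
      using has_pd_cong[OF assms(1) that(2) Suc.prems(1), where i=i]
      by (meson differentiableI_vector)
  qed
  moreover have "Ck_on k S (pd i v)" if "i \<in> Basis" for i
    by (rule Suc.IH[of "pd i u"])
       (use Suc.prems that in \<open>auto intro: pd_cong[OF assms(1)]\<close>)
  moreover have "continuous_on S v"
    using Suc.prems by (simp cong: continuous_on_cong)
  ultimately show ?case by simp
qed

lemma Ck_on_subset: "Ck_on k S u \<Longrightarrow> T \<subseteq> S \<Longrightarrow> Ck_on k T u"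
  by (induction k arbitrary: u) (auto intro: continuous_on_subset)

lemma Ck_on_continuous: "Ck_on k S u \<Longrightarrow> continuous_on S u"
  by (cases k) auto

lemma Ck_on_SucD: "Ck_on (Suc k) S u \<Longrightarrow> Ck_on k S u"
proof (induction k arbitrary: u)
  case 0 then show ?case by simp
next
  case (Suc k)
  show ?case
    unfolding Ck_on.simps(2)[of k]
    using Suc.prems Suc.IH by (auto simp: Ck_on.simps(2)[of "Suc k"] simp del: Ck_on.simps)
qed

lemma Ck_on_le: "Ck_on k S u \<Longrightarrow> j \<le> k \<Longrightarrow> Ck_on j S u"
  by (induction k) (auto simp: le_Suc_eq simp del: Ck_on.simps dest: Ck_on_SucD)

lemma Ck_on_pd: "Ck_on (Suc k) S u \<Longrightarrow> i \<in> Basis \<Longrightarrow> Ck_on k S (pd i u)"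
  by simp

lemma Ck_on_has_pd:
  "Ck_on (Suc k) S u \<Longrightarrow> i \<in> Basis \<Longrightarrow> x \<in> S \<Longrightarrow>
    ((\<lambda>t. u (x + t *\<^sub>R i)) has_vector_derivative pd i u x) (at 0)"
  by (intro has_pd) auto

text \<open>The candidates D i have to agree with \<open>pd i u\<close> on S only; elsewhere
  \<open>pd i u\<close> may be junk. This is the working rule for all smoothness proofs
  below.\<close>

lemma Ck_on_SucI:
  fixes u :: "'a::euclidean_space \<Rightarrow> 'b::real_normed_vector"
  assumes "open S" "continuous_on S u"
    and D: "\<And>i x. i \<in> Basis \<Longrightarrow> x \<in> S \<Longrightarrow> ((\<lambda>t. u (x + t *\<^sub>R i)) has_vector_derivative D i x) (at 0)"
    and "\<And>i. i \<in> Basis \<Longrightarrow> Ck_on k S (D i)"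
  shows "Ck_on (Suc k) S u"
proof -
  have "Ck_on k S (pd i u)" if "i \<in> Basis" for i
    by (rule Ck_on_cong[OF assms(1) _ assms(4)[OF that]]) (simp add: pd_eqI[OF D[OF that]])
  then show ?thesis
    using assms(2) D by (auto intro: differentiableI_vector)
qed

text \<open>Locality is what permits gluing: a function that is smooth on \<Omega> and zero on an
  open set covering the complement is smooth on the plane.\<close>

lemma Ck_on_local:
  fixes u :: "'a::euclidean_space \<Rightarrow> 'b::real_normed_vector"
  assumes "\<And>x. x \<in> S \<Longrightarrow> \<exists>V. open V \<and> x \<in> V \<and> Ck_on k V u"
  shows "Ck_on k S u"
  using assms
proof (induction k arbitrary: u)
  case 0
  have "continuous (at x within S) u" if x: "x \<in> S" for x
  proof -
    obtain V where V: "open V" "x \<in> V" "continuous_on V u" using "0.prems" x by (metis Ck_on.simps(1))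
    then show ?thesis
      using continuous_on_eq_continuous_at continuous_at_imp_continuous_at_within by blast
  qed
  then show ?case by (simp add: continuous_on_eq_continuous_within)
next
  case (Suc k)
  have c: "continuous (at x within S) u" if x: "x \<in> S" for x
  proof -
    obtain V where V: "open V" "x \<in> V" "continuous_on V u" using Suc.prems[OF x] by auto
    then show ?thesis
      using continuous_on_eq_continuous_at continuous_at_imp_continuous_at_within by blast
  qed
  have "Ck_on k S (pd i u)" if "i \<in> Basis" for i
    using Suc.prems that by (intro Suc.IH) fastforce
  then show ?case using c Suc.prems
    by (fastforce simp: continuous_on_eq_continuous_within)
qed

lemma Ck_on_Un:
  fixes u :: "'a::euclidean_space \<Rightarrow> 'b::real_normed_vector"
  assumes "open S" "open T" "Ck_on k S u" "Ck_on k T u"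
  shows "Ck_on k (S \<union> T) u"
  by (rule Ck_on_local) (use assms in blast)

lemma Ck_on_const [simp]: "Ck_on k S (\<lambda>x. c)"
proof (induction k arbitrary: c)
  case (Suc k)
  have "pd i (\<lambda>x::'a. c) = (\<lambda>x. 0 :: 'b)" for i :: 'a
    by (rule ext, rule pd_eqI) simp
  then show ?case by (simp add: Suc)
qed simp

lemma Ck_on_add:
  fixes u v :: "'a::euclidean_space \<Rightarrow> 'b::real_normed_vector"
  assumes "open S"
  shows "Ck_on k S u \<Longrightarrow> Ck_on k S v \<Longrightarrow> Ck_on k S (\<lambda>x. u x + v x)"
proof (induction k arbitrary: u v)
  case (Suc k)
  show ?case
    by (rule Ck_on_SucI[OF assms, where D="\<lambda>i x. pd i u x + pd i v x"])
       (use Suc in \<open>auto intro!: continuous_intros has_vector_derivative_add has_pd Suc.IH\<close>)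
qed (auto intro: continuous_intros)

lemma Ck_on_minus:
  fixes u :: "'a::euclidean_space \<Rightarrow> 'b::real_normed_vector"
  assumes "open S"
  shows "Ck_on k S u \<Longrightarrow> Ck_on k S (\<lambda>x. - u x)"
proof (induction k arbitrary: u)
  case (Suc k)
  show ?case
    by (rule Ck_on_SucI[OF assms, where D="\<lambda>i x. - pd i u x"])
       (use Suc in \<open>auto intro!: continuous_intros has_vector_derivative_minus has_pd Suc.IH\<close>)
qed (auto intro: continuous_intros)

lemma Ck_on_diff:
  fixes u v :: "'a::euclidean_space \<Rightarrow> 'b::real_normed_vector"
  assumes "open S" "Ck_on k S u" "Ck_on k S v"
  shows "Ck_on k S (\<lambda>x. u x - v x)"
  using Ck_on_add[OF assms(1,2) Ck_on_minus[OF assms(1,3)]] by simp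

lemma Ck_on_mult:
  fixes u v :: "'a::euclidean_space \<Rightarrow> real"
  assumes "open S"
  shows "Ck_on k S u \<Longrightarrow> Ck_on k S v \<Longrightarrow> Ck_on k S (\<lambda>x. u x * v x)"
proof (induction k arbitrary: u v)
  case (Suc k)
  have "((\<lambda>t. u (x + t *\<^sub>R i) * v (x + t *\<^sub>R i)) has_vector_derivative
        u x * pd i v x + pd i u x * v x) (at 0)" if "i \<in> Basis" "x \<in> S" for i x
    using has_vector_derivative_mult[OF Ck_on_has_pd[OF Suc.prems(1) that] Ck_on_has_pd[OF Suc.prems(2) that]]
    by simp
  moreover have "Ck_on k S (\<lambda>x. u x * pd i v x + pd i u x * v x)" if "i \<in> Basis" for i
    by (intro Ck_on_add[OF assms] Suc.IH Ck_on_pd that Ck_on_SucD[OF Suc.prems(1)] Ck_on_SucD[OF Suc.prems(2)] Suc.prems)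
  ultimately show ?case
    using Suc.prems
    by (intro Ck_on_SucI[OF assms, where D="\<lambda>i x. u x * pd i v x + pd i u x * v x"])
       (auto intro!: continuous_intros)
qed (auto intro: continuous_intros)

lemma Ck_on_cmult:
  fixes u :: "'a::euclidean_space \<Rightarrow> real"
  shows "open S \<Longrightarrow> Ck_on k S u \<Longrightarrow> Ck_on k S (\<lambda>x. c * u x)"
  by (intro Ck_on_mult) auto

lemma pd_compose:
  fixes u :: "'a::euclidean_space \<Rightarrow> real" and h :: "real \<Rightarrow> real"
  assumes "((\<lambda>t. u (x + t *\<^sub>R i)) has_vector_derivative D) (at 0)"
    and "(h has_field_derivative E) (at (u x))"
  shows "((\<lambda>t. h (u (x + t *\<^sub>R i))) has_vector_derivative E * D) (at 0)"
  using assms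
  by (auto simp flip: has_real_derivative_iff_has_vector_derivative intro!: DERIV_chain2[of h])

lemma Ck_on_real_DERIV:
  fixes h :: "real \<Rightarrow> real"
  assumes "Ck_on (Suc k) T h" "x \<in> T"
  shows "(h has_field_derivative pd 1 h x) (at x)"
proof -
  have "((\<lambda>t. h (x + t *\<^sub>R 1)) has_vector_derivative pd 1 h x) (at 0)"
    using Ck_on_has_pd[OF assms(1) _ assms(2), of 1] by simp
  then have "((\<lambda>t. h (x + t)) has_field_derivative pd 1 h x) (at 0)"
    by (simp add: has_real_derivative_iff_has_vector_derivative)
  then show ?thesis
    using DERIV_shift[of h "pd 1 h x" 0 x] by (simp add: add.commute)
qed

text \<open>The chain rule replaces h by \<open>pd 1 h\<close>, so the induction runs over all h. A
  set T smaller than the line is allowed in order to compose with \<open>inverse\<close> on the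
  positive axis.\<close>

lemma Ck_on_compose:
  fixes u :: "'a::euclidean_space \<Rightarrow> real" and h :: "real \<Rightarrow> real"
  assumes "open S" "\<And>x. x \<in> S \<Longrightarrow> u x \<in> T"
  shows "Ck_on k T h \<Longrightarrow> Ck_on k S u \<Longrightarrow> Ck_on k S (\<lambda>x. h (u x))"
proof (induction k arbitrary: h)
  case 0
  then show ?case
    using assms(2) by (auto intro: continuous_on_compose2)
next
  case (Suc k)
  show ?case
  proof (rule Ck_on_SucI[OF assms(1), where D="\<lambda>i x. pd 1 h (u x) * pd i u x"])
    show "continuous_on S (\<lambda>x. h (u x))"
      using Suc.prems assms(2) by (auto intro: continuous_on_compose2)
    show "Ck_on k S (\<lambda>x. pd 1 h (u x) * pd i u x)" if "i \<in> Basis" for i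
      using Suc.prems(1,2) that
      by (intro Ck_on_mult[OF assms(1)] Suc.IH[OF Ck_on_pd Ck_on_SucD] Ck_on_pd) auto
    show "((\<lambda>t. h (u (x + t *\<^sub>R i))) has_vector_derivative pd 1 h (u x) * pd i u x) (at 0)"
      if "i \<in> Basis" "x \<in> S" for i x
      by (rule pd_compose[OF Ck_on_has_pd[OF Suc.prems(2) that] Ck_on_real_DERIV[OF Suc.prems(1)]])
         (use that assms(2) in auto)
  qed
qed

lemma Ck_on_real_SucI:
  fixes h h' :: "real \<Rightarrow> real"
  assumes "open T" "\<And>x. x \<in> T \<Longrightarrow> (h has_field_derivative h' x) (at x)" "Ck_on k T h'"
  shows "Ck_on (Suc k) T h"
proof (rule Ck_on_SucI[OF assms(1), where D="\<lambda>i. h'"])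
  show "continuous_on T h"
    using assms(2) DERIV_isCont continuous_at_imp_continuous_on by blast
  show "((\<lambda>t. h (x + t *\<^sub>R i)) has_vector_derivative h' x) (at 0)" if "i \<in> Basis" "x \<in> T" for i x :: real
    using assms(2)[OF that(2)] DERIV_shift[of h "h' x" 0 x] that(1)
    by (simp add: has_real_derivative_iff_has_vector_derivative add.commute)
qed (use assms in auto)

lemma Ck_on_exp [simp]: "Ck_on k UNIV (exp :: real \<Rightarrow> real)"
proof (induction k)
  case 0 show ?case by (simp add: continuous_on_exp)
next
  case (Suc k)
  show ?case by (rule Ck_on_real_SucI[OF open_UNIV DERIV_exp Suc])
qed

lemma Ck_on_inverse [simp]: "Ck_on k {0<..} (inverse :: real \<Rightarrow> real)"
proof (induction k)
  case 0 show ?case by (auto intro!: continuous_intros)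
next
  case (Suc k)
  have "Ck_on k {0<..} (\<lambda>x::real. - (inverse x * inverse x))"
    by (intro Ck_on_minus Ck_on_mult Suc) auto
  then show ?case
    by (intro Ck_on_real_SucI[of _ _ "\<lambda>x::real. - (inverse x * inverse x)"])
       (auto intro!: derivative_eq_intros simp: power2_eq_square)
qed

lemma Ck_on_inner [simp]:
  fixes v :: "'a::euclidean_space"
  shows "Ck_on k S (\<lambda>x. x \<bullet> v)"
proof (cases k)
  case (Suc j)
  have "Ck_on k UNIV (\<lambda>x. x \<bullet> v)"
    unfolding Suc
    by (rule Ck_on_SucI[where D="\<lambda>i x. i \<bullet> v"])
       (auto intro!: continuous_intros derivative_eq_intros simp: has_vector_derivative_def inner_simps)
  then show ?thesis by (rule Ck_on_subset) auto
qed (auto intro!: continuous_intros)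

lemma Ck_on_norm_square [simp]:
  fixes a :: complex
  shows "Ck_on k UNIV (\<lambda>x. (norm (x - a))\<^sup>2)"
proof -
  have "Ck_on k UNIV (\<lambda>x::complex. (x \<bullet> 1 - a \<bullet> 1) * (x \<bullet> 1 - a \<bullet> 1) + (x \<bullet> \<i> - a \<bullet> \<i>) * (x \<bullet> \<i> - a \<bullet> \<i>))"
    by (intro Ck_on_add Ck_on_mult Ck_on_diff Ck_on_inner) auto
  then show ?thesis
    by (rule Ck_on_cong[rotated 2]) (auto simp: cmod_power2 inner_complex_def simp flip: power2_eq_square)
qed

text \<open>Smooth cutoffs are built from \<open>p(1/t) e\<^bsup>-1/t\<^esup>\<close>, extended by zero to \<open>t \<le> 0\<close>, because this
  class of functions is closed under differentiation.\<close>

definition flat_fun :: "real poly \<Rightarrow> real \<Rightarrow> real" where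
  "flat_fun p t = (if t > 0 then poly p (inverse t) * exp (- inverse t) else 0)"

lemma flat_fun_lim: "(flat_fun p \<longlongrightarrow> 0) (at_right 0)"
proof -
  have "((\<lambda>x. poly p x / exp x) \<longlongrightarrow> 0) at_top"
  proof (induction p)
    case (pCons a p)
    have 1: "((\<lambda>x. x ^ i / exp x) \<longlongrightarrow> (0::real)) at_top" for i
      by (rule tendsto_power_div_exp_0)
    have "((\<lambda>x. \<Sum>i\<le>degree (pCons a p). coeff (pCons a p) i * (x ^ i / exp x)) \<longlongrightarrow>
           (\<Sum>i\<le>degree (pCons a p). coeff (pCons a p) i * 0)) at_top"
      by (intro tendsto_intros 1)
    then show ?case by (simp only: poly_altdef sum_divide_distrib times_divide_eq_right mult_zero_right sum.neutral_const)
  qed simp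
  then have "((\<lambda>t. poly p (inverse t) / exp (inverse t)) \<longlongrightarrow> 0) (at_right (0::real))"
    using filterlim_inverse_at_top_right by (rule filterlim_compose)
  then show ?thesis
    by (rule Lim_transform_eventually)
       (auto simp: flat_fun_def eventually_at_filter exp_minus divide_inverse)
qed

text \<open>With X = 1/t one has dX/dt = - X^2, so differentiating p(X) e^(-X) yields the polynomial
  X^2 (p - p').\<close>

lemma flat_fun_has_derivative:
  "(flat_fun p has_field_derivative flat_fun ([:0,0,1:] * (p - pderiv p)) t) (at t)"
proof -
  consider "t < 0" | "t = 0" | "t > 0" by linarith
  then show ?thesis
  proof cases
    case 1
    have "((\<lambda>_. 0) has_field_derivative 0) (at t)" by simp
    then have "(flat_fun p has_field_derivative 0) (at t)"
      by (rule has_field_derivative_transform_within_open[of _ _ _ "{..<0}"])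
         (use 1 in \<open>auto simp: flat_fun_def\<close>)
    then show ?thesis using 1 by (simp add: flat_fun_def)
  next
    case 2
    \<comment> \<open>Division by h multiplies the polynomial by X, so the right difference quotient
      is itself a flat function.\<close>
    have "((\<lambda>h. (flat_fun p (0 + h) - flat_fun p 0) / h) \<longlongrightarrow> 0) (at_right 0)"
      using flat_fun_lim[of "[:0,1:] * p"]
      by (rule Lim_transform_eventually)
         (auto simp: flat_fun_def eventually_at_filter divide_inverse)
    moreover have "((\<lambda>h. (flat_fun p (0 + h) - flat_fun p 0) / h) \<longlongrightarrow> 0) (at_left 0)"
      by (rule tendsto_eventually) (auto simp: flat_fun_def eventually_at_filter)
    ultimately show ?thesis
      unfolding 2 by (simp add: DERIV_def filterlim_at_split flat_fun_def)
  next
    case 3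
    have "((\<lambda>t. poly p (inverse t) * exp (- inverse t)) has_field_derivative
        flat_fun ([:0,0,1:] * (p - pderiv p)) t) (at t)"
      using 3 by (auto intro!: derivative_eq_intros DERIV_chain2[OF poly_DERIV]
          simp: flat_fun_def field_simps power2_eq_square)
    then show ?thesis
      by (rule has_field_derivative_transform_within_open[of _ _ _ "{0<..}"])
         (use 3 in \<open>auto simp: flat_fun_def\<close>)
  qed
qed

lemma Ck_on_flat_fun: "Ck_on k UNIV (flat_fun p)"
proof (induction k arbitrary: p)
  case 0
  show ?case using DERIV_isCont[OF flat_fun_has_derivative]
    by (auto simp: continuous_on_eq_continuous_at simp del: mult_pCons_left)
next
  case (Suc k)
  show ?case by (rule Ck_on_real_SucI[OF open_UNIV flat_fun_has_derivative Suc])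
qed

section \<open>A smooth monotone step\<close>

definition smooth_step :: "real \<Rightarrow> real" where
  "smooth_step t = flat_fun 1 t / (flat_fun 1 t + flat_fun 1 (1 - t))"

text \<open>At least one of t and 1 - t is positive.\<close>

lemma flat_fun_1_pos: "flat_fun 1 t + flat_fun 1 (1 - t) > 0"
proof -
  have "flat_fun 1 s \<ge> 0" "s > 0 \<Longrightarrow> flat_fun 1 s > 0" for s
    by (auto simp: flat_fun_def)
  then show ?thesis
    by (cases "t > 0") (auto intro: add_pos_nonneg add_nonneg_pos)
qed

lemma Ck_on_smooth_step: "Ck_on k UNIV smooth_step"
proof -
  have 1: "Ck_on k UNIV (\<lambda>t::real. 1 - t)"
    by (intro Ck_on_diff Ck_on_const) (use Ck_on_inner[of k UNIV "1::real"] in auto)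
  have 2: "Ck_on k UNIV (\<lambda>t. flat_fun 1 t + flat_fun 1 (1 - t))"
    by (intro Ck_on_add open_UNIV Ck_on_flat_fun Ck_on_compose[OF _ _ Ck_on_flat_fun 1]) auto
  have "Ck_on k UNIV (\<lambda>t. flat_fun 1 t * inverse (flat_fun 1 t + flat_fun 1 (1 - t)))"
    by (intro Ck_on_mult open_UNIV Ck_on_flat_fun Ck_on_compose[OF _ _ Ck_on_inverse 2])
       (use flat_fun_1_pos in auto)
  then show ?thesis by (simp add: smooth_step_def[abs_def] divide_inverse)
qed

lemma smooth_step_eq_0: "t \<le> 0 \<Longrightarrow> smooth_step t = 0"
  and smooth_step_eq_1: "t \<ge> 1 \<Longrightarrow> smooth_step t = 1"
  and smooth_step_nonneg: "smooth_step t \<ge> 0"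
  and smooth_step_le_1: "smooth_step t \<le> 1"
  using flat_fun_1_pos[of t] by (auto simp: smooth_step_def flat_fun_def divide_simps)

text \<open>After cross-multiplication the common product cancels, and monotonicity of
  \<open>flat_fun 1\<close> in each remaining factor suffices. The result makes the derivative of
  \<open>soft_id\<close> nonnegative.\<close>

lemma smooth_step_mono:
  assumes "s \<le> t" shows "smooth_step s \<le> smooth_step t"
proof -
  have m: "flat_fun 1 a \<le> flat_fun 1 b" if "a \<le> b" for a b
    using that by (auto simp: flat_fun_def le_imp_inverse_le)
  have n: "flat_fun 1 a \<ge> 0" for a by (auto simp: flat_fun_def)
  have "flat_fun 1 s * flat_fun 1 (1 - t) \<le> flat_fun 1 t * flat_fun 1 (1 - s)"
    by (intro mult_mono m n) (use assms in auto)
  then show ?thesis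
    unfolding smooth_step_def using flat_fun_1_pos[of s] flat_fun_1_pos[of t]
    by (simp add: divide_simps algebra_simps)
qed

subsection \<open>Differentiation under the integral and radial integrability\<close>

text \<open>On a convex set the mean value inequality dominates the difference quotients by w. The
  rule covers real and complex fields, so it serves for derivatives along lines as well as for
  holomorphy of parameter integrals.\<close>

lemma has_field_derivative_integral:
  fixes F :: "'f::{real_normed_field,banach,second_countable_topology} \<Rightarrow> 'b \<Rightarrow> 'f"
  assumes S: "open S" "convex S" "x0 \<in> S"
    and int: "\<And>x. x \<in> S \<Longrightarrow> integrable M (F x)"
    and meas: "F' x0 \<in> borel_measurable M"
    and der: "AE \<zeta> in M. \<forall>x\<in>S. ((\<lambda>x. F x \<zeta>) has_field_derivative F' x \<zeta>) (at x) \<and> norm (F' x \<zeta>) \<le> w \<zeta>"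
    and w: "integrable M w"
  shows "((\<lambda>x. \<integral>\<zeta>. F x \<zeta> \<partial>M) has_field_derivative (\<integral>\<zeta>. F' x0 \<zeta> \<partial>M)) (at x0)"
    and "integrable M (F' x0)"
proof -
  show "integrable M (F' x0)"
    by (rule Bochner_Integration.integrable_bound[OF w meas]) (use der S(3) in \<open>auto elim!: eventually_mono intro: order_trans[OF _ abs_ge_self]\<close>)
  have "((\<lambda>x. ((\<integral>\<zeta>. F x \<zeta> \<partial>M) - (\<integral>\<zeta>. F x0 \<zeta> \<partial>M)) / (x - x0)) \<longlongrightarrow> (\<integral>\<zeta>. F' x0 \<zeta> \<partial>M)) (at x0 within S)"
    unfolding tendsto_at_iff_sequentially
  proof (intro allI impI)
    fix X assume X: "\<forall>i. X i \<in> S - {x0}" "X \<longlonglongrightarrow> x0"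
    have "(\<lambda>n. \<integral>\<zeta>. (F (X n) \<zeta> - F x0 \<zeta>) / (X n - x0) \<partial>M) \<longlonglongrightarrow> (\<integral>\<zeta>. F' x0 \<zeta> \<partial>M)"
    proof (rule integral_dominated_convergence[OF meas _ w])
      show "(\<lambda>\<zeta>. (F (X n) \<zeta> - F x0 \<zeta>) / (X n - x0)) \<in> borel_measurable M" for n
        using X(1) S(3) by (intro borel_measurable_integrable integrable_divide Bochner_Integration.integrable_diff int) auto
      show "AE \<zeta> in M. (\<lambda>n. (F (X n) \<zeta> - F x0 \<zeta>) / (X n - x0)) \<longlonglongrightarrow> F' x0 \<zeta>"
        using der
      proof eventually_elim
        case (elim \<zeta>)
        then have "((\<lambda>x. F x \<zeta>) has_field_derivative F' x0 \<zeta>) (at x0 within S)"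
          using S(3) by (auto intro: has_field_derivative_at_within)
        then show ?case
          using X unfolding has_field_derivative_iff tendsto_at_iff_sequentially comp_def by blast
      qed
      show "AE \<zeta> in M. norm ((F (X n) \<zeta> - F x0 \<zeta>) / (X n - x0)) \<le> w \<zeta>" for n
        using der
      proof eventually_elim
        case (elim \<zeta>)
        have "norm (F (X n) \<zeta> - F x0 \<zeta>) \<le> w \<zeta> * norm (X n - x0)"
          by (rule field_differentiable_bound[OF S(2), where f'="\<lambda>x. F' x \<zeta>"])
             (use elim X(1) S(3) in \<open>auto intro: has_field_derivative_at_within\<close>)
        then show ?case
          using X(1) by (simp add: norm_divide divide_simps)
      qed
    qed
    moreover have "(\<integral>\<zeta>. (F (X n) \<zeta> - F x0 \<zeta>) / (X n - x0) \<partial>M) =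
        ((\<integral>\<zeta>. F (X n) \<zeta> \<partial>M) - (\<integral>\<zeta>. F x0 \<zeta> \<partial>M)) / (X n - x0)" for n
    proof -
      have "integrable M (F (X n))" "integrable M (F x0)" using X(1) S(3) int by auto
      moreover have "X n \<noteq> x0" using X(1) by auto
      ultimately show ?thesis by (simp add: Bochner_Integration.integral_diff)
    qed
    ultimately show "((\<lambda>x. ((\<integral>\<zeta>. F x \<zeta> \<partial>M) - (\<integral>\<zeta>. F x0 \<zeta> \<partial>M)) / (x - x0)) \<circ> X) \<longlonglongrightarrow> (\<integral>\<zeta>. F' x0 \<zeta> \<partial>M)"
      by (simp only: comp_def)
  qed
  then show "((\<lambda>x. \<integral>\<zeta>. F x \<zeta> \<partial>M) has_field_derivative (\<integral>\<zeta>. F' x0 \<zeta> \<partial>M)) (at x0)"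
    unfolding has_field_derivative_iff using at_within_open[OF S(3,1)] by simp
qed

section \<open>Affine substitutions and integrability of radial functions\<close>

lemma
  fixes f :: "'a::euclidean_space \<Rightarrow> 'b::{banach, second_countable_topology}"
  assumes "c \<noteq> 0"
  shows lborel_integrable_affine: "integrable lborel f \<Longrightarrow> integrable lborel (\<lambda>x. f (t + c *\<^sub>R x))"
    and lborel_integral_affine:
      "f \<in> borel_measurable borel \<Longrightarrow> (\<integral>x. f x \<partial>lborel) = \<bar>c\<bar> ^ DIM('a) *\<^sub>R (\<integral>x. f (t + c *\<^sub>R x) \<partial>lborel)"
proof -
  have eq: "lborel = density (distr lborel borel (\<lambda>x::'a. t + c *\<^sub>R x)) (\<lambda>_. ennreal (\<bar>c\<bar>^DIM('a)))"
    using lborel_affine[OF assms, of t] by (simp add: ennreal_power)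
  show "integrable lborel (\<lambda>x. f (t + c *\<^sub>R x))" if f: "integrable lborel f"
  proof -
    have m: "f \<in> borel_measurable borel" using borel_measurable_integrable[OF f] by simp
    have "integrable (density (distr lborel borel (\<lambda>x::'a. t + c *\<^sub>R x)) (\<lambda>_. ennreal (\<bar>c\<bar>^DIM('a)))) f"
      using f eq by simp
    then have "integrable (distr lborel borel (\<lambda>x::'a. t + c *\<^sub>R x)) (\<lambda>x. \<bar>c\<bar>^DIM('a) *\<^sub>R f x)"
      using m by (subst (asm) integrable_density) auto
    then have "integrable lborel (\<lambda>x. \<bar>c\<bar>^DIM('a) *\<^sub>R f (t + c *\<^sub>R x))"
      using m by (subst (asm) integrable_distr_eq) auto
    from integrable_scaleR_right[of "1 / \<bar>c\<bar> ^ DIM('a)", OF this] show ?thesis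
      using assms by simp
  qed
  show "(\<integral>x. f x \<partial>lborel) = \<bar>c\<bar> ^ DIM('a) *\<^sub>R (\<integral>x. f (t + c *\<^sub>R x) \<partial>lborel)"
    if m: "f \<in> borel_measurable borel"
  proof -
    have "(\<integral>x. f x \<partial>lborel) = (\<integral>x. f x \<partial>(density (distr lborel borel (\<lambda>x::'a. t + c *\<^sub>R x)) (\<lambda>_. ennreal (\<bar>c\<bar>^DIM('a)))))"
      using eq by simp
    also have "\<dots> = (\<integral>x. \<bar>c\<bar>^DIM('a) *\<^sub>R f x \<partial>(distr lborel borel (\<lambda>x::'a. t + c *\<^sub>R x)))"
      using m by (subst integral_density) auto
    also have "\<dots> = (\<integral>x. \<bar>c\<bar>^DIM('a) *\<^sub>R f (t + c *\<^sub>R x) \<partial>lborel)"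
      using m by (subst integral_distr) auto
    finally show ?thesis by simp
  qed
qed

lemma lborel_integral_reflect:
  fixes f :: "'a::euclidean_space \<Rightarrow> 'b::{banach, second_countable_topology}"
  assumes "f \<in> borel_measurable borel"
  shows "(\<integral>x. f (z - x) \<partial>lborel) = (\<integral>x. f x \<partial>lborel)"
  using lborel_integral_affine[OF _ assms, of "-1" z] by simp

lemma lborel_integrable_reflect:
  fixes f :: "'a::euclidean_space \<Rightarrow> 'b::{banach, second_countable_topology}"
  assumes "integrable lborel f"
  shows "integrable lborel (\<lambda>x. f (z - x))"
  using lborel_integrable_affine[OF _ assms, of "-1" z] by simp

lemma emeasure_ball_complex: "r \<ge> 0 \<Longrightarrow> emeasure lborel (ball (c::complex) r) = ennreal (pi * r\<^sup>2)"
  using emeasure_ball[of r c] by (simp add: unit_ball_vol_2)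

lemma ball_borel [measurable]: "ball c r \<in> sets borel" "cball c r \<in> sets borel"
  by auto

text \<open>|f| is dominated by the sum of the functions
  \<open>a n * indicator (ball 0 (r n))\<close>, whose integrals form the given series. Shrinking
  radii handle a singularity at 0 and growing radii handle decay at infinity, in place of polar
  coordinates.\<close>

lemma integrable_dyadic:
  fixes f :: "complex \<Rightarrow> real"
  assumes [measurable]: "f \<in> borel_measurable borel"
    and a: "\<And>n. a n \<ge> 0" "\<And>n. r n \<ge> 0" "summable (\<lambda>n. a n * (pi * (r n)\<^sup>2))"
    and f: "\<And>z. f z \<noteq> 0 \<Longrightarrow> \<exists>n. z \<in> ball 0 (r n) \<and> \<bar>f z\<bar> \<le> a n"
  shows "integrable lborel f"
proof (rule integrableI_bounded)
  have "(\<integral>\<^sup>+z. ennreal (norm (f z)) \<partial>lborel) \<le> (\<integral>\<^sup>+z. (\<Sum>n. ennreal (a n) * indicator (ball (0::complex) (r n)) z) \<partial>lborel)"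
  proof (rule nn_integral_mono)
    fix z
    show "ennreal (norm (f z)) \<le> (\<Sum>n. ennreal (a n) * indicator (ball 0 (r n)) z)"
    proof (cases "f z = 0")
      case False
      then obtain n where n: "z \<in> ball 0 (r n)" "\<bar>f z\<bar> \<le> a n" using f by blast
      have "ennreal (norm (f z)) \<le> (\<Sum>i\<in>{n}. ennreal (a i) * indicator (ball 0 (r i)) z)"
        using n a(1) by (auto intro!: ennreal_leI)
      also have "\<dots> \<le> (\<Sum>n. ennreal (a n) * indicator (ball 0 (r n)) z)"
        by (rule sum_le_suminf) auto
      finally show ?thesis .
    qed simp
  qed
  also have "\<dots> = (\<Sum>n. ennreal (a n) * emeasure lborel (ball (0::complex) (r n)))"
  proof (subst nn_integral_suminf)
    show "(\<lambda>z::complex. ennreal (a i) * indicator (ball 0 (r i)) z) \<in> borel_measurable lborel" for i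
      by measurable
  qed (simp add: nn_integral_cmult_indicator)
  also have "\<dots> = (\<Sum>n. ennreal (a n * (pi * (r n)\<^sup>2)))"
    using a by (simp add: emeasure_ball_complex ennreal_mult)
  also have "\<dots> < \<infinity>"
    using a by (subst suminf_ennreal2) auto
  finally show "(\<integral>\<^sup>+z. ennreal (norm (f z)) \<partial>lborel) < \<infinity>" .
qed simp

definition loc_int :: "(complex \<Rightarrow> real) \<Rightarrow> bool" where
  "loc_int K \<longleftrightarrow> K \<in> borel_measurable borel \<and> (\<forall>R>0. integrable lborel (\<lambda>w. indicator (ball 0 R) w * K w))"

lemma loc_int_inverse_norm: "loc_int (\<lambda>w. 1 / norm w)"
  unfolding loc_int_def
proof (intro conjI allI impI)
  fix R :: real assume R: "R > 0"
  show "integrable lborel (\<lambda>w::complex. indicator (ball 0 R) w * (1 / norm w))"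
  \<comment> \<open>In the shell R / 2^(n+1) \<le> |z| < R / 2^n the function is at most 2^(n+1) /
    R, and the n-th term of the series is 2 \<pi> R / 2^n.\<close>
  proof (rule integrable_dyadic[where a="\<lambda>n. 2 ^ Suc n / R" and r="\<lambda>n. R / 2 ^ n"])
    have "summable (\<lambda>n. 2 * pi * R * (1 / 2) ^ n)"
      by (intro summable_mult summable_geometric) auto
    then show "summable (\<lambda>n. 2 ^ Suc n / R * (pi * (R / 2 ^ n)\<^sup>2))"
      using R by (simp add: power2_eq_square field_simps power_divide)
  next
    fix z :: complex assume "indicator (ball 0 R) z * (1 / norm z) \<noteq> 0"
    then have z: "norm z < R" "norm z > 0" by (auto simp: indicator_def split: if_splits)
    define n where "n = (LEAST n. R / 2 ^ Suc n \<le> norm z)"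
    obtain m :: nat where "R / norm z < 2 ^ m"
      using real_arch_pow[of 2 "R / norm z"] by auto
    then have ex: "R / 2 ^ Suc m \<le> norm z"
      using z R by (simp add: field_simps)
    have n: "R / 2 ^ Suc n \<le> norm z" unfolding n_def using ex by (rule LeastI)
    have "norm z < R / 2 ^ n"
    proof (cases n)
      case (Suc k)
      then have "\<not> R / 2 ^ Suc k \<le> norm z" unfolding n_def by (intro not_less_Least) auto
      then show ?thesis using Suc by simp
    qed (use z in simp)
    then show "\<exists>n. z \<in> ball 0 (R / 2 ^ n) \<and> \<bar>indicator (ball 0 R) z * (1 / norm z)\<bar> \<le> 2 ^ Suc n / R"
      using n z R by (intro exI[of _ n]) (auto simp: field_simps)
  qed (use R in auto)
qed simp

text \<open>The density is the Laplacian of the regularised logarithm \<open>lnk 1\<close>; for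
  general \<epsilon> the Laplacian of \<open>lnk \<epsilon>\<close> is its rescaling, an approximate
  identity up to normalisation.\<close>

lemma integrable_fundamental_density: "integrable lborel (\<lambda>v::complex. 2 / (1 + (norm v)\<^sup>2)\<^sup>2)"
\<comment> \<open>For n > 0 and 2^(n-1) \<le> |z| the denominator is at least |z|^4 \<ge> 16^(n-1),
  and 2 / 16^(n-1) = 32 / 16^n.\<close>
proof (rule integrable_dyadic[where a="\<lambda>n. 32 / 16 ^ n" and r="\<lambda>n. 2 ^ n"])
  have "summable (\<lambda>n. 32 * pi * (1 / 4) ^ n)"
    by (intro summable_mult summable_geometric) auto
  moreover have "32 * pi * (1 / 4) ^ n = 32 / 16 ^ n * (pi * (2 ^ n)\<^sup>2)" for n
  proof -
    have "(16::real) ^ n = 4 ^ n * 4 ^ n" "(2 ^ n)\<^sup>2 = (4::real) ^ n"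
      by (simp_all flip: power_mult_distrib add: power2_eq_square)
    then show ?thesis by (simp add: field_simps power_divide)
  qed
  ultimately show "summable (\<lambda>n. 32 / 16 ^ n * (pi * (2 ^ n)\<^sup>2))" by simp
next
  fix z :: complex
  define n where "n = (LEAST n. norm z < 2 ^ n)"
  obtain m :: nat where "norm z < 2 ^ m"
    using real_arch_pow[of 2 "norm z"] by auto
  then have n: "norm z < 2 ^ n" unfolding n_def by (rule LeastI)
  have "\<bar>2 / (1 + (norm z)\<^sup>2)\<^sup>2\<bar> \<le> 32 / 16 ^ n"
  proof (cases n)
    case 0
    have "1 \<le> (1 + (norm z)\<^sup>2)\<^sup>2" by (simp add: power2_eq_square algebra_simps)
    then have "2 / (1 + (norm z)\<^sup>2)\<^sup>2 \<le> 2 / 1"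
      by (intro divide_left_mono) (auto simp: add_nonneg_eq_0_iff)
    then show ?thesis using 0 by simp
  next
    case (Suc k)
    then have "\<not> norm z < 2 ^ k" unfolding n_def by (intro not_less_Least) auto
    then have "(2 ^ k) ^ 4 \<le> norm z ^ 4" by (intro power_mono) auto
    also have "\<dots> \<le> (1 + (norm z)\<^sup>2)\<^sup>2" by (simp add: power2_eq_square algebra_simps power4_eq_xxxx)
    finally have "16 ^ k \<le> (1 + (norm z)\<^sup>2)\<^sup>2" by (simp flip: power_mult_distrib power_mult add: mult.commute[of k] power_mult)
    then show ?thesis using Suc zero_less_power[of "16::real" k]
      by (auto simp: divide_simps intro: order_trans)
  qed
  then show "\<exists>n. z \<in> ball 0 (2 ^ n) \<and> \<bar>2 / (1 + (norm z)\<^sup>2)\<^sup>2\<bar> \<le> 32 / 16 ^ n"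
    using n by auto
qed auto

text \<open>The value is \<open>2\<pi>\<close>, but only positivity is needed.\<close>

definition fund_const :: real where
  "fund_const = integral\<^sup>L lborel (\<lambda>v::complex. 2 / (1 + (norm v)\<^sup>2)\<^sup>2)"

lemma fund_const_pos: "fund_const > 0"
proof -
  have "fund_const \<noteq> 0"
    unfolding fund_const_def
  proof (subst integral_nonneg_eq_0_iff_AE[OF integrable_fundamental_density])
    have p: "2 / (1 + (norm v)\<^sup>2)\<^sup>2 \<noteq> 0" for v :: complex
      by (simp add: add_nonneg_eq_0_iff)
    show "\<not> (AE v::complex in lborel. 2 / (1 + (norm v)\<^sup>2)\<^sup>2 = 0)"
      using p by (simp add: AE_iff_measurable[OF _ refl])
  qed simp
  moreover have "fund_const \<ge> 0" unfolding fund_const_def by simp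
  ultimately show ?thesis by simp
qed

subsection \<open>The logarithmic potential\<close>

lemma loc_int_borel: "loc_int K \<Longrightarrow> K \<in> borel_measurable borel"
  by (simp add: loc_int_def)

lemma loc_int_bound:
  assumes "loc_int K'" "K \<in> borel_measurable borel" "\<And>w. \<bar>K w\<bar> \<le> K' w"
  shows "loc_int K"
  unfolding loc_int_def
proof (intro conjI allI impI)
  fix R :: real assume R: "R > 0"
  note [measurable] = assms(2) loc_int_borel[OF assms(1)]
  show "integrable lborel (\<lambda>w. indicator (ball 0 R) w * K w)"
  proof (rule Bochner_Integration.integrable_bound)
    show "integrable lborel (\<lambda>w. indicator (ball 0 R) w * K' w)"
      using assms(1) R by (simp add: loc_int_def)
  qed (use assms(3) in \<open>auto simp: indicator_def intro: order_trans[OF _ abs_ge_self]\<close>)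
qed (rule assms)

lemma loc_int_continuous:
  assumes "continuous_on UNIV K" shows "loc_int K"
  unfolding loc_int_def
proof (intro conjI allI impI)
  show b: "K \<in> borel_measurable borel"
    using assms by (rule borel_measurable_continuous_onI)
  fix R :: real assume R: "R > 0"
  have "integrable lborel (\<lambda>w. indicator (cball 0 R) w *\<^sub>R K w)"
    using borel_integrable_compact[of "cball 0 R" K] assms continuous_on_subset
    by (auto simp: indicator_scaleR_eq_if)
  then show "integrable lborel (\<lambda>w. indicator (ball 0 R) w * K w)"
    by (rule Bochner_Integration.integrable_bound) (use b in \<open>auto simp: indicator_def\<close>)
qed

lemma loc_int_add: "loc_int K \<Longrightarrow> loc_int L \<Longrightarrow> loc_int (\<lambda>w. K w + L w)"
  unfolding loc_int_def by (auto simp: distrib_left)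

text \<open>Translating the density instead of the kernel lets all derivatives fall on \<phi>, so
  the kernel may be singular.\<close>

definition conv :: "(complex \<Rightarrow> real) \<Rightarrow> (complex \<Rightarrow> real) \<Rightarrow> complex \<Rightarrow> real" where
  "conv K \<phi> z = (\<integral>w. K w * \<phi> (z - w) \<partial>lborel)"

definition bsupp :: "real \<Rightarrow> (complex \<Rightarrow> real) \<Rightarrow> bool" where
  "bsupp R \<phi> \<longleftrightarrow> (\<forall>y. norm y > R \<longrightarrow> \<phi> y = 0)"

lemma bsupp_bounded:
  assumes "bsupp R \<phi>" "continuous_on UNIV \<phi>"
  obtains B where "\<And>y. \<bar>\<phi> y\<bar> \<le> B" "B \<ge> 0"
proof -
  have "compact (\<phi> ` cball 0 R)"
    using assms(2) by (intro compact_continuous_image) (auto intro: continuous_on_subset)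
  then obtain B where B: "\<forall>x\<in>\<phi> ` cball 0 R. norm x \<le> B"
    using compact_imp_bounded bounded_iff by blast
  have "\<bar>\<phi> y\<bar> \<le> max B 0" for y
    using B assms(1) by (cases "norm y \<le> R") (auto simp: bsupp_def le_max_iff_disj)
  then show ?thesis using that[of "max B 0"] by auto
qed

lemma pd_bsupp:
  assumes "bsupp R \<phi>" shows "bsupp R (pd i \<phi>)"
  unfolding bsupp_def
proof (intro allI impI)
  fix y :: complex assume y: "R < norm y"
  have "open {y::complex. R < norm y}" by (intro open_Collect_less continuous_intros)
  then have "pd i \<phi> y = pd i (\<lambda>_. 0) y"
    by (rule pd_cong) (use assms y in \<open>auto simp: bsupp_def\<close>)
  also have "\<dots> = 0" by (rule pd_eqI) simp
  finally show "pd i \<phi> y = 0" .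
qed

text \<open>A nonzero \<phi>(z - w) forces |w| \<le> Z + R, and the extra 1 puts w into an open
  ball. The bound no longer depends on z, so it dominates whole families of integrands.\<close>

lemma conv_integrand_bound:
  assumes "bsupp R \<phi>" "\<And>y. \<bar>\<phi> y\<bar> \<le> B" "norm z \<le> Z"
  shows "\<bar>K w * \<phi> (z - w)\<bar> \<le> B * \<bar>indicator (ball 0 (Z + R + 1)) w * K w\<bar>"
proof (cases "norm (z - w) > R")
  case True
  have "B \<ge> 0" using assms(2)[of 0] by linarith
  then show ?thesis using True assms(1) by (auto simp: bsupp_def)
next
  case False
  then have "norm w < Z + R + 1"
    using assms(3) norm_triangle_ineq2[of w z] by (simp add: norm_minus_commute)
  then have "indicator (ball 0 (Z + R + 1)) w = (1::real)" by (simp add: indicator_def)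
  then show ?thesis
    using assms(2)[of "z - w"] by (simp add: abs_mult mult_mono' mult.commute[of B])
qed

lemma
  assumes K: "loc_int K" and \<phi>: "bsupp R \<phi>" "\<And>y. \<bar>\<phi> y\<bar> \<le> B" "\<phi> \<in> borel_measurable borel"
    and z: "norm z \<le> Z" and Z: "Z + R + 1 > 0"
  shows conv_integrable: "integrable lborel (\<lambda>w. K w * \<phi> (z - w))"
    and conv_majorant: "integrable lborel (\<lambda>w. B * \<bar>indicator (ball 0 (Z + R + 1)) w * K w\<bar>)"
    and conv_bound: "\<bar>conv K \<phi> z\<bar> \<le> B * (\<integral>w. \<bar>indicator (ball 0 (Z + R + 1)) w * K w\<bar> \<partial>lborel)"
proof -
  note [measurable] = loc_int_borel[OF K] \<phi>(3)
  have *: "integrable lborel (\<lambda>w. \<bar>indicator (ball 0 (Z + R + 1)) w * K w\<bar>)"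
    using K Z by (auto simp: loc_int_def)
  then show 1: "integrable lborel (\<lambda>w. B * \<bar>indicator (ball 0 (Z + R + 1)) w * K w\<bar>)"
    by simp
  have b: "\<bar>K w * \<phi> (z - w)\<bar> \<le> B * \<bar>indicator (ball 0 (Z + R + 1)) w * K w\<bar>" for w
    by (rule conv_integrand_bound[OF \<phi>(1,2) z])
  show 2: "integrable lborel (\<lambda>w. K w * \<phi> (z - w))"
    by (rule Bochner_Integration.integrable_bound[OF 1])
       (use b in \<open>auto intro: order_trans[OF _ abs_ge_self]\<close>)
  have "\<bar>conv K \<phi> z\<bar> \<le> (\<integral>w. \<bar>K w * \<phi> (z - w)\<bar> \<partial>lborel)"
    unfolding conv_def by (rule integral_abs_bound)
  also have "\<dots> \<le> (\<integral>w. B * \<bar>indicator (ball 0 (Z + R + 1)) w * K w\<bar> \<partial>lborel)"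
    by (rule integral_mono) (use 1 2 b in auto)
  finally show "\<bar>conv K \<phi> z\<bar> \<le> B * (\<integral>w. \<bar>indicator (ball 0 (Z + R + 1)) w * K w\<bar> \<partial>lborel)"
    by simp
qed

lemma conv_continuous:
  assumes K: "loc_int K" and \<phi>: "bsupp R \<phi>" "continuous_on UNIV \<phi>" and R: "R > 0"
  shows "continuous_on UNIV (conv K \<phi>)"
proof -
  obtain B where B: "\<And>y. \<bar>\<phi> y\<bar> \<le> B" using bsupp_bounded[OF \<phi>] by blast
  have [measurable]: "\<phi> \<in> borel_measurable borel" "K \<in> borel_measurable borel"
    using \<phi>(2) borel_measurable_continuous_onI loc_int_borel[OF K] by auto
  have "isCont (conv K \<phi>) z" for z
    unfolding continuous_at_sequentially comp_def
  proof (intro allI impI)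
    fix X assume X: "X \<longlonglongrightarrow> z"
    then obtain Z where Z: "\<And>n. norm (X n) \<le> Z" "Z > 0"
      using convergent_imp_Bseq[of X] by (auto simp: convergent_def Bseq_def)
    show "(\<lambda>n. conv K \<phi> (X n)) \<longlonglongrightarrow> conv K \<phi> z"
      unfolding conv_def
    proof (rule integral_dominated_convergence)
      show "integrable lborel (\<lambda>w. B * \<bar>indicator (ball 0 (Z + R + 1)) w * K w\<bar>)"
        by (rule conv_majorant[OF K \<phi>(1) B _ Z(1)]) (use Z R in auto)
      show "AE w in lborel. (\<lambda>n. K w * \<phi> (X n - w)) \<longlonglongrightarrow> K w * \<phi> (z - w)"
        by (intro AE_I2 tendsto_intros continuous_on_tendsto_compose[OF \<phi>(2)] X) auto
      show "AE w in lborel. norm (K w * \<phi> (X n - w)) \<le> B * \<bar>indicator (ball 0 (Z + R + 1)) w * K w\<bar>" for n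
        using conv_integrand_bound[OF \<phi>(1) B Z(1)] by auto
    qed auto
  qed
  then show ?thesis by (simp add: continuous_on_eq_continuous_at)
qed

lemma Ck_on_line_DERIV:
  fixes \<phi> :: "'a::euclidean_space \<Rightarrow> real"
  assumes "Ck_on (Suc k) S \<phi>" "i \<in> Basis" "y + t *\<^sub>R i \<in> S"
  shows "((\<lambda>t. \<phi> (y + t *\<^sub>R i)) has_field_derivative pd i \<phi> (y + t *\<^sub>R i)) (at t)"
proof -
  have "((\<lambda>s. \<phi> ((y + t *\<^sub>R i) + s *\<^sub>R i)) has_field_derivative pd i \<phi> (y + t *\<^sub>R i)) (at 0)"
    using Ck_on_has_pd[OF assms] by (simp add: has_real_derivative_iff_has_vector_derivative)
  then have "((\<lambda>s. \<phi> (y + (s + t) *\<^sub>R i)) has_field_derivative pd i \<phi> (y + t *\<^sub>R i)) (at 0)"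
    by (simp add: algebra_simps scaleR_add_left)
  then show ?thesis
    using DERIV_shift[of "\<lambda>s. \<phi> (y + s *\<^sub>R i)" "pd i \<phi> (y + t *\<^sub>R i)" 0 t] by simp
qed

lemma conv_has_pd:
  assumes K: "loc_int K" and \<phi>: "bsupp R \<phi>" "Ck_on (Suc 0) UNIV \<phi>" and R: "R > 0" and i: "i \<in> Basis"
  shows "((\<lambda>t. conv K \<phi> (z + t *\<^sub>R i)) has_vector_derivative conv K (pd i \<phi>) z) (at 0)"
proof -
  have c: "continuous_on UNIV \<phi>" "continuous_on UNIV (pd i \<phi>)"
    using \<phi>(2) i by auto
  have [measurable]: "\<phi> \<in> borel_measurable borel" "pd i \<phi> \<in> borel_measurable borel" "K \<in> borel_measurable borel"
    using c borel_measurable_continuous_onI loc_int_borel[OF K] by auto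
  obtain B where B: "\<And>y. \<bar>\<phi> y\<bar> \<le> B" using bsupp_bounded[OF \<phi>(1) c(1)] by blast
  obtain B' where B': "\<And>y. \<bar>pd i \<phi> y\<bar> \<le> B'" using bsupp_bounded[OF pd_bsupp[OF \<phi>(1)] c(2)] by blast
  have nz: "norm (z + t *\<^sub>R i) \<le> norm z + 1" if "t \<in> {-1<..<1}" for t
    using that i norm_triangle_ineq[of z "t *\<^sub>R i"] by auto
  have "((\<lambda>t. conv K \<phi> (z + t *\<^sub>R i)) has_field_derivative conv K (pd i \<phi>) (z + 0 *\<^sub>R i)) (at 0)"
    unfolding conv_def
  proof (rule has_field_derivative_integral(1)[where S="{-1<..<1}" and F'="\<lambda>t w. K w * pd i \<phi> (z + t *\<^sub>R i - w)"])
    show "integrable lborel (\<lambda>w. K w * \<phi> (z + t *\<^sub>R i - w))" if "t \<in> {-1<..<1}" for t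
      by (rule conv_integrable[OF K \<phi>(1) B _ nz[OF that]]) (use R in \<open>auto simp: add_nonneg_pos\<close>)
    show "integrable lborel (\<lambda>w. B' * \<bar>indicator (ball 0 (norm z + 1 + R + 1)) w * K w\<bar>)"
      by (rule conv_majorant[OF K pd_bsupp[OF \<phi>(1)] B' _ nz[of 0]]) (use R in \<open>auto simp: add_nonneg_pos\<close>)
    have "((\<lambda>t. \<phi> (z + t *\<^sub>R i - w)) has_field_derivative pd i \<phi> (z + t *\<^sub>R i - w)) (at t)" for t w
      using Ck_on_line_DERIV[OF \<phi>(2) i, of "z - w" t] by (simp add: algebra_simps)
    then show "AE w in lborel. \<forall>t\<in>{-1<..<1}. ((\<lambda>t. K w * \<phi> (z + t *\<^sub>R i - w)) has_field_derivative K w * pd i \<phi> (z + t *\<^sub>R i - w)) (at t)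
        \<and> norm (K w * pd i \<phi> (z + t *\<^sub>R i - w)) \<le> B' * \<bar>indicator (ball 0 (norm z + 1 + R + 1)) w * K w\<bar>"
      using conv_integrand_bound[OF pd_bsupp[OF \<phi>(1)] B' nz] by (auto intro!: AE_I2 DERIV_cmult)
  qed auto
  then show ?thesis by (simp add: has_real_derivative_iff_has_vector_derivative)
qed

lemma conv_Ck:
  assumes K: "loc_int K" and R: "R > 0"
  shows "bsupp R \<phi> \<Longrightarrow> Ck_on k UNIV \<phi> \<Longrightarrow> Ck_on k UNIV (conv K \<phi>)"
proof (induction k arbitrary: \<phi>)
  case 0
  then show ?case using conv_continuous[OF K _ _ R] by simp
next
  case (Suc k)
  show ?case
  proof (rule Ck_on_SucI[OF open_UNIV, where D="\<lambda>i. conv K (pd i \<phi>)"])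
    show "continuous_on UNIV (conv K \<phi>)"
      using conv_continuous[OF K Suc.prems(1) _ R] Suc.prems(2) by simp
    show "((\<lambda>t. conv K \<phi> (x + t *\<^sub>R i)) has_vector_derivative conv K (pd i \<phi>) x) (at 0)" if "i \<in> Basis" for i x
      by (rule conv_has_pd[OF K Suc.prems(1) Ck_on_le[OF Suc.prems(2)] R that]) simp
    show "Ck_on k UNIV (conv K (pd i \<phi>))" if "i \<in> Basis" for i
      by (rule Suc.IH[OF pd_bsupp[OF Suc.prems(1)] Ck_on_pd[OF Suc.prems(2) that]])
  qed
qed

text \<open>Convolution with the constant kernel 1 is a constant function of z, and its derivative
  is the integral in question. This gives integration by parts in the plane without iterated
  integrals.\<close>

lemma integral_pd_eq_0:
  assumes \<phi>: "bsupp R \<phi>" "Ck_on (Suc 0) UNIV \<phi>" and R: "R > 0" and i: "i \<in> Basis"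
  shows "(\<integral>z. pd i \<phi> z \<partial>lborel) = 0"
proof -
  have c: "continuous_on UNIV \<phi>" "continuous_on UNIV (pd i \<phi>)"
    using \<phi>(2) i by auto
  then have m: "\<phi> \<in> borel_measurable borel" "pd i \<phi> \<in> borel_measurable borel"
    using borel_measurable_continuous_onI by auto
  have 1: "conv (\<lambda>_. 1) \<phi> z = (\<integral>w. \<phi> w \<partial>lborel)" for z
    unfolding conv_def using lborel_integral_reflect[OF m(1)] by simp
  have 2: "conv (\<lambda>_. 1) (pd i \<phi>) 0 = (\<integral>w. pd i \<phi> w \<partial>lborel)"
    unfolding conv_def using lborel_integral_reflect[OF m(2), of 0] by simp
  have "((\<lambda>t. conv (\<lambda>_. 1) \<phi> (0 + t *\<^sub>R i)) has_vector_derivative conv (\<lambda>_. 1) (pd i \<phi>) 0) (at 0)"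
    by (rule conv_has_pd[OF loc_int_continuous \<phi> R i]) auto
  then have "((\<lambda>t::real. (\<integral>w. \<phi> w \<partial>lborel)) has_vector_derivative (\<integral>w. pd i \<phi> w \<partial>lborel)) (at 0)"
    using 1 2 by simp
  moreover have "((\<lambda>t::real. (\<integral>w. \<phi> w \<partial>lborel)) has_vector_derivative 0) (at 0)" by simp
  ultimately show ?thesis by (rule vector_derivative_unique_at)
qed

lemma conv_reflect:
  assumes "K \<in> borel_measurable borel" "\<phi> \<in> borel_measurable borel"
  shows "conv K \<phi> z = (\<integral>w. K (z - w) * \<phi> w \<partial>lborel)"
proof -
  note [measurable] = assms
  show ?thesis unfolding conv_def
    by (subst lborel_integral_reflect[where z=z, symmetric]) auto
qed

text \<open>Here the derivative falls on the kernel, so the density need only be continuous. The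
  bounded gradient required of the kernel is provided by the regularisation with \<epsilon> >
  0.\<close>

lemma conv_kernel_has_pd:
  assumes K: "loc_int K" and \<phi>: "bsupp R \<phi>" "continuous_on UNIV \<phi>" and R: "R > 0"
    and K': "K' \<in> borel_measurable borel" "\<And>w. \<bar>K' w\<bar> \<le> B"
    and der: "\<And>w t. ((\<lambda>t. K (w + t *\<^sub>R i)) has_field_derivative K' (w + t *\<^sub>R i)) (at t)"
  shows "((\<lambda>t. conv K \<phi> (z + t *\<^sub>R i)) has_field_derivative conv K' \<phi> (z + t *\<^sub>R i)) (at t)"
proof -
  have [measurable]: "\<phi> \<in> borel_measurable borel" "K \<in> borel_measurable borel" "K' \<in> borel_measurable borel"
    using \<phi>(2) borel_measurable_continuous_onI loc_int_borel[OF K] K' by auto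
  obtain A where A: "\<And>y. \<bar>\<phi> y\<bar> \<le> A" using bsupp_bounded[OF \<phi>] by blast
  have "integrable lborel (\<lambda>w. K (x - w) * \<phi> w)" for x
    using lborel_integrable_reflect[OF conv_integrable[OF K \<phi>(1) A _ order_refl, of x], of x] R
    by (simp add: add_nonneg_pos)
  have int\<phi>: "integrable lborel \<phi>"
    using lborel_integrable_reflect[OF conv_integrable[OF loc_int_continuous[of "\<lambda>_. 1"] \<phi>(1) A _ order_refl, of 0], of 0] R
    by simp
  have *: "conv K \<phi> z = (\<integral>w. K (z - w) * \<phi> w \<partial>lborel)" "conv K' \<phi> z = (\<integral>w. K' (z - w) * \<phi> w \<partial>lborel)" for z
    by (intro conv_reflect; simp)+
  show ?thesis
    unfolding *
  proof (rule has_field_derivative_integral(1)[where S="UNIV" and F'="\<lambda>t w. K' (z + t *\<^sub>R i - w) * \<phi> w"])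
    show "integrable lborel (\<lambda>w. K (z + t *\<^sub>R i - w) * \<phi> w)" for t by fact
    show "integrable lborel (\<lambda>w. B * \<bar>\<phi> w\<bar>)" using int\<phi> by auto
    have "((\<lambda>t. K (z + t *\<^sub>R i - w)) has_field_derivative K' (z + t *\<^sub>R i - w)) (at t)" for t w
      using der[of "z - w" t] by (simp add: algebra_simps)
    then show "AE w in lborel. \<forall>t\<in>UNIV. ((\<lambda>t. K (z + t *\<^sub>R i - w) * \<phi> w) has_field_derivative K' (z + t *\<^sub>R i - w) * \<phi> w) (at t)
        \<and> norm (K' (z + t *\<^sub>R i - w) * \<phi> w) \<le> B * \<bar>\<phi> w\<bar>"
      using K'(2) by (auto intro!: AE_I2 DERIV_cmult_right simp: abs_mult mult_right_mono)
  qed auto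
qed

text \<open>\<open>\<epsilon> = 0\<close> gives \<open>ln |w|\<close> and its gradient \<open>w / |w|\<^sup>2\<close>, with the junk value 0 at \<open>w = 0\<close>.\<close>

definition lnk :: "real \<Rightarrow> complex \<Rightarrow> real" where
  "lnk \<epsilon> w = ln ((norm w)\<^sup>2 + \<epsilon>\<^sup>2) / 2"

definition gradk :: "real \<Rightarrow> complex \<Rightarrow> complex \<Rightarrow> real" where
  "gradk \<epsilon> i w = (w \<bullet> i) / ((norm w)\<^sup>2 + \<epsilon>\<^sup>2)"

lemma lnk_0: "lnk 0 w = ln (norm w)"
  by (cases "w = 0") (auto simp: lnk_def ln_realpow)

lemma lnk_borel [measurable]: "lnk \<epsilon> \<in> borel_measurable borel"
  unfolding lnk_def by measurable

lemma gradk_borel [measurable]: "gradk \<epsilon> i \<in> borel_measurable borel"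
  unfolding gradk_def by measurable

text \<open>The majorant is uniform in \<epsilon>. It comes from ln x \<le> x - 1, used above for
  |w|^2 + \<epsilon>^2 and below for 1 / |w| after dropping \<epsilon>.\<close>

lemma abs_lnk_le:
  assumes "0 \<le> \<epsilon>" "\<epsilon> \<le> 1" "w \<noteq> 0"
  shows "\<bar>lnk \<epsilon> w\<bar> \<le> 1 / norm w + (norm w)\<^sup>2"
proof -
  have "\<epsilon>\<^sup>2 \<le> 1" using assms by (simp add: power_le_one)
  have "lnk \<epsilon> w \<le> ((norm w)\<^sup>2 + \<epsilon>\<^sup>2 - 1) / 2"
    unfolding lnk_def using assms by (intro divide_right_mono ln_le_minus_one) (auto simp: add_pos_nonneg)
  also have "\<dots> \<le> 1 / norm w + (norm w)\<^sup>2"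
  proof -
    have "(\<epsilon>\<^sup>2 - 1) / 2 \<le> 0" "1 / norm w \<ge> 0" "(norm w)\<^sup>2 \<ge> 0"
      using \<open>\<epsilon>\<^sup>2 \<le> 1\<close> by auto
    then show ?thesis by argo
  qed
  finally have 1: "lnk \<epsilon> w \<le> 1 / norm w + (norm w)\<^sup>2" .
  have "ln (1 / norm w) \<le> 1 / norm w - 1"
    using assms by (intro ln_le_minus_one) auto
  moreover have "lnk 0 w \<le> lnk \<epsilon> w"
    unfolding lnk_def using assms by (auto intro!: divide_right_mono simp: add_pos_nonneg)
  ultimately have 2: "- (1 / norm w) \<le> lnk \<epsilon> w"
    using assms by (simp add: lnk_0 ln_div)
  show ?thesis using 1 2 zero_le_power2[of "norm w"] by linarith
qed

lemma abs_gradk_le: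
  assumes "norm i = 1"
  shows "\<bar>gradk \<epsilon> i w\<bar> \<le> 1 / norm w"
proof (cases "w = 0")
  case False
  have "\<bar>w \<bullet> i\<bar> \<le> norm w" using Cauchy_Schwarz_ineq2[of w i] assms by simp
  moreover have "(norm w)\<^sup>2 + \<epsilon>\<^sup>2 \<ge> (norm w)\<^sup>2" by simp
  ultimately have "\<bar>w \<bullet> i\<bar> / ((norm w)\<^sup>2 + \<epsilon>\<^sup>2) \<le> norm w / (norm w)\<^sup>2"
    using False by (intro frac_le) auto
  then show ?thesis using False by (simp add: gradk_def power2_eq_square)
qed (simp add: gradk_def)

lemma loc_int_lnk:
  assumes "0 \<le> \<epsilon>" "\<epsilon> \<le> 1" shows "loc_int (lnk \<epsilon>)"
proof (rule loc_int_bound)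
  \<comment> \<open>The constant covers w = 0, where 1 / 0 = 0 spoils the majorant.\<close>
  show "loc_int (\<lambda>w. 1 / norm w + ((norm w)\<^sup>2 + \<bar>lnk \<epsilon> 0\<bar>))"
    by (intro loc_int_add loc_int_inverse_norm loc_int_continuous continuous_intros)
  show "\<bar>lnk \<epsilon> w\<bar> \<le> 1 / norm w + ((norm w)\<^sup>2 + \<bar>lnk \<epsilon> 0\<bar>)" for w
    using abs_lnk_le[OF assms, of w] by (cases "w = 0") auto
qed simp

lemma loc_int_gradk: "norm i = 1 \<Longrightarrow> loc_int (gradk \<epsilon> i)"
  by (rule loc_int_bound[OF loc_int_inverse_norm gradk_borel abs_gradk_le])

lemma has_deriv_norm_square:
  "((\<lambda>t. (norm (w + t *\<^sub>R i))\<^sup>2) has_field_derivative 2 * ((w + t *\<^sub>R i) \<bullet> i)) (at t)"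
  unfolding power2_norm_eq_inner has_field_derivative_def
  by (auto intro!: derivative_eq_intros simp: inner_commute algebra_simps)

lemma lnk_DERIV:
  assumes "\<epsilon> > 0"
  shows "((\<lambda>t. lnk \<epsilon> (w + t *\<^sub>R i)) has_field_derivative gradk \<epsilon> i (w + t *\<^sub>R i)) (at t)"
proof -
  have p: "(norm (w + t *\<^sub>R i))\<^sup>2 + \<epsilon>\<^sup>2 > 0" using assms by (simp add: add_nonneg_pos)
  have "((\<lambda>t. ln ((norm (w + t *\<^sub>R i))\<^sup>2 + \<epsilon>\<^sup>2) / 2) has_field_derivative
      (inverse ((norm (w + t *\<^sub>R i))\<^sup>2 + \<epsilon>\<^sup>2) * (2 * ((w + t *\<^sub>R i) \<bullet> i) + 0)) / 2) (at t)"
    by (intro DERIV_cdivide DERIV_chain2[where f=ln and g="\<lambda>t. (norm (w + t *\<^sub>R i))\<^sup>2 + \<epsilon>\<^sup>2", OF DERIV_ln[OF p]] DERIV_add has_deriv_norm_square DERIV_const)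
  note * = this
  show ?thesis
  proof -
    have eq: "inverse s * (2 * x + 0) / 2 = x / s" for s x :: real by (simp add: inverse_eq_divide)
    show ?thesis
      unfolding lnk_def gradk_def by (rule DERIV_cong[OF * eq])
  qed
qed

lemma abs_gradk_le':
  assumes "\<epsilon> > 0" "norm i = 1"
  shows "\<bar>gradk \<epsilon> i w\<bar> \<le> 1 / \<epsilon>"
proof -
  have p: "(norm w)\<^sup>2 + \<epsilon>\<^sup>2 > 0" using assms by (simp add: add_nonneg_pos)
  have "\<bar>w \<bullet> i\<bar> \<le> norm w" using Cauchy_Schwarz_ineq2[of w i] assms by simp
  then have "\<epsilon> * \<bar>w \<bullet> i\<bar> \<le> \<epsilon> * norm w" using assms by simp
  also have "\<dots> \<le> (norm w)\<^sup>2 + \<epsilon>\<^sup>2"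
  proof -
    have "\<epsilon> * norm w \<ge> 0" using assms by simp
    then show ?thesis using sum_squares_bound[of \<epsilon> "norm w"] by linarith
  qed
  finally show ?thesis using p assms by (simp add: gradk_def field_simps)
qed

text \<open>The difference is at most sup |\<phi>| times the L^1 distance of the kernels on one
  ball, which does not involve z. The resulting uniformity is what differentiation of a limit
  requires.\<close>

lemma conv_L1_limit:
  assumes K: "\<And>n. loc_int (K n)" "loc_int K0" "loc_int D"
    and lim: "\<And>w. w \<noteq> 0 \<Longrightarrow> (\<lambda>n. K n w) \<longlonglongrightarrow> K0 w"
    and D: "\<And>n w. w \<noteq> 0 \<Longrightarrow> \<bar>K n w\<bar> \<le> D w" "\<And>w. w \<noteq> 0 \<Longrightarrow> \<bar>K0 w\<bar> \<le> D w"
    and \<phi>: "bsupp R \<phi>" "continuous_on UNIV \<phi>" and R: "R > 0" and e: "e > 0"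
  shows "\<forall>\<^sub>F n in sequentially. \<forall>z. norm z \<le> Z \<longrightarrow> \<bar>conv (K n) \<phi> z - conv K0 \<phi> z\<bar> \<le> e"
proof (cases "Z \<ge> 0")
  case True
  obtain B where B: "\<And>y. \<bar>\<phi> y\<bar> \<le> B" "B \<ge> 0" using bsupp_bounded[OF \<phi>] by blast
  let ?R = "Z + R + 1"
  have [measurable]: "\<phi> \<in> borel_measurable borel" "K n \<in> borel_measurable borel" "K0 \<in> borel_measurable borel"
     "D \<in> borel_measurable borel" for n
    using \<phi>(2) borel_measurable_continuous_onI loc_int_borel K by auto
  have ne: "AE w::complex in lborel. w \<noteq> 0" by (rule AE_lborel_singleton)
  have "(\<lambda>n. \<integral>w. \<bar>indicator (ball 0 ?R) w * (K n w - K0 w)\<bar> \<partial>lborel) \<longlonglongrightarrow> integral\<^sup>L lborel (\<lambda>w::complex. 0)"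
  proof (rule integral_dominated_convergence)
    show "integrable lborel (\<lambda>w. 2 * (indicator (ball 0 ?R) w * D w))"
      using K(3) True R by (auto simp: loc_int_def)
    show "AE w in lborel. (\<lambda>n. \<bar>indicator (ball 0 ?R) w * (K n w - K0 w)\<bar>) \<longlonglongrightarrow> 0"
      using ne
    proof eventually_elim
      case (elim w)
      have "(\<lambda>n. \<bar>indicator (ball 0 ?R) w * (K n w - K0 w)\<bar>) \<longlonglongrightarrow> \<bar>indicator (ball 0 ?R) w * (K0 w - K0 w)\<bar>"
        by (intro tendsto_intros lim elim)
      then show ?case by simp
    qed
    show "AE w in lborel. norm \<bar>indicator (ball 0 ?R) w * (K n w - K0 w)\<bar> \<le> 2 * (indicator (ball 0 ?R) w * D w)" for n
      using ne
    proof eventually_elim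
      case (elim w)
      then have "\<bar>K n w - K0 w\<bar> \<le> 2 * D w" using D(1)[OF elim, of n] D(2)[OF elim] by linarith
      then show ?case by (auto simp: indicator_def)
    qed
  qed auto
  then have "(\<lambda>n. B * (\<integral>w. \<bar>indicator (ball 0 ?R) w * (K n w - K0 w)\<bar> \<partial>lborel)) \<longlonglongrightarrow> B * 0"
    by (intro tendsto_mult_left) simp
  then have "\<forall>\<^sub>F n in sequentially. B * (\<integral>w. \<bar>indicator (ball 0 ?R) w * (K n w - K0 w)\<bar> \<partial>lborel) < e"
    using e by (intro order_tendstoD) auto
  then show ?thesis
  proof eventually_elim
    case (elim n)
    show ?case
    proof (intro allI impI)
      fix z :: complex assume z: "norm z \<le> Z"
      have "loc_int (\<lambda>w. K n w - K0 w)"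
        using loc_int_add[of "K n" "\<lambda>w. - K0 w"] K by (auto simp: loc_int_def)
      then have "\<bar>conv (\<lambda>w. K n w - K0 w) \<phi> z\<bar> \<le> B * (\<integral>w. \<bar>indicator (ball 0 ?R) w * (K n w - K0 w)\<bar> \<partial>lborel)"
        by (rule conv_bound[OF _ \<phi>(1) B(1) _ z]) (use True R in auto)
      moreover have "conv (\<lambda>w. K n w - K0 w) \<phi> z = conv (K n) \<phi> z - conv K0 \<phi> z"
        unfolding conv_def left_diff_distrib
        by (intro Bochner_Integration.integral_diff conv_integrable[OF _ \<phi>(1) B(1) _ z] K) (use True R in auto)
      ultimately show "\<bar>conv (K n) \<phi> z - conv K0 \<phi> z\<bar> \<le> e" using elim by linarith
    qed
  qed
next
  case False
  then have "\<not> norm (z::complex) \<le> Z" for z using norm_ge_zero[of z] by linarith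
  then show ?thesis by simp
qed

abbreviation (input) inv_seq :: "nat \<Rightarrow> real" where "inv_seq n \<equiv> inverse (real (Suc n))"

lemma lnk_limit: "w \<noteq> 0 \<Longrightarrow> (\<lambda>n. lnk (inv_seq n) w) \<longlonglongrightarrow> lnk 0 w"
  unfolding lnk_def by (intro tendsto_intros LIMSEQ_inverse_real_of_nat) auto

lemma gradk_limit: "w \<noteq> 0 \<Longrightarrow> (\<lambda>n. gradk (inv_seq n) i w) \<longlonglongrightarrow> gradk 0 i w"
  unfolding gradk_def by (intro tendsto_intros LIMSEQ_inverse_real_of_nat) auto

lemma inv_seq_bounds: "0 < inv_seq n" "inv_seq n \<le> 1" "0 \<le> inv_seq n"
  by (auto simp: field_simps)

lemma conv_gradk_limit:
  assumes "bsupp R \<phi>" "continuous_on UNIV \<phi>" "R > 0" "norm i = 1" "e > 0"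
  shows "\<forall>\<^sub>F n in sequentially. \<forall>z. norm z \<le> Z \<longrightarrow> \<bar>conv (gradk (inv_seq n) i) \<phi> z - conv (gradk 0 i) \<phi> z\<bar> \<le> e"
  by (rule conv_L1_limit[OF _ _ loc_int_inverse_norm gradk_limit abs_gradk_le abs_gradk_le assms(1,2,3,5)])
     (use assms in \<open>auto intro: loc_int_gradk\<close>)

lemma conv_lnk_limit:
  assumes "bsupp R \<phi>" "continuous_on UNIV \<phi>" "R > 0" "e > 0"
  shows "\<forall>\<^sub>F n in sequentially. \<forall>z. norm z \<le> Z \<longrightarrow> \<bar>conv (lnk (inv_seq n)) \<phi> z - conv (lnk 0) \<phi> z\<bar> \<le> e"
proof (rule conv_L1_limit[where D="\<lambda>w. 1 / norm w + (norm w)\<^sup>2", OF _ _ _ lnk_limit abs_lnk_le[OF inv_seq_bounds(3,2)] abs_lnk_le assms])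
  show "loc_int (\<lambda>w. 1 / norm w + (norm w)\<^sup>2)"
    by (intro loc_int_add loc_int_inverse_norm loc_int_continuous continuous_intros)
qed (rule loc_int_lnk inv_seq_bounds order_refl zero_le_one | assumption)+

text \<open>The density is only continuous and cannot absorb a derivative. Instead the gradients of
  the regularised potentials converge uniformly on bounded sets, and the limit of the potentials may
  be differentiated.\<close>

lemma conv_log_has_pd:
  assumes \<phi>: "bsupp R \<phi>" "continuous_on UNIV \<phi>" and R: "R > 0" and i: "norm i = 1"
  shows "((\<lambda>t. conv (lnk 0) \<phi> (z + t *\<^sub>R i)) has_vector_derivative conv (gradk 0 i) \<phi> z) (at 0)"
proof -
  let ?S = "{-1<..<1::real}"
  have nz: "norm (z + t *\<^sub>R i) \<le> norm z + 1" if "t \<in> ?S" for t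
    using that i norm_triangle_ineq[of z "t *\<^sub>R i"] by auto
  have lim: "(\<lambda>n. conv (lnk (inv_seq n)) \<phi> y) \<longlonglongrightarrow> conv (lnk 0) \<phi> y" for y
  proof (rule LIMSEQ_I)
    fix e :: real assume "e > 0"
    have "\<forall>\<^sub>F n in sequentially. \<bar>conv (lnk (inv_seq n)) \<phi> y - conv (lnk 0) \<phi> y\<bar> \<le> e / 2"
      using conv_lnk_limit[OF \<phi> R, of "e / 2" "norm y"] \<open>e > 0\<close> by (auto elim!: eventually_mono)
    then show "\<exists>N. \<forall>n\<ge>N. norm (conv (lnk (inv_seq n)) \<phi> y - conv (lnk 0) \<phi> y) < e"
      using \<open>e > 0\<close> unfolding eventually_sequentially by (force intro: le_less_trans)
  qed
  have "\<exists>g. \<forall>t\<in>?S. (\<lambda>n. conv (lnk (inv_seq n)) \<phi> (z + t *\<^sub>R i)) \<longlonglongrightarrow> g t \<and>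
      (g has_derivative (\<lambda>h. conv (gradk 0 i) \<phi> (z + t *\<^sub>R i) * h)) (at t within ?S)"
  proof (rule has_derivative_sequence[where f'="\<lambda>n t h. conv (gradk (inv_seq n) i) \<phi> (z + t *\<^sub>R i) * h"])
    show "((\<lambda>t. conv (lnk (inv_seq n)) \<phi> (z + t *\<^sub>R i)) has_derivative
        (\<lambda>h. conv (gradk (inv_seq n) i) \<phi> (z + t *\<^sub>R i) * h)) (at t within ?S)" if "t \<in> ?S" for n t
      using conv_kernel_has_pd[OF loc_int_lnk \<phi> R gradk_borel abs_gradk_le' lnk_DERIV, of "inv_seq n" i z t] inv_seq_bounds[of n] i
      by (auto simp: has_field_derivative_def intro: has_derivative_at_withinI)
    show "\<forall>\<^sub>F n in sequentially. \<forall>t\<in>?S. \<forall>h. norm (conv (gradk (inv_seq n) i) \<phi> (z + t *\<^sub>R i) * h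
        - conv (gradk 0 i) \<phi> (z + t *\<^sub>R i) * h) \<le> e * norm h" if "e > 0" for e
      using conv_gradk_limit[OF \<phi> R i that, of "norm z + 1"]
      by eventually_elim (use nz in \<open>auto simp: abs_mult intro!: mult_right_mono simp flip: left_diff_distrib\<close>)
    show "(\<lambda>n. conv (lnk (inv_seq n)) \<phi> (z + 0 *\<^sub>R i)) \<longlonglongrightarrow> conv (lnk 0) \<phi> z"
      using lim[of z] by simp
  qed auto
  then obtain g where g: "\<And>t. t \<in> ?S \<Longrightarrow> (\<lambda>n. conv (lnk (inv_seq n)) \<phi> (z + t *\<^sub>R i)) \<longlonglongrightarrow> g t"
      "\<And>t. t \<in> ?S \<Longrightarrow> (g has_derivative (\<lambda>h. conv (gradk 0 i) \<phi> (z + t *\<^sub>R i) * h)) (at t within ?S)"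
    by blast
  have "g t = conv (lnk 0) \<phi> (z + t *\<^sub>R i)" if "t \<in> ?S" for t
    using LIMSEQ_unique[OF g(1)[OF that] lim] .
  moreover have "(g has_field_derivative conv (gradk 0 i) \<phi> z) (at 0)"
    using g(2)[of 0] at_within_open[of 0 ?S] by (simp add: has_field_derivative_def)
  ultimately have "((\<lambda>t. conv (lnk 0) \<phi> (z + t *\<^sub>R i)) has_field_derivative conv (gradk 0 i) \<phi> z) (at 0)"
    by (elim has_field_derivative_transform_within_open[of _ _ _ ?S]) auto
  then show ?thesis by (simp add: has_real_derivative_iff_has_vector_derivative)
qed

text \<open>The first derivative is taken on the kernel, the other k on the density. The gain is one
  order, so a C^1 density is needed for a C^2 potential.\<close>

lemma conv_log_Ck:
  assumes \<phi>: "bsupp R \<phi>" "Ck_on k UNIV \<phi>" and R: "R > 0"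
  shows "Ck_on (Suc k) UNIV (conv (lnk 0) \<phi>)"
proof (rule Ck_on_SucI[OF open_UNIV, where D="\<lambda>i. conv (gradk 0 i) \<phi>"])
  have c: "continuous_on UNIV \<phi>" using \<phi>(2) by (rule Ck_on_continuous)
  show "continuous_on UNIV (conv (lnk 0) \<phi>)"
    by (rule conv_continuous[OF loc_int_lnk \<phi>(1) c R]) auto
  show "((\<lambda>t. conv (lnk 0) \<phi> (x + t *\<^sub>R i)) has_vector_derivative conv (gradk 0 i) \<phi> x) (at 0)" if "i \<in> Basis" for i x
    by (rule conv_log_has_pd[OF \<phi>(1) c R]) (use that in auto)
  show "Ck_on k UNIV (conv (gradk 0 i) \<phi>)" if "i \<in> Basis" for i
    by (rule conv_Ck[OF loc_int_gradk R \<phi>]) (use that in auto)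
qed

lemma gradk_DERIV:
  assumes "\<epsilon> > 0" "norm i = 1"
  shows "((\<lambda>t. gradk \<epsilon> i (w + t *\<^sub>R i)) has_field_derivative
    1 / ((norm w)\<^sup>2 + \<epsilon>\<^sup>2) - 2 * (w \<bullet> i)\<^sup>2 / ((norm w)\<^sup>2 + \<epsilon>\<^sup>2)\<^sup>2) (at 0)"
proof -
  have p: "(norm w)\<^sup>2 + \<epsilon>\<^sup>2 > 0" using assms by (simp add: add_nonneg_pos)
  have i: "i \<bullet> i = 1" using assms by (simp add: dot_square_norm)
  have 1: "((\<lambda>t. (w + t *\<^sub>R i) \<bullet> i) has_field_derivative 1) (at 0)"
    unfolding has_field_derivative_def by (auto intro!: derivative_eq_intros simp: i)
  have 2: "((\<lambda>t. (norm (w + t *\<^sub>R i))\<^sup>2 + \<epsilon>\<^sup>2) has_field_derivative 2 * (w \<bullet> i) + 0) (at 0)"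
    using has_deriv_norm_square[of w i 0] by (intro DERIV_add) auto
  have "((\<lambda>t. ((w + t *\<^sub>R i) \<bullet> i) / ((norm (w + t *\<^sub>R i))\<^sup>2 + \<epsilon>\<^sup>2)) has_field_derivative
    (1 * ((norm (w + 0 *\<^sub>R i))\<^sup>2 + \<epsilon>\<^sup>2) - ((w + 0 *\<^sub>R i) \<bullet> i) * (2 * (w \<bullet> i) + 0)) /
     (((norm (w + 0 *\<^sub>R i))\<^sup>2 + \<epsilon>\<^sup>2) * ((norm (w + 0 *\<^sub>R i))\<^sup>2 + \<epsilon>\<^sup>2))) (at 0)"
    by (rule DERIV_divide[OF 1 2]) (use p in auto)
  then show ?thesis unfolding gradk_def
  proof (rule DERIV_cong)
    show "(1 * ((norm (w + 0 *\<^sub>R i))\<^sup>2 + \<epsilon>\<^sup>2) - ((w + 0 *\<^sub>R i) \<bullet> i) * (2 * (w \<bullet> i) + 0)) /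
     (((norm (w + 0 *\<^sub>R i))\<^sup>2 + \<epsilon>\<^sup>2) * ((norm (w + 0 *\<^sub>R i))\<^sup>2 + \<epsilon>\<^sup>2)) =
     1 / ((norm w)\<^sup>2 + \<epsilon>\<^sup>2) - 2 * (w \<bullet> i)\<^sup>2 / ((norm w)\<^sup>2 + \<epsilon>\<^sup>2)\<^sup>2"
      using p by (simp add: divide_simps) (simp add: power2_eq_square algebra_simps)
  qed
qed

lemma Ck_on_gradk: "\<epsilon> > 0 \<Longrightarrow> Ck_on k UNIV (gradk \<epsilon> i)"
proof -
  assume e: "\<epsilon> > 0"
  have 0: "Ck_on k UNIV (\<lambda>w::complex. (norm w)\<^sup>2)"
    using Ck_on_norm_square[of k 0] by simp
  have "Ck_on k UNIV (\<lambda>w. (w \<bullet> i) * inverse ((norm w)\<^sup>2 + \<epsilon>\<^sup>2))"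
    by (intro Ck_on_mult Ck_on_inner open_UNIV Ck_on_compose[OF _ _ Ck_on_inverse] Ck_on_add 0 Ck_on_const)
       (use e in \<open>auto simp: add_nonneg_pos\<close>)
  then show ?thesis by (simp add: gradk_def[abs_def] divide_inverse)
qed

lemma sum_Basis_complex: "(\<Sum>i\<in>(Basis::complex set). f i) = f 1 + f \<i>"
  by (simp add: Basis_complex_def)

text \<open>Integration by parts moves the derivative from \<phi> to the smooth kernel. The
  divergence of the kernel is 2 \<epsilon>^2 / (|w|^2 + \<epsilon>^2)^2, and the substitution w =
  \<epsilon> v makes the weight independent of \<epsilon>.\<close>

lemma sum_conv_gradk:
  assumes \<phi>: "bsupp R \<phi>" "Ck_on (Suc 0) UNIV \<phi>" and R: "R > 0" and e: "\<epsilon> > 0"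
  shows "(\<Sum>i\<in>Basis. conv (gradk \<epsilon> i) (pd i \<phi>) z) =
    (\<integral>v. 2 / (1 + (norm v)\<^sup>2)\<^sup>2 * \<phi> (z - \<epsilon> *\<^sub>R v) \<partial>lborel)"
proof -
  have [measurable]: "\<phi> \<in> borel_measurable borel"
    using \<phi>(2) borel_measurable_continuous_onI by auto
  obtain B where B: "\<And>y. \<bar>\<phi> y\<bar> \<le> B" using bsupp_bounded[OF \<phi>(1) Ck_on_continuous[OF \<phi>(2)]] by blast
  let ?s = "\<lambda>w::complex. (norm w)\<^sup>2 + \<epsilon>\<^sup>2"
  have p: "?s w > 0" for w using e by (simp add: add_nonneg_pos)
  define D where "D i w = 1 / ?s w - 2 * (w \<bullet> i)\<^sup>2 / (?s w)\<^sup>2" for i w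
  have cD: "continuous_on UNIV (D i)" for i
    unfolding D_def using e by (intro continuous_intros) (auto simp: add_nonneg_eq_0_iff)
  have "conv (gradk \<epsilon> i) (pd i \<phi>) z = conv (D i) \<phi> z" if i: "i \<in> Basis" for i
  proof -
    have i1: "norm i = 1" using i by simp
    define \<psi> where "\<psi> w = \<phi> (z - w)" for w
    define F where "F w = gradk \<epsilon> i w * \<psi> w" for w
    have \<psi>pd: "((\<lambda>t. \<psi> (w + t *\<^sub>R j)) has_vector_derivative - pd j \<phi> (z - w)) (at 0)" if "j \<in> Basis" for j w
    proof -
      have "((\<lambda>t. \<phi> ((z - w) + t *\<^sub>R j)) has_field_derivative pd j \<phi> (z - w)) (at (- 0))"
        using Ck_on_has_pd[OF \<phi>(2) that] by (simp add: has_real_derivative_iff_has_vector_derivative)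
      then have "((\<lambda>t. \<phi> ((z - w) + (- t) *\<^sub>R j)) has_field_derivative pd j \<phi> (z - w) * (- 1)) (at 0)"
        by (rule DERIV_chain2) (auto intro!: derivative_eq_intros)
      then show ?thesis
        by (simp add: \<psi>_def algebra_simps has_real_derivative_iff_has_vector_derivative)
    qed
    have \<psi>C: "Ck_on (Suc 0) UNIV \<psi>"
    proof (rule Ck_on_SucI[OF open_UNIV _ \<psi>pd])
      show "continuous_on UNIV \<psi>"
        unfolding \<psi>_def
        by (rule continuous_on_compose2[OF Ck_on_continuous[OF \<phi>(2)]]) (auto intro!: continuous_intros)
      show "Ck_on 0 UNIV (\<lambda>w. - pd j \<phi> (z - w))" if "j \<in> Basis" for j
        unfolding Ck_on.simps
        by (intro continuous_on_minus continuous_on_compose2[OF Ck_on_continuous[OF Ck_on_pd[OF \<phi>(2) that]]])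
           (auto intro!: continuous_intros)
    qed
    have FC: "Ck_on (Suc 0) UNIV F"
      unfolding F_def by (intro Ck_on_mult open_UNIV \<psi>C Ck_on_gradk e)
    have "bsupp (norm z + R) F"
      unfolding bsupp_def F_def \<psi>_def
    proof (intro allI impI)
      fix y :: complex assume y: "norm z + R < norm y"
      have "norm (z - y) > R" using y norm_triangle_ineq2[of y z] by (simp add: norm_minus_commute)
      then show "gradk \<epsilon> i y * \<phi> (z - y) = 0" using \<phi>(1) by (simp add: bsupp_def)
    qed
    then have "(\<integral>w. pd i F w \<partial>lborel) = 0"
      using integral_pd_eq_0[OF _ FC _ i] R by (meson add_nonneg_pos norm_ge_zero)
    moreover have "pd i F w = D i w * \<phi> (z - w) - gradk \<epsilon> i w * pd i \<phi> (z - w)" for w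
    proof (rule pd_eqI)
      have "((\<lambda>t. gradk \<epsilon> i (w + t *\<^sub>R i)) has_vector_derivative D i w) (at 0)"
        using gradk_DERIV[OF e i1] unfolding D_def by (simp add: has_real_derivative_iff_has_vector_derivative)
      from has_vector_derivative_mult[OF this \<psi>pd[OF i]]
      show "((\<lambda>t. F (w + t *\<^sub>R i)) has_vector_derivative D i w * \<phi> (z - w) - gradk \<epsilon> i w * pd i \<phi> (z - w)) (at 0)"
        unfolding F_def by (simp add: \<psi>_def algebra_simps)
    qed
    ultimately have 0: "(\<integral>w. D i w * \<phi> (z - w) - gradk \<epsilon> i w * pd i \<phi> (z - w) \<partial>lborel) = 0" by simp
    obtain B' where B': "\<And>y. \<bar>pd i \<phi> y\<bar> \<le> B'" using bsupp_bounded[OF pd_bsupp[OF \<phi>(1)] Ck_on_continuous[OF Ck_on_pd[OF \<phi>(2) i]]] by blast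
    have "pd i \<phi> \<in> borel_measurable borel"
      using \<phi>(2) i borel_measurable_continuous_onI by auto
    then have "integrable lborel (\<lambda>w. gradk \<epsilon> i w * pd i \<phi> (z - w))"
      by (intro conv_integrable[OF loc_int_gradk[OF i1] pd_bsupp[OF \<phi>(1)] B' _ order_refl])
         (use R in \<open>auto simp: add_nonneg_pos\<close>)
    moreover have "integrable lborel (\<lambda>w. D i w * \<phi> (z - w))"
      by (intro conv_integrable[OF loc_int_continuous[OF cD] \<phi>(1) B _ order_refl])
         (use R in \<open>auto simp: add_nonneg_pos\<close>)
    ultimately show ?thesis using 0 unfolding conv_def by (simp add: Bochner_Integration.integral_diff)
  qed
  then have "(\<Sum>i\<in>Basis. conv (gradk \<epsilon> i) (pd i \<phi>) z) = (\<Sum>i\<in>Basis. conv (D i) \<phi> z)"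
    by (intro sum.cong) auto
  also have "\<dots> = (\<integral>w. (\<Sum>i\<in>Basis. D i w * \<phi> (z - w)) \<partial>lborel)"
    unfolding conv_def
    by (intro Bochner_Integration.integral_sum[symmetric] conv_integrable[OF loc_int_continuous[OF cD] \<phi>(1) B _ order_refl])
       (use R in \<open>auto simp: add_nonneg_pos\<close>)
  also have "\<dots> = (\<integral>w. 2 * \<epsilon>\<^sup>2 / (?s w)\<^sup>2 * \<phi> (z - w) \<partial>lborel)"
  proof (intro Bochner_Integration.integral_cong refl)
    fix w :: complex
    have n: "(norm w)\<^sup>2 = (Re w)\<^sup>2 + (Im w)\<^sup>2" by (rule cmod_power2)
    have "D 1 w + D \<i> w = 2 / ?s w - 2 * (norm w)\<^sup>2 / (?s w)\<^sup>2"
      unfolding D_def n by (simp add: inner_complex_def add_divide_distrib distrib_left)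
    also have "\<dots> = 2 * \<epsilon>\<^sup>2 / (?s w)\<^sup>2"
      using p[of w] by (simp add: divide_simps power2_eq_square)
    finally show "(\<Sum>i\<in>Basis. D i w * \<phi> (z - w)) = 2 * \<epsilon>\<^sup>2 / (?s w)\<^sup>2 * \<phi> (z - w)"
      by (simp add: sum_Basis_complex flip: distrib_right)
  qed
  also have "\<dots> = \<epsilon>\<^sup>2 * (\<integral>v. 2 * \<epsilon>\<^sup>2 / (?s (\<epsilon> *\<^sub>R v))\<^sup>2 * \<phi> (z - \<epsilon> *\<^sub>R v) \<partial>lborel)"
    using e by (subst lborel_integral_affine[of \<epsilon> _ 0]) auto
  also have "\<dots> = (\<integral>v. \<epsilon>\<^sup>2 * (2 * \<epsilon>\<^sup>2 / (?s (\<epsilon> *\<^sub>R v))\<^sup>2 * \<phi> (z - \<epsilon> *\<^sub>R v)) \<partial>lborel)"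
    by (rule integral_mult_right_zero[symmetric])
  also have "\<dots> = (\<integral>v. 2 / (1 + (norm v)\<^sup>2)\<^sup>2 * \<phi> (z - \<epsilon> *\<^sub>R v) \<partial>lborel)"
  proof (intro Bochner_Integration.integral_cong refl)
    fix v :: complex
    have s: "?s (\<epsilon> *\<^sub>R v) = \<epsilon>\<^sup>2 * (1 + (norm v)\<^sup>2)" by (simp add: power_mult_distrib algebra_simps)
    have "1 + (norm v)\<^sup>2 > 0" by (simp add: add_pos_nonneg)
    then show "\<epsilon>\<^sup>2 * (2 * \<epsilon>\<^sup>2 / (?s (\<epsilon> *\<^sub>R v))\<^sup>2 * \<phi> (z - \<epsilon> *\<^sub>R v)) = 2 / (1 + (norm v)\<^sup>2)\<^sup>2 * \<phi> (z - \<epsilon> *\<^sub>R v)"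
    proof -
      have "a * (2 * a / (a * q)\<^sup>2 * f) = 2 / q\<^sup>2 * f" if "a \<noteq> 0" for a q f :: real
        using that by (simp add: power2_eq_square)
      then show ?thesis unfolding s using e by simp
    qed
  qed
  finally show ?thesis .
qed

text \<open>One derivative is placed on the kernel and the other on \<phi>. The regularised
  expression has two descriptions: \<open>L1\<close> lets \<epsilon> tend to 0 in the kernel, while
  in \<open>L2\<close> the argument z - \<epsilon> v of \<phi> contracts to z.\<close>

lemma laplacian_conv_log:
  assumes \<phi>: "bsupp R \<phi>" "Ck_on (Suc 0) UNIV \<phi>" and R: "R > 0"
  shows "laplacian (conv (lnk 0) \<phi>) z = fund_const * \<phi> z"
proof -
  have c: "continuous_on UNIV \<phi>" using \<phi>(2) by simp
  obtain B where B: "\<And>y. \<bar>\<phi> y\<bar> \<le> B" using bsupp_bounded[OF \<phi>(1) c] by auto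
  have [measurable]: "\<phi> \<in> borel_measurable borel"
    using c borel_measurable_continuous_onI by auto
  have "pd i (conv (lnk 0) \<phi>) = conv (gradk 0 i) \<phi>" if "i \<in> Basis" for i
    by (rule ext, rule pd_eqI, rule conv_log_has_pd[OF \<phi>(1) c R]) (use that in auto)
  moreover have "pd i (conv (gradk 0 i) \<phi>) z = conv (gradk 0 i) (pd i \<phi>) z" if "i \<in> Basis" for i
    by (rule pd_eqI, rule conv_has_pd[OF loc_int_gradk \<phi> R that]) (use that in auto)
  ultimately have "laplacian (conv (lnk 0) \<phi>) z = (\<Sum>i\<in>Basis. conv (gradk 0 i) (pd i \<phi>) z)"
    by (simp add: laplacian_def)
  moreover have L1: "(\<lambda>n. \<Sum>i\<in>Basis. conv (gradk (inv_seq n) i) (pd i \<phi>) z) \<longlonglongrightarrow> (\<Sum>i\<in>Basis. conv (gradk 0 i) (pd i \<phi>) z)"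
  proof (intro tendsto_sum LIMSEQ_I)
    fix i :: complex and e :: real assume i: "i \<in> Basis" and e: "e > 0"
    have "\<forall>\<^sub>F n in sequentially. \<bar>conv (gradk (inv_seq n) i) (pd i \<phi>) z - conv (gradk 0 i) (pd i \<phi>) z\<bar> \<le> e / 2"
      using conv_gradk_limit[OF pd_bsupp[OF \<phi>(1)] _ R, of i i "e / 2" "norm z"] \<phi>(2) i e by (auto elim!: eventually_mono)
    then show "\<exists>N. \<forall>n\<ge>N. norm (conv (gradk (inv_seq n) i) (pd i \<phi>) z - conv (gradk 0 i) (pd i \<phi>) z) < e"
      using e unfolding eventually_sequentially by (force intro: le_less_trans)
  qed
  moreover have L2: "(\<lambda>n. \<Sum>i\<in>Basis. conv (gradk (inv_seq n) i) (pd i \<phi>) z) \<longlonglongrightarrow> fund_const * \<phi> z"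
  proof -
    have "(\<lambda>n. \<integral>v. 2 / (1 + (norm v)\<^sup>2)\<^sup>2 * \<phi> (z - inv_seq n *\<^sub>R v) \<partial>lborel) \<longlonglongrightarrow>
      (\<integral>v. 2 / (1 + (norm v)\<^sup>2)\<^sup>2 * \<phi> (z - 0 *\<^sub>R v) \<partial>lborel)"
    proof (rule integral_dominated_convergence)
      show "integrable lborel (\<lambda>v::complex. 2 / (1 + (norm v)\<^sup>2)\<^sup>2 * B)"
        using integrable_fundamental_density by (intro integrable_mult_left) auto
      show "AE v in lborel. (\<lambda>n. 2 / (1 + (norm v)\<^sup>2)\<^sup>2 * \<phi> (z - inv_seq n *\<^sub>R v)) \<longlonglongrightarrow> 2 / (1 + (norm v)\<^sup>2)\<^sup>2 * \<phi> (z - 0 *\<^sub>R v)"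
        by (intro AE_I2 tendsto_mult tendsto_const continuous_on_tendsto_compose[OF c] tendsto_diff tendsto_scaleR LIMSEQ_inverse_real_of_nat) auto
      show "AE v in lborel. norm (2 / (1 + (norm v)\<^sup>2)\<^sup>2 * \<phi> (z - inv_seq n *\<^sub>R v)) \<le> 2 / (1 + (norm v)\<^sup>2)\<^sup>2 * B" for n
        using B by (auto intro!: AE_I2 simp: abs_mult divide_right_mono)
    qed auto
    moreover have "(\<integral>v. 2 / (1 + (norm v)\<^sup>2)\<^sup>2 * \<phi> (z - 0 *\<^sub>R v) \<partial>lborel) = fund_const * \<phi> z"
      unfolding fund_const_def by (subst integral_mult_left_zero[symmetric]) simp
    ultimately show ?thesis using sum_conv_gradk[OF \<phi> R] inv_seq_bounds(1) by simp
  qed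
  ultimately show ?thesis using LIMSEQ_unique[OF L1 L2] by simp
qed

subsection \<open>The maximum principle and harmonic kernels\<close>

lemma second_derivative_at_max:
  fixes f :: "real \<Rightarrow> real"
  assumes r: "r > 0" and f: "\<And>t. \<bar>t\<bar> < r \<Longrightarrow> (f has_field_derivative f' t) (at t)"
    and f': "(f' has_field_derivative l) (at 0)" and max: "\<And>t. \<bar>t\<bar> < r \<Longrightarrow> f t \<le> f 0"
  shows "l \<le> 0"
proof (rule ccontr)
  assume "\<not> l \<le> 0"
  then have l: "l > 0" by simp
  have "f' 0 = 0"
    by (rule DERIV_local_max[OF f r]) (use r max in auto)
  obtain d where d: "d > 0" "\<And>h. h > 0 \<Longrightarrow> h < d \<Longrightarrow> f' 0 < f' (0 + h)"
    using DERIV_pos_inc_right[OF f' l] by blast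
  define h where "h = min d r / 2"
  have h: "0 < h" "h < d" "h < r" using d(1) r by (auto simp: h_def)
  obtain x where x: "0 < x" "x < h" "f h - f 0 = (h - 0) * f' x"
    using MVT2[OF h(1), of f f'] f h by auto
  have "f' x > 0" using d(2)[of x] x h \<open>f' 0 = 0\<close> by auto
  then have "f h > f 0" using x h by (metis diff_gt_0_iff_gt diff_zero mult_pos_pos)
  then show False using max[of h] h by simp
qed

text \<open>Adding \<delta> |z|^2 makes the Laplacian strictly positive, which is incompatible with
  an interior maximum.\<close>

lemma weak_max_principle:
  fixes w :: "complex \<Rightarrow> real"
  assumes V: "open V" "bounded V" and c: "continuous_on (closure V) w" and w: "Ck_on 2 V w"
    and lap: "\<And>x. x \<in> V \<Longrightarrow> laplacian w x \<ge> 0" and bd: "\<And>x. x \<in> frontier V \<Longrightarrow> w x \<le> m"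
    and x0: "x0 \<in> V"
  shows "w x0 \<le> m"
proof (rule ccontr)
  assume "\<not> w x0 \<le> m"
  then have gt: "w x0 > m" by simp
  obtain R where R: "R > 0" "\<And>x. x \<in> closure V \<Longrightarrow> norm x \<le> R"
    using bounded_closure[OF V(2)] bounded_pos by metis
  \<comment> \<open>With this choice the perturbation \<delta> R^2 is half of the excess w x0 - m,
    so the perturbed maximum cannot sit on the frontier.\<close>
  define \<delta> where "\<delta> = (w x0 - m) / (2 * R\<^sup>2)"
  have \<delta>: "\<delta> > 0" "\<delta> * R\<^sup>2 < w x0 - m" using gt R by (auto simp: \<delta>_def)
  define v where "v z = w z + \<delta> * (norm z)\<^sup>2" for z
  have "compact (closure V)" using V(2) by (simp add: compact_closure)
  moreover have "continuous_on (closure V) v" unfolding v_def by (intro continuous_intros c)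
  ultimately obtain z1 where z1: "z1 \<in> closure V" "\<And>y. y \<in> closure V \<Longrightarrow> v y \<le> v z1"
    using continuous_attains_sup[of "closure V" v] x0 closure_subset by blast
  have "v z1 \<ge> v x0" using z1(2) x0 closure_subset by blast
  moreover have "v x0 \<ge> w x0" using \<delta>(1) by (simp add: v_def)
  ultimately have big: "v z1 > m + \<delta> * R\<^sup>2" using \<delta> by linarith
  have "z1 \<in> V"
  proof (rule ccontr)
    assume "z1 \<notin> V"
    then have "w z1 \<le> m" using z1(1) V(1) bd by (auto simp: frontier_def interior_open)
    moreover have "\<delta> * (norm z1)\<^sup>2 \<le> \<delta> * R\<^sup>2"
      using \<delta>(1) R(2)[OF z1(1)] by (intro mult_left_mono power_mono) auto
    ultimately show False using big by (simp add: v_def)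
  qed
  then obtain r where r: "r > 0" "ball z1 r \<subseteq> V" using V(1) openE by blast
  have w2: "Ck_on (Suc (Suc 0)) V w" using w by (simp add: numeral_2_eq_2)
  have le: "pd i (pd i w) z1 + 2 * \<delta> \<le> 0" if i: "i \<in> Basis" for i
  proof (rule second_derivative_at_max[OF r(1), where f="\<lambda>t. v (z1 + t *\<^sub>R i)" and f'="\<lambda>t. pd i w (z1 + t *\<^sub>R i) + \<delta> * (2 * ((z1 + t *\<^sub>R i) \<bullet> i))"])
    have mem: "z1 + t *\<^sub>R i \<in> V" if "\<bar>t\<bar> < r" for t
      using that i r(2) by (auto simp: dist_norm subset_iff)
    show "((\<lambda>t. v (z1 + t *\<^sub>R i)) has_field_derivative pd i w (z1 + t *\<^sub>R i) + \<delta> * (2 * ((z1 + t *\<^sub>R i) \<bullet> i))) (at t)" if "\<bar>t\<bar> < r" for t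
      unfolding v_def
      by (intro DERIV_add DERIV_cmult has_deriv_norm_square Ck_on_line_DERIV[OF w2 i mem[OF that]])
    have "((\<lambda>t. (z1 + t *\<^sub>R i) \<bullet> i) has_field_derivative 1) (at 0)"
      unfolding has_field_derivative_def using i by (auto intro!: derivative_eq_intros)
    then have "((\<lambda>t. pd i w (z1 + t *\<^sub>R i) + \<delta> * (2 * ((z1 + t *\<^sub>R i) \<bullet> i))) has_field_derivative
      pd i (pd i w) (z1 + 0 *\<^sub>R i) + \<delta> * (2 * 1)) (at 0)"
      by (intro DERIV_add DERIV_cmult Ck_on_line_DERIV[OF Ck_on_pd[OF w2 i] i mem]) (use r in auto)
    then show "((\<lambda>t. pd i w (z1 + t *\<^sub>R i) + \<delta> * (2 * ((z1 + t *\<^sub>R i) \<bullet> i))) has_field_derivative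
      pd i (pd i w) z1 + 2 * \<delta>) (at 0)" by (simp add: mult.commute)
    show "v (z1 + t *\<^sub>R i) \<le> v (z1 + 0 *\<^sub>R i)" if "\<bar>t\<bar> < r" for t
      using z1(2) mem[OF that] closure_subset by auto
  qed
  have "laplacian w z1 + 4 * \<delta> \<le> 0"
    using le[of 1] le[of \<i>] by (simp add: laplacian_def sum_Basis_complex)
  then show False using lap[OF \<open>z1 \<in> V\<close>] \<delta>(1) by linarith
qed

section \<open>Harmonic functions obtained from holomorphic ones\<close>

lemma holomorphic_line_derivative:
  assumes "f holomorphic_on S" "open S" "z + t *\<^sub>R e \<in> S"
  shows "((\<lambda>t. f (z + t *\<^sub>R e)) has_vector_derivative e * deriv f (z + t *\<^sub>R e)) (at t)"
proof -
  have 1: "(f has_field_derivative deriv f (z + t *\<^sub>R e)) (at (z + t *\<^sub>R e))"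
    using assms holomorphic_derivI by blast
  have 2: "((\<lambda>t. z + t *\<^sub>R e) has_vector_derivative e) (at t)"
    unfolding has_vector_derivative_def by (auto intro!: derivative_eq_intros)
  show ?thesis
    using field_vector_diff_chain_at[OF 2 1] by (simp add: comp_def)
qed

lemma Re_holomorphic_line_derivative:
  assumes "f holomorphic_on S" "open S" "z \<in> S"
  shows "((\<lambda>t. Re (c * f (z + t *\<^sub>R e))) has_vector_derivative Re (e * c * deriv f z)) (at 0)"
proof -
  have "((\<lambda>t. c * f (z + t *\<^sub>R e)) has_vector_derivative c * (e * deriv f z)) (at 0)"
    using holomorphic_line_derivative[OF assms(1,2), of z 0 e] assms(3)
    by (intro has_vector_derivative_mult_right) auto
  from bounded_linear.has_vector_derivative[OF bounded_linear_Re this]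
  show ?thesis by (simp add: mult_ac)
qed

text \<open>The factor c closes the family under differentiation: the derivative in direction i
  replaces c by i c and f by f'.\<close>

lemma Ck_on_Re_holomorphic:
  "f holomorphic_on S \<Longrightarrow> open S \<Longrightarrow> Ck_on k S (\<lambda>z. Re (c * f z))"
proof (induction k arbitrary: c f)
  case 0
  then show ?case by (auto intro!: continuous_intros holomorphic_on_imp_continuous_on)
next
  case (Suc k)
  show ?case
  proof (rule Ck_on_SucI[OF Suc.prems(2)])
    show "continuous_on S (\<lambda>z. Re (c * f z))"
      using Suc.prems by (auto intro!: continuous_intros holomorphic_on_imp_continuous_on)
    show "((\<lambda>t. Re (c * f (x + t *\<^sub>R i))) has_vector_derivative Re (i * c * deriv f x)) (at 0)" if "x \<in> S" for i x
      by (rule Re_holomorphic_line_derivative[OF Suc.prems that])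
    show "Ck_on k S (\<lambda>z. Re (i * c * deriv f z))" for i
      by (rule Suc.IH[OF holomorphic_deriv[OF Suc.prems] Suc.prems(2)])
  qed
qed

text \<open>Formally ln |Q| = Re (log Q), with derivative Re (e Q' / Q). Differentiating the norm
  directly avoids choosing a branch of the logarithm.\<close>

lemma ln_norm_line_derivative:
  assumes "Q holomorphic_on S" "open S" "z + t *\<^sub>R e \<in> S" "Q (z + t *\<^sub>R e) \<noteq> 0"
  shows "((\<lambda>t. ln (norm (Q (z + t *\<^sub>R e)))) has_field_derivative
           Re (e * (deriv Q (z + t *\<^sub>R e) / Q (z + t *\<^sub>R e)))) (at t)"
proof -
  let ?q = "Q (z + t *\<^sub>R e)" and ?d = "e * deriv Q (z + t *\<^sub>R e)"
  have "((\<lambda>t. Q (z + t *\<^sub>R e)) has_derivative (\<lambda>h. h *\<^sub>R ?d)) (at t)"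
    using holomorphic_line_derivative[OF assms(1-3)] by (simp add: has_vector_derivative_def)
  from has_derivative_compose[OF this has_derivative_norm[OF assms(4)]]
  have "((\<lambda>t. norm (Q (z + t *\<^sub>R e))) has_derivative (\<lambda>h. (h *\<^sub>R ?d) \<bullet> sgn ?q)) (at t)" .
  then have 1: "((\<lambda>t. norm (Q (z + t *\<^sub>R e))) has_field_derivative ?d \<bullet> sgn ?q) (at t)"
    unfolding has_field_derivative_def by (rule has_derivative_eq_rhs) (auto simp: mult.commute)
  have "((\<lambda>t. ln (norm (Q (z + t *\<^sub>R e)))) has_field_derivative inverse (norm ?q) * (?d \<bullet> sgn ?q)) (at t)"
    by (rule DERIV_chain2[where f=ln and g="\<lambda>t. norm (Q (z + t *\<^sub>R e))", OF DERIV_ln 1]) (use assms(4) in auto)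
  moreover have "inverse (norm ?q) * (?d \<bullet> sgn ?q) = Re (e * (deriv Q (z + t *\<^sub>R e) / ?q))"
  proof -
    have "inverse (norm q) * (d \<bullet> sgn q) = Re (d / q)" if "q \<noteq> 0" for q d :: complex
    proof -
      have "Re (d / q) = Re (d * cnj q) / (norm q)\<^sup>2" by (subst complex_div_cnj) simp
      also have "\<dots> = (d \<bullet> q) / (norm q)\<^sup>2" by (simp add: inner_complex_def)
      also have "\<dots> = inverse (norm q) * (d \<bullet> sgn q)"
        by (simp add: sgn_div_norm power2_eq_square divide_inverse)
      finally show ?thesis by simp
    qed
    from this[OF assms(4), of ?d] show ?thesis by simp
  qed
  ultimately show ?thesis by simp
qed

lemma Cauchy_deriv_bound:
  assumes "f holomorphic_on ball a s" "\<And>z. z \<in> ball a s \<Longrightarrow> norm (f z) \<le> B" "z \<in> ball a (s / 2)" "s > 0"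
  shows "norm (deriv f z) \<le> B * 2 / s"
proof -
  have sub: "cball z (s / 2) \<subseteq> ball a s"
  proof
    fix x assume "x \<in> cball z (s / 2)"
    then show "x \<in> ball a s" using assms(3) dist_triangle[of a x z] by auto
  qed
  have "norm ((deriv ^^ 1) f z) \<le> fact 1 * B / (s / 2) ^ 1"
  proof (rule Cauchy_inequality)
    show "f holomorphic_on ball z (s / 2)"
      using assms(1) sub ball_subset_cball by (meson holomorphic_on_subset order_trans)
    show "continuous_on (cball z (s / 2)) f"
      using assms(1) sub by (meson holomorphic_on_imp_continuous_on continuous_on_subset)
    show "norm (f x) \<le> B" if "norm (z - x) = s / 2" for x
      using assms(2) sub that by (auto simp: dist_norm)
  qed (use assms in auto)
  then show ?thesis by simp
qed

text \<open>An integral of kernels \<open>ln |Q|\<close> with \<open>Q\<close> holomorphic: its gradient is given by the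
  holomorphic function \<open>\<integral> Q'/Q\<close>. The bound on \<open>ln |Q|\<close> controls \<open>Q'/Q\<close> by Cauchy's estimate.\<close>

lemma log_kernel_harmonic:
  fixes h :: "complex \<Rightarrow> 'b \<Rightarrow> real" and \<phi> :: "'b \<Rightarrow> real"
  assumes s: "s > 0"
    and hm: "\<And>z. z \<in> ball a s \<Longrightarrow> h z \<in> borel_measurable M"
    and \<phi>: "integrable M \<phi>"
    and Q: "\<And>\<zeta>. \<phi> \<zeta> \<noteq> 0 \<Longrightarrow> \<exists>Q. Q holomorphic_on ball a s \<and>
        (\<forall>z\<in>ball a s. Q z \<noteq> 0 \<and> h z \<zeta> = ln (norm (Q z)) \<and> \<bar>h z \<zeta>\<bar> \<le> B)"
  shows "Ck_on k (ball a (s / 4)) (\<lambda>z. \<integral>\<zeta>. h z \<zeta> * \<phi> \<zeta> \<partial>M)"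
    and "z \<in> ball a (s / 4) \<Longrightarrow> laplacian (\<lambda>z. \<integral>\<zeta>. h z \<zeta> * \<phi> \<zeta> \<partial>M) z = 0"
proof -
  obtain q where q: "\<And>\<zeta>. \<phi> \<zeta> \<noteq> 0 \<Longrightarrow> q \<zeta> holomorphic_on ball a s"
    "\<And>\<zeta> z. \<phi> \<zeta> \<noteq> 0 \<Longrightarrow> z \<in> ball a s \<Longrightarrow> q \<zeta> z \<noteq> 0 \<and> h z \<zeta> = ln (norm (q \<zeta> z)) \<and> \<bar>h z \<zeta>\<bar> \<le> B"
    using Q by metis
  note [measurable] = borel_measurable_integrable[OF \<phi>]
  define K where "K \<zeta> z = deriv (q \<zeta>) z / q \<zeta> z" for \<zeta> z
  define L where "L z \<zeta> = K \<zeta> z * of_real (\<phi> \<zeta>)" for z \<zeta>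
  define P where "P z \<zeta> = h z \<zeta> * \<phi> \<zeta>" for z \<zeta>
  \<comment> \<open>From |ln |Q|| \<le> B one gets 1 / |Q| \<le> e^B, and |Q'| \<le> 2 e^B / s on
    the ball of half the radius.\<close>
  define B1 where "B1 = exp B * (exp B * 2 / s)"
  define \<Phi> where "\<Phi> z = (\<integral>\<zeta>. L z \<zeta> \<partial>M)" for z
  have B1: "B1 \<ge> 0" using s by (simp add: B1_def)
  have Khol: "K \<zeta> holomorphic_on ball a s" if "\<phi> \<zeta> \<noteq> 0" for \<zeta>
    unfolding K_def using q[OF that] by (intro holomorphic_intros holomorphic_deriv) auto
  have Kb: "norm (K \<zeta> z) \<le> B1" if "\<phi> \<zeta> \<noteq> 0" "z \<in> ball a (s / 2)" for \<zeta> z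
  proof -
    have zs: "z \<in> ball a s" using that(2) s by auto
    have lo: "exp (- B) \<le> norm (q \<zeta> x)" and up: "norm (q \<zeta> x) \<le> exp B" if "x \<in> ball a s" for x
    proof -
      have p: "norm (q \<zeta> x) > 0" and b: "\<bar>ln (norm (q \<zeta> x))\<bar> \<le> B" using q(2)[OF \<open>\<phi> \<zeta> \<noteq> 0\<close> that] by auto
      show "exp (- B) \<le> norm (q \<zeta> x)"
        using p b by (subst ln_ge_iff[symmetric]) auto
      show "norm (q \<zeta> x) \<le> exp B"
        using p b by (metis abs_le_D1 exp_le_cancel_iff exp_ln)
    qed
    have "norm (deriv (q \<zeta>) z) \<le> exp B * 2 / s"
      by (rule Cauchy_deriv_bound[OF q(1)[OF that(1)] up that(2) s])
    moreover have "1 / norm (q \<zeta> z) \<le> exp B"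
      using lo[OF zs] q(2)[OF that(1) zs] by (simp add: exp_minus field_simps)
    ultimately have "norm (deriv (q \<zeta>) z) * (1 / norm (q \<zeta> z)) \<le> (exp B * 2 / s) * exp B"
      by (intro mult_mono) (use s in auto)
    then show ?thesis by (simp add: K_def norm_divide B1_def mult_ac)
  qed
  have Lb: "norm (L z \<zeta>) \<le> B1 * \<bar>\<phi> \<zeta>\<bar>" if "z \<in> ball a (s / 2)" for z \<zeta>
    using Kb[OF _ that, of \<zeta>] by (cases "\<phi> \<zeta> = 0") (auto simp: L_def norm_mult intro: mult_right_mono)
  have Pm: "P z \<in> borel_measurable M" if "z \<in> ball a s" for z
    unfolding P_def using hm[OF that] by measurable
  have Pder: "((\<lambda>t. P (z + t *\<^sub>R e) \<zeta>) has_field_derivative Re (e * L (z + t *\<^sub>R e) \<zeta>)) (at t)"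
    if "z + t *\<^sub>R e \<in> ball a s" for z e t \<zeta>
  proof (cases "\<phi> \<zeta> = 0")
    case False
    have "((\<lambda>t. ln (norm (q \<zeta> (z + t *\<^sub>R e))) * \<phi> \<zeta>) has_field_derivative Re (e * K \<zeta> (z + t *\<^sub>R e)) * \<phi> \<zeta>) (at t)"
      unfolding K_def
      by (intro DERIV_cmult_right ln_norm_line_derivative[OF q(1)[OF False] open_ball that]) (use q(2)[OF False that] in auto)
    moreover have "Re (e * K \<zeta> (z + t *\<^sub>R e)) * \<phi> \<zeta> = Re (e * L (z + t *\<^sub>R e) \<zeta>)"
      by (simp add: L_def algebra_simps)
    moreover have "open ((\<lambda>t. z + t *\<^sub>R e) -` ball a s)"
      by (intro continuous_open_vimage) (auto intro!: continuous_intros)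
    ultimately show ?thesis
      using q(2)[OF False] that
      by (auto simp: P_def elim!: has_field_derivative_transform_within_open[where S="(\<lambda>t. z + t *\<^sub>R e) -` ball a s"])
  qed (simp add: P_def L_def)
  have near: "\<exists>d>0. \<forall>t. \<bar>t\<bar> < d \<longrightarrow> z + t *\<^sub>R e \<in> ball a r" if z: "z \<in> ball a r" for z e r
  proof -
    have "open ((\<lambda>t. z + t *\<^sub>R e) -` ball a r)"
      by (intro continuous_open_vimage) (auto intro!: continuous_intros)
    moreover have "0 \<in> (\<lambda>t. z + t *\<^sub>R e) -` ball a r" using z by simp
    ultimately obtain d where "d > 0" "ball 0 d \<subseteq> (\<lambda>t. z + t *\<^sub>R e) -` ball a r"
      using openE by blast
    then show ?thesis by (intro exI[of _ d]) (auto simp: subset_iff dist_norm)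
  qed
  \<comment> \<open>The functions \<open>q \<zeta>\<close> come from the axiom of choice, so their
    dependence on \<zeta> is unknown. Measurability of the derivative is inherited from the
    difference quotients of \<open>P\<close>.\<close>
  have ReLm: "(\<lambda>\<zeta>. Re (e * L z \<zeta>)) \<in> borel_measurable M" if z: "z \<in> ball a s" for z e
  proof -
    obtain d where d: "d > 0" "\<And>t. \<bar>t\<bar> < d \<Longrightarrow> z + t *\<^sub>R e \<in> ball a s" using near[OF z] by blast
    define X where "X n = d / 2 * inverse (real (Suc n))" for n
    have X0: "X n \<noteq> 0" and Xd: "\<bar>X n\<bar> < d" for n
    proof -
      have "d / 2 * inverse (real (Suc n)) \<le> d / 2 * 1"
        using d by (intro mult_left_mono) (auto simp: field_simps)
      then show "\<bar>X n\<bar> < d" using d by (simp add: X_def)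
      show "X n \<noteq> 0" using d by (simp add: X_def)
    qed
    have XL: "X \<longlonglongrightarrow> 0"
      unfolding X_def by (rule tendsto_eq_intros LIMSEQ_inverse_real_of_nat refl)+ simp
    show ?thesis
    proof (rule borel_measurable_LIMSEQ_metric)
      show "(\<lambda>\<zeta>. (P (z + X n *\<^sub>R e) \<zeta> - P z \<zeta>) / X n) \<in> borel_measurable M" for n
        using Pm[OF d(2)[OF Xd]] Pm[OF z] by measurable
      show "(\<lambda>n. (P (z + X n *\<^sub>R e) \<zeta> - P z \<zeta>) / X n) \<longlonglongrightarrow> Re (e * L z \<zeta>)" for \<zeta>
      proof -
        have "((\<lambda>t. P (z + t *\<^sub>R e) \<zeta>) has_field_derivative Re (e * L z \<zeta>)) (at 0)"
          using Pder[of z 0 e \<zeta>] z by simp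
        then have "((\<lambda>t. (P (z + t *\<^sub>R e) \<zeta> - P z \<zeta>) / t) \<longlongrightarrow> Re (e * L z \<zeta>)) (at 0)"
          by (simp add: has_field_derivative_iff)
        then show ?thesis
          using X0 XL unfolding tendsto_at_iff_sequentially comp_def by auto
      qed
    qed
  qed
  have Lm: "L z \<in> borel_measurable M" if z: "z \<in> ball a s" for z
  proof -
    have "(\<lambda>\<zeta>. Complex (Re (1 * L z \<zeta>)) (Re (- \<i> * L z \<zeta>))) \<in> borel_measurable M"
      unfolding Complex_eq using ReLm[OF z, of 1] ReLm[OF z, of "- \<i>"] by measurable
    moreover have "(\<lambda>\<zeta>. Complex (Re (1 * L z \<zeta>)) (Re (- \<i> * L z \<zeta>))) = L z"
      by (auto simp: complex_eq_iff)
    ultimately show ?thesis by simp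
  qed
  have intL: "integrable M (L z)" if "z \<in> ball a (s / 2)" for z
  proof (rule Bochner_Integration.integrable_bound)
    show "integrable M (\<lambda>\<zeta>. B1 * \<bar>\<phi> \<zeta>\<bar>)" using \<phi> by auto
    show "L z \<in> borel_measurable M" using Lm that s by auto
    show "AE \<zeta> in M. norm (L z \<zeta>) \<le> norm (B1 * \<bar>\<phi> \<zeta>\<bar>)"
      using Lb[OF that] by (auto intro!: AE_I2 intro: order_trans[OF _ abs_ge_self])
  qed
  have Pb: "\<bar>P z \<zeta>\<bar> \<le> \<bar>B\<bar> * \<bar>\<phi> \<zeta>\<bar>" if "z \<in> ball a s" for z \<zeta>
    using q(2)[OF _ that, of \<zeta>] by (cases "\<phi> \<zeta> = 0") (auto simp: P_def abs_mult intro!: mult_right_mono)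
  have intP: "integrable M (P z)" if "z \<in> ball a s" for z
  proof (rule Bochner_Integration.integrable_bound)
    show "integrable M (\<lambda>\<zeta>. \<bar>B\<bar> * \<bar>\<phi> \<zeta>\<bar>)" using \<phi> by auto
    show "P z \<in> borel_measurable M" using Pm that by auto
    show "AE \<zeta> in M. norm (P z \<zeta>) \<le> norm (\<bar>B\<bar> * \<bar>\<phi> \<zeta>\<bar>)"
      using Pb[OF that] by (auto intro!: AE_I2 intro: order_trans[OF _ abs_ge_self])
  qed
  have Mder: "((\<lambda>t. \<integral>\<zeta>. P (z + t *\<^sub>R e) \<zeta> \<partial>M) has_vector_derivative Re (e * \<Phi> z)) (at 0)"
    if z: "z \<in> ball a (s / 2)" for z e
  proof -
    obtain d where d: "d > 0" "\<And>t. \<bar>t\<bar> < d \<Longrightarrow> z + t *\<^sub>R e \<in> ball a (s / 2)" using near[OF z] by blast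
    have d': "z + t *\<^sub>R e \<in> ball a s" if "\<bar>t\<bar> < d" for t using d(2)[OF that] s by auto
    have "((\<lambda>t. \<integral>\<zeta>. P (z + t *\<^sub>R e) \<zeta> \<partial>M) has_field_derivative (\<integral>\<zeta>. Re (e * L (z + 0 *\<^sub>R e) \<zeta>) \<partial>M)) (at 0)"
    proof (rule has_field_derivative_integral(1)[where S="{-d<..<d}" and F'="\<lambda>t \<zeta>. Re (e * L (z + t *\<^sub>R e) \<zeta>)"])
      show "integrable M (P (z + t *\<^sub>R e))" if "t \<in> {-d<..<d}" for t
        using that by (intro intP d') auto
      show "(\<lambda>\<zeta>. Re (e * L (z + 0 *\<^sub>R e) \<zeta>)) \<in> borel_measurable M"
        using ReLm[OF d'[of 0]] d(1) by simp
      show "integrable M (\<lambda>\<zeta>. norm e * (B1 * \<bar>\<phi> \<zeta>\<bar>))" using \<phi> by auto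
      show "AE \<zeta> in M. \<forall>t\<in>{-d<..<d}. ((\<lambda>t. P (z + t *\<^sub>R e) \<zeta>) has_field_derivative Re (e * L (z + t *\<^sub>R e) \<zeta>)) (at t)
          \<and> norm (Re (e * L (z + t *\<^sub>R e) \<zeta>)) \<le> norm e * (B1 * \<bar>\<phi> \<zeta>\<bar>)"
      proof (intro AE_I2 ballI conjI)
        fix \<zeta> t assume t: "t \<in> {-d<..<d}"
        show "((\<lambda>t. P (z + t *\<^sub>R e) \<zeta>) has_field_derivative Re (e * L (z + t *\<^sub>R e) \<zeta>)) (at t)"
          using t by (intro Pder d') auto
        have "norm (Re (e * L (z + t *\<^sub>R e) \<zeta>)) \<le> norm (e * L (z + t *\<^sub>R e) \<zeta>)"
          unfolding real_norm_def by (rule abs_Re_le_cmod)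
        also have "\<dots> \<le> norm e * (B1 * \<bar>\<phi> \<zeta>\<bar>)"
          unfolding norm_mult using t by (intro mult_left_mono Lb d(2)) auto
        finally show "norm (Re (e * L (z + t *\<^sub>R e) \<zeta>)) \<le> norm e * (B1 * \<bar>\<phi> \<zeta>\<bar>)" .
      qed
    qed (use d in auto)
    moreover have "(\<integral>\<zeta>. Re (e * L z \<zeta>) \<partial>M) = Re (e * \<Phi> z)"
      unfolding \<Phi>_def using intL[OF z] by (subst integral_Re) auto
    ultimately show ?thesis by (simp add: has_real_derivative_iff_has_vector_derivative)
  qed
  \<comment> \<open>A second Cauchy estimate, now for Q' / Q, costs another half of the radius; this
    is the origin of s / 4.\<close>
  have dKb: "norm (deriv (K \<zeta>) z) \<le> B1 * 2 / (s / 2)" if "\<phi> \<zeta> \<noteq> 0" "z \<in> ball a (s / 4)" for \<zeta> z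
  proof (rule Cauchy_deriv_bound)
    show "K \<zeta> holomorphic_on ball a (s / 2)"
      using Khol[OF that(1)] s by (auto elim!: holomorphic_on_subset)
  qed (use that Kb s in auto)
  have Lder: "((\<lambda>z. L z \<zeta>) has_field_derivative deriv (K \<zeta>) z * of_real (\<phi> \<zeta>)) (at z)"
    if "z \<in> ball a s" for z \<zeta>
  proof (cases "\<phi> \<zeta> = 0")
    case False
    then show ?thesis
      unfolding L_def using Khol[OF False] that
      by (intro DERIV_cmult_right holomorphic_derivI[OF _ open_ball]) auto
  qed (simp add: L_def)
  have "\<Phi> holomorphic_on ball a (s / 4)"
  proof -
    have "(\<Phi> has_field_derivative (\<integral>\<zeta>. deriv (K \<zeta>) z * of_real (\<phi> \<zeta>) \<partial>M)) (at z)" if z: "z \<in> ball a (s / 4)" for z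
      unfolding \<Phi>_def
    proof (rule has_field_derivative_integral(1)[where S="ball a (s / 4)" and F'="\<lambda>z \<zeta>. deriv (K \<zeta>) z * of_real (\<phi> \<zeta>)"])
      show "integrable M (L x)" if "x \<in> ball a (s / 4)" for x using that s by (intro intL) auto
      show "integrable M (\<lambda>\<zeta>. B1 * 2 / (s / 2) * \<bar>\<phi> \<zeta>\<bar>)" using \<phi> by auto
      show "AE \<zeta> in M. \<forall>x\<in>ball a (s / 4). ((\<lambda>z. L z \<zeta>) has_field_derivative deriv (K \<zeta>) x * of_real (\<phi> \<zeta>)) (at x)
           \<and> norm (deriv (K \<zeta>) x * of_real (\<phi> \<zeta>)) \<le> B1 * 2 / (s / 2) * \<bar>\<phi> \<zeta>\<bar>"
      proof (intro AE_I2 ballI conjI)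
        fix \<zeta> x assume x: "x \<in> ball a (s / 4)"
        show "((\<lambda>z. L z \<zeta>) has_field_derivative deriv (K \<zeta>) x * of_real (\<phi> \<zeta>)) (at x)"
          using x s by (intro Lder) auto
        show "norm (deriv (K \<zeta>) x * of_real (\<phi> \<zeta>)) \<le> B1 * 2 / (s / 2) * \<bar>\<phi> \<zeta>\<bar>"
          using dKb[OF _ x, of \<zeta>] by (cases "\<phi> \<zeta> = 0") (auto simp: norm_mult simp del: times_divide_eq_left intro: mult_right_mono)
      qed
      obtain d where d: "d > 0" "\<And>t. \<bar>t\<bar> < d \<Longrightarrow> z + t *\<^sub>R 1 \<in> ball a (s / 4)" using near[OF z] by blast
      define X where "X n = complex_of_real (d / 2 * inverse (real (Suc n)))" for n
      have X0: "X n \<noteq> 0" and Xd: "z + X n \<in> ball a s" for n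
      proof -
        have le: "d / 2 * inverse (real (Suc n)) \<le> d / 2 * 1"
          using d by (intro mult_left_mono) (auto simp: field_simps)
        have "\<bar>d / 2 * inverse (real (Suc n))\<bar> < d" using d le by (subst abs_of_pos) auto
        from d(2)[OF this] have "z + X n \<in> ball a (s / 4)" by (simp add: X_def scaleR_conv_of_real)
        then show "z + X n \<in> ball a s" using s by auto
        show "X n \<noteq> 0" using d unfolding X_def of_real_eq_0_iff by simp
      qed
      have "(\<lambda>n. complex_of_real (d / 2 * inverse (real (Suc n)))) \<longlonglongrightarrow> complex_of_real (d / 2 * 0)"
        by (intro tendsto_intros LIMSEQ_inverse_real_of_nat)
      then have XL: "X \<longlonglongrightarrow> 0" by (simp only: X_def[abs_def] mult_zero_right of_real_0)
      have zs: "z \<in> ball a s" using z s by auto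
      show "(\<lambda>\<zeta>. deriv (K \<zeta>) z * of_real (\<phi> \<zeta>)) \<in> borel_measurable M"
      proof (rule borel_measurable_LIMSEQ_metric)
        show "(\<lambda>\<zeta>. (L (z + X n) \<zeta> - L z \<zeta>) / X n) \<in> borel_measurable M" for n
          using Lm[OF Xd] Lm[OF zs] by measurable
        show "(\<lambda>n. (L (z + X n) \<zeta> - L z \<zeta>) / X n) \<longlonglongrightarrow> deriv (K \<zeta>) z * of_real (\<phi> \<zeta>)" for \<zeta>
        proof -
          have "((\<lambda>h. (L (z + h) \<zeta> - L z \<zeta>) / h) \<longlongrightarrow> deriv (K \<zeta>) z * of_real (\<phi> \<zeta>)) (at 0)"
            using Lder[OF zs, of \<zeta>] by (simp add: DERIV_def)
          then show ?thesis
            using X0 XL unfolding tendsto_at_iff_sequentially comp_def by auto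
        qed
      qed
    qed (use z in auto)
    then show ?thesis using holomorphic_on_open by blast
  qed
  note \<Phi>hol = this
  have ReC: "Ck_on k (ball a (s / 4)) (\<lambda>z. Re (e * \<Phi> z))" for k e
    by (rule Ck_on_Re_holomorphic[OF \<Phi>hol open_ball])
  have in2: "z \<in> ball a (s / 2)" if "z \<in> ball a (s / 4)" for z using that s by auto
  have cM: "continuous_on (ball a (s / 4)) (\<lambda>z. \<integral>\<zeta>. P z \<zeta> \<partial>M)"
  proof (rule continuous_on_sequentiallyI)
    fix X x assume X: "\<forall>n. X n \<in> ball a (s / 4)" "x \<in> ball a (s / 4)" "X \<longlonglongrightarrow> x"
    have Xs: "X n \<in> ball a s" "x \<in> ball a s" for n
      using in2[of "X n"] in2[of x] X(1,2) s by (auto simp del: mem_ball intro: subsetD[OF subset_ball[of "s / 2" s]])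
    show "(\<lambda>n. \<integral>\<zeta>. P (X n) \<zeta> \<partial>M) \<longlonglongrightarrow> (\<integral>\<zeta>. P x \<zeta> \<partial>M)"
    proof (rule integral_dominated_convergence)
      show "integrable M (\<lambda>\<zeta>. \<bar>B\<bar> * \<bar>\<phi> \<zeta>\<bar>)" using \<phi> by auto
      show "AE \<zeta> in M. (\<lambda>n. P (X n) \<zeta>) \<longlonglongrightarrow> P x \<zeta>"
      proof (intro AE_I2)
        fix \<zeta>
        show "(\<lambda>n. P (X n) \<zeta>) \<longlonglongrightarrow> P x \<zeta>"
        proof (cases "\<phi> \<zeta> = 0")
          case False
          have "(\<lambda>n. q \<zeta> (X n)) \<longlonglongrightarrow> q \<zeta> x"
            by (rule continuous_on_tendsto_compose[OF holomorphic_on_imp_continuous_on[OF q(1)[OF False]] X(3) Xs(2)])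
               (intro always_eventually allI Xs(1))
          then have "(\<lambda>n. ln (norm (q \<zeta> (X n))) * \<phi> \<zeta>) \<longlonglongrightarrow> ln (norm (q \<zeta> x)) * \<phi> \<zeta>"
            by (intro tendsto_intros) (use q(2)[OF False Xs(2)] in simp)+
          then show ?thesis using q(2)[OF False Xs(1)] q(2)[OF False Xs(2)] by (simp only: P_def)
        qed (simp add: P_def)
      qed
    qed (use Pm Pb Xs in auto)
  qed
  have Mder': "((\<lambda>t. \<integral>\<zeta>. P (x + t *\<^sub>R i) \<zeta> \<partial>M) has_vector_derivative Re (i * \<Phi> x)) (at 0)"
    if "x \<in> ball a (s / 4)" for i x using Mder[OF in2[OF that]] .
  have eq: "(\<lambda>z. \<integral>\<zeta>. h z \<zeta> * \<phi> \<zeta> \<partial>M) = (\<lambda>z. \<integral>\<zeta>. P z \<zeta> \<partial>M)" by (simp add: P_def)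
  show "Ck_on k (ball a (s / 4)) (\<lambda>z. \<integral>\<zeta>. h z \<zeta> * \<phi> \<zeta> \<partial>M)"
  proof -
    have "Ck_on (Suc k) (ball a (s / 4)) (\<lambda>z. \<integral>\<zeta>. P z \<zeta> \<partial>M)"
      by (rule Ck_on_SucI[OF open_ball cM Mder' ReC])
    then show ?thesis unfolding eq by (rule Ck_on_SucD)
  qed
  show "laplacian (\<lambda>z. \<integral>\<zeta>. h z \<zeta> * \<phi> \<zeta> \<partial>M) z = 0" if z: "z \<in> ball a (s / 4)"
  proof -
    \<comment> \<open>The two directions 1 and \<open>\<i>\<close> contribute deriv \<Phi> with
      factors 1 and -1, so the sum vanishes.\<close>
    have "pd i (pd i (\<lambda>z. \<integral>\<zeta>. P z \<zeta> \<partial>M)) z = Re (i * i * deriv \<Phi> z)" for i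
    proof -
      have "pd i (pd i (\<lambda>z. \<integral>\<zeta>. P z \<zeta> \<partial>M)) z = pd i (\<lambda>z. Re (i * \<Phi> z)) z"
        by (rule pd_cong[OF open_ball z]) (rule pd_eqI[OF Mder'])
      also have "\<dots> = Re (i * i * deriv \<Phi> z)"
        by (rule pd_eqI[OF Re_holomorphic_line_derivative[OF \<Phi>hol open_ball z]])
      finally show ?thesis .
    qed
    then show ?thesis unfolding eq laplacian_def by (simp add: sum_Basis_complex)
  qed
qed

subsection \<open>Green's operator of a simply connected domain\<close>

lemma norm_Moebius_identity:
  "(norm (1 - cnj Y * X))\<^sup>2 = (norm (X - Y))\<^sup>2 + (1 - (norm X)\<^sup>2) * (1 - (norm Y)\<^sup>2)"
proof -
  have "complex_of_real ((norm (1 - cnj Y * X))\<^sup>2) =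
      complex_of_real ((norm (X - Y))\<^sup>2 + (1 - (norm X)\<^sup>2) * (1 - (norm Y)\<^sup>2))"
    unfolding of_real_add of_real_mult of_real_diff complex_norm_square by (simp add: algebra_simps)
  then show ?thesis unfolding of_real_eq_iff .
qed

lemma one_minus_cnj_mult_neq_0:
  assumes "norm X < 1" "norm Y < 1" shows "1 - cnj Y * X \<noteq> 0"
proof
  assume "1 - cnj Y * X = 0"
  then have "norm (cnj Y * X) = 1" by (metis eq_iff_diff_eq_0 norm_one)
  moreover have "norm Y * norm X < 1 * 1" using assms by (intro mult_strict_mono') auto
  ultimately show False by (simp add: norm_mult)
qed

locale disc_domain =
  fixes \<Omega> :: "complex set" and g h :: "complex \<Rightarrow> complex"
  assumes open_dom: "open \<Omega>" and bounded_dom: "bounded \<Omega>" and dom_ne: "\<Omega> \<noteq> {}"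
    and g_holo: "g holomorphic_on \<Omega>" and h_holo: "h holomorphic_on ball 0 1"
    and gh: "\<And>z. z \<in> \<Omega> \<Longrightarrow> g z \<in> ball 0 1 \<and> h (g z) = z"
    and hg: "\<And>X. X \<in> ball 0 1 \<Longrightarrow> h X \<in> \<Omega> \<and> g (h X) = X"
begin

text \<open>The added 1 makes distances in \<Omega> strictly smaller than D, as Schwarz's lemma
  demands, and keeps ln D nonnegative.\<close>

definition D :: real where "D = diameter \<Omega> + 1"

lemma D_ge_1: "D \<ge> 1"
  unfolding D_def using diameter_ge_0[OF bounded_dom] by simp

lemma dist_less_D: "z \<in> \<Omega> \<Longrightarrow> \<zeta> \<in> \<Omega> \<Longrightarrow> norm (z - \<zeta>) < D"
  using diameter_bounded_bound[OF bounded_dom, of z \<zeta>] by (simp add: D_def dist_norm)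

lemma norm_g: "z \<in> \<Omega> \<Longrightarrow> norm (g z) < 1"
  using gh by auto

lemma inj_g: "z \<in> \<Omega> \<Longrightarrow> \<zeta> \<in> \<Omega> \<Longrightarrow> g z = g \<zeta> \<longleftrightarrow> z = \<zeta>"
  using gh by metis

text \<open>Green's function up to the factor \<open>fund_const\<close>, transplanted from the disc. On the diagonal
  the value is the junk \<open>ln 0 = 0\<close>.\<close>

definition gr :: "complex \<Rightarrow> complex \<Rightarrow> real" where
  "gr z \<zeta> = (if z \<in> \<Omega> \<and> \<zeta> \<in> \<Omega> then ln (norm ((1 - cnj (g \<zeta>) * g z) / (g z - g \<zeta>))) else 0)"

lemma gr_sym: "gr z \<zeta> = gr \<zeta> z"
proof -
  have "norm (1 - cnj (g \<zeta>) * g z) = norm (1 - cnj (g z) * g \<zeta>)"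
    by (metis complex_cnj_cnj complex_cnj_diff complex_cnj_mult complex_cnj_one complex_mod_cnj mult.commute)
  then show ?thesis by (simp add: gr_def norm_divide norm_minus_commute[of "g z"])
qed

lemma gr_off: "z \<notin> \<Omega> \<Longrightarrow> gr z \<zeta> = 0" "\<zeta> \<notin> \<Omega> \<Longrightarrow> gr z \<zeta> = 0"
  by (auto simp: gr_def)

lemma gr_diag: "gr z z = 0" by (simp add: gr_def)

text \<open>In this form positivity is visible, and so is the decay at the boundary: the term added
  to 1 tends to 0 as |g z| tends to 1.\<close>

lemma gr_eq:
  assumes "z \<in> \<Omega>" "\<zeta> \<in> \<Omega>" "z \<noteq> \<zeta>"
  shows "gr z \<zeta> = ln (1 + (1 - (norm (g z))\<^sup>2) * (1 - (norm (g \<zeta>))\<^sup>2) / (norm (g z - g \<zeta>))\<^sup>2) / 2"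
proof -
  have n: "norm (g z - g \<zeta>) > 0" using inj_g assms by simp
  have p: "norm (1 - cnj (g \<zeta>) * g z) > 0"
    using one_minus_cnj_mult_neq_0[of "g z" "g \<zeta>"] norm_g assms by simp
  have "gr z \<zeta> = ln ((norm (1 - cnj (g \<zeta>) * g z) / norm (g z - g \<zeta>))\<^sup>2) / 2"
    using assms n p by (simp add: gr_def norm_divide ln_realpow)
  also have "(norm (1 - cnj (g \<zeta>) * g z) / norm (g z - g \<zeta>))\<^sup>2 =
      1 + (1 - (norm (g z))\<^sup>2) * (1 - (norm (g \<zeta>))\<^sup>2) / (norm (g z - g \<zeta>))\<^sup>2"
    unfolding power_divide norm_Moebius_identity using n by (simp add: add_divide_distrib)
  finally show ?thesis .
qed

lemma norm_g_sq: "z \<in> \<Omega> \<Longrightarrow> 1 - (norm (g z))\<^sup>2 > 0"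
  using norm_g[of z] by (simp add: power_less_one_iff abs_square_less_1)

lemma gr_pos:
  assumes "z \<in> \<Omega>" "\<zeta> \<in> \<Omega>" "z \<noteq> \<zeta>" shows "gr z \<zeta> > 0"
proof -
  have n: "norm (g z - g \<zeta>) > 0" using inj_g assms by simp
  have "(1 - (norm (g z))\<^sup>2) * (1 - (norm (g \<zeta>))\<^sup>2) / (norm (g z - g \<zeta>))\<^sup>2 > 0"
    using norm_g_sq assms n by (intro divide_pos_pos mult_pos_pos) auto
  then show ?thesis unfolding gr_eq[OF assms] by simp
qed

lemma gr_nonneg: "gr z \<zeta> \<ge> 0"
  using gr_pos[of z \<zeta>] gr_off gr_diag by (cases "z \<in> \<Omega> \<and> \<zeta> \<in> \<Omega> \<and> z \<noteq> \<zeta>") auto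

text \<open>For fixed \<zeta> the right-hand side tends to 0 as r tends to 1, which is the source of
  the zero boundary values. The estimate is ln (1 + x) \<le> x applied to
  \<open>gr_eq\<close>.\<close>

lemma gr_le_boundary:
  assumes "z \<in> \<Omega>" "\<zeta> \<in> \<Omega>" "norm (g \<zeta>) < r" "r \<le> norm (g z)"
  shows "gr z \<zeta> \<le> (1 - r\<^sup>2) / (r - norm (g \<zeta>))\<^sup>2"
proof -
  have ne: "z \<noteq> \<zeta>" using assms by auto
  have r: "r > 0" using assms(3) norm_ge_zero[of "g \<zeta>"] by linarith
  have d: "r - norm (g \<zeta>) \<le> norm (g z - g \<zeta>)"
    using assms(4) norm_triangle_ineq2[of "g z" "g \<zeta>"] by linarith
  let ?a = "(1 - (norm (g z))\<^sup>2) * (1 - (norm (g \<zeta>))\<^sup>2) / (norm (g z - g \<zeta>))\<^sup>2"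
  have a0: "?a \<ge> 0" using norm_g_sq[OF assms(1)] norm_g_sq[OF assms(2)] by (simp add: zero_le_divide_iff)
  have "gr z \<zeta> \<le> ?a / 2"
    unfolding gr_eq[OF assms(1,2) ne] using ln_add_one_self_le_self[OF a0] by simp
  also have "\<dots> \<le> ?a" using a0 by simp
  also have "\<dots> \<le> (1 - r\<^sup>2) * 1 / (r - norm (g \<zeta>))\<^sup>2"
  proof (rule frac_le)
    have "r < 1" using assms norm_g[OF assms(1)] by linarith
    show "(1 - (norm (g z))\<^sup>2) * (1 - (norm (g \<zeta>))\<^sup>2) \<le> (1 - r\<^sup>2) * 1"
    proof (rule mult_mono)
      show "1 - (norm (g z))\<^sup>2 \<le> 1 - r\<^sup>2" using assms(4) r by (simp add: power_mono)
      show "0 \<le> 1 - r\<^sup>2" using \<open>r < 1\<close> r by (simp add: power_le_one)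
    qed (use norm_g_sq[OF assms(2)] in auto)
    then show "0 \<le> (1 - r\<^sup>2) * 1" using r \<open>r < 1\<close> by (simp add: power_le_one)
    show "0 < (r - norm (g \<zeta>))\<^sup>2" using assms by simp
    show "(r - norm (g \<zeta>))\<^sup>2 \<le> (norm (g z - g \<zeta>))\<^sup>2" using d assms(3) by (intro power_mono) auto
  qed
  finally show ?thesis by simp
qed

text \<open>Schwarz's lemma for \<open>h\<close>, precomposed with a disc automorphism moving \<open>0\<close> to \<open>g \<zeta>\<close>.\<close>

lemma gr_le_log:
  assumes "z \<in> \<Omega>" "\<zeta> \<in> \<Omega>" "z \<noteq> \<zeta>"
  shows "gr z \<zeta> \<le> ln D - ln (norm (z - \<zeta>))"
proof -
  let ?Y = "g \<zeta>" and ?X = "g z"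
  have Y: "norm ?Y < 1" and X: "norm ?X < 1" using norm_g assms by auto
  have Dp: "D > 0" using D_ge_1 by simp
  define k where "k x = (h (Moebius_function 0 (- ?Y) x) - \<zeta>) / of_real D" for x
  have mb: "Moebius_function 0 (- ?Y) x \<in> ball 0 1" if "norm x < 1" for x
    using Moebius_function_norm_lt_1[of "- ?Y" x] Y that by simp
  have "norm (k (Moebius_function 0 ?Y ?X)) \<le> norm (Moebius_function 0 ?Y ?X)"
  proof (rule Schwarz_Lemma)
    show "k holomorphic_on ball 0 1"
      unfolding k_def
    proof (intro holomorphic_intros)
      have "(h \<circ> Moebius_function 0 (- ?Y)) holomorphic_on ball 0 1"
        by (rule holomorphic_on_compose_gen[OF Moebius_function_holomorphic h_holo]) (use mb Y in auto)
      then show "(\<lambda>x. h (Moebius_function 0 (- ?Y) x)) holomorphic_on ball 0 1" by (simp add: comp_def)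
      show "complex_of_real D \<noteq> 0" using Dp by simp
    qed
    show "k 0 = 0"
      using gh[OF assms(2)] by (simp add: k_def Moebius_function_of_zero)
    show "norm (k x) < 1" if "norm x < 1" for x
      using dist_less_D[OF _ assms(2), of "h (Moebius_function 0 (- ?Y) x)"] hg[OF mb[OF that]] Dp
      by (simp add: k_def norm_divide)
    show "norm (Moebius_function 0 ?Y ?X) < 1" by (rule Moebius_function_norm_lt_1[OF Y X])
  qed
  moreover have "Moebius_function 0 (- ?Y) (Moebius_function 0 ?Y ?X) = ?X"
    by (rule Moebius_function_compose) (use X Y in auto)
  ultimately have le: "norm (z - \<zeta>) / D \<le> norm (?X - ?Y) / norm (1 - cnj ?Y * ?X)"
    using gh[OF assms(1)] Dp by (simp add: k_def norm_divide Moebius_function_simple)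
  have p: "norm (1 - cnj ?Y * ?X) > 0" using one_minus_cnj_mult_neq_0[OF X Y] by simp
  have q: "norm (?X - ?Y) > 0" using inj_g assms by simp
  have "gr z \<zeta> = - ln (norm (?X - ?Y) / norm (1 - cnj ?Y * ?X))"
    using assms p q by (simp add: gr_def norm_divide ln_div)
  also have "\<dots> \<le> - ln (norm (z - \<zeta>) / D)"
    using ln_mono[OF le] assms Dp by simp
  also have "\<dots> = ln D - ln (norm (z - \<zeta>))"
    using assms Dp by (simp add: ln_div)
  finally show ?thesis .
qed

text \<open>A translation-invariant integrable majorant of \<open>gr\<close>. The cutoff at D loses
  nothing, since distances in \<Omega> are smaller.\<close>

definition Bk :: "complex \<Rightarrow> real" where
  "Bk w = indicator (ball 0 D) w * (ln D - lnk 0 w)"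

lemma Bk_borel [measurable]: "Bk \<in> borel_measurable borel"
  unfolding Bk_def by measurable

lemma Bk_nonneg: "Bk w \<ge> 0"
proof (cases "w = 0")
  case True then show ?thesis using D_ge_1 by (simp add: Bk_def lnk_0)
next
  case False
  then have "norm w < D \<Longrightarrow> ln (norm w) \<le> ln D" by (intro ln_mono) auto
  then show ?thesis by (auto simp: Bk_def lnk_0 indicator_def)
qed

lemma integrable_Bk: "integrable lborel Bk"
proof -
  have "loc_int (\<lambda>w. - lnk 0 w)" using loc_int_lnk[of 0] by (simp add: loc_int_def)
  then have "loc_int (\<lambda>w. ln D + - lnk 0 w)"
    by (rule loc_int_add[OF loc_int_continuous[OF continuous_on_const]])
  then show ?thesis using D_ge_1 by (simp add: loc_int_def Bk_def[abs_def])
qed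

lemma gr_le_Bk: "gr z \<zeta> \<le> Bk (z - \<zeta>)"
proof (cases "z \<in> \<Omega> \<and> \<zeta> \<in> \<Omega> \<and> z \<noteq> \<zeta>")
  case True
  then show ?thesis using gr_le_log[of z \<zeta>] dist_less_D[of z \<zeta>] by (auto simp: Bk_def lnk_0)
next
  case False
  then have "gr z \<zeta> = 0" using gr_off gr_diag by auto
  then show ?thesis using Bk_nonneg by simp
qed

lemma dom_borel [measurable]: "\<Omega> \<in> sets borel" using open_dom by simp

lemma fin_dom: "emeasure lborel \<Omega> < \<infinity>"
  using bounded_dom by (rule emeasure_bounded_finite)

lemma emeasure_dom_ne_0: "emeasure lborel \<Omega> \<noteq> 0"
proof
  assume "emeasure lborel \<Omega> = 0"
  then have "\<Omega> \<in> null_sets lborel" using open_dom by (simp add: null_sets_def)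
  then show False
    using open_dom dom_ne open_not_negligible negligible_iff_null_sets null_sets_completionI by blast
qed

lemma measure_dom_pos: "measure lborel \<Omega> > 0"
  using fin_dom emeasure_dom_ne_0 by (simp add: measure_def enn2real_positive_iff zero_less_iff_neq_zero)

lemma gr_measurable2: "(\<lambda>(z, \<zeta>). gr z \<zeta>) \<in> borel_measurable (borel \<Otimes>\<^sub>M borel)"
proof -
  \<comment> \<open>Off \<Omega> the map g is arbitrary; setting it to 0 there gives a Borel
    function. Joint measurability is needed later for Fubini.\<close>
  define G where "G z = (if z \<in> \<Omega> then g z else 0)" for z
  have [measurable]: "G \<in> borel_measurable borel"
    unfolding G_def
    by (rule borel_measurable_continuous_on_if) (use g_holo in \<open>auto intro: holomorphic_on_imp_continuous_on\<close>)
  have eq: "(\<lambda>(z, \<zeta>). gr z \<zeta>) = (\<lambda>p. if fst p \<in> \<Omega> \<and> snd p \<in> \<Omega> then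
      ln (norm ((1 - cnj (G (snd p)) * G (fst p)) / (G (fst p) - G (snd p)))) else 0)"
    by (auto simp: gr_def G_def fun_eq_iff)
  have [measurable]: "cnj \<in> borel_measurable borel"
    by (rule borel_measurable_continuous_onI) (intro continuous_intros)
  show ?thesis unfolding eq by measurable
qed

lemma gr_measurable [measurable]: "gr z \<in> borel_measurable borel"
  using measurable_compose[OF measurable_Pair1' gr_measurable2, of z] by simp

lemma integrable_Bk_shift: "integrable lborel (\<lambda>\<zeta>. Bk (z - \<zeta>))"
  by (rule lborel_integrable_reflect[OF integrable_Bk])

lemma integrable_gr: "integrable lborel (gr z)"
  by (rule Bochner_Integration.integrable_bound[OF integrable_Bk_shift[of z]])
     (use gr_le_Bk gr_nonneg Bk_nonneg in auto)

text \<open>The bound is asked on \<Omega> only, because \<open>gr\<close> vanishes for \<zeta>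
  outside.\<close>

definition adm :: "real \<Rightarrow> (complex \<Rightarrow> real) \<Rightarrow> bool" where
  "adm B f \<longleftrightarrow> f \<in> borel_measurable borel \<and> (\<forall>\<zeta>\<in>\<Omega>. \<bar>f \<zeta>\<bar> \<le> B)"

lemma adm_nonneg: "adm B f \<Longrightarrow> B \<ge> 0"
  using dom_ne by (force simp: adm_def)

lemma gr_mult_bound: "adm B f \<Longrightarrow> \<bar>gr z \<zeta> * f \<zeta>\<bar> \<le> B * gr z \<zeta>"
  using gr_nonneg[of z \<zeta>] gr_off(2)[of \<zeta> z]
  by (cases "\<zeta> \<in> \<Omega>") (auto simp: adm_def abs_mult mult.commute[of _ "gr z \<zeta>"] intro!: mult_left_mono)

lemma integrable_gr_mult:
  assumes "adm B f" shows "integrable lborel (\<lambda>\<zeta>. gr z \<zeta> * f \<zeta>)"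
proof (rule Bochner_Integration.integrable_bound)
  show "integrable lborel (\<lambda>\<zeta>. B * gr z \<zeta>)" using integrable_gr by auto
  show "(\<lambda>\<zeta>. gr z \<zeta> * f \<zeta>) \<in> borel_measurable lborel" using assms by (auto simp: adm_def)
  show "AE \<zeta> in lborel. norm (gr z \<zeta> * f \<zeta>) \<le> norm (B * gr z \<zeta>)"
    using gr_mult_bound[OF assms] by (auto intro!: AE_I2 intro: order_trans[OF _ abs_ge_self])
qed

text \<open>The division by \<open>fund_const\<close> normalises the solution of - \<Delta> u = f.
  Since the value off \<Omega> is 0, continuity on the whole plane will include the boundary
  condition.\<close>

definition Gop :: "(complex \<Rightarrow> real) \<Rightarrow> complex \<Rightarrow> real" where
  "Gop f z = (\<integral>\<zeta>. gr z \<zeta> * f \<zeta> \<partial>lborel) / fund_const"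

lemma Gop_off: "z \<notin> \<Omega> \<Longrightarrow> Gop f z = 0"
  by (simp add: Gop_def gr_off)

lemma Gop_add: "adm B f \<Longrightarrow> adm B' f' \<Longrightarrow> Gop (\<lambda>\<zeta>. f \<zeta> + f' \<zeta>) z = Gop f z + Gop f' z"
  by (simp add: Gop_def distrib_left Bochner_Integration.integral_add[OF integrable_gr_mult integrable_gr_mult] add_divide_distrib)

lemma Gop_diff: "adm B f \<Longrightarrow> adm B' f' \<Longrightarrow> Gop (\<lambda>\<zeta>. f \<zeta> - f' \<zeta>) z = Gop f z - Gop f' z"
  by (simp add: Gop_def right_diff_distrib Bochner_Integration.integral_diff[OF integrable_gr_mult integrable_gr_mult] diff_divide_distrib)

lemma Gop_cmult: "Gop (\<lambda>\<zeta>. c * f \<zeta>) z = c * Gop f z"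
proof -
  have "(\<integral>\<zeta>. gr z \<zeta> * (c * f \<zeta>) \<partial>lborel) = (\<integral>\<zeta>. c * (gr z \<zeta> * f \<zeta>) \<partial>lborel)"
    by (intro Bochner_Integration.integral_cong) (auto simp: mult_ac)
  then show ?thesis by (simp add: Gop_def)
qed

lemma Gop_mono:
  assumes "adm B f" "adm B' f'" "\<And>\<zeta>. \<zeta> \<in> \<Omega> \<Longrightarrow> f \<zeta> \<le> f' \<zeta>"
  shows "Gop f z \<le> Gop f' z"
proof -
  have "gr z \<zeta> * f \<zeta> \<le> gr z \<zeta> * f' \<zeta>" for \<zeta>
    using assms(3)[of \<zeta>] gr_nonneg[of z \<zeta>] gr_off(2)[of \<zeta> z] by (cases "\<zeta> \<in> \<Omega>") (auto intro: mult_left_mono)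
  then have "(\<integral>\<zeta>. gr z \<zeta> * f \<zeta> \<partial>lborel) \<le> (\<integral>\<zeta>. gr z \<zeta> * f' \<zeta> \<partial>lborel)"
    by (intro integral_mono integrable_gr_mult[OF assms(1)] integrable_gr_mult[OF assms(2)])
  then show ?thesis using fund_const_pos by (simp add: Gop_def divide_right_mono)
qed

lemma adm_const [simp]: "adm \<bar>c\<bar> (\<lambda>_. c)"
  by (simp add: adm_def)

lemma Gop_nonneg: "adm B f \<Longrightarrow> (\<And>\<zeta>. \<zeta> \<in> \<Omega> \<Longrightarrow> f \<zeta> \<ge> 0) \<Longrightarrow> Gop f z \<ge> 0"
  using Gop_mono[OF adm_const[of 0], of B f z] by (simp add: Gop_def)

lemma Gop_abs_le: "adm B f \<Longrightarrow> \<bar>Gop f z\<bar> \<le> B * Gop (\<lambda>_. 1) z"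
proof -
  assume f: "adm B f"
  have "Gop f z \<le> Gop (\<lambda>_. B) z"
    by (rule Gop_mono[OF f adm_const]) (use f in \<open>auto simp: adm_def\<close>)
  moreover have "Gop (\<lambda>_. - B) z \<le> Gop f z"
    by (rule Gop_mono[OF adm_const f]) (use f in \<open>auto simp: adm_def abs_le_iff\<close>)
  ultimately show ?thesis using Gop_cmult[of B "\<lambda>_. 1" z] Gop_cmult[of "- B" "\<lambda>_. 1" z] by (simp add: abs_le_iff)
qed

lemma Gop_pos:
  assumes f: "adm B f" "\<And>\<zeta>. \<zeta> \<in> \<Omega> \<Longrightarrow> f \<zeta> > 0" and z: "z \<in> \<Omega>"
  shows "Gop f z > 0"
proof -
  have nn: "gr z \<zeta> * f \<zeta> \<ge> 0" for \<zeta>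
    using f(2)[of \<zeta>] gr_nonneg[of z \<zeta>] gr_off(2)[of \<zeta> z] by (cases "\<zeta> \<in> \<Omega>") (auto intro: mult_nonneg_nonneg less_imp_le)
  have "(\<integral>\<zeta>. gr z \<zeta> * f \<zeta> \<partial>lborel) \<noteq> 0"
  proof
    assume "(\<integral>\<zeta>. gr z \<zeta> * f \<zeta> \<partial>lborel) = 0"
    then have "AE \<zeta> in lborel. gr z \<zeta> * f \<zeta> = 0"
      using integral_nonneg_eq_0_iff_AE[OF integrable_gr_mult[OF f(1)]] nn by auto
    moreover have "AE \<zeta> in lborel. \<zeta> \<noteq> z" by (rule AE_lborel_singleton)
    ultimately have "AE \<zeta> in lborel. \<zeta> \<notin> \<Omega>"
      by eventually_elim (use gr_pos[OF z] f(2) in force)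
    then have "emeasure lborel \<Omega> = 0"
      by (subst (asm) AE_iff_measurable[OF _ refl]) (use open_dom in auto)
    then show False using emeasure_dom_ne_0 by simp
  qed
  moreover have "(\<integral>\<zeta>. gr z \<zeta> * f \<zeta> \<partial>lborel) \<ge> 0" using nn by (rule Bochner_Integration.integral_nonneg)
  ultimately show ?thesis using fund_const_pos by (simp add: Gop_def)
qed

lemma compact_inner: "r < 1 \<Longrightarrow> compact (h ` cball 0 r)"
proof -
  assume "r < 1"
  then have "cball 0 r \<subseteq> ball (0::complex) 1" by auto
  then show ?thesis
    using h_holo by (intro compact_continuous_image) (auto intro: holomorphic_on_imp_continuous_on continuous_on_subset)
qed

lemma gr_tendsto:
  assumes X: "X \<longlonglongrightarrow> z" and ne: "\<zeta> \<noteq> z"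
  shows "(\<lambda>n. gr (X n) \<zeta>) \<longlonglongrightarrow> gr z \<zeta>"
proof (cases "\<zeta> \<in> \<Omega>")
  case False then show ?thesis by (simp add: gr_off)
next
  case z: True
  show ?thesis
  proof (cases "z \<in> \<Omega>")
    case True
    have ev: "\<forall>\<^sub>F n in sequentially. X n \<in> \<Omega>"
      using X open_dom True by (rule topological_tendstoD)
    have "(\<lambda>n. g (X n)) \<longlonglongrightarrow> g z"
      by (rule continuous_on_tendsto_compose[OF holomorphic_on_imp_continuous_on[OF g_holo] X True ev])
    then have "(\<lambda>n. ln (norm ((1 - cnj (g \<zeta>) * g (X n)) / (g (X n) - g \<zeta>)))) \<longlonglongrightarrow>
        ln (norm ((1 - cnj (g \<zeta>) * g z) / (g z - g \<zeta>)))"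
      using inj_g[OF True z] ne one_minus_cnj_mult_neq_0[OF norm_g[OF True] norm_g[OF z]]
      by (intro tendsto_intros) auto
    then have "(\<lambda>n. ln (norm ((1 - cnj (g \<zeta>) * g (X n)) / (g (X n) - g \<zeta>)))) \<longlonglongrightarrow> gr z \<zeta>"
      using True z by (simp add: gr_def)
    then show ?thesis
      by (rule Lim_transform_eventually) (use ev in eventually_elim, use z in \<open>simp add: gr_def\<close>)
  next
    case False
    have "(\<lambda>n. gr (X n) \<zeta>) \<longlonglongrightarrow> 0"
    proof (rule LIMSEQ_I)
      fix e :: real assume e: "e > 0"
      let ?y = "norm (g \<zeta>)"
      have y: "?y < 1" by (rule norm_g[OF z])
      have "((\<lambda>r. (1 - r\<^sup>2) / (r - ?y)\<^sup>2) \<longlongrightarrow> (1 - 1\<^sup>2) / (1 - ?y)\<^sup>2) (at_left 1)"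
        using y by (intro tendsto_intros) auto
      then have "\<forall>\<^sub>F r in at_left 1. (1 - r\<^sup>2) / (r - ?y)\<^sup>2 < e"
        using e by (intro order_tendstoD) auto
      moreover have "\<forall>\<^sub>F r in at_left 1. r \<in> {?y<..<1}"
        using y by (rule eventually_at_left_real)
      ultimately obtain r where r: "(1 - r\<^sup>2) / (r - ?y)\<^sup>2 < e" "?y < r" "r < 1"
        using eventually_happens[OF eventually_conj] trivial_limit_at_left_real by fastforce
      \<comment> \<open>The image of the closed disc of radius r is a compact part of \<Omega> that
        avoids z. The sequence eventually leaves it, so |g (X n)| > r whenever X n lies in
        \<Omega>.\<close>
      have "z \<notin> h ` cball 0 r" using False hg r by auto
      then have "\<forall>\<^sub>F n in sequentially. X n \<in> - h ` cball 0 r"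
        using X compact_imp_closed[OF compact_inner[OF r(3)]] by (intro topological_tendstoD[OF X]) auto
      then have "\<forall>\<^sub>F n in sequentially. norm (gr (X n) \<zeta> - 0) < e"
      proof eventually_elim
        case (elim n)
        show ?case
        proof (cases "X n \<in> \<Omega>")
          case True
          have "\<not> norm (g (X n)) \<le> r"
          proof
            assume "norm (g (X n)) \<le> r"
            then have "h (g (X n)) \<in> h ` cball 0 r" by auto
            then show False using elim gh[OF True] by auto
          qed
          then have "gr (X n) \<zeta> \<le> (1 - r\<^sup>2) / (r - ?y)\<^sup>2"
            by (intro gr_le_boundary True z r) auto
          then show ?thesis using r(1) gr_nonneg[of "X n" \<zeta>] by simp
        qed (use e in \<open>simp add: gr_off\<close>)
      qed
      then show "\<exists>N. \<forall>n\<ge>N. norm (gr (X n) \<zeta> - 0) < e" by (simp add: eventually_sequentially)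
    qed
    then show ?thesis using False by (simp add: gr_off)
  qed
qed

text \<open>Continuity up to the boundary: the truncated kernels converge boundedly, and the tails
  \<open>(Bk - m)\<^sup>+\<close> are uniformly small by translation invariance.\<close>

lemma Gop_continuous:
  assumes f: "adm B f"
  shows "continuous_on UNIV (Gop f)"
proof -
  define tail where "tail m = (\<integral>w. max (Bk w - m) 0 \<partial>lborel)" for m :: real
  have int_tail: "integrable lborel (\<lambda>w. max (Bk w - m) 0)" if "m \<ge> 0" for m
  proof (rule Bochner_Integration.integrable_bound[OF integrable_Bk])
    show "AE w in lborel. norm (max (Bk w - m) 0) \<le> norm (Bk w)"
      using Bk_nonneg that by (intro AE_I2) (simp add: abs_of_nonneg)
  qed simp
  have tail0: "(\<lambda>m. tail (real m)) \<longlonglongrightarrow> 0"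
  proof -
    have "(\<lambda>m. \<integral>w. max (Bk w - real m) 0 \<partial>lborel) \<longlonglongrightarrow> integral\<^sup>L lborel (\<lambda>w::complex. 0)"
    proof (rule integral_dominated_convergence[OF _ _ integrable_Bk])
      show "AE w in lborel. (\<lambda>m. max (Bk w - real m) 0) \<longlonglongrightarrow> 0"
      proof (intro AE_I2 tendsto_eventually)
        fix w
        show "\<forall>\<^sub>F m in sequentially. max (Bk w - real m) 0 = 0"
          using eventually_ge_at_top[of "nat \<lceil>Bk w\<rceil>"] by eventually_elim linarith
      qed
      show "AE w in lborel. norm (max (Bk w - real m) 0) \<le> Bk w" for m
        using Bk_nonneg by (intro AE_I2) (simp add: abs_of_nonneg)
    qed auto
    then show ?thesis by (simp add: tail_def)
  qed
  have B: "B \<ge> 0" by (rule adm_nonneg[OF f])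
  have "isCont (Gop f) z" for z
    unfolding continuous_at_sequentially comp_def
  proof (intro allI impI LIMSEQ_I)
    fix X :: "nat \<Rightarrow> complex" and e :: real assume X: "X \<longlonglongrightarrow> z" and e: "e > 0"
    \<comment> \<open>The total error will be below B times 3/2 of e', and 2 (B + 1) e' equals
      \<open>fund_const * e\<close>; B + 1 replaces B because B may be 0.\<close>
    define e' where "e' = e * fund_const / (2 * (B + 1))"
    have e': "e' > 0" using e B fund_const_pos by (simp add: e'_def)
    have "\<forall>\<^sub>F m in sequentially. tail (real m) < e' / 4" using tail0 e' by (intro order_tendstoD) auto
    then obtain m where m: "tail (real m) < e' / 4"
      by (auto simp: eventually_sequentially)
    define T where "T x \<zeta> = min (gr x \<zeta>) (real m)" for x \<zeta>
    have [measurable]: "T x \<in> borel_measurable borel" for x unfolding T_def by measurable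
    have ae: "AE \<zeta> in lborel. \<zeta> \<noteq> z" by (rule AE_lborel_singleton)
    have intT: "integrable lborel (\<lambda>\<zeta>. \<bar>T x \<zeta> - T z \<zeta>\<bar>)" for x
    proof (rule Bochner_Integration.integrable_bound)
      show "integrable lborel (\<lambda>\<zeta>. gr x \<zeta> + gr z \<zeta>)" by (intro Bochner_Integration.integrable_add integrable_gr)
      show "AE \<zeta> in lborel. norm \<bar>T x \<zeta> - T z \<zeta>\<bar> \<le> norm (gr x \<zeta> + gr z \<zeta>)"
        proof (intro AE_I2)
        fix \<zeta>
        have "T x \<zeta> \<ge> 0" "T x \<zeta> \<le> gr x \<zeta>" "T z \<zeta> \<ge> 0" "T z \<zeta> \<le> gr z \<zeta>"
          using gr_nonneg by (auto simp: T_def)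
        then show "norm \<bar>T x \<zeta> - T z \<zeta>\<bar> \<le> norm (gr x \<zeta> + gr z \<zeta>)" by simp
      qed
    qed simp
    have "(\<lambda>n. \<integral>\<zeta>. \<bar>T (X n) \<zeta> - T z \<zeta>\<bar> \<partial>lborel) \<longlonglongrightarrow> integral\<^sup>L lborel (\<lambda>w::complex. 0)"
    proof (rule integral_dominated_convergence)
      show "integrable lborel (\<lambda>\<zeta>. real m * indicator \<Omega> \<zeta>)"
        using fin_dom by (intro integrable_mult_right integrable_real_indicator) auto
      show "AE \<zeta> in lborel. (\<lambda>n. \<bar>T (X n) \<zeta> - T z \<zeta>\<bar>) \<longlonglongrightarrow> 0"
        using ae
      proof eventually_elim
        case (elim \<zeta>)
        have "(\<lambda>n. \<bar>T (X n) \<zeta> - T z \<zeta>\<bar>) \<longlonglongrightarrow> \<bar>T z \<zeta> - T z \<zeta>\<bar>"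
          unfolding T_def by (intro tendsto_intros gr_tendsto X elim)
        then show ?case by simp
      qed
      show "AE \<zeta> in lborel. norm \<bar>T (X n) \<zeta> - T z \<zeta>\<bar> \<le> real m * indicator \<Omega> \<zeta>" for n
      proof (intro AE_I2)
        fix \<zeta>
        have "T x \<zeta> \<ge> 0" "T x \<zeta> \<le> real m" "\<zeta> \<notin> \<Omega> \<Longrightarrow> T x \<zeta> = 0" for x
          using gr_nonneg by (auto simp: T_def gr_off)
        from this[of "X n"] this[of z] show "norm \<bar>T (X n) \<zeta> - T z \<zeta>\<bar> \<le> real m * indicator \<Omega> \<zeta>"
          by (auto simp: indicator_def abs_le_iff)
      qed
    qed auto
    then have "\<forall>\<^sub>F n in sequentially. (\<integral>\<zeta>. \<bar>T (X n) \<zeta> - T z \<zeta>\<bar> \<partial>lborel) < e'"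
      using e' by (intro order_tendstoD) auto
    then obtain N where N: "\<And>n. n \<ge> N \<Longrightarrow> (\<integral>\<zeta>. \<bar>T (X n) \<zeta> - T z \<zeta>\<bar> \<partial>lborel) < e'"
      by (auto simp: eventually_sequentially)
    have tails: "gr x \<zeta> - T x \<zeta> \<le> max (Bk (x - \<zeta>) - real m) 0" "gr x \<zeta> - T x \<zeta> \<ge> 0" for x \<zeta>
      using gr_le_Bk[of x \<zeta>] by (auto simp: T_def)
    have itail: "integrable lborel (\<lambda>\<zeta>. max (Bk (x - \<zeta>) - real m) 0)" for x
      by (rule lborel_integrable_reflect[OF int_tail]) simp
    have vtail: "(\<integral>\<zeta>. max (Bk (x - \<zeta>) - real m) 0 \<partial>lborel) = tail (real m)" for x
      unfolding tail_def by (rule lborel_integral_reflect) simp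
    have est: "\<bar>Gop f x - Gop f z\<bar> < e" if small: "(\<integral>\<zeta>. \<bar>T x \<zeta> - T z \<zeta>\<bar> \<partial>lborel) < e'" for x
    proof -
      have "fund_const * (Gop f x - Gop f z) = (\<integral>\<zeta>. gr x \<zeta> * f \<zeta> - gr z \<zeta> * f \<zeta> \<partial>lborel)"
        using fund_const_pos by (simp add: Gop_def right_diff_distrib Bochner_Integration.integral_diff[OF integrable_gr_mult[OF f] integrable_gr_mult[OF f]])
      then have "\<bar>fund_const * (Gop f x - Gop f z)\<bar> \<le> (\<integral>\<zeta>. \<bar>gr x \<zeta> * f \<zeta> - gr z \<zeta> * f \<zeta>\<bar> \<partial>lborel)"
        by (metis integral_abs_bound)
      also have "\<dots> \<le> (\<integral>\<zeta>. B * (\<bar>T x \<zeta> - T z \<zeta>\<bar> + (max (Bk (x - \<zeta>) - real m) 0 + max (Bk (z - \<zeta>) - real m) 0)) \<partial>lborel)"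
      proof (rule integral_mono)
        show "integrable lborel (\<lambda>\<zeta>. \<bar>gr x \<zeta> * f \<zeta> - gr z \<zeta> * f \<zeta>\<bar>)"
          by (intro integrable_abs Bochner_Integration.integrable_diff integrable_gr_mult[OF f])
        show "integrable lborel (\<lambda>\<zeta>. B * (\<bar>T x \<zeta> - T z \<zeta>\<bar> + (max (Bk (x - \<zeta>) - real m) 0 + max (Bk (z - \<zeta>) - real m) 0)))"
          by (intro integrable_mult_right Bochner_Integration.integrable_add intT itail)
        fix \<zeta>
        show "\<bar>gr x \<zeta> * f \<zeta> - gr z \<zeta> * f \<zeta>\<bar> \<le> B * (\<bar>T x \<zeta> - T z \<zeta>\<bar> + (max (Bk (x - \<zeta>) - real m) 0 + max (Bk (z - \<zeta>) - real m) 0))"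
        proof (cases "\<zeta> \<in> \<Omega>")
          case True
          have "\<bar>gr x \<zeta> - gr z \<zeta>\<bar> \<le> \<bar>T x \<zeta> - T z \<zeta>\<bar> + (max (Bk (x - \<zeta>) - real m) 0 + max (Bk (z - \<zeta>) - real m) 0)"
            using tails[of x \<zeta>] tails[of z \<zeta>] by linarith
          moreover have "\<bar>f \<zeta>\<bar> \<le> B" using f True by (simp add: adm_def)
          ultimately have "\<bar>f \<zeta>\<bar> * \<bar>gr x \<zeta> - gr z \<zeta>\<bar> \<le> B * (\<bar>T x \<zeta> - T z \<zeta>\<bar> + (max (Bk (x - \<zeta>) - real m) 0 + max (Bk (z - \<zeta>) - real m) 0))"
            using B by (intro mult_mono) auto
          then show ?thesis by (simp only: mult.commute[of _ "f \<zeta>"] flip: abs_mult right_diff_distrib)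
        qed (use B in \<open>simp add: gr_off\<close>)
      qed
      also have "\<dots> = B * ((\<integral>\<zeta>. \<bar>T x \<zeta> - T z \<zeta>\<bar> \<partial>lborel) + (tail (real m) + tail (real m)))"
        using intT itail vtail by simp
      also have "\<dots> \<le> B * (e' + (e' / 4 + e' / 4))"
        using B small m by (intro mult_left_mono add_mono) auto
      also have "\<dots> < 2 * ((B + 1) * e')"
        using B e' by (simp add: algebra_simps add_nonneg_pos)
      also have "\<dots> = fund_const * e" using B by (simp add: e'_def field_simps)
      finally show ?thesis using fund_const_pos by (simp add: abs_mult)
    qed
    show "\<exists>N. \<forall>n\<ge>N. norm (Gop f (X n) - Gop f z) < e"
      using est[OF N] by (intro exI[of _ N]) auto
  qed
  then show ?thesis by (simp add: continuous_on_eq_continuous_at)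
qed

end

subsection \<open>Interior regularity\<close>

lemma laplacian_lincomb:
  fixes u v :: "'a::euclidean_space \<Rightarrow> real"
  assumes V: "open V" "z \<in> V" and u: "Ck_on 2 V u" and v: "Ck_on 2 V v"
  shows "laplacian (\<lambda>x. a * u x + b * v x) z = a * laplacian u z + b * laplacian v z"
proof -
  have u2: "Ck_on (Suc (Suc 0)) V u" and v2: "Ck_on (Suc (Suc 0)) V v"
    using u v by (simp_all add: numeral_2_eq_2)
  have pd1: "pd i (\<lambda>x. a * u x + b * v x) y = a * pd i u y + b * pd i v y" if "i \<in> Basis" "y \<in> V" for i y
    by (rule pd_eqI)
       (intro has_vector_derivative_add has_vector_derivative_mult_right Ck_on_has_pd[OF u2 that] Ck_on_has_pd[OF v2 that])
  have "pd i (pd i (\<lambda>x. a * u x + b * v x)) z = a * pd i (pd i u) z + b * pd i (pd i v) z" if i: "i \<in> Basis" for i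
  proof -
    have "pd i (pd i (\<lambda>x. a * u x + b * v x)) z = pd i (\<lambda>y. a * pd i u y + b * pd i v y) z"
      by (rule pd_cong[OF V pd1[OF i]])
    also have "\<dots> = a * pd i (pd i u) z + b * pd i (pd i v) z"
      by (rule pd_eqI)
         (intro has_vector_derivative_add has_vector_derivative_mult_right
           Ck_on_has_pd[OF Ck_on_pd[OF u2 i] i V(2)] Ck_on_has_pd[OF Ck_on_pd[OF v2 i] i V(2)])
    finally show ?thesis .
  qed
  then show ?thesis by (simp add: laplacian_def sum.distrib sum_distrib_left)
qed

context disc_domain
begin

lemma Gop_regular_local:
  assumes f: "adm B f" "Ck_on k \<Omega> f" and a: "a \<in> \<Omega>"
  obtains V where "open V" "a \<in> V" "Ck_on (Suc k) V (Gop f)" "k \<ge> 1 \<Longrightarrow> laplacian (Gop f) a = - f a"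
proof -
  obtain r where r: "r > 0" "ball a r \<subseteq> \<Omega>" using open_dom a openE by blast
  have [measurable]: "f \<in> borel_measurable borel" using f by (simp add: adm_def)
  \<comment> \<open>The argument of the step equals 1 for |\<zeta> - a| = r / 4 and 0 for |\<zeta> -
    a| = r / 2. Squares of norms keep it smooth at a.\<close>
  define co where "co \<zeta> = smooth_step ((16 / (3 * r\<^sup>2)) * (r\<^sup>2 / 4 - (norm (\<zeta> - a))\<^sup>2))" for \<zeta>
  have coC: "Ck_on j UNIV co" for j
    unfolding co_def
    by (intro Ck_on_compose[OF _ _ Ck_on_smooth_step] Ck_on_cmult Ck_on_diff) auto
  have co1: "co \<zeta> = 1" if "norm (\<zeta> - a) \<le> r / 4" for \<zeta>
  proof -
    have "(norm (\<zeta> - a))\<^sup>2 \<le> (r / 4)\<^sup>2" using that by (intro power_mono) auto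
    then show ?thesis unfolding co_def using r(1)
      by (intro smooth_step_eq_1) (simp add: field_simps power2_eq_square)
  qed
  have co0: "co \<zeta> = 0" if "norm (\<zeta> - a) \<ge> r / 2" for \<zeta>
  proof -
    have "(r / 2)\<^sup>2 \<le> (norm (\<zeta> - a))\<^sup>2" using that r(1) by (intro power_mono) auto
    then show ?thesis unfolding co_def using r(1)
      by (intro smooth_step_eq_0 mult_nonneg_nonpos) (auto simp: field_simps power2_eq_square)
  qed
  have cob: "0 \<le> co \<zeta>" "co \<zeta> \<le> 1" for \<zeta>
    unfolding co_def by (rule smooth_step_nonneg smooth_step_le_1)+
  have [measurable]: "co \<in> borel_measurable borel"
    using Ck_on_continuous[OF coC] by (rule borel_measurable_continuous_onI)
  define \<phi>1 where "\<phi>1 \<zeta> = indicator \<Omega> \<zeta> * ((1 - co \<zeta>) * f \<zeta>)" for \<zeta>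
  define \<phi>2 where "\<phi>2 \<zeta> = co \<zeta> * f \<zeta>" for \<zeta>
  have [measurable]: "\<phi>1 \<in> borel_measurable borel" "\<phi>2 \<in> borel_measurable borel"
    unfolding \<phi>1_def \<phi>2_def by measurable
  have in_dom: "\<zeta> \<in> \<Omega>" if "norm (\<zeta> - a) < r" for \<zeta>
    using r(2) that by (auto simp: subset_iff dist_norm norm_minus_commute)
  have \<phi>2ne: "\<zeta> \<in> \<Omega> \<and> norm (\<zeta> - a) < r / 2" if "\<phi>2 \<zeta> \<noteq> 0" for \<zeta>
    using that co0[of \<zeta>] in_dom[of \<zeta>] r(1) by (force simp: \<phi>2_def not_le[symmetric])
  have \<phi>1ne: "\<zeta> \<in> \<Omega> \<and> norm (\<zeta> - a) > r / 4" if "\<phi>1 \<zeta> \<noteq> 0" for \<zeta>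
    using that co1[of \<zeta>] by (force simp: \<phi>1_def indicator_def not_le[symmetric])
  have fb: "\<zeta> \<in> \<Omega> \<Longrightarrow> \<bar>f \<zeta>\<bar> \<le> B" for \<zeta> using f by (simp add: adm_def)
  have B: "B \<ge> 0" by (rule adm_nonneg[OF f(1)])
  have b2: "\<bar>\<phi>2 \<zeta>\<bar> \<le> B * indicator \<Omega> \<zeta>" for \<zeta>
  proof (cases "\<phi>2 \<zeta> = 0")
    case False
    have "\<bar>co \<zeta>\<bar> * \<bar>f \<zeta>\<bar> \<le> 1 * B"
      using cob[of \<zeta>] fb \<phi>2ne[OF False] by (intro mult_mono) auto
    then show ?thesis using \<phi>2ne[OF False] by (simp add: \<phi>2_def abs_mult)
  qed (use B in simp)
  have b1: "\<bar>\<phi>1 \<zeta>\<bar> \<le> B * indicator \<Omega> \<zeta>" for \<zeta>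
  proof (cases "\<zeta> \<in> \<Omega>")
    case True
    have "\<bar>1 - co \<zeta>\<bar> * \<bar>f \<zeta>\<bar> \<le> 1 * B"
      using cob[of \<zeta>] fb True by (intro mult_mono) auto
    then show ?thesis using True by (simp add: \<phi>1_def abs_mult)
  qed (simp add: \<phi>1_def)
  have intI: "integrable lborel (\<lambda>\<zeta>. B * indicator \<Omega> \<zeta>)"
    using fin_dom by (intro integrable_mult_right integrable_real_indicator) auto
  have int1: "integrable lborel \<phi>1"
    by (rule Bochner_Integration.integrable_bound[OF intI]) (use b1 in \<open>auto intro: order_trans[OF _ abs_ge_self]\<close>)
  have int2: "integrable lborel \<phi>2"
    by (rule Bochner_Integration.integrable_bound[OF intI]) (use b2 in \<open>auto intro: order_trans[OF _ abs_ge_self]\<close>)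
  have adm1: "adm B \<phi>1" unfolding adm_def using b1 by (auto intro: order_trans[OF b1])
  have adm2: "adm B \<phi>2" unfolding adm_def using b2 by (auto intro: order_trans[OF b2])
  define R where "R = norm a + r"
  have R: "R > 0" using r by (simp add: R_def add_nonneg_pos)
  have supp2: "bsupp R \<phi>2"
    unfolding bsupp_def
  proof (intro allI impI)
    fix y :: complex assume y: "R < norm y"
    have "norm (y - a) > r" using y norm_triangle_ineq2[of y a] by (simp add: R_def)
    then show "\<phi>2 y = 0" using co0[of y] r(1) by (simp add: \<phi>2_def)
  qed
  have \<phi>2C: "Ck_on k UNIV \<phi>2"
  proof -
    have "Ck_on k (ball a r) \<phi>2"
      unfolding \<phi>2_def by (intro Ck_on_mult open_ball Ck_on_subset[OF coC] Ck_on_subset[OF f(2) r(2)]) auto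
    moreover have "Ck_on k (- cball a (r / 2)) \<phi>2"
    proof (rule Ck_on_cong[OF _ _ Ck_on_const[of k _ 0]])
      show "0 = \<phi>2 y" if "y \<in> - cball a (r / 2)" for y
        using that co0[of y] by (simp add: \<phi>2_def dist_norm norm_minus_commute)
    qed (simp add: open_Compl)
    ultimately have "Ck_on k (ball a r \<union> - cball a (r / 2)) \<phi>2"
      by (intro Ck_on_Un) (auto simp: open_Compl)
    moreover have "ball a r \<union> - cball a (r / 2) = UNIV" using r(1) by auto
    ultimately show ?thesis by simp
  qed
  \<comment> \<open>The diagonal value is the limit of gr z \<zeta> + ln |z - \<zeta>|, so the
    kernel has the form ln |Q| at \<zeta> = z as well.\<close>
  define h2 where "h2 z \<zeta> = (if \<zeta> = z then ln (norm ((1 - cnj (g z) * g z) / deriv g z)) else gr z \<zeta> + lnk 0 (z - \<zeta>))" for z \<zeta>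
  have [measurable]: "h2 z \<in> borel_measurable borel" for z unfolding h2_def by measurable
  define u1 where "u1 z = (\<integral>\<zeta>. gr z \<zeta> * \<phi>1 \<zeta> \<partial>lborel)" for z
  define u2 where "u2 z = (\<integral>\<zeta>. h2 z \<zeta> * \<phi>2 \<zeta> \<partial>lborel)" for z
  define u3 where "u3 = conv (lnk 0) \<phi>2"
  have split: "Gop f z = (1 / fund_const) * ((1 * u1 z + 1 * u2 z)) + (- 1 / fund_const) * u3 z" for z
  proof -
    have "(\<integral>\<zeta>. gr z \<zeta> * f \<zeta> \<partial>lborel) = (\<integral>\<zeta>. gr z \<zeta> * \<phi>1 \<zeta> + gr z \<zeta> * \<phi>2 \<zeta> \<partial>lborel)"
    proof (intro Bochner_Integration.integral_cong refl)
      fix \<zeta> show "gr z \<zeta> * f \<zeta> = gr z \<zeta> * \<phi>1 \<zeta> + gr z \<zeta> * \<phi>2 \<zeta>"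
        by (cases "\<zeta> \<in> \<Omega>") (auto simp: gr_off \<phi>1_def \<phi>2_def algebra_simps)
    qed
    also have "\<dots> = u1 z + (\<integral>\<zeta>. gr z \<zeta> * \<phi>2 \<zeta> \<partial>lborel)"
      unfolding u1_def by (intro Bochner_Integration.integral_add integrable_gr_mult[OF adm1] integrable_gr_mult[OF adm2])
    also have "(\<integral>\<zeta>. gr z \<zeta> * \<phi>2 \<zeta> \<partial>lborel) = u2 z - u3 z"
    proof -
      have i3: "integrable lborel (\<lambda>\<zeta>. lnk 0 (z - \<zeta>) * \<phi>2 \<zeta>)"
      proof -
        have "\<bar>\<phi>2 \<zeta>\<bar> \<le> B" for \<zeta> using b2[of \<zeta>] B by (cases "\<zeta> \<in> \<Omega>") auto
        then have "integrable lborel (\<lambda>w. lnk 0 w * \<phi>2 (z - w))"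
          by (intro conv_integrable[OF loc_int_lnk supp2 _ _ order_refl]) (use R in \<open>auto simp: add_nonneg_pos\<close>)
        from lborel_integrable_reflect[OF this, of z] show ?thesis by simp
      qed
      have "(\<integral>\<zeta>. gr z \<zeta> * \<phi>2 \<zeta> \<partial>lborel) + u3 z = (\<integral>\<zeta>. gr z \<zeta> * \<phi>2 \<zeta> + lnk 0 (z - \<zeta>) * \<phi>2 \<zeta> \<partial>lborel)"
        unfolding u3_def by (subst conv_reflect) (auto simp: Bochner_Integration.integral_add[OF integrable_gr_mult[OF adm2] i3])
      also have "\<dots> = u2 z"
        unfolding u2_def
      proof (rule integral_cong_AE)
        have "AE \<zeta> in lborel. \<zeta> \<noteq> z" by (rule AE_lborel_singleton)
        then show "AE \<zeta> in lborel. gr z \<zeta> * \<phi>2 \<zeta> + lnk 0 (z - \<zeta>) * \<phi>2 \<zeta> = h2 z \<zeta> * \<phi>2 \<zeta>"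
          by eventually_elim (simp add: h2_def distrib_right)
      qed auto
      finally show ?thesis by simp
    qed
    finally show ?thesis using fund_const_pos by (simp add: Gop_def diff_divide_distrib add_divide_distrib)
  qed
  \<comment> \<open>The density lives beyond distance r / 4 from a, so points z within r / 8 keep
    distance r / 8 from the singularity, where \<open>gr_le_log\<close> gives a uniform
    bound.\<close>
  have q1: "\<exists>Q. Q holomorphic_on ball a (r / 8) \<and>
        (\<forall>z\<in>ball a (r / 8). Q z \<noteq> 0 \<and> gr z \<zeta> = ln (norm (Q z)) \<and> \<bar>gr z \<zeta>\<bar> \<le> ln D - ln (r / 8))"
    if "\<phi>1 \<zeta> \<noteq> 0" for \<zeta>
  proof (intro exI[of _ "\<lambda>z. (1 - cnj (g \<zeta>) * g z) / (g z - g \<zeta>)"] conjI ballI)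
    have \<zeta>: "\<zeta> \<in> \<Omega>" "norm (\<zeta> - a) > r / 4" using \<phi>1ne[OF that] by auto
    have far: "z \<in> \<Omega> \<and> z \<noteq> \<zeta> \<and> norm (z - \<zeta>) \<ge> r / 8" if "z \<in> ball a (r / 8)" for z
    proof -
      have "norm (z - a) < r / 8" using that by (simp add: dist_norm norm_minus_commute)
      moreover have "norm (\<zeta> - a) \<le> norm (z - a) + norm (z - \<zeta>)"
        using norm_triangle_ineq4[of "z - a" "z - \<zeta>"] by simp
      ultimately have "norm (z - \<zeta>) \<ge> r / 8" "norm (z - a) < r" using \<zeta>(2) r(1) by linarith+
      then show ?thesis using in_dom[of z] r(1) by auto
    qed
    show "(\<lambda>z. (1 - cnj (g \<zeta>) * g z) / (g z - g \<zeta>)) holomorphic_on ball a (r / 8)"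
      using far inj_g \<zeta>(1) by (intro holomorphic_intros holomorphic_on_subset[OF g_holo]) auto
    fix z assume z: "z \<in> ball a (r / 8)"
    show "(1 - cnj (g \<zeta>) * g z) / (g z - g \<zeta>) \<noteq> 0"
      using far[OF z] inj_g \<zeta>(1) one_minus_cnj_mult_neq_0[of "g z" "g \<zeta>"] norm_g by auto
    show "gr z \<zeta> = ln (norm ((1 - cnj (g \<zeta>) * g z) / (g z - g \<zeta>)))"
      using far[OF z] \<zeta>(1) by (simp add: gr_def)
    have "gr z \<zeta> \<le> ln D - ln (norm (z - \<zeta>))" using far[OF z] \<zeta>(1) by (intro gr_le_log) auto
    also have "\<dots> \<le> ln D - ln (r / 8)" using far[OF z] r(1) by (simp add: ln_mono)
    finally show "\<bar>gr z \<zeta>\<bar> \<le> ln D - ln (r / 8)" using gr_nonneg[of z \<zeta>] by simp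
  qed
  have q2: "\<exists>Q. Q holomorphic_on ball a (3 * r / 4) \<and>
        (\<forall>z\<in>ball a (3 * r / 4). Q z \<noteq> 0 \<and> h2 z \<zeta> = ln (norm (Q z)) \<and> \<bar>h2 z \<zeta>\<bar> \<le> max (ln D) (ln (4 / r)))"
    if "\<phi>2 \<zeta> \<noteq> 0" for \<zeta>
  proof -
    have \<zeta>: "\<zeta> \<in> \<Omega>" "norm (\<zeta> - a) < r / 2" using \<phi>2ne[OF that] by auto
    \<comment> \<open>Adding ln |z - \<zeta>| multiplies the Moebius quotient by z - \<zeta>. This
      replaces its denominator by the divided difference of g, which is holomorphic across \<zeta>
      and has no zeros because g is injective.\<close>
    define N where "N z = (if z = \<zeta> then deriv g \<zeta> else (g z - g \<zeta>) / (z - \<zeta>))" for z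
    define Q where "Q z = (1 - cnj (g \<zeta>) * g z) / N z" for z
    have Nh: "N holomorphic_on \<Omega>" unfolding N_def by (rule pole_lemma_open[OF g_holo open_dom])
    have "inj_on g \<Omega>" using inj_g by (auto simp: inj_on_def)
    then have N0: "N z \<noteq> 0" if "z \<in> \<Omega>" for z
      using holomorphic_injective_imp_regular[OF g_holo open_dom _ \<zeta>(1)] inj_g[OF that \<zeta>(1)] by (simp add: N_def)
    have Q0: "Q z \<noteq> 0" if "z \<in> \<Omega>" for z
      using N0[OF that] one_minus_cnj_mult_neq_0[OF norm_g[OF that] norm_g[OF \<zeta>(1)]] by (simp add: Q_def)
    have Qh: "Q holomorphic_on \<Omega>"
      unfolding Q_def using N0 by (intro holomorphic_intros g_holo Nh) auto
    have h2Q: "h2 z \<zeta> = ln (norm (Q z))" if "z \<in> \<Omega>" for z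
    proof (cases "z = \<zeta>")
      case False
      have "1 - cnj (g \<zeta>) * g z \<noteq> 0" "g z \<noteq> g \<zeta>"
        using one_minus_cnj_mult_neq_0[OF norm_g[OF that] norm_g[OF \<zeta>(1)]] inj_g[OF that \<zeta>(1)] False by auto
      then show ?thesis
        using False that \<zeta>(1) by (simp add: h2_def Q_def N_def gr_def lnk_0 norm_divide norm_mult ln_div ln_mult)
    qed (simp add: h2_def Q_def N_def)
    have sub: "cball a (3 * r / 4) \<subseteq> \<Omega>" using r by auto
    \<comment> \<open>The sphere of radius 3 r / 4 stays at distance more than r / 4 from \<zeta>,
      so Q is controlled there from both sides. The maximum modulus principle for Q and 1 / Q
      carries the bounds inside, across \<zeta>.\<close>
    have on_sphere: "norm (Q z) \<le> D \<and> norm (1 / Q z) \<le> 4 / r" if "norm (z - a) = 3 * r / 4" for z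
    proof -
      have z: "z \<in> \<Omega>" using that sub by (auto simp: dist_norm norm_minus_commute)
      have "norm (z - a) \<le> norm (z - \<zeta>) + norm (\<zeta> - a)" using norm_triangle_ineq[of "z - \<zeta>" "\<zeta> - a"] by simp
      then have d: "norm (z - \<zeta>) > r / 4" using that \<zeta>(2) by linarith
      then have ne: "z \<noteq> \<zeta>" using r(1) by auto
      have eq: "ln (norm (Q z)) = gr z \<zeta> + ln (norm (z - \<zeta>))"
        using h2Q[OF z] ne by (simp add: h2_def lnk_0)
      have Qp: "norm (Q z) > 0" using Q0[OF z] by simp
      have "ln (norm (Q z)) \<le> ln D" using gr_le_log[OF z \<zeta>(1) ne] eq by simp
      then have "norm (Q z) \<le> D" using Qp D_ge_1 by simp
      moreover have "ln (r / 4) \<le> ln (norm (Q z))"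
        using gr_nonneg[of z \<zeta>] eq d r(1) by (smt (verit) ln_mono divide_pos_pos)
      then have "r / 4 \<le> norm (Q z)" using Qp r(1) by simp
      then have "1 / norm (Q z) \<le> 1 / (r / 4)" using r(1) Qp by (intro divide_left_mono) auto
      ultimately show ?thesis by (simp add: norm_divide)
    qed
    have fr: "frontier (cball a (3 * r / 4)) = sphere a (3 * r / 4)" by simp
    have up: "norm (Q z) \<le> D" if "z \<in> cball a (3 * r / 4)" for z
    proof (rule maximum_modulus_frontier[OF _ _ bounded_cball _ that])
      show "Q holomorphic_on interior (cball a (3 * r / 4))"
        by (rule holomorphic_on_subset[OF Qh order_trans[OF interior_subset sub]])
      show "continuous_on (closure (cball a (3 * r / 4))) Q"
        using sub by (auto intro: holomorphic_on_imp_continuous_on holomorphic_on_subset[OF Qh])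
    qed (use on_sphere in \<open>auto simp: fr dist_norm norm_minus_commute\<close>)
    have invh: "(\<lambda>z. 1 / Q z) holomorphic_on \<Omega>" using Q0 by (intro holomorphic_intros Qh) auto
    have lo: "norm (1 / Q z) \<le> 4 / r" if "z \<in> cball a (3 * r / 4)" for z
    proof (rule maximum_modulus_frontier[OF _ _ bounded_cball _ that, where f="\<lambda>z. 1 / Q z"])
      show "(\<lambda>z. 1 / Q z) holomorphic_on interior (cball a (3 * r / 4))"
        by (rule holomorphic_on_subset[OF invh order_trans[OF interior_subset sub]])
      show "continuous_on (closure (cball a (3 * r / 4))) (\<lambda>z. 1 / Q z)"
        using sub by (auto intro: holomorphic_on_imp_continuous_on holomorphic_on_subset[OF invh])
      show "norm (1 / Q z) \<le> 4 / r" if "z \<in> frontier (cball a (3 * r / 4))" for z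
        using on_sphere[of z] that unfolding fr by (auto simp: dist_norm norm_minus_commute)
    qed
    show ?thesis
    proof (intro exI[of _ Q] conjI ballI)
      show "Q holomorphic_on ball a (3 * r / 4)"
        by (rule holomorphic_on_subset[OF Qh order_trans[OF ball_subset_cball sub]])
      fix z assume "z \<in> ball a (3 * r / 4)"
      then have zc: "z \<in> cball a (3 * r / 4)" and z: "z \<in> \<Omega>" using sub by auto
      show "Q z \<noteq> 0" by (rule Q0[OF z])
      show "h2 z \<zeta> = ln (norm (Q z))" by (rule h2Q[OF z])
      have Qp: "norm (Q z) > 0" using Q0[OF z] by simp
      have "ln (norm (Q z)) \<le> ln D" using ln_mono[OF up[OF zc]] Qp by simp
      moreover have "ln (norm (1 / Q z)) \<le> ln (4 / r)" using ln_mono[OF lo[OF zc]] Qp by simp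
      moreover have "ln (norm (1 / Q z)) = - ln (norm (Q z))" using Qp by (simp add: norm_divide ln_div)
      ultimately show "\<bar>h2 z \<zeta>\<bar> \<le> max (ln D) (ln (4 / r))" unfolding h2Q[OF z] by linarith
    qed
  qed
  \<comment> \<open>The radius r / 32 is the quarter of r / 8 on which
    \<open>log_kernel_harmonic\<close> speaks about \<open>u1\<close>; for \<open>u2\<close> a
    larger ball is available.\<close>
  define V where "V = ball a (r / 32)"
  have V: "open V" "a \<in> V" using r(1) by (auto simp: V_def)
  have s1: "r / 8 > 0" and s2: "3 * r / 4 > 0" using r(1) by auto
  have V1: "V \<subseteq> ball a (r / 8 / 4)" and V2: "V \<subseteq> ball a (3 * r / 4 / 4)"
    unfolding V_def using r(1) by (auto intro!: subset_ball)
  have c1: "Ck_on j V u1" for j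
    unfolding u1_def
    by (rule Ck_on_subset[OF log_kernel_harmonic(1)[OF s1 _ int1 q1] V1]) simp_all
  have l1: "laplacian u1 a = 0"
    unfolding u1_def
    by (rule log_kernel_harmonic(2)[OF s1 _ int1 q1]) (use V V1 in auto)
  have c2: "Ck_on j V u2" for j
    unfolding u2_def
    by (rule Ck_on_subset[OF log_kernel_harmonic(1)[OF s2 _ int2 q2] V2]) simp_all
  have l2: "laplacian u2 a = 0"
    unfolding u2_def
    by (rule log_kernel_harmonic(2)[OF s2 _ int2 q2]) (use V V2 in auto)
  have c3: "Ck_on (Suc k) V u3"
    unfolding u3_def by (rule Ck_on_subset[OF conv_log_Ck[OF supp2 \<phi>2C R]]) simp
  show ?thesis
  proof (rule that[OF V])
    show "Ck_on (Suc k) V (Gop f)"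
      unfolding split[abs_def] by (intro Ck_on_add Ck_on_cmult V c1 c2 c3)
    assume k: "k \<ge> 1"
    have c3': "Ck_on 2 V u3" by (rule Ck_on_le[OF c3]) (use k in simp)
    have "laplacian (Gop f) a = (1 / fund_const) * laplacian (\<lambda>z. 1 * u1 z + 1 * u2 z) a + (- 1 / fund_const) * laplacian u3 a"
      unfolding split[abs_def]
      by (rule laplacian_lincomb[OF V _ c3']) (intro Ck_on_add Ck_on_cmult V c1 c2)
    also have "laplacian (\<lambda>z. 1 * u1 z + 1 * u2 z) a = 0"
      using laplacian_lincomb[OF V c1 c2, of 1 1] l1 l2 by simp
    also have "laplacian u3 a = fund_const * \<phi>2 a"
      unfolding u3_def by (rule laplacian_conv_log[OF supp2 Ck_on_le[OF \<phi>2C] R]) (use k in simp)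
    also have "\<phi>2 a = f a" using co1[of a] r(1) by (simp add: \<phi>2_def)
    finally show "laplacian (Gop f) a = - f a" using fund_const_pos by simp
  qed
qed

text \<open>A gain of one order per application is all that the logarithmic potential was shown to
  give, and it suffices for bootstrapping.\<close>

lemma Gop_Ck:
  assumes "adm B f" "Ck_on k \<Omega> f"
  shows "Ck_on (Suc k) \<Omega> (Gop f)"
  by (rule Ck_on_local) (meson Gop_regular_local[OF assms])

lemma laplacian_Gop:
  assumes "adm B f" "Ck_on k \<Omega> f" "k \<ge> 1" "z \<in> \<Omega>"
  shows "laplacian (Gop f) z = - f z"
  by (rule Gop_regular_local[OF assms(1,2,4)]) (use assms(3) in blast)

end

subsection \<open>Comparison and existence\<close>

lemma Ck_on_real_polynomial_function:
  fixes p :: "'a::euclidean_space \<Rightarrow> real"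
  shows "real_polynomial_function p \<Longrightarrow> Ck_on k UNIV p"
proof (induction p rule: real_polynomial_function.induct)
  case (linear f)
  interpret f: bounded_linear f by fact
  have c: "continuous_on UNIV f" by (intro f.continuous_on continuous_intros)
  have "Ck_on (Suc k) UNIV f"
  proof (rule Ck_on_SucI[OF open_UNIV c])
    show "((\<lambda>t. f (x + t *\<^sub>R i)) has_vector_derivative f i) (at 0)" for i x
      by (rule f.has_vector_derivative) (auto intro!: derivative_eq_intros simp: has_vector_derivative_def)
  qed simp
  then show ?case by (rule Ck_on_SucD)
qed (auto intro: Ck_on_add Ck_on_mult)

text \<open>Truncation makes the exponential globally Lipschitz, as contraction arguments on all
  bounded continuous functions demand. The constant comes from the tangent inequality 1 + x \<le>
  e^x.\<close>

lemma abs_exp_min_diff_le: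
  fixes s t b :: real
  shows "\<bar>exp (min s b) - exp (min t b)\<bar> \<le> exp b * \<bar>s - t\<bar>"
proof -
  have *: "exp y - exp x \<le> exp b * (y - x)" if "x \<le> y" "y \<le> b" for x y :: real
  proof -
    have "1 + (x - y) \<le> exp (x - y)" by (rule exp_ge_add_one_self)
    then have "exp y * (1 + (x - y)) \<le> exp y * exp (x - y)" by (intro mult_left_mono) auto
    then have "exp y - exp x \<le> exp y * (y - x)" by (simp add: algebra_simps flip: exp_add)
    also have "\<dots> \<le> exp b * (y - x)" using that by (intro mult_right_mono) auto
    finally show ?thesis .
  qed
  have le: "exp (min y b) - exp (min x b) \<le> exp b * (y - x)" if "x \<le> y" for x y :: real
  proof -
    have "exp (min y b) - exp (min x b) \<le> exp b * (min y b - min x b)"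
      using that by (intro *) auto
    also have "\<dots> \<le> exp b * (y - x)" using that by (intro mult_left_mono) auto
    finally show ?thesis .
  qed
  show ?thesis
  proof (cases "s \<le> t")
    case True
    then have "exp (min s b) \<le> exp (min t b)" by auto
    then have "\<bar>exp (min s b) - exp (min t b)\<bar> = exp (min t b) - exp (min s b)" "\<bar>s - t\<bar> = t - s"
      using True by linarith+
    then show ?thesis using le[OF True] by simp
  next
    case False
    then have "exp (min t b) \<le> exp (min s b)" by auto
    then have "\<bar>exp (min s b) - exp (min t b)\<bar> = exp (min s b) - exp (min t b)" "\<bar>s - t\<bar> = s - t"
      using False by linarith+
    then show ?thesis using le[of t s] False by simp
  qed
qed

context disc_domain
begin

lemma adm_continuous:
  assumes "continuous_on UNIV f"
  obtains B where "adm B f"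
proof -
  have "compact (f ` closure \<Omega>)"
    using assms bounded_dom by (intro compact_continuous_image) (auto intro: continuous_on_subset simp: compact_closure)
  then obtain B where "\<forall>x\<in>f ` closure \<Omega>. norm x \<le> B"
    using compact_imp_bounded bounded_iff by blast
  then have "adm B f"
    using assms closure_subset by (auto simp: adm_def intro: borel_measurable_continuous_onI)
  then show ?thesis by (rule that)
qed

lemma Gop_one_nonneg: "Gop (\<lambda>_. 1) z \<ge> 0"
  by (rule Gop_nonneg[OF adm_const]) simp

text \<open>A bound without explicit size, from continuity and compactness. It serves the comparison
  argument and the negative branch; the explicit b^2 / 2 is for the positive one.\<close>

lemma Gop_one_bounded: obtains \<kappa> where "\<kappa> > 0" "\<And>z. Gop (\<lambda>_. 1) z \<le> \<kappa>"
proof -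
  have "compact (Gop (\<lambda>_. 1) ` closure \<Omega>)"
    using Gop_continuous[OF adm_const] bounded_dom
    by (intro compact_continuous_image) (auto intro: continuous_on_subset simp: compact_closure)
  then obtain B where B: "\<forall>x\<in>Gop (\<lambda>_. 1) ` closure \<Omega>. norm x \<le> B"
    using compact_imp_bounded bounded_iff by blast
  have "Gop (\<lambda>_. 1) z \<le> max B 1" for z
    using B closure_subset[of \<Omega>] Gop_off[of z] by (cases "z \<in> \<Omega>") (fastforce simp: le_max_iff_disj)+
  then show ?thesis using that[of "max B 1"] by auto
qed

text \<open>For a merely continuous source the potential need not be \<open>C\<^sup>2\<close>. A polynomial approximation of
  the source makes the classical maximum principle applicable.\<close>

lemma Gop_le_0:
  assumes f: "continuous_on UNIV f" and neg: "\<And>z. z \<in> \<Omega> \<Longrightarrow> Gop f z > 0 \<Longrightarrow> f z \<le> 0"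
  shows "Gop f z0 \<le> 0"
proof (rule ccontr)
  assume "\<not> Gop f z0 \<le> 0"
  then have pos: "Gop f z0 > 0" by simp
  obtain \<kappa> where \<kappa>: "\<kappa> > 0" "\<And>z. Gop (\<lambda>_. 1) z \<le> \<kappa>" using Gop_one_bounded by blast
  obtain B where B: "adm B f" using adm_continuous[OF f] by blast
  \<comment> \<open>The final error 2 \<delta> \<kappa> is then half of the positive value to be
    contradicted.\<close>
  define \<delta> where "\<delta> = Gop f z0 / (4 * \<kappa>)"
  have \<delta>: "\<delta> > 0" "2 * \<delta> * \<kappa> < Gop f z0" using pos \<kappa>(1) by (auto simp: \<delta>_def)
  have "compact (closure \<Omega>)" using bounded_dom by (simp add: compact_closure)
  then obtain p where p: "real_polynomial_function p" "\<And>x. x \<in> closure \<Omega> \<Longrightarrow> \<bar>f x - p x\<bar> < \<delta>"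
    using Stone_Weierstrass_real_polynomial_function[OF _ continuous_on_subset[OF f] \<delta>(1)] by blast
  have pC: "Ck_on k UNIV p" for k by (rule Ck_on_real_polynomial_function[OF p(1)])
  obtain B' where B': "adm B' p" using adm_continuous[OF Ck_on_continuous[OF pC]] by blast
  have close: "\<bar>f x - p x\<bar> < \<delta>" if "x \<in> \<Omega>" for x using p(2) that closure_subset by blast
  \<comment> \<open>The shift puts q below f on \<Omega>. So Gop q \<le> Gop f \<le> 0 on the
    frontier of V, while q \<le> f \<le> 0 inside V makes Gop q subharmonic there.\<close>
  define q where "q x = p x - \<delta>" for x
  have qC: "Ck_on k UNIV q" for k unfolding q_def by (intro Ck_on_diff pC) auto
  obtain B'' where B'': "adm B'' q" using adm_continuous[OF Ck_on_continuous[OF qC]] by blast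
  define V where "V = {z. Gop f z > 0}"
  have V: "open V" unfolding V_def
    by (intro open_Collect_less continuous_on_const Gop_continuous[OF B])
  have sub: "V \<subseteq> \<Omega>" unfolding V_def using Gop_off by force
  have qf: "Gop q x \<le> Gop f x" for x
    by (rule Gop_mono[OF B'' B]) (use close in \<open>force simp: q_def\<close>)
  have "Gop q z0 \<le> 0"
  proof (rule weak_max_principle[OF V])
    show "bounded V" using bounded_dom sub by (rule bounded_subset)
    show "continuous_on (closure V) (Gop q)"
      using Gop_continuous[OF B''] by (rule continuous_on_subset) simp
    have "Ck_on (Suc 1) \<Omega> (Gop q)" by (rule Gop_Ck[OF B'' Ck_on_subset[OF qC]]) simp
    then show "Ck_on 2 V (Gop q)" using sub by (auto simp: numeral_2_eq_2 intro: Ck_on_subset simp del: Ck_on.simps)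
    show "z0 \<in> V" using pos by (simp add: V_def)
    show "Gop q x \<le> 0" if "x \<in> frontier V" for x
    proof -
      have "x \<notin> V" using that V by (simp add: frontier_def interior_open)
      then show ?thesis using qf[of x] by (simp add: V_def)
    qed
    fix x assume x: "x \<in> V"
    have "laplacian (Gop q) x = - q x"
      by (rule laplacian_Gop[OF B'' Ck_on_subset[OF qC[of 1]]]) (use x sub in auto)
    moreover have "f x \<le> 0" using neg x sub by (auto simp: V_def)
    moreover have "q x \<le> f x" using close[of x] x sub by (auto simp: q_def)
    ultimately show "laplacian (Gop q) x \<ge> 0" by simp
  qed
  have "Gop f z0 \<le> Gop (\<lambda>x. q x + 2 * \<delta>) z0"
  proof (rule Gop_mono[OF B])
    show "adm (B'' + 2 * \<delta>) (\<lambda>x. q x + 2 * \<delta>)"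
      using B'' \<delta>(1) by (auto simp: adm_def intro!: order_trans[OF abs_triangle_ineq])
  qed (use close in \<open>force simp: q_def\<close>)
  also have "\<dots> = Gop q z0 + 2 * \<delta> * Gop (\<lambda>_. 1) z0"
    using Gop_add[OF B'' adm_const[of "2 * \<delta>"], of z0] Gop_cmult[of "2 * \<delta>" "\<lambda>_. 1" z0] by simp
  also have "\<dots> \<le> 0 + 2 * \<delta> * \<kappa>"
    using \<open>Gop q z0 \<le> 0\<close> \<kappa>(2)[of z0] \<delta>(1) by (intro add_mono mult_left_mono) auto
  finally show False using \<delta>(2) by simp
qed

text \<open>The source f - K falls under \<open>Gop_le_0\<close>: where its potential is positive,
  Gop f exceeds K Gop 1 \<ge> 0, and the hypothesis gives f \<le> K.\<close>

lemma Gop_comparison: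
  assumes f: "continuous_on UNIV f" and K: "K \<ge> 0" "\<And>z. z \<in> \<Omega> \<Longrightarrow> Gop f z > 0 \<Longrightarrow> f z \<le> K"
  shows "Gop f z \<le> K * Gop (\<lambda>_. 1) z"
proof -
  obtain B where B: "adm B f" using adm_continuous[OF f] by blast
  have eq: "Gop (\<lambda>\<zeta>. f \<zeta> - K) x = Gop f x - K * Gop (\<lambda>_. 1) x" for x
    using Gop_diff[OF B adm_const[of K], of x] Gop_cmult[of K "\<lambda>_. 1" x] by simp
  have "Gop (\<lambda>\<zeta>. f \<zeta> - K) z \<le> 0"
  proof (rule Gop_le_0)
    show "continuous_on UNIV (\<lambda>\<zeta>. f \<zeta> - K)" by (intro continuous_intros f)
    fix x assume x: "x \<in> \<Omega>" "Gop (\<lambda>\<zeta>. f \<zeta> - K) x > 0"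
    have "K * Gop (\<lambda>_. 1) x \<ge> 0" using K(1) Gop_one_nonneg by simp
    then have "Gop f x > 0" using x(2) eq[of x] by simp
    then show "f x - K \<le> 0" using K(2)[OF x(1)] by simp
  qed
  then show ?thesis using eq[of z] by simp
qed

text \<open>Half the squared distance to the axis of the strip has Laplacian 1, so its sum with the
  torsion function is harmonic. On the frontier the sum is at most b^2 / 2, and the added term is
  nonnegative inside.\<close>

lemma Gop_one_le_strip:
  assumes n: "norm n = 1" and strip: "\<And>z. z \<in> \<Omega> \<Longrightarrow> \<bar>(z - p) \<bullet> n\<bar> \<le> b"
  shows "Gop (\<lambda>_. 1) z \<le> b\<^sup>2 / 2"
proof (cases "z \<in> \<Omega>")
  case False then show ?thesis by (simp add: Gop_off)
next
  case True
  define s where "s z = (z \<bullet> n - p \<bullet> n) * (z \<bullet> n - p \<bullet> n)" for z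
  have sC: "Ck_on k UNIV s" for k
    unfolding s_def by (intro Ck_on_mult Ck_on_diff Ck_on_inner) auto
  have pd1: "pd i s y = 2 * (i \<bullet> n) * (y \<bullet> n - p \<bullet> n)" for i y
  proof (rule pd_eqI)
    have "((\<lambda>t. s (y + t *\<^sub>R i)) has_field_derivative 2 * (i \<bullet> n) * (y \<bullet> n - p \<bullet> n)) (at 0)"
      unfolding s_def inner_add_left inner_scaleR_left by (auto intro!: derivative_eq_intros)
    then show "((\<lambda>t. s (y + t *\<^sub>R i)) has_vector_derivative 2 * (i \<bullet> n) * (y \<bullet> n - p \<bullet> n)) (at 0)"
      by (simp add: has_real_derivative_iff_has_vector_derivative)
  qed
  have pd2: "pd i (pd i s) y = 2 * (i \<bullet> n)\<^sup>2" for i y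
  proof (rule pd_eqI)
    have "((\<lambda>t. 2 * (i \<bullet> n) * ((y + t *\<^sub>R i) \<bullet> n - p \<bullet> n)) has_field_derivative 2 * (i \<bullet> n)\<^sup>2) (at 0)"
      unfolding inner_add_left inner_scaleR_left by (auto intro!: derivative_eq_intros simp: power2_eq_square)
    then show "((\<lambda>t. pd i s (y + t *\<^sub>R i)) has_vector_derivative 2 * (i \<bullet> n)\<^sup>2) (at 0)"
      by (simp add: pd1 has_real_derivative_iff_has_vector_derivative)
  qed
  have laps: "laplacian s y = 2" for y
  proof -
    have "(Re n)\<^sup>2 + (Im n)\<^sup>2 = 1" using n cmod_power2[of n] by simp
    then show ?thesis by (simp add: laplacian_def pd2 sum_Basis_complex inner_complex_def)
  qed
  have G2: "Ck_on 2 \<Omega> (Gop (\<lambda>_. 1))"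
    using Gop_Ck[OF adm_const Ck_on_const, of 1 1] by (simp add: numeral_2_eq_2 del: Ck_on.simps)
  have "1 * Gop (\<lambda>_. 1) z + (1 / 2) * s z \<le> b\<^sup>2 / 2"
  proof (rule weak_max_principle[OF open_dom bounded_dom _ _ _ _ True])
    show "continuous_on (closure \<Omega>) (\<lambda>x. 1 * Gop (\<lambda>_. 1) x + (1 / 2) * s x)"
      by (intro continuous_intros continuous_on_subset[OF Gop_continuous[OF adm_const]] continuous_on_subset[OF Ck_on_continuous[OF sC]]) auto
    show "Ck_on 2 \<Omega> (\<lambda>x. 1 * Gop (\<lambda>_. 1) x + (1 / 2) * s x)"
      by (intro Ck_on_add Ck_on_cmult open_dom G2 Ck_on_subset[OF sC]) auto
    show "laplacian (\<lambda>x. 1 * Gop (\<lambda>_. 1) x + (1 / 2) * s x) x \<ge> 0" if "x \<in> \<Omega>" for x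
      using laplacian_lincomb[OF open_dom that G2 Ck_on_subset[OF sC], of 1 "1 / 2"] laps
        laplacian_Gop[OF adm_const Ck_on_const, of 1 x 1] that by simp
    fix x assume x: "x \<in> frontier \<Omega>"
    then have "x \<notin> \<Omega>" using open_dom by (simp add: frontier_def interior_open)
    have "closed {z. \<bar>(z - p) \<bullet> n\<bar> \<le> b}" by (intro closed_Collect_le continuous_intros)
    then have "closure \<Omega> \<subseteq> {z. \<bar>(z - p) \<bullet> n\<bar> \<le> b}" by (intro closure_minimal) (use strip in auto)
    then have "\<bar>(x - p) \<bullet> n\<bar> \<le> b" using x by (auto simp: frontier_def)
    then have "\<bar>(x - p) \<bullet> n\<bar>\<^sup>2 \<le> b\<^sup>2" by (intro power_mono) auto
    then have "s x \<le> b\<^sup>2" by (simp add: s_def inner_diff_left power2_eq_square)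
    then show "1 * Gop (\<lambda>_. 1) x + (1 / 2) * s x \<le> b\<^sup>2 / 2" using \<open>x \<notin> \<Omega>\<close> by (simp add: Gop_off)
  qed
  moreover have "s z \<ge> 0" by (simp add: s_def)
  ultimately show ?thesis by simp
qed

lemma Gop_bcontfun:
  assumes "continuous_on UNIV f" shows "Gop f \<in> bcontfun"
proof -
  obtain B where B: "adm B f" using adm_continuous[OF assms] by blast
  obtain \<kappa> where \<kappa>: "\<kappa> > 0" "\<And>z. Gop (\<lambda>_. 1) z \<le> \<kappa>" using Gop_one_bounded by blast
  have "\<bar>Gop f z\<bar> \<le> B * \<kappa>" for z
    using Gop_abs_le[OF B, of z] mult_left_mono[OF \<kappa>(2)[of z] adm_nonneg[OF B]] by linarith
  then show ?thesis
    using Gop_continuous[OF B] unfolding bcontfun_def bounded_iff by auto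
qed

section \<open>The mean field problem in integral form\<close>

definition mass :: "(complex \<Rightarrow> real) \<Rightarrow> real" where
  "mass u = (\<integral>y. indicator \<Omega> y * exp (u y) \<partial>lborel)"

text \<open>Only continuity is demanded; smoothness in \<Omega> and zero boundary values follow from
  the equation. The nonlocal coefficient is hidden in \<mu>, and \<lambda> is read off as
  \<open>\<mu> * mass u\<close>.\<close>

definition integral_sol :: "real \<Rightarrow> (complex \<Rightarrow> real) \<Rightarrow> bool" where
  "integral_sol \<mu> u \<longleftrightarrow> continuous_on UNIV u \<and> (\<forall>z. u z = \<mu> * Gop (\<lambda>\<zeta>. exp (u \<zeta>)) z)"

lemma integrable_dom_mult:
  fixes v :: "complex \<Rightarrow> real"
  assumes "continuous_on UNIV v"
  shows "integrable lborel (\<lambda>y. indicator \<Omega> y * v y)"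
proof -
  obtain B where B: "adm B v" using adm_continuous[OF assms] by blast
  then have [measurable]: "v \<in> borel_measurable borel" by (simp add: adm_def)
  show ?thesis
  proof (rule Bochner_Integration.integrable_bound)
    show "integrable lborel (\<lambda>\<zeta>. B * indicator \<Omega> \<zeta>)"
      using fin_dom by (intro integrable_mult_right integrable_real_indicator) auto
    show "AE y in lborel. norm (indicator \<Omega> y * v y) \<le> norm (B * indicator \<Omega> y :: real)"
      using B by (auto intro!: AE_I2 simp: adm_def indicator_def intro: order_trans[OF _ abs_ge_self])
  qed simp
qed

lemma integral_indicator_dom: "(\<integral>y. indicator \<Omega> y \<partial>lborel) = measure lborel \<Omega>"
  using fin_dom by simp

lemma mass_lower:
  assumes "continuous_on UNIV u" "\<And>z. u z \<ge> a"
  shows "mass u \<ge> exp a * measure lborel \<Omega>"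
proof -
  have "(\<integral>y. indicator \<Omega> y * exp a \<partial>lborel) \<le> mass u"
    unfolding mass_def
    by (intro integral_mono integrable_dom_mult continuous_intros assms(1)) (use assms(2) in \<open>auto simp: indicator_def\<close>)
  then show ?thesis using integral_indicator_dom by (simp add: mult.commute)
qed

lemma mass_lipschitz:
  assumes u: "continuous_on UNIV u" "\<And>z. u z \<le> b" and v: "continuous_on UNIV v" "\<And>z. v z \<le> b"
    and uv: "\<And>z. \<bar>u z - v z\<bar> \<le> d"
  shows "\<bar>mass u - mass v\<bar> \<le> measure lborel \<Omega> * (exp b * d)"
proof -
  have "mass u - mass v = (\<integral>y. indicator \<Omega> y * exp (u y) - indicator \<Omega> y * exp (v y) \<partial>lborel)"
    unfolding mass_def by (intro Bochner_Integration.integral_diff[symmetric] integrable_dom_mult continuous_intros u v)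
  also have "\<bar>\<dots>\<bar> \<le> (\<integral>y. \<bar>indicator \<Omega> y * exp (u y) - indicator \<Omega> y * exp (v y)\<bar> \<partial>lborel)"
    by (rule integral_abs_bound)
  also have "\<dots> \<le> (\<integral>y. indicator \<Omega> y * (exp b * d) \<partial>lborel)"
  proof (rule integral_mono)
    show "integrable lborel (\<lambda>y. \<bar>indicator \<Omega> y * exp (u y) - indicator \<Omega> y * exp (v y)\<bar>)"
      by (intro integrable_abs Bochner_Integration.integrable_diff integrable_dom_mult continuous_intros u v)
    show "integrable lborel (\<lambda>y. indicator \<Omega> y * (exp b * d))"
      by (intro integrable_dom_mult continuous_intros)
    fix y
    have "\<bar>exp (u y) - exp (v y)\<bar> \<le> exp b * \<bar>u y - v y\<bar>"
      using abs_exp_min_diff_le[of "u y" b "v y"] u(2)[of y] v(2)[of y] by (simp add: min_def)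
    also have "\<dots> \<le> exp b * d" using uv by (intro mult_left_mono) auto
    finally show "\<bar>indicator \<Omega> y * exp (u y) - indicator \<Omega> y * exp (v y)\<bar> \<le> indicator \<Omega> y * (exp b * d)"
      by (auto simp: indicator_def)
  qed
  also have "\<dots> = measure lborel \<Omega> * (exp b * d)" using integral_indicator_dom by simp
  finally show ?thesis .
qed

lemma adm_exp_min:
  assumes "continuous_on UNIV u" shows "adm (exp b) (\<lambda>\<zeta>. exp (min (u \<zeta>) b))"
proof -
  have "(\<lambda>\<zeta>. exp (min (u \<zeta>) b)) \<in> borel_measurable borel"
    using assms by (intro borel_measurable_continuous_onI continuous_intros)
  then show ?thesis by (auto simp: adm_def)
qed

lemma Gop_exp_min_lipschitz:
  assumes u: "continuous_on UNIV u" and v: "continuous_on UNIV v"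
    and uv: "\<And>z. \<bar>u z - v z\<bar> \<le> d" and \<kappa>: "\<And>z. Gop (\<lambda>_. 1) z \<le> \<kappa>"
  shows "\<bar>Gop (\<lambda>\<zeta>. exp (min (u \<zeta>) b)) z - Gop (\<lambda>\<zeta>. exp (min (v \<zeta>) b)) z\<bar> \<le> exp b * d * \<kappa>"
proof -
  have d: "d \<ge> 0" using uv[of 0] by linarith
  have "adm (exp b * d) (\<lambda>\<zeta>. exp (min (u \<zeta>) b) - exp (min (v \<zeta>) b))"
    unfolding adm_def
  proof (intro conjI ballI)
    show "(\<lambda>\<zeta>. exp (min (u \<zeta>) b) - exp (min (v \<zeta>) b)) \<in> borel_measurable borel"
      using u v by (intro borel_measurable_continuous_onI continuous_intros)
    fix z
    have "\<bar>exp (min (u z) b) - exp (min (v z) b)\<bar> \<le> exp b * \<bar>u z - v z\<bar>" by (rule abs_exp_min_diff_le)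
    also have "\<dots> \<le> exp b * d" using uv by (intro mult_left_mono) auto
    finally show "\<bar>exp (min (u z) b) - exp (min (v z) b)\<bar> \<le> exp b * d" .
  qed
  from Gop_abs_le[OF this, of z] Gop_diff[OF adm_exp_min[OF u] adm_exp_min[OF v]]
  have "\<bar>Gop (\<lambda>\<zeta>. exp (min (u \<zeta>) b)) z - Gop (\<lambda>\<zeta>. exp (min (v \<zeta>) b)) z\<bar> \<le> exp b * d * Gop (\<lambda>_. 1) z" by simp
  also have "\<dots> \<le> exp b * d * \<kappa>" using \<kappa> d by (intro mult_left_mono) auto
  finally show ?thesis .
qed

text \<open>For positive parameters the truncated problem is a contraction, and its solution stays below
  the truncation level 1.\<close>

lemma positive_branch:
  assumes \<kappa>: "\<kappa> > 0" "\<And>z. Gop (\<lambda>_. 1) z \<le> \<kappa>" and \<mu>max: "0 \<le> \<mu>max" "\<mu>max * exp 1 * \<kappa> < 1"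
    and lam: "0 \<le> lam" "lam \<le> \<mu>max * measure lborel \<Omega>"
  shows "\<exists>\<mu> u. integral_sol \<mu> u \<and> lam = \<mu> * mass u"
proof -
  define T where "T \<mu> u = Bcontfun (\<lambda>z. \<mu> * Gop (\<lambda>\<zeta>. exp (min (apply_bcontfun u \<zeta>) 1)) z)" for \<mu> u
  have Tin: "(\<lambda>z. \<mu> * Gop (\<lambda>\<zeta>. exp (min (apply_bcontfun u \<zeta>) 1)) z) \<in> bcontfun" for \<mu> u
  proof -
    have "Gop (\<lambda>\<zeta>. exp (min (apply_bcontfun u \<zeta>) 1)) \<in> bcontfun"
      by (intro Gop_bcontfun continuous_intros) auto
    then have c: "continuous_on UNIV (Gop (\<lambda>\<zeta>. exp (min (apply_bcontfun u \<zeta>) 1)))"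
      and "bounded (range (Gop (\<lambda>\<zeta>. exp (min (apply_bcontfun u \<zeta>) 1))))"
      by (auto simp: bcontfun_def)
    then obtain B where B: "\<And>z. \<bar>Gop (\<lambda>\<zeta>. exp (min (apply_bcontfun u \<zeta>) 1)) z\<bar> \<le> B"
      unfolding bounded_iff by auto
    have "bounded (range (\<lambda>z. \<mu> * Gop (\<lambda>\<zeta>. exp (min (apply_bcontfun u \<zeta>) 1)) z))"
      unfolding bounded_iff
      by (intro exI[of _ "\<bar>\<mu>\<bar> * B"]) (auto simp: abs_mult intro!: mult_left_mono B)
    then show ?thesis
      unfolding bcontfun_def using c by (auto intro!: continuous_intros)
  qed
  have T: "apply_bcontfun (T \<mu> u) z = \<mu> * Gop (\<lambda>\<zeta>. exp (min (apply_bcontfun u \<zeta>) 1)) z" for \<mu> u z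
    unfolding T_def using Tin by (simp add: Bcontfun_inverse)
  define q where "q = \<mu>max * exp 1 * \<kappa>"
  have q: "0 \<le> q" "q < 1" using \<mu>max \<kappa>(1) by (auto simp: q_def)
  have lip: "dist (T \<mu> u) (T \<mu> v) \<le> q * dist u v" if "0 \<le> \<mu>" "\<mu> \<le> \<mu>max" for \<mu> u v
  proof (rule dist_bound)
    fix z
    have "\<bar>Gop (\<lambda>\<zeta>. exp (min (apply_bcontfun u \<zeta>) 1)) z - Gop (\<lambda>\<zeta>. exp (min (apply_bcontfun v \<zeta>) 1)) z\<bar> \<le> exp 1 * dist u v * \<kappa>"
      by (rule Gop_exp_min_lipschitz) (use dist_bounded[of u _ v] \<kappa>(2) in \<open>auto simp: dist_real_def\<close>)
    then have "\<mu> * \<bar>Gop (\<lambda>\<zeta>. exp (min (apply_bcontfun u \<zeta>) 1)) z - Gop (\<lambda>\<zeta>. exp (min (apply_bcontfun v \<zeta>) 1)) z\<bar> \<le> \<mu>max * (exp 1 * dist u v * \<kappa>)"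
      using that by (intro mult_mono) auto
    then show "dist (T \<mu> u z) (T \<mu> v z) \<le> q * dist u v"
      using that by (simp add: T dist_real_def q_def abs_mult mult_ac flip: right_diff_distrib)
  qed
  have "\<exists>u. T \<mu> u = u" if "0 \<le> \<mu>" "\<mu> \<le> \<mu>max" for \<mu>
    using banach_fix_type[OF q, of "T \<mu>"] lip[OF that] by blast
  then obtain U where U: "\<And>\<mu>. 0 \<le> \<mu> \<Longrightarrow> \<mu> \<le> \<mu>max \<Longrightarrow> T \<mu> (U \<mu>) = U \<mu>" by metis
  have eq: "U \<mu> z = \<mu> * Gop (\<lambda>\<zeta>. exp (min (U \<mu> \<zeta>) 1)) z" if "0 \<le> \<mu>" "\<mu> \<le> \<mu>max" for \<mu> z
    using T[of \<mu> "U \<mu>" z] U[OF that] by simp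
  have cU: "continuous_on UNIV (U \<mu>)" for \<mu> by simp
  have Gb: "0 \<le> Gop (\<lambda>\<zeta>. exp (min (U \<mu> \<zeta>) 1)) z \<and> Gop (\<lambda>\<zeta>. exp (min (U \<mu> \<zeta>) 1)) z \<le> exp 1 * \<kappa>" for \<mu> z
  proof
    show "0 \<le> Gop (\<lambda>\<zeta>. exp (min (U \<mu> \<zeta>) 1)) z" by (rule Gop_nonneg[OF adm_exp_min[OF cU]]) simp
    have "Gop (\<lambda>\<zeta>. exp (min (U \<mu> \<zeta>) 1)) z \<le> exp 1 * Gop (\<lambda>_. 1) z"
      using Gop_abs_le[OF adm_exp_min[OF cU, of 1 \<mu>], of z] by simp
    also have "\<dots> \<le> exp 1 * \<kappa>" using \<kappa>(2) by (intro mult_left_mono) auto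
    finally show "Gop (\<lambda>\<zeta>. exp (min (U \<mu> \<zeta>) 1)) z \<le> exp 1 * \<kappa>" .
  qed
  have Ub: "0 \<le> U \<mu> z" "U \<mu> z \<le> 1" if "0 \<le> \<mu>" "\<mu> \<le> \<mu>max" for \<mu> z
  proof -
    show "0 \<le> U \<mu> z" using eq[OF that, of z] Gb[of \<mu> z] that by simp
    have "\<mu> * Gop (\<lambda>\<zeta>. exp (min (U \<mu> \<zeta>) 1)) z \<le> \<mu>max * (exp 1 * \<kappa>)"
      using Gb[of \<mu> z] that by (intro mult_mono) auto
    then show "U \<mu> z \<le> 1" using eq[OF that, of z] \<mu>max(2) by (simp add: mult.assoc)
  qed
  have sol: "integral_sol \<mu> (U \<mu>)" if "0 \<le> \<mu>" "\<mu> \<le> \<mu>max" for \<mu>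
    unfolding integral_sol_def
  proof (intro conjI allI)
    have "(\<lambda>\<zeta>. exp (min (U \<mu> \<zeta>) 1)) = (\<lambda>\<zeta>. exp (U \<mu> \<zeta>))" using Ub(2)[OF that] by (simp add: min_absorb1)
    then show "U \<mu> z = \<mu> * Gop (\<lambda>\<zeta>. exp (U \<mu> \<zeta>)) z" for z using eq[OF that, of z] by simp
  qed simp
  \<comment> \<open>Changing \<mu> moves T by at most |\<mu> - \<nu>| e \<kappa>; the contraction
    constant q turns this into a bound for the fixed points.\<close>
  have Ulip: "dist (U \<mu>) (U \<nu>) \<le> \<bar>\<mu> - \<nu>\<bar> * (exp 1 * \<kappa>) / (1 - q)"
    if "0 \<le> \<mu>" "\<mu> \<le> \<mu>max" "0 \<le> \<nu>" "\<nu> \<le> \<mu>max" for \<mu> \<nu>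
  proof -
    have "dist (T \<mu> (U \<nu>)) (T \<nu> (U \<nu>)) \<le> \<bar>\<mu> - \<nu>\<bar> * (exp 1 * \<kappa>)"
    proof (rule dist_bound)
      fix z
      have "\<bar>\<mu> - \<nu>\<bar> * \<bar>Gop (\<lambda>\<zeta>. exp (min (U \<nu> \<zeta>) 1)) z\<bar> \<le> \<bar>\<mu> - \<nu>\<bar> * (exp 1 * \<kappa>)"
        using Gb[of \<nu> z] by (intro mult_left_mono) auto
      then show "dist (T \<mu> (U \<nu>) z) (T \<nu> (U \<nu>) z) \<le> \<bar>\<mu> - \<nu>\<bar> * (exp 1 * \<kappa>)"
        by (simp add: T dist_real_def flip: abs_mult left_diff_distrib)
    qed
    moreover have "dist (T \<mu> (U \<mu>)) (T \<mu> (U \<nu>)) \<le> q * dist (U \<mu>) (U \<nu>)" by (rule lip) (use that in auto)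
    moreover have "dist (U \<mu>) (U \<nu>) \<le> dist (T \<mu> (U \<mu>)) (T \<mu> (U \<nu>)) + dist (T \<mu> (U \<nu>)) (T \<nu> (U \<nu>))"
      using dist_triangle[of "U \<mu>" "U \<nu>" "T \<mu> (U \<nu>)"] U[of \<mu>] U[of \<nu>] that by simp
    ultimately have "(1 - q) * dist (U \<mu>) (U \<nu>) \<le> \<bar>\<mu> - \<nu>\<bar> * (exp 1 * \<kappa>)" by (simp add: algebra_simps)
    then show ?thesis using q by (simp add: field_simps)
  qed
  define C where "C = measure lborel \<Omega> * (exp 1 * ((exp 1 * \<kappa>) / (1 - q)))"
  have C: "C \<ge> 0" using \<kappa>(1) q by (simp add: C_def)
  have mlip: "C-lipschitz_on {0..\<mu>max} (\<lambda>\<mu>. mass (U \<mu>))"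
  proof (rule lipschitz_onI[OF _ C])
    fix \<mu> \<nu> assume *: "\<mu> \<in> {0..\<mu>max}" "\<nu> \<in> {0..\<mu>max}"
    have "\<bar>mass (U \<mu>) - mass (U \<nu>)\<bar> \<le> measure lborel \<Omega> * (exp 1 * (\<bar>\<mu> - \<nu>\<bar> * (exp 1 * \<kappa>) / (1 - q)))"
    proof (rule mass_lipschitz[OF cU Ub(2) cU Ub(2)])
      show "\<bar>U \<mu> z - U \<nu> z\<bar> \<le> \<bar>\<mu> - \<nu>\<bar> * (exp 1 * \<kappa>) / (1 - q)" for z
        using dist_bounded[of "U \<mu>" z "U \<nu>"] Ulip[of \<mu> \<nu>] * by (simp add: dist_real_def)
    qed (use * in auto)
    then show "dist (mass (U \<mu>)) (mass (U \<nu>)) \<le> C * dist \<mu> \<nu>"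
      by (simp add: dist_real_def C_def mult_ac)
  qed
  have "continuous_on {0..\<mu>max} (\<lambda>\<mu>. \<mu> * mass (U \<mu>))"
    by (intro continuous_intros lipschitz_on_continuous_on[OF mlip])
  \<comment> \<open>Since u \<ge> 0, the mass is at least the area, which is why the target was
    limited to \<mu>max times the area.\<close>
  moreover have "\<mu>max * mass (U \<mu>max) \<ge> lam"
  proof -
    have "mass (U \<mu>max) \<ge> exp 0 * measure lborel \<Omega>"
      by (rule mass_lower[OF cU]) (use Ub \<mu>max in auto)
    then have "\<mu>max * mass (U \<mu>max) \<ge> \<mu>max * measure lborel \<Omega>" using \<mu>max(1) by (intro mult_left_mono) auto
    then show ?thesis using lam by simp
  qed
  ultimately obtain \<mu> where "0 \<le> \<mu>" "\<mu> \<le> \<mu>max" "\<mu> * mass (U \<mu>) = lam"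
    using IVT'[of "\<lambda>\<mu>. \<mu> * mass (U \<mu>)" 0 lam \<mu>max] lam \<mu>max(1) by auto
  then show ?thesis using sol[of \<mu>] by auto
qed

text \<open>For negative parameters the problem \<open>u + m G(e\<^sup>u) = G h\<close> is solved by continuation in
  \<open>m\<close>: by comparison its solution operator is Lipschitz in \<open>h\<close> uniformly in \<open>m\<close>, so that steps of
  a fixed size are contractions.\<close>

lemma negative_comparison:
  assumes m: "m \<ge> 0" and \<kappa>: "\<And>z. Gop (\<lambda>_. 1) z \<le> \<kappa>"
    and u: "continuous_on UNIV u" and v: "continuous_on UNIV v"
    and w: "continuous_on UNIV w" and k: "continuous_on UNIV k"
    and equ: "\<And>z. u z + m * Gop (\<lambda>\<zeta>. exp (min (u \<zeta>) 0)) z = Gop w z"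
    and eqv: "\<And>z. v z + m * Gop (\<lambda>\<zeta>. exp (min (v \<zeta>) 0)) z = Gop k z"
    and hk: "\<And>z. \<bar>w z - k z\<bar> \<le> d"
  shows "\<bar>u z - v z\<bar> \<le> d * \<kappa>"
proof -
  have d: "d \<ge> 0" using hk[of 0] by linarith
  have one: "u z - v z \<le> d * \<kappa>"
    if u: "continuous_on UNIV u" and v: "continuous_on UNIV v"
    and w: "continuous_on UNIV w" and k: "continuous_on UNIV k"
    and equ: "\<And>z. u z + m * Gop (\<lambda>\<zeta>. exp (min (u \<zeta>) 0)) z = Gop w z"
    and eqv: "\<And>z. v z + m * Gop (\<lambda>\<zeta>. exp (min (v \<zeta>) 0)) z = Gop k z"
    and hk: "\<And>z. \<bar>w z - k z\<bar> \<le> d" for u v w k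
  proof -
    \<comment> \<open>F is the source of u - v. Where u > v the exponential difference is
      nonnegative and only lowers F, so F \<le> d there, whatever the size of m.\<close>
    define F where "F \<zeta> = (w \<zeta> - k \<zeta>) - m * (exp (min (u \<zeta>) 0) - exp (min (v \<zeta>) 0))" for \<zeta>
    have cF: "continuous_on UNIV F" unfolding F_def by (intro continuous_intros u v w k)
    obtain B1 B2 where B: "adm B1 w" "adm B2 k" using adm_continuous w k by metis
    have c1: "continuous_on UNIV (\<lambda>\<zeta>. w \<zeta> - k \<zeta>)" by (intro continuous_intros w k)
    have c2: "continuous_on UNIV (\<lambda>\<zeta>. m * (exp (min (u \<zeta>) 0) - exp (min (v \<zeta>) 0)))" by (intro continuous_intros u v)
    obtain B3 B4 where B': "adm B3 (\<lambda>\<zeta>. w \<zeta> - k \<zeta>)" "adm B4 (\<lambda>\<zeta>. m * (exp (min (u \<zeta>) 0) - exp (min (v \<zeta>) 0)))"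
      using adm_continuous[OF c1] adm_continuous[OF c2] by metis
    have GF: "Gop F x = u x - v x" for x
      unfolding F_def Gop_diff[OF B'] Gop_diff[OF B] Gop_cmult Gop_diff[OF adm_exp_min[OF u] adm_exp_min[OF v]]
      using equ[of x] eqv[of x] by (simp add: algebra_simps)
    have "Gop F z \<le> d * Gop (\<lambda>_. 1) z"
    proof (rule Gop_comparison[OF cF d])
      fix x assume "Gop F x > 0"
      then have "exp (min (v x) 0) \<le> exp (min (u x) 0)" unfolding GF by auto
      then have "m * (exp (min (u x) 0) - exp (min (v x) 0)) \<ge> 0" using m by simp
      then show "F x \<le> d" using hk[of x] unfolding F_def by linarith
    qed
    also have "\<dots> \<le> d * \<kappa>" using \<kappa> d by (intro mult_left_mono) auto
    finally show ?thesis unfolding GF .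
  qed
  show ?thesis
    using one[OF u v w k equ eqv hk] one[OF v u k w eqv equ] hk by (simp add: abs_minus_commute abs_le_iff)
qed

lemma negative_solvable:
  assumes \<kappa>: "\<kappa> > 0" "\<And>z. Gop (\<lambda>_. 1) z \<le> \<kappa>" and m: "m \<ge> 0"
  shows "\<exists>u :: complex \<Rightarrow>\<^sub>C real. \<forall>z. u z + m * Gop (\<lambda>\<zeta>. exp (min (u \<zeta>) 0)) z = Gop (apply_bcontfun w) z"
proof -
  define P where "P m \<longleftrightarrow> (\<forall>w :: complex \<Rightarrow>\<^sub>C real. \<exists>u :: complex \<Rightarrow>\<^sub>C real.
      \<forall>z. u z + m * Gop (\<lambda>\<zeta>. exp (min (u \<zeta>) 0)) z = Gop (apply_bcontfun w) z)" for m
  have P0: "P 0"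
    unfolding P_def
  proof
    fix w :: "complex \<Rightarrow>\<^sub>C real"
    have "Gop (apply_bcontfun w) \<in> bcontfun" by (rule Gop_bcontfun) simp
    then show "\<exists>u :: complex \<Rightarrow>\<^sub>C real. \<forall>z. u z + 0 * Gop (\<lambda>\<zeta>. exp (min (u \<zeta>) 0)) z = Gop (apply_bcontfun w) z"
      by (intro exI[of _ "Bcontfun (Gop (apply_bcontfun w))"]) (simp add: Bcontfun_inverse)
  qed
  have step: "P (m + s)" if Pm: "P m" and m: "m \<ge> 0" and s: "s \<ge> 0" "s * \<kappa> < 1" for m s
    unfolding P_def
  proof
    fix w :: "complex \<Rightarrow>\<^sub>C real"
    obtain N where N: "\<And>w z. apply_bcontfun (N w) z + m * Gop (\<lambda>\<zeta>. exp (min (apply_bcontfun (N w) \<zeta>) 0)) z = Gop (apply_bcontfun w) z"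
      using Pm unfolding P_def by metis
    \<comment> \<open>S moves the extra term with coefficient s into the source. A fixed point of N
      after S therefore solves the problem with parameter m + s.\<close>
    define S where "S u = Bcontfun (\<lambda>\<zeta>. w \<zeta> - s * exp (min (apply_bcontfun u \<zeta>) 0))" for u :: "complex \<Rightarrow>\<^sub>C real"
    have Sin: "(\<lambda>\<zeta>. w \<zeta> - s * exp (min (apply_bcontfun u \<zeta>) 0)) \<in> bcontfun" for u :: "complex \<Rightarrow>\<^sub>C real"
    proof -
      have "bounded (range (\<lambda>\<zeta>. s * exp (min (apply_bcontfun u \<zeta>) 0)))"
        unfolding bounded_iff using s(1) by (intro exI[of _ s]) (auto simp: abs_mult mult_left_le)
      then have "bounded (range (\<lambda>\<zeta>. w \<zeta> - s * exp (min (apply_bcontfun u \<zeta>) 0)))"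
        by (intro bounded_minus_comp) auto
      then show ?thesis unfolding bcontfun_def by (auto intro!: continuous_intros)
    qed
    have S: "apply_bcontfun (S u) z = w z - s * exp (min (apply_bcontfun u z) 0)" for u z
      unfolding S_def using Sin by (simp add: Bcontfun_inverse)
    have "dist (N (S u)) (N (S v)) \<le> (s * \<kappa>) * dist u v" for u v
    proof (rule dist_bound)
      fix z
      have "\<bar>N (S u) z - N (S v) z\<bar> \<le> (s * dist u v) * \<kappa>"
      proof (rule negative_comparison[OF m \<kappa>(2) _ _ _ _ N N])
        fix z
        have "\<bar>exp (min (u z) 0) - exp (min (v z) 0)\<bar> \<le> exp 0 * \<bar>u z - v z\<bar>" by (rule abs_exp_min_diff_le)
        also have "\<dots> \<le> dist u v" using dist_bounded[of u z v] by (simp add: dist_real_def)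
        finally have "s * \<bar>exp (min (u z) 0) - exp (min (v z) 0)\<bar> \<le> s * dist u v" using s(1) by (intro mult_left_mono)
        then show "\<bar>S u z - S v z\<bar> \<le> s * dist u v"
          using s(1) by (simp add: S abs_minus_commute abs_mult flip: right_diff_distrib)
      qed auto
      then show "dist (N (S u) z) (N (S v) z) \<le> (s * \<kappa>) * dist u v" by (simp add: dist_real_def mult_ac)
    qed
    then obtain u where u: "N (S u) = u"
      using banach_fix_type[of "s * \<kappa>" "\<lambda>u. N (S u)"] s \<kappa>(1) by auto
    show "\<exists>u :: complex \<Rightarrow>\<^sub>C real. \<forall>z. u z + (m + s) * Gop (\<lambda>\<zeta>. exp (min (u \<zeta>) 0)) z = Gop (apply_bcontfun w) z"
    proof (intro exI[of _ u] allI)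
      fix z
      obtain B where B: "adm B (apply_bcontfun w)" using adm_continuous[of "apply_bcontfun w"] by auto
      have c: "continuous_on UNIV (\<lambda>\<zeta>. s * exp (min (u \<zeta>) 0))" by (intro continuous_intros) auto
      obtain B' where B': "adm B' (\<lambda>\<zeta>. s * exp (min (u \<zeta>) 0))" using adm_continuous[OF c] by blast
      have "u z + m * Gop (\<lambda>\<zeta>. exp (min (u \<zeta>) 0)) z = Gop (apply_bcontfun (S u)) z"
        using N[of "S u" z] u by simp
      also have "\<dots> = Gop (apply_bcontfun w) z - s * Gop (\<lambda>\<zeta>. exp (min (u \<zeta>) 0)) z"
      proof -
        have "apply_bcontfun (S u) = (\<lambda>\<zeta>. w \<zeta> - s * exp (min (u \<zeta>) 0))" by (rule ext) (rule S)
        then show ?thesis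
          using Gop_diff[OF B B', of z] Gop_cmult[of s "\<lambda>\<zeta>. exp (min (u \<zeta>) 0)" z] by simp
      qed
      finally show "u z + (m + s) * Gop (\<lambda>\<zeta>. exp (min (u \<zeta>) 0)) z = Gop (apply_bcontfun w) z"
        by (simp add: algebra_simps)
    qed
  qed
  define s0 where "s0 = 1 / (2 * \<kappa>)"
  have s0: "s0 > 0" "s0 * \<kappa> < 1" using \<kappa>(1) by (auto simp: s0_def)
  have Pn: "P (real n * s0)" for n
  proof (induction n)
    case (Suc n)
    then have "P (real n * s0 + s0)" using s0 by (intro step) auto
    then show ?case by (simp add: algebra_simps)
  qed (use P0 in simp)
  \<comment> \<open>After n full steps of length s0 the remainder is at most s0, hence again an
    admissible step.\<close>
  define n where "n = nat \<lfloor>m / s0\<rfloor>"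
  have n1: "real n * s0 \<le> m" and n2: "m \<le> real n * s0 + s0"
  proof -
    have "real n = of_int \<lfloor>m / s0\<rfloor>" using m s0 by (simp add: n_def)
    then have "real n \<le> m / s0" "m / s0 \<le> real n + 1" by linarith+
    then show "real n * s0 \<le> m" "m \<le> real n * s0 + s0" using s0(1) by (auto simp: field_simps)
  qed
  have "P (real n * s0 + (m - real n * s0))"
  proof (rule step[OF Pn])
    have "(m - real n * s0) * \<kappa> \<le> s0 * \<kappa>" using n2 \<kappa>(1) by (intro mult_right_mono) auto
    then show "(m - real n * s0) * \<kappa> < 1" using s0(2) by linarith
  qed (use n1 s0 in auto)
  then show ?thesis unfolding P_def by simp
qed

text \<open>By Fubini and symmetry of \<open>gr\<close> the operator moves to the constant 1: the
  integral of Gop f equals that of f Gop 1, and Gop 1 \<le> \<kappa>.\<close>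

lemma integral_Gop_le:
  assumes f: "continuous_on UNIV f" "\<And>\<zeta>. f \<zeta> \<ge> 0" and \<kappa>: "\<And>z. Gop (\<lambda>_. 1) z \<le> \<kappa>"
  shows "(\<integral>z. Gop f z \<partial>lborel) \<le> \<kappa> * (\<integral>\<zeta>. indicator \<Omega> \<zeta> * f \<zeta> \<partial>lborel)"
    and "integrable lborel (Gop f)"
proof -
  obtain B where B: "adm B f" using adm_continuous[OF f(1)] by blast
  have [measurable]: "f \<in> borel_measurable borel" using B by (simp add: adm_def)
  have iG: "integrable lborel (Gop v)" if "adm B v" for v B
  proof -
    have "Gop v y = indicator \<Omega> y * Gop v y" for y by (cases "y \<in> \<Omega>") (auto simp: Gop_off)
    then show ?thesis using integrable_dom_mult[OF Gop_continuous[OF that]] by presburger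
  qed
  show "integrable lborel (Gop f)" by (rule iG[OF B])
  have [measurable]: "(\<lambda>p. gr (fst p) (snd p)) \<in> borel_measurable (borel \<Otimes>\<^sub>M borel)"
    using gr_measurable2 by (simp add: case_prod_beta')
  have meas: "(\<lambda>(z, \<zeta>). gr z \<zeta> * f \<zeta>) \<in> borel_measurable (lborel \<Otimes>\<^sub>M lborel)"
    unfolding case_prod_beta' by measurable
  have int2: "integrable (lborel \<Otimes>\<^sub>M lborel) (\<lambda>(z, \<zeta>). gr z \<zeta> * f \<zeta>)"
  proof (rule lborel_pair.Fubini_integrable[OF meas])
    have "(\<lambda>z. \<integral>\<zeta>. norm (gr z \<zeta> * f \<zeta>) \<partial>lborel) = (\<lambda>z. fund_const * Gop f z)"
      using gr_nonneg f(2) fund_const_pos by (auto simp: Gop_def abs_mult)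
    then show "integrable lborel (\<lambda>x. \<integral>y. norm (case (x, y) of (z, \<zeta>) \<Rightarrow> gr z \<zeta> * f \<zeta>) \<partial>lborel)"
      using iG[OF B] by simp
    show "AE x in lborel. integrable lborel (\<lambda>y. case (x, y) of (z, \<zeta>) \<Rightarrow> gr z \<zeta> * f \<zeta>)"
      using integrable_gr_mult[OF B] by simp
  qed
  have "(\<integral>z. (\<integral>\<zeta>. gr z \<zeta> * f \<zeta> \<partial>lborel) \<partial>lborel) = (\<integral>\<zeta>. (\<integral>z. gr z \<zeta> * f \<zeta> \<partial>lborel) \<partial>lborel)"
    using lborel_pair.Fubini_integral[OF int2] by simp
  also have "\<dots> = (\<integral>\<zeta>. fund_const * (f \<zeta> * Gop (\<lambda>_. 1) \<zeta>) \<partial>lborel)"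
    using fund_const_pos by (intro Bochner_Integration.integral_cong refl) (simp add: Gop_def gr_sym[of _ "_ :: complex"])
  finally have "(\<integral>z. Gop f z \<partial>lborel) = (\<integral>\<zeta>. f \<zeta> * Gop (\<lambda>_. 1) \<zeta> \<partial>lborel)"
    using fund_const_pos by (simp add: Gop_def)
  also have "\<dots> \<le> (\<integral>\<zeta>. \<kappa> * (indicator \<Omega> \<zeta> * f \<zeta>) \<partial>lborel)"
  proof (rule integral_mono)
    have "f \<zeta> * Gop (\<lambda>_. 1) \<zeta> = indicator \<Omega> \<zeta> * (f \<zeta> * Gop (\<lambda>_. 1) \<zeta>)" for \<zeta>
      by (cases "\<zeta> \<in> \<Omega>") (auto simp: Gop_off)
    then show "integrable lborel (\<lambda>\<zeta>. f \<zeta> * Gop (\<lambda>_. 1) \<zeta>)"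
      using integrable_dom_mult[OF continuous_on_mult[OF f(1) Gop_continuous[OF adm_const, of 1]]] by presburger
    show "integrable lborel (\<lambda>\<zeta>. \<kappa> * (indicator \<Omega> \<zeta> * f \<zeta>))"
      by (intro integrable_mult_right integrable_dom_mult f)
    show "f \<zeta> * Gop (\<lambda>_. 1) \<zeta> \<le> \<kappa> * (indicator \<Omega> \<zeta> * f \<zeta>)" for \<zeta>
      using mult_left_mono[OF \<kappa>[of \<zeta>] f(2)[of \<zeta>]] Gop_off[of \<zeta>] by (cases "\<zeta> \<in> \<Omega>") (auto simp: mult.commute)
  qed
  finally show "(\<integral>z. Gop f z \<partial>lborel) \<le> \<kappa> * (\<integral>\<zeta>. indicator \<Omega> \<zeta> * f \<zeta> \<partial>lborel)" by simp
qed

text \<open>Jensen's inequality together with the symmetry of Green's function.\<close>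

lemma negative_mass_bound:
  assumes u: "integral_sol (- m) u" and m: "m \<ge> 0" and \<kappa>: "\<And>z. Gop (\<lambda>_. 1) z \<le> \<kappa>"
  shows "m * mass u \<ge> m * (measure lborel \<Omega> * exp (- \<kappa> * (m * mass u) / measure lborel \<Omega>))"
proof -
  have c: "continuous_on UNIV u" and eq: "\<And>z. u z = - m * Gop (\<lambda>\<zeta>. exp (u \<zeta>)) z"
    using u unfolding integral_sol_def by blast+
  let ?A = "measure lborel \<Omega>"
  have A: "?A > 0" by (rule measure_dom_pos)
  \<comment> \<open>t bounds the mean of u over \<Omega> from below. Jensen's inequality is used in
    tangent form: e^u \<ge> e^t (1 + u - t), integrated over \<Omega>.\<close>
  define t where "t = - \<kappa> * (m * mass u) / ?A"
  have ce: "continuous_on UNIV (\<lambda>\<zeta>. exp (u \<zeta>))" by (intro continuous_intros c)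
  have iu: "(\<integral>y. indicator \<Omega> y * u y \<partial>lborel) \<ge> t * ?A"
  proof -
    have "(\<integral>y. indicator \<Omega> y * u y \<partial>lborel) = (\<integral>y. - m * Gop (\<lambda>\<zeta>. exp (u \<zeta>)) y \<partial>lborel)"
    proof (intro Bochner_Integration.integral_cong refl)
      show "indicator \<Omega> y * u y = - m * Gop (\<lambda>\<zeta>. exp (u \<zeta>)) y" for y
        using eq[of y] by (cases "y \<in> \<Omega>") (simp_all add: Gop_off)
    qed
    also have "\<dots> = - m * (\<integral>y. Gop (\<lambda>\<zeta>. exp (u \<zeta>)) y \<partial>lborel)" by simp
    also have "\<dots> \<ge> - m * (\<kappa> * mass u)"
      using integral_Gop_le(1)[OF ce _ \<kappa>] m unfolding mass_def by (intro mult_left_mono_neg) auto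
    finally show ?thesis using A by (simp add: t_def mult_ac)
  qed
  have "exp t * (?A + (\<integral>y. indicator \<Omega> y * u y \<partial>lborel) - t * ?A) =
      (\<integral>y. exp t * (indicator \<Omega> y * 1 + indicator \<Omega> y * u y - indicator \<Omega> y * t) \<partial>lborel)"
  proof -
    have i: "integrable lborel (\<lambda>y. indicator \<Omega> y * u y)" "integrable lborel (\<lambda>y. indicator \<Omega> y * 1 :: real)"
        "integrable lborel (\<lambda>y. indicator \<Omega> y * t)"
      by (intro integrable_dom_mult c continuous_intros)+
    have "(\<integral>y. indicator \<Omega> y * 1 \<partial>lborel) = ?A" "(\<integral>y. indicator \<Omega> y * t \<partial>lborel) = t * ?A"
      using integral_indicator_dom by (simp_all add: mult.commute)
    then show ?thesis
      unfolding integral_mult_right_zero Bochner_Integration.integral_diff[OF Bochner_Integration.integrable_add[OF i(2,1)] i(3)]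
        Bochner_Integration.integral_add[OF i(2,1)] by simp
  qed
  also have "\<dots> \<le> mass u"
    unfolding mass_def
  proof (rule integral_mono)
    show "integrable lborel (\<lambda>y. exp t * (indicator \<Omega> y * 1 + indicator \<Omega> y * u y - indicator \<Omega> y * t))"
      by (intro integrable_mult_right Bochner_Integration.integrable_add Bochner_Integration.integrable_diff integrable_dom_mult c continuous_intros)
    show "integrable lborel (\<lambda>y. indicator \<Omega> y * exp (u y))" by (rule integrable_dom_mult[OF ce])
    fix y
    have "1 + (u y - t) \<le> exp (u y - t)" by (rule exp_ge_add_one_self)
    then have "exp t * (1 + (u y - t)) \<le> exp t * exp (u y - t)" by (intro mult_left_mono) auto
    also have "\<dots> = exp (u y)" by (simp flip: exp_add)
    finally show "exp t * (indicator \<Omega> y * 1 + indicator \<Omega> y * u y - indicator \<Omega> y * t) \<le> indicator \<Omega> y * exp (u y)"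
      by (cases "y \<in> \<Omega>") (auto simp: algebra_simps)
  qed
  finally have "exp t * (?A + (\<integral>y. indicator \<Omega> y * u y \<partial>lborel) - t * ?A) \<le> mass u" .
  moreover have "exp t * ?A \<le> exp t * (?A + (\<integral>y. indicator \<Omega> y * u y \<partial>lborel) - t * ?A)"
    using iu by (intro mult_left_mono) auto
  ultimately have "exp t * ?A \<le> mass u" by (rule order_trans[rotated])
  then have "?A * exp t \<le> mass u" by (simp add: mult.commute)
  then show ?thesis using m by (simp add: t_def mult_left_mono)
qed

lemma negative_branch:
  assumes lam: "lam \<ge> 0"
  shows "\<exists>\<mu> u. integral_sol \<mu> u \<and> - lam = \<mu> * mass u"
proof -
  obtain \<kappa> where \<kappa>: "\<kappa> > 0" "\<And>z. Gop (\<lambda>_. 1) z \<le> \<kappa>" using Gop_one_bounded by blast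
  have "\<exists>u :: complex \<Rightarrow>\<^sub>C real. \<forall>z. u z + m * Gop (\<lambda>\<zeta>. exp (min (u \<zeta>) 0)) z = 0" if "m \<ge> 0" for m
  proof -
    have "Gop (apply_bcontfun (Bcontfun (\<lambda>_. 0))) z = 0" for z
      by (simp add: Bcontfun_inverse[OF const_bcontfun] Gop_def)
    then show ?thesis using negative_solvable[OF \<kappa> that, of "Bcontfun (\<lambda>_. 0)"] by simp
  qed
  then obtain U :: "real \<Rightarrow> complex \<Rightarrow>\<^sub>C real" where
    U: "\<And>m z. m \<ge> 0 \<Longrightarrow> U m z + m * Gop (\<lambda>\<zeta>. exp (min (U m \<zeta>) 0)) z = 0" by metis
  have cU: "continuous_on UNIV (U m)" for m by simp
  have Ub: "U m z \<le> 0" if "m \<ge> 0" for m z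
  proof -
    have "Gop (\<lambda>\<zeta>. exp (min (U m \<zeta>) 0)) z \<ge> 0" by (rule Gop_nonneg[OF adm_exp_min[OF cU]]) simp
    then have "m * Gop (\<lambda>\<zeta>. exp (min (U m \<zeta>) 0)) z \<ge> 0" using that by simp
    then show ?thesis using U[OF that, of z] by simp
  qed
  have sol: "integral_sol (- m) (U m)" if "m \<ge> 0" for m
    unfolding integral_sol_def
  proof (intro conjI allI)
    have "(\<lambda>\<zeta>. exp (min (U m \<zeta>) 0)) = (\<lambda>\<zeta>. exp (U m \<zeta>))" using Ub[OF that] by (simp add: min_absorb1)
    then show "U m z = - m * Gop (\<lambda>\<zeta>. exp (U m \<zeta>)) z" for z using U[OF that, of z] by simp
  qed simp
  have Ulip: "\<bar>U m z - U n z\<bar> \<le> \<bar>m - n\<bar> * \<kappa>" if m: "m \<ge> 0" and n: "n \<ge> 0" for m n z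
  proof (rule negative_comparison[OF m \<kappa>(2) cU cU])
    show "U m z + m * Gop (\<lambda>\<zeta>. exp (min (U m \<zeta>) 0)) z = Gop (\<lambda>_. 0) z" for z
      using U[OF m] by (simp add: Gop_def)
    \<comment> \<open>U n solves the problem with parameter m once the difference m - n is put into
      the source. That source is at most |m - n|, as the truncated exponential is at most 1.\<close>
    show "U n z + m * Gop (\<lambda>\<zeta>. exp (min (U n \<zeta>) 0)) z = Gop (\<lambda>\<zeta>. (m - n) * exp (min (U n \<zeta>) 0)) z" for z
      using U[OF n, of z] unfolding Gop_cmult by (simp add: algebra_simps)
    show "\<bar>0 - (m - n) * exp (min (U n z) 0)\<bar> \<le> \<bar>m - n\<bar>" for z
      by (simp add: abs_mult mult_left_le)
    show "continuous_on UNIV (\<lambda>\<zeta>. (m - n) * exp (min (U n \<zeta>) 0))" by (intro continuous_intros cU)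
  qed simp
  let ?A = "measure lborel \<Omega>"
  have A: "?A > 0" by (rule measure_dom_pos)
  \<comment> \<open>M solves M |\<Omega>| exp (- \<kappa> lam / |\<Omega>|) = lam. If lam were not
    reached at M, the Jensen bound would give M mass \<ge> lam after all.\<close>
  define M where "M = lam * exp (\<kappa> * lam / ?A) / ?A"
  have M: "M \<ge> 0" using lam A by (simp add: M_def)
  have C: "?A * \<kappa> \<ge> 0" using \<kappa>(1) by simp
  have mlip: "(?A * \<kappa>)-lipschitz_on {0..M} (\<lambda>m. mass (U m))"
  proof (rule lipschitz_onI[OF _ C])
    fix m n assume *: "m \<in> {0..M}" "n \<in> {0..M}"
    have "\<bar>mass (U m) - mass (U n)\<bar> \<le> ?A * (exp 0 * (\<bar>m - n\<bar> * \<kappa>))"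
      by (rule mass_lipschitz[OF cU Ub cU Ub Ulip]) (use * in auto)
    then show "dist (mass (U m)) (mass (U n)) \<le> ?A * \<kappa> * dist m n"
      by (simp add: dist_real_def mult_ac)
  qed
  have "continuous_on {0..M} (\<lambda>m. m * mass (U m))"
    by (intro continuous_intros lipschitz_on_continuous_on[OF mlip])
  moreover have "M * mass (U M) \<ge> lam"
  proof (rule ccontr)
    assume neg: "\<not> M * mass (U M) \<ge> lam"
    have "lam = M * (?A * exp (- \<kappa> * lam / ?A))"
      using A by (simp add: M_def exp_minus)
    also have "\<dots> \<le> M * (?A * exp (- \<kappa> * (M * mass (U M)) / ?A))"
      using neg A M \<kappa>(1) by (intro mult_left_mono) (auto intro!: divide_right_mono)
    also have "\<dots> \<le> M * mass (U M)" by (rule negative_mass_bound[OF sol[OF M] M \<kappa>(2)])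
    finally show False using neg by simp
  qed
  ultimately obtain m where "0 \<le> m" "m \<le> M" "m * mass (U m) = lam"
    using IVT'[of "\<lambda>m. m * mass (U m)" 0 lam M] lam M by auto
  then show ?thesis using sol[of m] by (intro exI[of _ "- m"] exI[of _ "apply_bcontfun (U m)"]) simp
qed

theorem exists_integral_sol:
  assumes n: "norm n = 1" and strip: "\<And>z. z \<in> \<Omega> \<Longrightarrow> \<bar>(z - p) \<bullet> n\<bar> \<le> b" and b: "b > 0"
    and lam: "lam < 2 * measure lborel \<Omega> / (exp 1 * b\<^sup>2)"
  shows "\<exists>\<mu> u. integral_sol \<mu> u \<and> lam = \<mu> * mass u"
proof (cases "lam \<ge> 0")
  case False
  then show ?thesis using negative_branch[of "- lam"] by simp
next
  case True
  have A: "measure lborel \<Omega> > 0" by (rule measure_dom_pos)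
  show ?thesis
  \<comment> \<open>With this \<mu>max the contraction condition \<mu>max e \<kappa> < 1 is exactly
    the assumed bound on lam.\<close>
  proof (rule positive_branch[where \<kappa>="b\<^sup>2 / 2" and \<mu>max="lam / measure lborel \<Omega>"])
    show "Gop (\<lambda>_. 1) z \<le> b\<^sup>2 / 2" for z by (rule Gop_one_le_strip[OF n strip])
    show "lam / measure lborel \<Omega> * exp 1 * (b\<^sup>2 / 2) < 1"
      using lam A b by (simp add: field_simps)
  qed (use True A b in auto)
qed

end

subsection \<open>Energy estimates\<close>

lemma DERIV_nonneg_of_mono:
  fixes f :: "real \<Rightarrow> real"
  assumes "mono f" "(f has_field_derivative l) (at x)"
  shows "l \<ge> 0"
proof (rule ccontr)
  assume "\<not> l \<ge> 0"
  then obtain d where d: "d > 0" "\<And>h. 0 < h \<Longrightarrow> h < d \<Longrightarrow> f (x + h) < f x"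
    using DERIV_neg_dec_right[OF assms(2)] by (metis not_le)
  have "f (x + d / 2) < f x" using d(1) by (intro d(2)) auto
  moreover have "f x \<le> f (x + d / 2)" using d(1) by (intro monoD[OF assms(1)]) simp
  ultimately show False by linarith
qed

text \<open>A smooth function that vanishes on [-1, 1] and is the identity beyond |t| = 2, where
  (t^2 - 1) / 3 reaches 1. Applied to a large multiple of u, it removes a neighbourhood of the zero
  set, in particular of the frontier.\<close>

definition soft_id :: "real \<Rightarrow> real" where
  "soft_id t = t * smooth_step ((t\<^sup>2 - 1) / 3)"

lemma Ck_on_id_real: "Ck_on k UNIV (\<lambda>t::real. t)"
  using Ck_on_inner[of k UNIV "1::real"] by simp

lemma Ck_on_soft_id: "Ck_on k UNIV soft_id"
proof -
  have *: "Ck_on k UNIV (\<lambda>t::real. (1 / 3) * (t * t - 1))"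
    by (intro Ck_on_cmult Ck_on_diff Ck_on_mult Ck_on_id_real Ck_on_const open_UNIV)
  have "Ck_on k UNIV (\<lambda>t. t * smooth_step ((1 / 3) * (t * t - 1)))"
    by (intro Ck_on_mult open_UNIV Ck_on_id_real Ck_on_compose[OF open_UNIV UNIV_I Ck_on_smooth_step *])
  moreover have "(\<lambda>t. t * smooth_step ((1 / 3) * (t * t - 1))) = soft_id"
    by (simp add: soft_id_def fun_eq_iff power2_eq_square)
  ultimately show ?thesis by simp
qed

lemma soft_id_DERIV: "(soft_id has_field_derivative pd 1 soft_id t) (at t)"
  by (rule Ck_on_real_DERIV[OF Ck_on_soft_id[of "Suc 0"]]) simp

lemma soft_id_eq_0: "\<bar>t\<bar> \<le> 1 \<Longrightarrow> soft_id t = 0"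
proof -
  assume "\<bar>t\<bar> \<le> 1"
  then have "t\<^sup>2 \<le> 1" by (simp add: abs_square_le_1)
  then show ?thesis by (simp add: soft_id_def smooth_step_eq_0)
qed

lemma soft_id_eq_id: "\<bar>t\<bar> \<ge> 2 \<Longrightarrow> soft_id t = t"
proof -
  assume "\<bar>t\<bar> \<ge> 2"
  then have "2\<^sup>2 \<le> \<bar>t\<bar>\<^sup>2" by (intro power_mono) auto
  then show ?thesis by (simp add: soft_id_def smooth_step_eq_1)
qed

lemma abs_soft_id_le: "\<bar>soft_id t\<bar> \<le> \<bar>t\<bar>"
proof -
  let ?s = "smooth_step ((t\<^sup>2 - 1) / 3)"
  have "\<bar>t\<bar> * \<bar>?s\<bar> \<le> \<bar>t\<bar> * 1"
    using smooth_step_nonneg[of "(t\<^sup>2 - 1) / 3"] smooth_step_le_1[of "(t\<^sup>2 - 1) / 3"] by (intro mult_left_mono) auto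
  then show ?thesis by (simp add: soft_id_def abs_mult)
qed

lemma abs_soft_id_diff: "\<bar>soft_id t - t\<bar> \<le> 2"
proof (cases "\<bar>t\<bar> \<ge> 2")
  case False
  let ?s = "smooth_step ((t\<^sup>2 - 1) / 3)"
  have "\<bar>t\<bar> * \<bar>?s - 1\<bar> \<le> 2 * 1"
    using smooth_step_nonneg[of "(t\<^sup>2 - 1) / 3"] smooth_step_le_1[of "(t\<^sup>2 - 1) / 3"] False by (intro mult_mono) auto
  moreover have "soft_id t - t = t * (?s - 1)" by (simp add: soft_id_def algebra_simps)
  ultimately show ?thesis by (simp add: abs_mult)
qed (simp add: soft_id_eq_id)

text \<open>The inner derivative 2 t / 3 meets the outer factor t and gives a square. The sign makes
  the energy integrand nonnegative, as Fatou's lemma requires.\<close>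

lemma pd_soft_id_nonneg: "pd 1 soft_id t \<ge> 0"
proof -
  have sD: "(smooth_step has_field_derivative pd 1 smooth_step x) (at x)" for x
    by (rule Ck_on_real_DERIV[OF Ck_on_smooth_step[of "Suc 0"]]) simp
  have "mono smooth_step" using smooth_step_mono by (intro monoI)
  then have s0: "pd 1 smooth_step x \<ge> 0" for x using sD by (rule DERIV_nonneg_of_mono)
  let ?x = "(t\<^sup>2 - 1) / 3"
  have "((\<lambda>t. (t\<^sup>2 - 1) / 3) has_field_derivative 2 * t / 3) (at t)"
    by (auto intro!: derivative_eq_intros)
  from DERIV_chain2[of smooth_step _ "\<lambda>t. (t\<^sup>2 - 1) / 3", OF sD this]
  have "((\<lambda>t. smooth_step ((t\<^sup>2 - 1) / 3)) has_field_derivative pd 1 smooth_step ?x * (2 * t / 3)) (at t)" .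
  from DERIV_mult[OF DERIV_ident this]
  have "(soft_id has_field_derivative (1 * smooth_step ?x + (pd 1 smooth_step ?x * (2 * t / 3)) * t)) (at t)"
    by (simp add: soft_id_def[abs_def])
  then have "pd 1 soft_id t = 1 * smooth_step ?x + (pd 1 smooth_step ?x * (2 * t / 3)) * t"
    using DERIV_unique[OF soft_id_DERIV] by blast
  also have "\<dots> = smooth_step ?x + pd 1 smooth_step ?x * (2 / 3 * t\<^sup>2)" by (simp add: power2_eq_square)
  also have "\<dots> \<ge> 0" using s0 smooth_step_nonneg by (intro add_nonneg_nonneg mult_nonneg_nonneg) auto
  finally show ?thesis .
qed

lemma pd_soft_id_eq_1: "\<bar>t\<bar> > 2 \<Longrightarrow> pd 1 soft_id t = 1"
proof -
  assume t: "\<bar>t\<bar> > 2"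
  have "open {t::real. 2 < \<bar>t\<bar>}" by (intro open_Collect_less continuous_intros)
  then have "((\<lambda>t. t) has_field_derivative pd 1 soft_id t) (at t)"
    by (intro has_field_derivative_transform_within_open[OF soft_id_DERIV, of "{t. 2 < \<bar>t\<bar>}"])
       (use t soft_id_eq_id in auto)
  then show ?thesis using DERIV_unique[OF _ DERIV_ident] by blast
qed

lemma pd_soft_id_bounded: obtains C where "\<And>t. pd 1 soft_id t \<le> C"
proof -
  have "compact (pd 1 soft_id ` {-2..2})"
    using Ck_on_continuous[OF Ck_on_pd[OF Ck_on_soft_id[of "Suc 0"]], of 1]
    by (intro compact_continuous_image) (auto intro: continuous_on_subset)
  then obtain B where B: "\<forall>x\<in>pd 1 soft_id ` {-2..2}. norm x \<le> B"
    using compact_imp_bounded bounded_iff by blast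
  have "pd 1 soft_id t \<le> max B 1" for t
  proof (cases "\<bar>t\<bar> > 2")
    case False
    then have "t \<in> {-2..2}" by auto
    then have "norm (pd 1 soft_id t) \<le> B" using B by blast
    then show ?thesis by simp
  qed (simp add: pd_soft_id_eq_1)
  then show ?thesis using that by blast
qed

lemma integrable_bsupp:
  assumes "continuous_on UNIV \<phi>" "bsupp R \<phi>" "R > 0"
  shows "integrable lborel \<phi>"
proof -
  obtain B where B: "\<And>y. \<bar>\<phi> y\<bar> \<le> B" using bsupp_bounded[OF assms(2,1)] by blast
  have "integrable lborel (\<lambda>w. 1 * \<phi> (0 - w))"
    by (rule conv_integrable[OF loc_int_continuous[OF continuous_on_const] assms(2) B _ order_refl])
       (use assms in \<open>auto intro: borel_measurable_continuous_onI\<close>)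
  from lborel_integrable_reflect[OF this, of 0] show ?thesis by simp
qed

lemma grad_complex: "grad u x = Complex (pd 1 u x) (pd \<i> u x)"
  by (simp add: grad_def sum_Basis_complex complex_eq_iff)

lemma grad_inner: "grad u x \<bullet> grad v x = pd 1 u x * pd 1 v x + pd \<i> u x * pd \<i> v x"
  by (simp add: grad_complex inner_complex_def)

context disc_domain
begin

text \<open>Solutions are defined with the completed measure restricted to \<Omega>, whereas
  potentials are integrated over the plane with \<open>lborel\<close>; this is the bridge.\<close>

lemma lebesgue_on_dom:
  fixes F :: "complex \<Rightarrow> 'b::{banach, second_countable_topology}"
  assumes [measurable]: "(\<lambda>x. indicator \<Omega> x *\<^sub>R F x) \<in> borel_measurable borel"
  shows integrable_lebesgue_on_dom: "integrable (lebesgue_on \<Omega>) F \<longleftrightarrow> integrable lborel (\<lambda>x. indicator \<Omega> x *\<^sub>R F x)"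
    and integral_lebesgue_on_dom: "integral\<^sup>L (lebesgue_on \<Omega>) F = (\<integral>x. indicator \<Omega> x *\<^sub>R F x \<partial>lborel)"
    and measurable_lebesgue_on_dom: "F \<in> borel_measurable (lebesgue_on \<Omega>)"
proof -
  have s: "\<Omega> \<inter> space lebesgue \<in> sets lebesgue" using open_dom by auto
  have m: "(\<lambda>x. indicator \<Omega> x *\<^sub>R F x) \<in> borel_measurable lborel" by measurable
  show "integrable (lebesgue_on \<Omega>) F \<longleftrightarrow> integrable lborel (\<lambda>x. indicator \<Omega> x *\<^sub>R F x)"
    unfolding integrable_restrict_space[OF s] by (rule integrable_completion[OF m])
  show "integral\<^sup>L (lebesgue_on \<Omega>) F = (\<integral>x. indicator \<Omega> x *\<^sub>R F x \<partial>lborel)"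
    unfolding integral_restrict_space[OF s] by (rule integral_completion[OF m])
  show "F \<in> borel_measurable (lebesgue_on \<Omega>)"
    unfolding borel_measurable_restrict_space_iff[OF s] using m by (rule measurable_completion)
qed

lemma lebesgue_on_dom_continuous:
  fixes F :: "complex \<Rightarrow> real"
  assumes "continuous_on UNIV F"
  shows "integrable (lebesgue_on \<Omega>) F"
    and "integral\<^sup>L (lebesgue_on \<Omega>) F = (\<integral>x. indicator \<Omega> x * F x \<partial>lborel)"
    and "F \<in> borel_measurable (lebesgue_on \<Omega>)"
proof -
  have [measurable]: "F \<in> borel_measurable borel" using assms by (rule borel_measurable_continuous_onI)
  have m: "(\<lambda>x. indicator \<Omega> x *\<^sub>R F x) \<in> borel_measurable borel" by measurable
  show "integrable (lebesgue_on \<Omega>) F"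
    unfolding integrable_lebesgue_on_dom[OF m] using integrable_dom_mult[OF assms] by simp
  show "integral\<^sup>L (lebesgue_on \<Omega>) F = (\<integral>x. indicator \<Omega> x * F x \<partial>lborel)"
    unfolding integral_lebesgue_on_dom[OF m] by simp
  show "F \<in> borel_measurable (lebesgue_on \<Omega>)" by (rule measurable_lebesgue_on_dom[OF m])
qed

lemma test_function_bsupp:
  assumes "test_function \<Omega> \<psi>"
  obtains R where "R > 0" "bsupp R \<psi>" "\<And>k. Ck_on k UNIV \<psi>"
proof -
  have "bounded {x. \<psi> x \<noteq> 0}"
    using assms compact_imp_bounded bounded_subset closure_subset unfolding test_function_def by metis
  then obtain R where "R > 0" "\<forall>x\<in>{x. \<psi> x \<noteq> 0}. norm x \<le> R" using bounded_pos by blast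
  then show ?thesis using that[of R] assms by (force simp: bsupp_def test_function_def)
qed

text \<open>Green's formula against a test function: the field \<open>\<psi> \<nabla>u\<close>, extended by zero, has compact
  support.\<close>

lemma green_identity:
  assumes u: "Ck_on 2 \<Omega> u" and \<psi>: "test_function \<Omega> \<psi>"
  shows "(\<integral>x. indicator \<Omega> x * (grad u x \<bullet> grad \<psi> x) \<partial>lborel) = (\<integral>x. indicator \<Omega> x * (- laplacian u x * \<psi> x) \<partial>lborel)"
    and "integrable lborel (\<lambda>x. indicator \<Omega> x * (grad u x \<bullet> grad \<psi> x))"
proof -
  obtain R where R: "R > 0" "bsupp R \<psi>" "\<And>k. Ck_on k UNIV \<psi>" using test_function_bsupp[OF \<psi>] by blast
  define K where "K = closure {x. \<psi> x \<noteq> 0}"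
  have K: "closed K" "K \<subseteq> \<Omega>" "\<And>x. x \<notin> K \<Longrightarrow> \<psi> x = 0"
    using \<psi> closure_subset[of "{x. \<psi> x \<noteq> 0}"] by (auto simp: K_def test_function_def)
  have oK: "open (- K)" using K(1) by (simp add: open_Compl)
  have cover: "\<Omega> \<union> - K = UNIV" using K(2) by auto
  have ext: "Ck_on k UNIV F" if "Ck_on k \<Omega> F" "\<And>x. x \<notin> K \<Longrightarrow> F x = 0" for k and F :: "complex \<Rightarrow> real"
  proof -
    have "Ck_on k (- K) F" by (rule Ck_on_cong[OF oK _ Ck_on_const[of k _ 0]]) (use that(2) in auto)
    then have "Ck_on k (\<Omega> \<union> - K) F" by (intro Ck_on_Un open_dom oK that(1))
    then show ?thesis by (simp only: cover)
  qed
  have u2: "Ck_on (Suc (Suc 0)) \<Omega> u" using u by (simp add: numeral_2_eq_2)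
  have pd\<psi>0: "pd i \<psi> x = 0" if "x \<notin> K" for i x
  proof -
    have "pd i \<psi> x = pd i (\<lambda>_. 0) x" by (rule pd_cong[OF oK]) (use that K(3) in auto)
    also have "\<dots> = 0" by (rule pd_eqI) simp
    finally show ?thesis .
  qed
  have bs: "bsupp R F" if "\<And>x. x \<notin> K \<Longrightarrow> F x = 0" for F
  proof -
    have "K \<subseteq> cball 0 R"
      unfolding K_def using R(2) by (intro closure_minimal) (force simp: bsupp_def)+
    then show ?thesis unfolding bsupp_def using that by force
  qed
  define F where "F i x = (if x \<in> \<Omega> then \<psi> x * pd i u x else 0)" for i x
  have F0: "F i x = 0" if "x \<notin> K" for i x using K(3)[OF that] by (simp add: F_def)
  have FC: "Ck_on (Suc 0) UNIV (F i)" if i: "i \<in> Basis" for i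
  proof (rule ext[OF _ F0])
    have "Ck_on (Suc 0) \<Omega> (\<lambda>x. \<psi> x * pd i u x)"
      by (intro Ck_on_mult open_dom Ck_on_pd[OF u2 i] Ck_on_subset[OF R(3)]) auto
    then show "Ck_on (Suc 0) \<Omega> (F i)" by (rule Ck_on_cong[OF open_dom, rotated]) (simp add: F_def)
  qed
  have pdF: "pd i (F i) x = indicator \<Omega> x * (\<psi> x * pd i (pd i u) x + pd i \<psi> x * pd i u x)" if i: "i \<in> Basis" for i x
  proof (cases "x \<in> \<Omega>")
    case True
    have "pd i (F i) x = pd i (\<lambda>x. \<psi> x * pd i u x) x"
      by (rule pd_cong[OF open_dom True]) (simp add: F_def)
    also have "\<dots> = \<psi> x * pd i (pd i u) x + pd i \<psi> x * pd i u x"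
    proof (rule pd_eqI)
      have "((\<lambda>t. \<psi> (x + t *\<^sub>R i)) has_vector_derivative pd i \<psi> x) (at 0)"
        by (rule Ck_on_has_pd[OF R(3)[of "Suc 0"] i]) simp
      from has_vector_derivative_mult[OF this Ck_on_has_pd[OF Ck_on_pd[OF u2 i] i True]]
      show "((\<lambda>t. \<psi> (x + t *\<^sub>R i) * pd i u (x + t *\<^sub>R i)) has_vector_derivative
          \<psi> x * pd i (pd i u) x + pd i \<psi> x * pd i u x) (at 0)" by simp
    qed
    finally show ?thesis using True by simp
  next
    case False
    then have "x \<notin> K" using K(2) by auto
    have "pd i (F i) x = pd i (\<lambda>_. 0) x" by (rule pd_cong[OF oK]) (use \<open>x \<notin> K\<close> F0 in auto)
    also have "\<dots> = 0" by (rule pd_eqI) simp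
    finally show ?thesis using False by simp
  qed
  have int0: "(\<integral>x. pd i (F i) x \<partial>lborel) = 0" if "i \<in> Basis" for i
    by (rule integral_pd_eq_0[OF bs FC[OF that] R(1) that]) (rule F0)
  have intF: "integrable lborel (pd i (F i))" if i: "i \<in> Basis" for i
    by (rule integrable_bsupp[OF Ck_on_continuous[OF Ck_on_pd[OF FC[OF i] i]] pd_bsupp[OF bs] R(1)]) (rule F0)
  define H where "H x = indicator \<Omega> x * (grad u x \<bullet> grad \<psi> x)" for x
  show iH: "integrable lborel (\<lambda>x. indicator \<Omega> x * (grad u x \<bullet> grad \<psi> x))"
  proof -
    have "Ck_on 0 UNIV H"
    proof (rule ext)
      have "Ck_on 0 \<Omega> (\<lambda>x. pd 1 u x * pd 1 \<psi> x + pd \<i> u x * pd \<i> \<psi> x)"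
        by (intro Ck_on_add Ck_on_mult open_dom Ck_on_pd[OF Ck_on_SucD[OF u2]] Ck_on_pd[OF Ck_on_subset[OF R(3)[of "Suc 0"]]]) auto
      then show "Ck_on 0 \<Omega> H" by (rule Ck_on_cong[OF open_dom, rotated]) (simp add: H_def grad_inner)
      show "H x = 0" if "x \<notin> K" for x using pd\<psi>0[OF that] by (simp add: H_def grad_inner)
    qed
    then have c: "continuous_on UNIV H" by simp
    have "bsupp R H" by (rule bs) (use pd\<psi>0 in \<open>simp add: H_def grad_inner\<close>)
    from integrable_bsupp[OF c this R(1)] show ?thesis by (simp add: H_def[abs_def])
  qed
  have "0 = (\<integral>x. pd 1 (F 1) x + pd \<i> (F \<i>) x \<partial>lborel)"
    using int0[of 1] int0[of \<i>] intF[of 1] intF[of \<i>] by (simp add: Bochner_Integration.integral_add)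
  also have "\<dots> = (\<integral>x. H x - indicator \<Omega> x * (- laplacian u x * \<psi> x) \<partial>lborel)"
    by (intro Bochner_Integration.integral_cong refl)
       (simp add: pdF H_def grad_inner laplacian_def sum_Basis_complex algebra_simps)
  also have "\<dots> = (\<integral>x. H x \<partial>lborel) - (\<integral>x. indicator \<Omega> x * (- laplacian u x * \<psi> x) \<partial>lborel)"
  proof (rule Bochner_Integration.integral_diff)
    show "integrable lborel H" using iH by (simp add: H_def[abs_def])
    have "integrable lborel (\<lambda>x. H x - (pd 1 (F 1) x + pd \<i> (F \<i>) x))"
      using iH intF[of 1] intF[of \<i>] by (intro Bochner_Integration.integrable_diff Bochner_Integration.integrable_add) (auto simp: H_def[abs_def])
    moreover have "H x - (pd 1 (F 1) x + pd \<i> (F \<i>) x) = indicator \<Omega> x * (- laplacian u x * \<psi> x)" for x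
      by (simp add: pdF H_def grad_inner laplacian_def sum_Basis_complex algebra_simps)
    ultimately show "integrable lborel (\<lambda>x. indicator \<Omega> x * (- laplacian u x * \<psi> x))" by simp
  qed
  finally show "(\<integral>x. indicator \<Omega> x * (grad u x \<bullet> grad \<psi> x) \<partial>lborel) = (\<integral>x. indicator \<Omega> x * (- laplacian u x * \<psi> x) \<partial>lborel)"
    by (simp add: H_def)
qed

lemma L2_on_test_function:
  assumes "test_function \<Omega> \<psi>"
  shows "L2_on \<Omega> \<psi>" "L2_on \<Omega> (grad \<psi>)"
proof -
  obtain R where R: "R > 0" "bsupp R \<psi>" "\<And>k. Ck_on k UNIV \<psi>" using test_function_bsupp[OF assms] by blast
  have c: "continuous_on UNIV \<psi>" using R(3) Ck_on_continuous by blast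
  have cp: "continuous_on UNIV (pd i \<psi>)" if "i \<in> Basis" for i
    by (rule Ck_on_continuous[OF Ck_on_pd[OF R(3)[of "Suc 0"] that]])
  have "grad \<psi> = (\<lambda>x. complex_of_real (pd 1 \<psi> x) + \<i> * complex_of_real (pd \<i> \<psi> x))"
    by (auto simp: grad_complex Complex_eq)
  moreover have "continuous_on UNIV (\<lambda>x. complex_of_real (pd 1 \<psi> x) + \<i> * complex_of_real (pd \<i> \<psi> x))"
    by (intro continuous_intros cp) auto
  ultimately have cg: "continuous_on UNIV (grad \<psi>)" by simp
  have L: "L2_on \<Omega> F" if "continuous_on UNIV F" for F :: "complex \<Rightarrow> 'b::euclidean_space"
  proof -
    have [measurable]: "F \<in> borel_measurable borel" using that by (rule borel_measurable_continuous_onI)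
    have "(\<lambda>x. indicator \<Omega> x *\<^sub>R F x) \<in> borel_measurable borel" by measurable
    then show ?thesis
      unfolding L2_on_def
      by (intro conjI measurable_lebesgue_on_dom lebesgue_on_dom_continuous(1) continuous_intros that)
  qed
  show "L2_on \<Omega> \<psi>" "L2_on \<Omega> (grad \<psi>)" by (intro L c cg)+
qed

end

section \<open>Square-integrable fields\<close>

lemma L2_on_inner_integrable:
  fixes a b :: "complex \<Rightarrow> 'b::euclidean_space"
  assumes "L2_on \<Omega> a" "L2_on \<Omega> b"
  shows "integrable (lebesgue_on \<Omega>) (\<lambda>x. a x \<bullet> b x)"
proof (rule Bochner_Integration.integrable_bound)
  have [measurable]: "a \<in> borel_measurable (lebesgue_on \<Omega>)" "b \<in> borel_measurable (lebesgue_on \<Omega>)"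
    using assms by (auto simp: L2_on_def)
  show "(\<lambda>x. a x \<bullet> b x) \<in> borel_measurable (lebesgue_on \<Omega>)" by measurable
  show "integrable (lebesgue_on \<Omega>) (\<lambda>x. (norm (a x))\<^sup>2 + (norm (b x))\<^sup>2)"
    using assms by (auto simp: L2_on_def)
  have "\<bar>a x \<bullet> b x\<bar> \<le> (norm (a x))\<^sup>2 + (norm (b x))\<^sup>2" for x
  proof -
    have "\<bar>a x \<bullet> b x\<bar> \<le> norm (a x) * norm (b x)" by (rule Cauchy_Schwarz_ineq2)
    moreover have "2 * norm (a x) * norm (b x) \<le> (norm (a x))\<^sup>2 + (norm (b x))\<^sup>2" by (rule sum_squares_bound)
    moreover have "norm (a x) * norm (b x) \<ge> 0" by simp
    ultimately show ?thesis by linarith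
  qed
  then show "AE x in lebesgue_on \<Omega>. norm (a x \<bullet> b x) \<le> norm ((norm (a x))\<^sup>2 + (norm (b x))\<^sup>2)"
    by (intro AE_I2) simp
qed

lemma L2_on_diff:
  fixes a b :: "complex \<Rightarrow> 'b::euclidean_space"
  assumes "L2_on \<Omega> a" "L2_on \<Omega> b"
  shows "L2_on \<Omega> (\<lambda>x. a x - b x)"
  unfolding L2_on_def
proof
  have [measurable]: "a \<in> borel_measurable (lebesgue_on \<Omega>)" "b \<in> borel_measurable (lebesgue_on \<Omega>)"
    using assms by (auto simp: L2_on_def)
  show "(\<lambda>x. a x - b x) \<in> borel_measurable (lebesgue_on \<Omega>)" by measurable
  have "(norm (a x - b x))\<^sup>2 = (norm (a x))\<^sup>2 + (norm (b x))\<^sup>2 - 2 * (a x \<bullet> b x)" for x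
    by (simp add: power2_norm_eq_inner inner_diff_left inner_diff_right inner_commute)
  then show "integrable (lebesgue_on \<Omega>) (\<lambda>x. (norm (a x - b x))\<^sup>2)"
    using assms L2_on_inner_integrable[OF assms] by (auto simp: L2_on_def)
qed

text \<open>The weighted inequality s t \<le> \<delta> s^2 / 2 + t^2 / (2 \<delta>), integrated,
  takes the place of Cauchy-Schwarz for integrals. With \<delta> = e / (A + 1) both halves
  contribute at most e / 2, the first strictly less; the 1 guards against A = 0.\<close>

lemma L2_inner_tendsto:
  fixes a b :: "complex \<Rightarrow> 'b::euclidean_space"
  assumes a: "L2_on \<Omega> a" and b: "L2_on \<Omega> b" and bn: "\<And>n. L2_on \<Omega> (bn n)"
    and lim: "(\<lambda>n::nat. LINT x|lebesgue_on \<Omega>. (norm (bn n x - b x))\<^sup>2) \<longlonglongrightarrow> 0"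
  shows "(\<lambda>n. LINT x|lebesgue_on \<Omega>. a x \<bullet> bn n x) \<longlonglongrightarrow> (LINT x|lebesgue_on \<Omega>. a x \<bullet> b x)"
proof (rule LIMSEQ_I)
  fix e :: real assume e: "e > 0"
  let ?A = "LINT x|lebesgue_on \<Omega>. (norm (a x))\<^sup>2"
  define \<delta> where "\<delta> = e / (?A + 1)"
  have A: "?A \<ge> 0" by simp
  have \<delta>: "\<delta> > 0" "\<delta> * ?A < e" 
  proof -
    have p: "?A + 1 > 0" using A by linarith
    then show "\<delta> > 0" unfolding \<delta>_def using e by (rule divide_pos_pos[rotated])
    have "e * ?A < e * (?A + 1)" using e by (intro mult_strict_left_mono) auto
    then have "e * ?A / (?A + 1) < e" using p by (simp only: pos_divide_less_eq)
    then show "\<delta> * ?A < e" by (simp only: \<delta>_def times_divide_eq_left)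
  qed
  have "\<forall>\<^sub>F n in sequentially. (LINT x|lebesgue_on \<Omega>. (norm (bn n x - b x))\<^sup>2) < \<delta> * e"
    using lim \<delta> e by (intro order_tendstoD) auto
  moreover have "norm ((LINT x|lebesgue_on \<Omega>. a x \<bullet> bn n x) - (LINT x|lebesgue_on \<Omega>. a x \<bullet> b x)) < e"
    if small: "(LINT x|lebesgue_on \<Omega>. (norm (bn n x - b x))\<^sup>2) < \<delta> * e" for n
  proof -
    note d = L2_on_diff[OF bn[of n] b]
    have "(LINT x|lebesgue_on \<Omega>. a x \<bullet> bn n x) - (LINT x|lebesgue_on \<Omega>. a x \<bullet> b x) =
        (LINT x|lebesgue_on \<Omega>. a x \<bullet> (bn n x - b x))"
      unfolding inner_diff_right
      by (intro Bochner_Integration.integral_diff[symmetric] L2_on_inner_integrable a b bn)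
    also have "norm \<dots> \<le> (LINT x|lebesgue_on \<Omega>. norm (a x \<bullet> (bn n x - b x)))"
      by (rule integral_norm_bound)
    also have "\<dots> \<le> (LINT x|lebesgue_on \<Omega>. \<delta> / 2 * (norm (a x))\<^sup>2 + 1 / (2 * \<delta>) * (norm (bn n x - b x))\<^sup>2)"
    proof (rule integral_mono)
      show "integrable (lebesgue_on \<Omega>) (\<lambda>x. norm (a x \<bullet> (bn n x - b x)))"
        by (intro integrable_norm L2_on_inner_integrable a d)
      show "integrable (lebesgue_on \<Omega>) (\<lambda>x. \<delta> / 2 * (norm (a x))\<^sup>2 + 1 / (2 * \<delta>) * (norm (bn n x - b x))\<^sup>2)"
        using a d by (auto simp: L2_on_def)
      fix x
      have amgm: "s * t \<le> \<delta> / 2 * s\<^sup>2 + 1 / (2 * \<delta>) * t\<^sup>2" for s t :: real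
      proof -
        have "0 \<le> (\<delta> * s - t)\<^sup>2 / (2 * \<delta>)" using \<delta>(1) by simp
        also have "\<dots> = \<delta> / 2 * s\<^sup>2 + 1 / (2 * \<delta>) * t\<^sup>2 - s * t"
          using \<delta>(1) by (simp add: field_simps power2_eq_square)
        finally show ?thesis by simp
      qed
      have "\<bar>a x \<bullet> (bn n x - b x)\<bar> \<le> norm (a x) * norm (bn n x - b x)" by (rule Cauchy_Schwarz_ineq2)
      also have "\<dots> \<le> \<delta> / 2 * (norm (a x))\<^sup>2 + 1 / (2 * \<delta>) * (norm (bn n x - b x))\<^sup>2" by (rule amgm)
      finally show "norm (a x \<bullet> (bn n x - b x)) \<le> \<delta> / 2 * (norm (a x))\<^sup>2 + 1 / (2 * \<delta>) * (norm (bn n x - b x))\<^sup>2" by simp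
    qed
    also have "\<dots> = \<delta> / 2 * ?A + 1 / (2 * \<delta>) * (LINT x|lebesgue_on \<Omega>. (norm (bn n x - b x))\<^sup>2)"
      using a d by (subst Bochner_Integration.integral_add) (auto simp: L2_on_def)
    also have "\<dots> < e / 2 + e / 2"
    proof (rule add_less_le_mono)
      show "\<delta> / 2 * ?A < e / 2" using \<delta>(2) by simp
      have "1 / (2 * \<delta>) * (LINT x|lebesgue_on \<Omega>. (norm (bn n x - b x))\<^sup>2) \<le> 1 / (2 * \<delta>) * (\<delta> * e)"
        using small \<delta>(1) by (intro mult_left_mono) auto
      then show "1 / (2 * \<delta>) * (LINT x|lebesgue_on \<Omega>. (norm (bn n x - b x))\<^sup>2) \<le> e / 2" using \<delta>(1) by simp
    qed
    finally show ?thesis by simp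
  qed
  ultimately show "\<exists>N. \<forall>n\<ge>N. norm ((LINT x|lebesgue_on \<Omega>. a x \<bullet> bn n x) - (LINT x|lebesgue_on \<Omega>. a x \<bullet> b x)) < e"
    unfolding eventually_sequentially by blast
qed

context disc_domain
begin

text \<open>Bootstrapping: if u is C^k then so is e^u, and the Green operator adds one
  order.\<close>

lemma integral_sol_Ck:
  assumes "integral_sol \<mu> u"
  shows "Ck_on k \<Omega> u"
proof -
  have c: "continuous_on UNIV u" and eq: "u = (\<lambda>z. \<mu> * Gop (\<lambda>\<zeta>. exp (u \<zeta>)) z)"
    using assms unfolding integral_sol_def by blast+
  have ce: "continuous_on UNIV (\<lambda>\<zeta>. exp (u \<zeta>))" by (intro continuous_intros c)
  obtain B where B: "adm B (\<lambda>\<zeta>. exp (u \<zeta>))" using adm_continuous[OF ce] by blast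
  show ?thesis
  proof (induction k)
    case 0
    show ?case using c by (auto intro: continuous_on_subset)
  next
    case (Suc k)
    have "Ck_on k \<Omega> (\<lambda>\<zeta>. exp (u \<zeta>))" by (rule Ck_on_compose[OF open_dom UNIV_I Ck_on_exp Suc])
    then have "Ck_on (Suc k) \<Omega> (\<lambda>z. \<mu> * Gop (\<lambda>\<zeta>. exp (u \<zeta>)) z)"
      by (intro Ck_on_cmult open_dom Gop_Ck[OF B])
    then show ?case by (subst eq)
  qed
qed

lemma integral_sol_laplacian:
  assumes "integral_sol \<mu> u" "x \<in> \<Omega>"
  shows "laplacian u x = - \<mu> * exp (u x)"
proof -
  have c: "continuous_on UNIV u" and eq: "u = (\<lambda>z. \<mu> * Gop (\<lambda>\<zeta>. exp (u \<zeta>)) z)"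
    using assms unfolding integral_sol_def by blast+
  have ce: "continuous_on UNIV (\<lambda>\<zeta>. exp (u \<zeta>))" by (intro continuous_intros c)
  obtain B where B: "adm B (\<lambda>\<zeta>. exp (u \<zeta>))" using adm_continuous[OF ce] by blast
  have E: "Ck_on 1 \<Omega> (\<lambda>\<zeta>. exp (u \<zeta>))"
    by (rule Ck_on_compose[OF open_dom UNIV_I Ck_on_exp integral_sol_Ck[OF assms(1)]])
  have G: "Ck_on 2 \<Omega> (Gop (\<lambda>\<zeta>. exp (u \<zeta>)))"
    using Gop_Ck[OF B E] by (simp add: numeral_2_eq_2 del: Ck_on.simps)
  have "laplacian u x = laplacian (\<lambda>z. \<mu> * Gop (\<lambda>\<zeta>. exp (u \<zeta>)) z + 0 * Gop (\<lambda>\<zeta>. exp (u \<zeta>)) z) x"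
    by (subst eq) simp
  also have "\<dots> = \<mu> * laplacian (Gop (\<lambda>\<zeta>. exp (u \<zeta>))) x"
    unfolding laplacian_lincomb[OF open_dom assms(2) G G] by simp
  also have "\<dots> = - \<mu> * exp (u x)" using laplacian_Gop[OF B E _ assms(2)] by simp
  finally show ?thesis .
qed

lemma integral_sol_off: "integral_sol \<mu> u \<Longrightarrow> x \<notin> \<Omega> \<Longrightarrow> u x = 0"
  using Gop_off[of x] unfolding integral_sol_def by (metis mult_zero_right)

text \<open>The potential of the positive source e^u is strictly positive inside. The truncations
  below say nothing at interior zeros of u, which by this lemma occur in the trivial case
  only.\<close>

lemma integral_sol_zero:
  assumes "integral_sol \<mu> u" "x \<in> \<Omega>" "u x = 0"
  shows "\<mu> = 0"
proof (rule ccontr)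
  assume "\<mu> \<noteq> 0"
  have c: "continuous_on UNIV u" and eq: "u x = \<mu> * Gop (\<lambda>\<zeta>. exp (u \<zeta>)) x"
    using assms unfolding integral_sol_def by blast+
  have ce: "continuous_on UNIV (\<lambda>\<zeta>. exp (u \<zeta>))" by (intro continuous_intros c)
  obtain B where B: "adm B (\<lambda>\<zeta>. exp (u \<zeta>))" using adm_continuous[OF ce] by blast
  have "Gop (\<lambda>\<zeta>. exp (u \<zeta>)) x > 0" by (rule Gop_pos[OF B _ assms(2)]) simp
  then show False using eq assms(3) \<open>\<mu> \<noteq> 0\<close> by simp
qed

lemma mass_eq:
  assumes "continuous_on UNIV u"
  shows "(LINT y|lebesgue_on \<Omega>. exp (u y)) = mass u"
  unfolding mass_def by (intro lebesgue_on_dom_continuous(2) continuous_intros assms)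

lemma mass_pos:
  assumes "continuous_on UNIV u" shows "mass u > 0"
proof -
  have c: "continuous_on UNIV (\<lambda>y. - u y)" by (intro continuous_intros assms)
  obtain B where B: "adm B (\<lambda>y. - u y)" using adm_continuous[OF c] by blast
  have "(\<integral>y. indicator \<Omega> y * exp (- B) \<partial>lborel) \<le> mass u"
    unfolding mass_def
  proof (intro integral_mono integrable_dom_mult continuous_intros assms)
    fix y
    show "indicator \<Omega> y * exp (- B) \<le> indicator \<Omega> y * exp (u y)"
      using B by (cases "y \<in> \<Omega>") (auto simp: adm_def abs_le_iff)
  qed
  then have "measure lborel \<Omega> * exp (- B) \<le> mass u" using integral_indicator_dom by simp
  then show ?thesis using measure_dom_pos by (meson exp_gt_zero less_le_trans mult_pos_pos)
qed

lemma classical_solution_of_integral_sol: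
  assumes "integral_sol \<mu> u"
  shows "classical_solution \<Omega> (\<mu> * mass u) u"
  unfolding classical_solution_def
proof (intro conjI ballI)
  have c: "continuous_on UNIV u" using assms unfolding integral_sol_def by blast
  show "Ck_on 2 \<Omega> u" by (rule integral_sol_Ck[OF assms])
  show "continuous_on (closure \<Omega>) u" using c by (rule continuous_on_subset) simp
  show "- laplacian u x = \<mu> * mass u * (exp (u x) / (LINT y|lebesgue_on \<Omega>. exp (u y)))" if "x \<in> \<Omega>" for x
    using mass_pos[OF c] integral_sol_laplacian[OF assms that] by (simp add: mass_eq[OF c])
  show "u x = 0" if "x \<in> frontier \<Omega>" for x
    using that open_dom by (intro integral_sol_off[OF assms]) (simp add: frontier_def interior_open)
qed

text \<open>The functions \<open>soft_id (N u) / N\<close> are test functions converging to \<open>u\<close> in \<open>H\<^sup>1\<close>. Testing the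
  equation with them bounds the energy of \<open>u\<close>.\<close>

lemma integral_sol_H10:
  assumes sol: "integral_sol \<mu> u"
  shows "H10_with_grad \<Omega> u (\<lambda>x. indicator \<Omega> x *\<^sub>R grad u x)"
proof -
  have c: "continuous_on UNIV u" using sol unfolding integral_sol_def by blast
  have uC: "Ck_on k \<Omega> u" for k by (rule integral_sol_Ck[OF sol])
  define N where "N n = real (Suc n)" for n
  have N: "N n > 0" for n by (simp add: N_def)
  define \<phi> where "\<phi> n x = (1 / N n) * soft_id (N n * u x)" for n x
  have \<phi>0: "\<phi> n x = 0" if "\<bar>u x\<bar> \<le> 1 / N n" for n x
    using that N[of n] by (simp add: \<phi>_def soft_id_eq_0 abs_mult field_simps)
  have test: "test_function \<Omega> (\<phi> n)" for n
    unfolding test_function_def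
  proof (intro conjI allI)
    \<comment> \<open>W is open, contains the complement of \<Omega>, and the truncation vanishes on
      it, so smoothness on \<Omega> and on W glues.\<close>
    define W where "W = {x. \<bar>u x\<bar> < 1 / N n}"
    have W: "open W" unfolding W_def by (intro open_Collect_less continuous_intros c)
    have cover: "\<Omega> \<union> W = UNIV" using integral_sol_off[OF sol] N[of n] by (auto simp: W_def)
    show "Ck_on k UNIV (\<phi> n)" for k
    proof -
      have "Ck_on k \<Omega> (\<phi> n)"
        unfolding \<phi>_def
        by (intro Ck_on_cmult open_dom Ck_on_compose[OF open_dom UNIV_I Ck_on_soft_id] uC)
      moreover have "Ck_on k W (\<phi> n)"
        by (rule Ck_on_cong[OF W _ Ck_on_const[of k _ 0]]) (use \<phi>0[of _ n] in \<open>force simp: W_def\<close>)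
      ultimately have "Ck_on k (\<Omega> \<union> W) (\<phi> n)" by (intro Ck_on_Un open_dom W)
      then show ?thesis by (simp only: cover)
    qed
    have "{x. \<phi> n x \<noteq> 0} \<subseteq> {x. 1 / N n \<le> \<bar>u x\<bar>}" using \<phi>0[of _ n] by force
    moreover have "closed {x. 1 / N n \<le> \<bar>u x\<bar>}" by (intro closed_Collect_le continuous_intros c)
    ultimately have "closure {x. \<phi> n x \<noteq> 0} \<subseteq> {x. 1 / N n \<le> \<bar>u x\<bar>}" by (rule closure_minimal)
    moreover have "{x. 1 / N n \<le> \<bar>u x\<bar>} \<subseteq> \<Omega>"
    proof
      fix x assume "x \<in> {x. 1 / N n \<le> \<bar>u x\<bar>}"
      then have "1 / N n \<le> \<bar>u x\<bar>" by simp
      moreover have "1 / N n > 0" using N[of n] by simp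
      ultimately have "u x \<noteq> 0" by linarith
      then show "x \<in> \<Omega>" using integral_sol_off[OF sol] by blast
    qed
    ultimately show sub: "closure {x. \<phi> n x \<noteq> 0} \<subseteq> \<Omega>" by (rule order_trans)
    show "compact (closure {x. \<phi> n x \<noteq> 0})"
      using bounded_subset[OF bounded_dom sub] by (simp add: compact_eq_bounded_closed)
  qed
  obtain C where C: "\<And>t. pd 1 soft_id t \<le> C" using pd_soft_id_bounded by blast
  have C0: "C \<ge> 0" using C[of 0] pd_soft_id_nonneg[of 0] by linarith
  define d where "d n x = pd 1 soft_id (N n * u x)" for n x
  have d: "0 \<le> d n x" "d n x \<le> C" for n x using C pd_soft_id_nonneg by (auto simp: d_def)
  have grad\<phi>: "grad (\<phi> n) x = d n x *\<^sub>R grad u x" if x: "x \<in> \<Omega>" for n x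
  proof -
    have "pd i (\<phi> n) x = d n x * pd i u x" if i: "i \<in> Basis" for i
    proof (rule pd_eqI)
      have u': "((\<lambda>t. u (x + t *\<^sub>R i)) has_vector_derivative pd i u x) (at 0)"
        by (rule Ck_on_has_pd[OF uC[of "Suc 0"] i x])
      have "((\<lambda>s. (1 / N n) * soft_id (N n * s)) has_field_derivative (1 / N n) * (d n x * (N n * 1))) (at (u x))"
        unfolding d_def by (intro DERIV_cmult DERIV_chain2[of soft_id _ "\<lambda>s. N n * s", OF soft_id_DERIV] DERIV_ident)
      then have "((\<lambda>s. (1 / N n) * soft_id (N n * s)) has_field_derivative d n x) (at (u x))" using N[of n] by simp
      from pd_compose[of u x i, OF u' this]
      show "((\<lambda>t. \<phi> n (x + t *\<^sub>R i)) has_vector_derivative d n x * pd i u x) (at 0)" by (simp add: \<phi>_def)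
    qed
    then show ?thesis by (simp add: grad_complex complex_eq_iff)
  qed
  \<comment> \<open>The factors d n x need not tend to 1 where u vanishes, so the gradient has to
    vanish there.\<close>
  have grad0: "grad u x = 0" if "x \<in> \<Omega>" "u x = 0" for x
  proof -
    have "\<mu> = 0" by (rule integral_sol_zero[OF sol that])
    then have "u = (\<lambda>_. 0)" using sol unfolding integral_sol_def by auto
    then have "pd i u x = 0" for i by (intro pd_eqI) simp
    then show ?thesis by (simp add: grad_complex complex_eq_iff)
  qed
  have dlim: "(\<lambda>n. d n x) \<longlonglongrightarrow> 1" if "u x \<noteq> 0" for x
  proof (rule tendsto_eventually)
    obtain M :: nat where M: "2 / \<bar>u x\<bar> < real M" using reals_Archimedean2 by blast
    show "\<forall>\<^sub>F n in sequentially. d n x = 1"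
      using eventually_ge_at_top[of M]
    proof eventually_elim
      case (elim n)
      have "2 / \<bar>u x\<bar> < N n" using M elim by (simp add: N_def)
      then have "2 < N n * \<bar>u x\<bar>" using that by (simp add: field_simps)
      then show ?case unfolding d_def using N[of n] by (intro pd_soft_id_eq_1) (simp add: abs_mult)
    qed
  qed
  define g where "g x = indicator \<Omega> x *\<^sub>R grad u x" for x
  have cpd: "continuous_on \<Omega> (pd i u)" if "i \<in> Basis" for i
    by (rule Ck_on_continuous[OF Ck_on_pd[OF uC[of "Suc 0"] that]])
  have cgrad: "continuous_on \<Omega> (grad u)"
  proof -
    have "continuous_on \<Omega> (\<lambda>x. complex_of_real (pd 1 u x) + \<i> * complex_of_real (pd \<i> u x))"
      by (intro continuous_intros cpd) auto
    moreover have "grad u = (\<lambda>x. complex_of_real (pd 1 u x) + \<i> * complex_of_real (pd \<i> u x))"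
      by (auto simp: grad_complex Complex_eq)
    ultimately show ?thesis by simp
  qed
  have gm [measurable]: "g \<in> borel_measurable borel"
    unfolding g_def by (rule borel_measurable_continuous_on_indicator[OF dom_borel cgrad])
  have um [measurable]: "u \<in> borel_measurable borel" using c by (rule borel_measurable_continuous_onI)
  have dm [measurable]: "d n \<in> borel_measurable borel" for n
  proof -
    have "continuous_on UNIV (pd 1 soft_id)" by (rule Ck_on_continuous[OF Ck_on_pd[OF Ck_on_soft_id[of "Suc 0"]]]) simp
    then have "continuous_on UNIV (d n)"
      unfolding d_def by (rule continuous_on_compose2) (auto intro!: continuous_intros c)
    then show ?thesis by (rule borel_measurable_continuous_onI)
  qed
  obtain Bu where Bu: "adm Bu u" using adm_continuous[OF c] by blast
  have ce: "continuous_on UNIV (\<lambda>x. \<mu> * exp (u x))" by (intro continuous_intros c)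
  obtain Bf where Bf: "adm Bf (\<lambda>x. \<mu> * exp (u x))" using adm_continuous[OF ce] by blast
  have Bf0: "Bf \<ge> 0" and Bu0: "Bu \<ge> 0" using adm_nonneg Bf Bu by auto
  have \<phi>u: "\<bar>\<phi> n x\<bar> \<le> \<bar>u x\<bar>" for n x
    using abs_soft_id_le[of "N n * u x"] N[of n] by (simp add: \<phi>_def abs_mult field_simps)
  \<comment> \<open>The bound is uniform in n: |\<phi> n| \<le> |u| \<le> Bu, and Bf bounds the
    source on \<Omega>.\<close>
  define E where "E = Bf * Bu * measure lborel \<Omega>"
  have energy: "integrable lborel (\<lambda>x. d n x * (norm (g x))\<^sup>2)" "(\<integral>x. d n x * (norm (g x))\<^sup>2 \<partial>lborel) \<le> E" for n
  proof -
    have eqg: "indicator \<Omega> x * (grad u x \<bullet> grad (\<phi> n) x) = d n x * (norm (g x))\<^sup>2" for x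
      by (cases "x \<in> \<Omega>") (auto simp: g_def grad\<phi> power2_norm_eq_inner)
    show "integrable lborel (\<lambda>x. d n x * (norm (g x))\<^sup>2)"
      using green_identity(2)[OF uC test[of n]] unfolding eqg .
    have "(\<integral>x. d n x * (norm (g x))\<^sup>2 \<partial>lborel) = (\<integral>x. indicator \<Omega> x * (- laplacian u x * \<phi> n x) \<partial>lborel)"
      using green_identity(1)[OF uC test[of n]] unfolding eqg .
    also have "\<dots> = (\<integral>x. indicator \<Omega> x * (\<mu> * exp (u x) * \<phi> n x) \<partial>lborel)"
    proof (intro Bochner_Integration.integral_cong refl)
      show "indicator \<Omega> x * (- laplacian u x * \<phi> n x) = indicator \<Omega> x * (\<mu> * exp (u x) * \<phi> n x)" for x
        by (cases "x \<in> \<Omega>") (simp_all add: integral_sol_laplacian[OF sol])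
    qed
    also have "\<dots> \<le> (\<integral>x. indicator \<Omega> x * (Bf * Bu) \<partial>lborel)"
    proof (rule integral_mono)
      have c\<phi>: "continuous_on UNIV (\<phi> n)"
        using test[of n] Ck_on_continuous unfolding test_function_def by blast
      show "integrable lborel (\<lambda>x. indicator \<Omega> x * (\<mu> * exp (u x) * \<phi> n x))"
        by (intro integrable_dom_mult continuous_intros c c\<phi>)
      show "integrable lborel (\<lambda>x. indicator \<Omega> x * (Bf * Bu))" by (intro integrable_dom_mult continuous_intros)
      show "indicator \<Omega> x * (\<mu> * exp (u x) * \<phi> n x) \<le> indicator \<Omega> x * (Bf * Bu)" for x
      proof (cases "x \<in> \<Omega>")
        case True
        have "\<bar>\<mu> * exp (u x)\<bar> * \<bar>\<phi> n x\<bar> \<le> Bf * Bu"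
          using Bf Bu True order_trans[OF \<phi>u[of n x]] Bf0 unfolding adm_def by (intro mult_mono) auto
        then show ?thesis using True by (simp flip: abs_mult add: abs_le_iff)
      qed simp
    qed
    also have "\<dots> = E" using integral_indicator_dom by (simp add: E_def mult_ac)
    finally show "(\<integral>x. d n x * (norm (g x))\<^sup>2 \<partial>lborel) \<le> E" .
  qed
  have E0: "E \<ge> 0" using Bf0 Bu0 by (simp add: E_def)
  \<comment> \<open>The weights d n x converge to 1 pointwise, not monotonically, so Fatou's lemma
    is the tool that removes them.\<close>
  have gL2: "integrable lborel (\<lambda>x. (norm (g x))\<^sup>2)"
  proof (rule integrableI_bounded)
    have "(\<integral>\<^sup>+x. ennreal (norm ((norm (g x))\<^sup>2)) \<partial>lborel) \<le> (\<integral>\<^sup>+x. liminf (\<lambda>n. ennreal (d n x * (norm (g x))\<^sup>2)) \<partial>lborel)"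
    proof (rule nn_integral_mono)
      fix x
      have "(\<lambda>n. d n x * (norm (g x))\<^sup>2) \<longlonglongrightarrow> (norm (g x))\<^sup>2"
      proof (cases "x \<in> \<Omega> \<and> u x \<noteq> 0")
        case True
        then have "(\<lambda>n. d n x * (norm (g x))\<^sup>2) \<longlonglongrightarrow> 1 * (norm (g x))\<^sup>2"
          by (intro tendsto_intros dlim) auto
        then show ?thesis by simp
      next
        case False
        then have "g x = 0" using grad0[of x] by (cases "x \<in> \<Omega>") (auto simp: g_def)
        then show ?thesis by simp
      qed
      then have "(\<lambda>n. ennreal (d n x * (norm (g x))\<^sup>2)) \<longlonglongrightarrow> ennreal ((norm (g x))\<^sup>2)"
        by (rule tendsto_ennrealI)
      then have "liminf (\<lambda>n. ennreal (d n x * (norm (g x))\<^sup>2)) = ennreal ((norm (g x))\<^sup>2)"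
        by (rule lim_imp_Liminf[rotated]) simp
      then show "ennreal (norm ((norm (g x))\<^sup>2)) \<le> liminf (\<lambda>n. ennreal (d n x * (norm (g x))\<^sup>2))" by simp
    qed
    also have "\<dots> \<le> liminf (\<lambda>n. \<integral>\<^sup>+x. ennreal (d n x * (norm (g x))\<^sup>2) \<partial>lborel)"
      by (rule nn_integral_liminf) measurable
    also have "\<dots> \<le> ennreal E"
    proof -
      have le: "(\<integral>\<^sup>+x. ennreal (d n x * (norm (g x))\<^sup>2) \<partial>lborel) \<le> ennreal E" for n
        using energy[of n] d(1) by (subst nn_integral_eq_integral) (auto intro: ennreal_leI)
      have "liminf (\<lambda>n. \<integral>\<^sup>+x. ennreal (d n x * (norm (g x))\<^sup>2) \<partial>lborel) \<le> liminf (\<lambda>n. ennreal E)"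
        using le by (intro Liminf_mono) auto
      then show ?thesis by (simp add: Liminf_const)
    qed
    also have "\<dots> < \<infinity>" by simp
    finally show "(\<integral>\<^sup>+x. ennreal (norm ((norm (g x))\<^sup>2)) \<partial>lborel) < \<infinity>" .
  qed simp
  have gdom: "indicator \<Omega> x *\<^sub>R g x = g x" for x by (simp add: g_def indicator_def)
  have "L2_on \<Omega> u"
    unfolding L2_on_def
    by (intro conjI lebesgue_on_dom_continuous c continuous_intros)
  moreover have "L2_on \<Omega> g"
    unfolding L2_on_def
  proof
    show "g \<in> borel_measurable (lebesgue_on \<Omega>)" by (rule measurable_lebesgue_on_dom) measurable
    have m: "(\<lambda>x. indicator \<Omega> x *\<^sub>R (norm (g x))\<^sup>2) \<in> borel_measurable borel" by measurable
    have "indicator \<Omega> x *\<^sub>R (norm (g x))\<^sup>2 = (norm (g x))\<^sup>2" for x by (simp add: g_def indicator_def)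
    then show "integrable (lebesgue_on \<Omega>) (\<lambda>x. (norm (g x))\<^sup>2)"
      unfolding integrable_lebesgue_on_dom[OF m] using gL2 by presburger
  qed
  moreover have "(\<lambda>n. LINT x|lebesgue_on \<Omega>. (\<phi> n x - u x)\<^sup>2) \<longlonglongrightarrow> 0"
  proof (rule tendsto_sandwich[OF _ _ tendsto_const])
    show "\<forall>\<^sub>F n in sequentially. 0 \<le> (LINT x|lebesgue_on \<Omega>. (\<phi> n x - u x)\<^sup>2)" by simp
    show "\<forall>\<^sub>F n in sequentially. (LINT x|lebesgue_on \<Omega>. (\<phi> n x - u x)\<^sup>2) \<le> measure lborel \<Omega> * (2 * inverse (real (Suc n)))\<^sup>2"
    proof (intro always_eventually allI)
      fix n
      have c\<phi>: "continuous_on UNIV (\<phi> n)"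
        using test[of n] Ck_on_continuous unfolding test_function_def by blast
      have "(LINT x|lebesgue_on \<Omega>. (\<phi> n x - u x)\<^sup>2) = (\<integral>x. indicator \<Omega> x * (\<phi> n x - u x)\<^sup>2 \<partial>lborel)"
        by (intro lebesgue_on_dom_continuous continuous_intros c c\<phi>)
      also have "\<dots> \<le> (\<integral>x. indicator \<Omega> x * (2 * inverse (real (Suc n)))\<^sup>2 \<partial>lborel)"
      proof (intro integral_mono integrable_dom_mult continuous_intros c c\<phi>)
        fix x
        have "\<bar>\<phi> n x - u x\<bar> = (1 / N n) * \<bar>soft_id (N n * u x) - N n * u x\<bar>"
        proof -
          have "\<phi> n x - u x = (1 / N n) * (soft_id (N n * u x) - N n * u x)"
            using N[of n] by (simp add: \<phi>_def right_diff_distrib)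
          then show ?thesis using N[of n] by (simp add: abs_mult)
        qed
        also have "\<dots> \<le> (1 / N n) * 2" using N[of n] abs_soft_id_diff by (intro mult_left_mono) auto
        finally have "\<bar>\<phi> n x - u x\<bar> \<le> 2 * inverse (real (Suc n))" by (simp add: N_def divide_inverse mult.commute)
        then have "\<bar>\<phi> n x - u x\<bar>\<^sup>2 \<le> (2 * inverse (real (Suc n)))\<^sup>2" by (intro power_mono) auto
        then show "indicator \<Omega> x * (\<phi> n x - u x)\<^sup>2 \<le> indicator \<Omega> x * (2 * inverse (real (Suc n)))\<^sup>2"
          by (simp add: mult_left_mono)
      qed
      also have "\<dots> = measure lborel \<Omega> * (2 * inverse (real (Suc n)))\<^sup>2"
        using integral_indicator_dom by simp
      finally show "(LINT x|lebesgue_on \<Omega>. (\<phi> n x - u x)\<^sup>2) \<le> measure lborel \<Omega> * (2 * inverse (real (Suc n)))\<^sup>2" .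
    qed
    have "(\<lambda>n. measure lborel \<Omega> * (2 * inverse (real (Suc n)))\<^sup>2) \<longlonglongrightarrow> measure lborel \<Omega> * (2 * 0)\<^sup>2"
      by (intro tendsto_intros LIMSEQ_inverse_real_of_nat)
    then show "(\<lambda>n. measure lborel \<Omega> * (2 * inverse (real (Suc n)))\<^sup>2) \<longlonglongrightarrow> 0" by simp
  qed
  moreover have "(\<lambda>n. LINT x|lebesgue_on \<Omega>. (norm (grad (\<phi> n) x - g x))\<^sup>2) \<longlonglongrightarrow> 0"
  proof -
    have eq: "(LINT x|lebesgue_on \<Omega>. (norm (grad (\<phi> n) x - g x))\<^sup>2) = (\<integral>x. (d n x - 1)\<^sup>2 * (norm (g x))\<^sup>2 \<partial>lborel)" for n
    proof -
      have p: "indicator \<Omega> x *\<^sub>R (norm (grad (\<phi> n) x - g x))\<^sup>2 = (d n x - 1)\<^sup>2 * (norm (g x))\<^sup>2" for x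
      proof (cases "x \<in> \<Omega>")
        case True
        then have "grad (\<phi> n) x - g x = (d n x - 1) *\<^sub>R g x" by (simp add: g_def grad\<phi> scaleR_left_diff_distrib)
        then show ?thesis using True by (simp add: power_mult_distrib)
      qed (simp add: g_def)
      have "(\<lambda>x. indicator \<Omega> x *\<^sub>R (norm (grad (\<phi> n) x - g x))\<^sup>2) \<in> borel_measurable borel"
        unfolding p by measurable
      from integral_lebesgue_on_dom[OF this] show ?thesis unfolding p .
    qed
    have "(\<lambda>n. \<integral>x. (d n x - 1)\<^sup>2 * (norm (g x))\<^sup>2 \<partial>lborel) \<longlonglongrightarrow> integral\<^sup>L lborel (\<lambda>x::complex. 0)"
    proof (rule integral_dominated_convergence)
      show "integrable lborel (\<lambda>x. (C + 1)\<^sup>2 * (norm (g x))\<^sup>2)" using gL2 by simp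
      show "AE x in lborel. (\<lambda>n. (d n x - 1)\<^sup>2 * (norm (g x))\<^sup>2) \<longlonglongrightarrow> 0"
      proof (intro AE_I2)
        fix x
        show "(\<lambda>n. (d n x - 1)\<^sup>2 * (norm (g x))\<^sup>2) \<longlonglongrightarrow> 0"
        proof (cases "x \<in> \<Omega> \<and> u x \<noteq> 0")
          case True
          then have "(\<lambda>n. (d n x - 1)\<^sup>2 * (norm (g x))\<^sup>2) \<longlonglongrightarrow> (1 - 1)\<^sup>2 * (norm (g x))\<^sup>2"
            by (intro tendsto_intros dlim) auto
          then show ?thesis by simp
        next
          case False
          then have "g x = 0" using grad0[of x] by (cases "x \<in> \<Omega>") (auto simp: g_def)
          then show ?thesis by simp
        qed
      qed
      show "AE x in lborel. norm ((d n x - 1)\<^sup>2 * (norm (g x))\<^sup>2) \<le> (C + 1)\<^sup>2 * (norm (g x))\<^sup>2" for n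
      proof (intro AE_I2)
        fix x
        have "\<bar>d n x - 1\<bar>\<^sup>2 \<le> (C + 1)\<^sup>2" using d[of n x] C0 by (intro power_mono) auto
        then show "norm ((d n x - 1)\<^sup>2 * (norm (g x))\<^sup>2) \<le> (C + 1)\<^sup>2 * (norm (g x))\<^sup>2"
          by (simp add: mult_right_mono)
      qed
    qed simp_all
    then show ?thesis unfolding eq by simp
  qed
  ultimately have "H10_with_grad \<Omega> u g"
    unfolding H10_with_grad_def using test by blast
  then show ?thesis by (simp add: g_def[abs_def])
qed

text \<open>Green's formula settles test functions. Both sides are continuous along H^1
  approximants, because the gradient of u and e^u are square integrable.\<close>

lemma weak_solution_of_integral_sol:
  assumes sol: "integral_sol \<mu> u"
  shows "weak_solution \<Omega> (\<mu> * mass u) u"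
proof -
  define g where "g x = indicator \<Omega> x *\<^sub>R grad u x" for x
  have H: "H10_with_grad \<Omega> u g" using integral_sol_H10[OF sol] by (simp add: g_def[abs_def])
  have c: "continuous_on UNIV u" using sol unfolding integral_sol_def by blast
  have ce: "continuous_on UNIV (\<lambda>x. exp (u x))" by (intro continuous_intros c)
  have eL2: "L2_on \<Omega> (\<lambda>x. exp (u x))"
    unfolding L2_on_def by (intro conjI lebesgue_on_dom_continuous ce continuous_intros c)
  have uC: "Ck_on 2 \<Omega> u" by (rule integral_sol_Ck[OF sol])
  have gL2: "L2_on \<Omega> g" using H by (simp add: H10_with_grad_def)
  have weak: "(LINT x|lebesgue_on \<Omega>. g x \<bullet> w x) =
        \<mu> * mass u * ((LINT x|lebesgue_on \<Omega>. exp (u x) * v x) / (LINT x|lebesgue_on \<Omega>. exp (u x)))"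
    if vw: "H10_with_grad \<Omega> v w" for v w
  proof -
    obtain \<psi> where \<psi>: "\<And>n::nat. test_function \<Omega> (\<psi> n)"
      "(\<lambda>n. LINT x|lebesgue_on \<Omega>. (\<psi> n x - v x)\<^sup>2) \<longlonglongrightarrow> 0"
      "(\<lambda>n. LINT x|lebesgue_on \<Omega>. (norm (grad (\<psi> n) x - w x))\<^sup>2) \<longlonglongrightarrow> 0"
      and L: "L2_on \<Omega> v" "L2_on \<Omega> w"
      using vw unfolding H10_with_grad_def by blast
    have 1: "(\<lambda>n. LINT x|lebesgue_on \<Omega>. g x \<bullet> grad (\<psi> n) x) \<longlonglongrightarrow> (LINT x|lebesgue_on \<Omega>. g x \<bullet> w x)"
      by (rule L2_inner_tendsto[OF gL2 L(2) L2_on_test_function(2)[OF \<psi>(1)] \<psi>(3)])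
    have "(\<lambda>n. LINT x|lebesgue_on \<Omega>. exp (u x) \<bullet> \<psi> n x) \<longlonglongrightarrow> (LINT x|lebesgue_on \<Omega>. exp (u x) \<bullet> v x)"
      by (rule L2_inner_tendsto[OF eL2 L(1) L2_on_test_function(1)[OF \<psi>(1)]]) (use \<psi>(2) in simp)
    then have 2: "(\<lambda>n. \<mu> * (LINT x|lebesgue_on \<Omega>. exp (u x) * \<psi> n x)) \<longlonglongrightarrow> \<mu> * (LINT x|lebesgue_on \<Omega>. exp (u x) * v x)"
      by (intro tendsto_mult_left) simp
    have "(LINT x|lebesgue_on \<Omega>. g x \<bullet> grad (\<psi> n) x) = \<mu> * (LINT x|lebesgue_on \<Omega>. exp (u x) * \<psi> n x)" for n
    proof -
      have p: "indicator \<Omega> x *\<^sub>R (g x \<bullet> grad (\<psi> n) x) = indicator \<Omega> x * (grad u x \<bullet> grad (\<psi> n) x)" for x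
        by (cases "x \<in> \<Omega>") (simp_all add: g_def)
      have m: "(\<lambda>x. indicator \<Omega> x *\<^sub>R (g x \<bullet> grad (\<psi> n) x)) \<in> borel_measurable borel"
        unfolding p using borel_measurable_integrable[OF green_identity(2)[OF uC \<psi>(1)]] by simp
      have "(LINT x|lebesgue_on \<Omega>. g x \<bullet> grad (\<psi> n) x) = (\<integral>x. indicator \<Omega> x * (- laplacian u x * \<psi> n x) \<partial>lborel)"
        unfolding integral_lebesgue_on_dom[OF m] p by (rule green_identity(1)[OF uC \<psi>(1)])
      also have "\<dots> = (\<integral>x. \<mu> * (indicator \<Omega> x * (exp (u x) * \<psi> n x)) \<partial>lborel)"
      proof (intro Bochner_Integration.integral_cong refl)
        show "indicator \<Omega> x * (- laplacian u x * \<psi> n x) = \<mu> * (indicator \<Omega> x * (exp (u x) * \<psi> n x))" for x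
          by (cases "x \<in> \<Omega>") (simp_all add: integral_sol_laplacian[OF sol])
      qed
      also have "\<dots> = \<mu> * (\<integral>x. indicator \<Omega> x * (exp (u x) * \<psi> n x) \<partial>lborel)"
        by (rule integral_mult_right_zero)
      also have "(\<integral>x. indicator \<Omega> x * (exp (u x) * \<psi> n x) \<partial>lborel) = (LINT x|lebesgue_on \<Omega>. exp (u x) * \<psi> n x)"
      proof -
        have "continuous_on UNIV (\<psi> n)"
          using \<psi>(1)[of n] Ck_on_continuous unfolding test_function_def by blast
        then show ?thesis by (intro lebesgue_on_dom_continuous(2)[symmetric] continuous_intros c)
      qed
      finally show ?thesis .
    qed
    with 1 have "(\<lambda>n. \<mu> * (LINT x|lebesgue_on \<Omega>. exp (u x) * \<psi> n x)) \<longlonglongrightarrow> (LINT x|lebesgue_on \<Omega>. g x \<bullet> w x)" by simp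
    from LIMSEQ_unique[OF this 2] show ?thesis
      using mass_pos[OF c] by (simp add: mass_eq[OF c])
  qed
  show ?thesis
    unfolding weak_solution_def using H weak lebesgue_on_dom_continuous(1)[OF ce] by blast
qed

lemma mean_field_solution_of_integral_sol:
  "integral_sol \<mu> u \<Longrightarrow> mean_field_solution \<Omega> (\<mu> * mass u) u"
  unfolding mean_field_solution_def
  using classical_solution_of_integral_sol weak_solution_of_integral_sol by blast

end

text \<open>On the strip \<open>{|(z - p) \<bullet> n| \<le> b}\<close> the torsion function is at most \<open>b\<^sup>2 / 2\<close>, which makes the
  first branch of solutions reach \<open>2 |\<Omega>| / (e b\<^sup>2)\<close>.\<close>

theorem exists_mean_field_solution_strip:
  fixes \<Omega> :: "complex set"
  assumes \<Omega>: "open \<Omega>" "bounded \<Omega>" "simply_connected \<Omega>" "\<Omega> \<noteq> {}"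
    and n: "norm n = 1" and strip: "\<And>z. z \<in> \<Omega> \<Longrightarrow> \<bar>(z - p) \<bullet> n\<bar> \<le> b" and b: "b > 0"
    and lam: "lam < 2 * measure lebesgue \<Omega> / (exp 1 * b\<^sup>2)"
  shows "\<exists>u. mean_field_solution \<Omega> lam u"
proof -
  have "\<Omega> \<noteq> UNIV" using \<Omega>(2) not_bounded_UNIV by metis
  then obtain g h where gh: "g holomorphic_on \<Omega>" "h holomorphic_on ball 0 1"
    "\<forall>z\<in>\<Omega>. g z \<in> ball 0 1 \<and> h (g z) = z" "\<forall>z\<in>ball 0 1. h z \<in> \<Omega> \<and> g (h z) = z"
    using Riemann_mapping_theorem[of \<Omega>] \<Omega> by auto
  interpret disc_domain \<Omega> g h by unfold_locales (use \<Omega> gh in auto)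
  have "lam < 2 * measure lborel \<Omega> / (exp 1 * b\<^sup>2)"
    using lam \<Omega>(1) by simp
  then obtain \<mu> u where "integral_sol \<mu> u" "lam = \<mu> * mass u"
    using exists_integral_sol[OF n strip b] by blast
  then show ?thesis using mean_field_solution_of_integral_sol by blast
qed

subsection \<open>Perimeter and area of convex regions\<close>

text \<open>The ellipse is the image of the disc of radius b under the stretching \<open>T\<close>,
  which has determinant 1 / \<rho>.\<close>

lemma emeasure_ellipse:
  assumes "\<rho> > 0" "b > 0"
  shows "emeasure lborel (ellipse \<rho> b) = ennreal (pi * b\<^sup>2 / \<rho>)"
proof -
  define co where "co j = (if j = 1 then 1 / \<rho> else 1)" for j :: complex
  define T where "T x = 0 + (\<Sum>j\<in>Basis. (co j * (x \<bullet> j)) *\<^sub>R j)" for x :: complex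
  have T: "T x = Complex (Re x / \<rho>) (Im x)" for x
    by (simp add: T_def co_def sum_Basis_complex complex_eq_iff inner_complex_def)
  have "closed (ellipse \<rho> b)"
    unfolding ellipse_def by (intro closed_Collect_le continuous_intros)
  then have m: "ellipse \<rho> b \<in> sets borel" by simp
  have Tm [measurable]: "T \<in> borel_measurable borel"
    unfolding T_def by measurable
  have "lborel = density (distr lborel borel T) (\<lambda>_. ennreal (\<Prod>j\<in>Basis. \<bar>co j\<bar>))"
    unfolding T_def by (rule lborel_affine_euclidean) (use assms in \<open>auto simp: co_def\<close>)
  moreover have "(\<Prod>j\<in>Basis. \<bar>co j\<bar>) = 1 / \<rho>"
    using assms by (simp add: Basis_complex_def co_def)
  ultimately have eq: "lborel = density (distr lborel borel T) (\<lambda>_. ennreal (1 / \<rho>))" by simp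
  have "emeasure lborel (ellipse \<rho> b) = emeasure (density (distr lborel borel T) (\<lambda>_. ennreal (1 / \<rho>))) (ellipse \<rho> b)"
    using eq by simp
  also have "\<dots> = ennreal (1 / \<rho>) * emeasure (distr lborel borel T) (ellipse \<rho> b)"
    using m by (subst emeasure_density) (auto simp: nn_integral_cmult_indicator)
  also have "emeasure (distr lborel borel T) (ellipse \<rho> b) = emeasure lborel (T -` ellipse \<rho> b)"
    using m by (subst emeasure_distr) auto
  also have "T -` ellipse \<rho> b = cball 0 b"
  proof -
    have "\<rho>\<^sup>2 * (Re x / \<rho>)\<^sup>2 + (Im x)\<^sup>2 = (norm x)\<^sup>2" for x
      using assms by (simp add: power_divide cmod_power2)
    then show ?thesis using assms by (auto simp: ellipse_def T abs_le_square_iff[symmetric])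
  qed
  also have "emeasure lborel (cball (0::complex) b) = ennreal (pi * b\<^sup>2)"
    using emeasure_cball[of b "0::complex"] assms by (simp add: unit_ball_vol_2)
  finally show ?thesis using assms by (simp flip: ennreal_mult)
qed

text \<open>The area formula \<open>content_triangle\<close> concerns \<open>real ^ 2\<close>; this
  measure-preserving identification carries it to the complex plane.\<close>

definition plane :: "real ^ 2 \<Rightarrow> complex" where
  "plane v = Complex (v $ 1) (v $ 2)"

lemma lborel_plane: "lborel = distr lborel borel plane"
proof (rule lborel_eqI)
  have pm: "plane \<in> borel_measurable borel"
    unfolding plane_def Complex_eq by measurable
  fix l u :: complex assume le: "\<And>b. b \<in> Basis \<Longrightarrow> l \<bullet> b \<le> u \<bullet> b"
  have le': "Re l \<le> Re u" "Im l \<le> Im u" using le[of 1] le[of \<i>] by (auto simp: inner_complex_def)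
  define l' u' :: "real ^ 2" where "l' = vector [Re l, Im l]" and "u' = vector [Re u, Im u]"
  have "plane -` box l u = box l' u'"
    by (auto simp: box_def plane_def Basis_complex_def inner_complex_def l'_def u'_def Basis_vec_def inner_axis forall_2)
  then have "emeasure (distr lborel borel plane) (box l u) = emeasure lborel (box l' u')"
    using pm by (subst emeasure_distr) auto
  also have "\<dots> = ennreal (\<Prod>b\<in>Basis. (u' - l') \<bullet> b)"
  proof (rule emeasure_lborel_box)
    have "l' $ i \<le> u' $ i" for i using le' exhaust_2[of i] by (auto simp: l'_def u'_def)
    then show "l' \<bullet> b \<le> u' \<bullet> b" if "b \<in> Basis" for b
      using that by (auto simp: Basis_vec_def inner_axis)
  qed
  also have "(\<Prod>b\<in>Basis. (u' - l') \<bullet> b) = (\<Prod>b\<in>Basis. (u - l) \<bullet> b)"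
  proof -
    have "(\<Prod>b\<in>(Basis :: (real ^ 2) set). (u' - l') \<bullet> b) = (\<Prod>i\<in>(UNIV :: 2 set). (u' - l') \<bullet> axis i 1)"
      unfolding Basis_vec_def by (subst prod.UNION_disjoint) (auto simp: axis_eq_axis)
    also have "\<dots> = (u - l) \<bullet> 1 * ((u - l) \<bullet> \<i>)"
      by (simp add: UNIV_2 inner_axis l'_def u'_def inner_complex_def)
    also have "\<dots> = (\<Prod>b\<in>Basis. (u - l) \<bullet> b)" by (simp add: Basis_complex_def)
    finally show ?thesis .
  qed
  finally show "emeasure (distr lborel borel plane) (box l u) = (\<Prod>b\<in>Basis. (u - l) \<bullet> b)" .
qed simp

lemma measure_triangle_complex:
  fixes P Q R :: complex
  shows "measure lborel (convex hull {P, Q, R}) =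
    \<bar>(Re R - Re P) * (Im Q - Im P) - (Re Q - Re P) * (Im R - Im P)\<bar> / 2"
proof -
  define v :: "complex \<Rightarrow> real ^ 2" where "v z = vector [Re z, Im z]" for z
  have vp: "plane (v z) = z" for z by (simp add: plane_def v_def)
  have pv: "v (plane x) = x" for x by (simp add: plane_def v_def vec_eq_iff forall_2)
  have lin: "linear v"
    by (rule linearI) (auto simp: v_def vec_eq_iff forall_2)
  have pm: "plane \<in> borel_measurable borel"
    unfolding plane_def Complex_eq by measurable
  have "plane -` (convex hull {P, Q, R}) = v ` (convex hull {P, Q, R})"
    using vp pv by (auto simp: image_iff) metis
  also have "\<dots> = convex hull {v P, v Q, v R}" by (simp add: convex_hull_linear_image[OF lin])
  finally have eq: "plane -` (convex hull {P, Q, R}) = convex hull {v P, v Q, v R}" .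
  have "compact (convex hull {P, Q, R})" by (intro finite_imp_compact_convex_hull) simp
  then have m: "convex hull {P, Q, R} \<in> sets borel" by (simp add: compact_imp_closed)
  have "measure lborel (convex hull {P, Q, R}) = measure (distr lborel borel plane) (convex hull {P, Q, R})"
    using lborel_plane by simp
  also have "\<dots> = measure lborel (convex hull {v P, v Q, v R})"
    using m pm eq by (simp add: measure_distr)
  also have "\<dots> = \<bar>(Re R - Re P) * (Im Q - Im P) - (Re Q - Re P) * (Im R - Im P)\<bar> / 2"
    unfolding content_triangle by (simp add: v_def)
  finally show ?thesis .
qed

text \<open>Of two frontier points on one ray from the interior point w, the nearer would lie on the
  open segment from w to the farther, and such a segment is interior.\<close>

lemma frontier_line_same_side:
  fixes \<Omega> :: "complex set"
  assumes \<Omega>: "convex \<Omega>" "open \<Omega>" and w: "w \<in> \<Omega>"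
    and y: "y \<in> frontier \<Omega>" "y' \<in> frontier \<Omega>" and line: "y - w = \<tau> *\<^sub>R k" "y' - w = \<tau>' *\<^sub>R k"
    and \<tau>: "\<tau> * \<tau>' > 0"
  shows "y = y'"
proof -
  have impossible: False
    if "y \<in> frontier \<Omega>" "y' \<in> frontier \<Omega>" "y - w = \<tau> *\<^sub>R k" "y' - w = \<tau>' *\<^sub>R k" "\<tau> * \<tau>' > 0" "\<bar>\<tau>\<bar> < \<bar>\<tau>'\<bar>"
    for y y' \<tau> \<tau>'
  proof -
    have t: "0 < \<tau> / \<tau>'" "\<tau> / \<tau>' < 1"
      using that(5,6) by (auto simp: zero_less_mult_iff zero_less_divide_iff divide_less_eq abs_if split: if_splits)
    have ne: "\<tau>' \<noteq> 0" using that by auto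
    have "y = w + \<tau> *\<^sub>R k" "y' = w + \<tau>' *\<^sub>R k" using that(3,4) by (simp_all add: algebra_simps)
    then have "y = (1 - \<tau> / \<tau>') *\<^sub>R w + (\<tau> / \<tau>') *\<^sub>R y'"
      using ne by (simp add: scaleR_add_right algebra_simps)
    moreover have "w \<noteq> y'" using that(2) w \<Omega>(2) by (auto simp: frontier_def interior_open)
    ultimately have "y \<in> open_segment w y'" using t by (auto simp: in_segment)
    moreover have "open_segment w y' \<subseteq> interior \<Omega>"
      by (rule in_interior_closure_convex_segment[OF \<Omega>(1)])
         (use w \<Omega>(2) that(2) in \<open>auto simp: interior_open frontier_def\<close>)
    ultimately show False using that(1) by (auto simp: frontier_def)
  qed
  have "\<bar>\<tau>\<bar> = \<bar>\<tau>'\<bar>"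
    using impossible[OF y line \<tau>] impossible[OF y(2,1) line(2,1)] \<tau> by (fastforce simp: mult.commute)
  then have "\<tau> = \<tau>'" using \<tau> by (auto simp: abs_if zero_less_mult_iff split: if_splits)
  then show ?thesis using line by (metis add_diff_cancel diff_add_cancel)
qed

text \<open>A line through the interior of a convex region meets the boundary at most twice. Integrating
  the number of crossings over all parallel lines bounds the variation of a boundary curve.\<close>

lemma frontier_line_card:
  fixes \<Omega> :: "complex set" and e :: complex
  assumes \<Omega>: "convex \<Omega>" "open \<Omega>" and e: "norm e = 1"
    and x: "x \<in> frontier \<Omega>" "x' \<in> frontier \<Omega>" "x \<bullet> e < c" "c < x' \<bullet> e"
    and S: "finite S" "S \<subseteq> frontier \<Omega>" "\<And>y. y \<in> S \<Longrightarrow> y \<bullet> e = c"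
  shows "card S \<le> 2"
proof (rule ccontr)
  have near: "\<exists>z\<in>\<Omega>. \<bar>z \<bullet> e - y \<bullet> e\<bar> < d" if yd: "y \<in> frontier \<Omega>" "d > 0" for y d
  proof -
    obtain z where z: "z \<in> \<Omega>" "dist z y < d"
      using yd by (auto simp: frontier_def closure_approachable)
    have "\<bar>(z - y) \<bullet> e\<bar> \<le> norm (z - y)" using Cauchy_Schwarz_ineq2[of "z - y" e] e by simp
    then show ?thesis using z by (intro bexI[of _ z]) (auto simp: dist_norm inner_diff_left)
  qed
  obtain z z' where z: "z \<in> \<Omega>" "z \<bullet> e < c" "z' \<in> \<Omega>" "c < z' \<bullet> e"
    using near[OF x(1), of "c - x \<bullet> e"] near[OF x(2), of "x' \<bullet> e - c"] x(3,4) by (auto simp: abs_less_iff)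
  have "connected ((\<lambda>v. v \<bullet> e) ` \<Omega>)"
    by (intro connected_continuous_image continuous_intros convex_connected \<Omega>)
  then have "c \<in> (\<lambda>v. v \<bullet> e) ` \<Omega>"
    by (rule connectedD_interval[of _ "z \<bullet> e" "z' \<bullet> e"]) (use z in auto)
  then obtain w where w: "w \<in> \<Omega>" "w \<bullet> e = c" by auto
  assume "\<not> card S \<le> 2"
  then have "3 \<le> card S" by simp
  then obtain S' where S': "S' \<subseteq> S" "card S' = 3" by (meson obtain_subset_with_card_n)
  then obtain p q r where pqr: "S' = {p, q, r}" "p \<noteq> q" "q \<noteq> r" "p \<noteq> r" by (auto simp: card_3_iff)
  define \<tau> where "\<tau> y = (y - w) \<bullet> (\<i> * e)" for y
  have n: "(Re e)\<^sup>2 + (Im e)\<^sup>2 = 1" using e cmod_power2[of e] by simp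
  have dec: "v = (v \<bullet> e) *\<^sub>R e + (v \<bullet> (\<i> * e)) *\<^sub>R (\<i> * e)" for v :: complex
  proof (rule complex_eqI)
    have "Re v = Re v * ((Re e)\<^sup>2 + (Im e)\<^sup>2)" "Im v = Im v * ((Re e)\<^sup>2 + (Im e)\<^sup>2)" using n by simp_all
    then show "Re v = Re ((v \<bullet> e) *\<^sub>R e + (v \<bullet> (\<i> * e)) *\<^sub>R (\<i> * e))"
        "Im v = Im ((v \<bullet> e) *\<^sub>R e + (v \<bullet> (\<i> * e)) *\<^sub>R (\<i> * e))"
      by (simp_all add: inner_complex_def power2_eq_square algebra_simps)
  qed
  have on: "y \<in> frontier \<Omega>" "y - w = \<tau> y *\<^sub>R (\<i> * e)" "\<tau> y \<noteq> 0" if "y \<in> S'" for y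
  proof -
    show yf: "y \<in> frontier \<Omega>" using that S' S by auto
    have "(y - w) \<bullet> e = 0" using S(3)[of y] S' that w by (auto simp: inner_diff_left)
    then show eq: "y - w = \<tau> y *\<^sub>R (\<i> * e)" using dec[of "y - w"] by (simp add: \<tau>_def)
    have "y \<noteq> w" using yf w \<Omega>(2) by (auto simp: frontier_def interior_open)
    then show "\<tau> y \<noteq> 0" using eq by auto
  qed
  have same: "y = y'" if "y \<in> S'" "y' \<in> S'" "\<tau> y * \<tau> y' > 0" for y y'
    by (rule frontier_line_same_side[OF \<Omega> w(1) on(1)[OF that(1)] on(1)[OF that(2)] on(2)[OF that(1)] on(2)[OF that(2)] that(3)])
  \<comment> \<open>Among three nonzero reals two have the same sign.\<close>
  have "\<tau> p * \<tau> q > 0 \<or> \<tau> q * \<tau> r > 0 \<or> \<tau> p * \<tau> r > 0"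
    using on(3)[of p] on(3)[of q] on(3)[of r] pqr(1) by (auto simp: zero_less_mult_iff linorder_neq_iff)
  then show False using same[of p q] same[of q r] same[of p r] pqr by auto
qed

text \<open>Each summand is the length of an interval of levels \<open>I i\<close>. A level c lies
  in at most as many of these intervals as the line at height c has frontier points met by the
  curve, hence in at most two; integration over c gives the bound.\<close>

lemma convex_boundary_variation:
  fixes \<Omega> :: "complex set" and \<gamma> :: "real \<Rightarrow> complex" and t :: "nat \<Rightarrow> real"
  assumes \<Omega>: "convex \<Omega>" "open \<Omega>" and e: "norm e = 1"
    and \<gamma>: "simple_path \<gamma>" "path_image \<gamma> \<subseteq> frontier \<Omega>"
    and range: "\<And>y. y \<in> frontier \<Omega> \<Longrightarrow> \<alpha> \<le> y \<bullet> e \<and> y \<bullet> e \<le> \<beta>"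
    and t: "\<And>i. i \<le> n \<Longrightarrow> t i \<in> {0..1}" "\<And>i. i < n \<Longrightarrow> t i \<le> t (Suc i)"
  shows "(\<Sum>i<n. \<bar>\<gamma> (t i) \<bullet> e - \<gamma> (t (Suc i)) \<bullet> e\<bar>) \<le> 2 * (\<beta> - \<alpha>)"
proof -
  define v where "v s = \<gamma> s \<bullet> e" for s
  have fr: "\<gamma> s \<in> frontier \<Omega>" if "s \<in> {0..1}" for s using \<gamma>(2) that by (auto simp: path_image_def)
  have cont: "continuous_on {0..1} v"
    unfolding v_def using \<gamma>(1) by (auto simp: simple_path_def path_def intro!: continuous_intros)
  have \<alpha>\<beta>: "\<alpha> \<le> \<beta>" using range[OF fr[of 0]] by simp
  \<comment> \<open>The intervals are open so that a level in \<open>I i\<close> is attained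
    strictly between t i and t (Suc i), and different i give different parameters.\<close>
  define I where "I i = {min (v (t i)) (v (t (Suc i)))<..<max (v (t i)) (v (t (Suc i)))}" for i
  have tm: "t i \<le> t j" if "i \<le> j" "j \<le> n" for i j
    using that(1)
  proof (induction rule: inc_induct)
    case (step m)
    have "t m \<le> t (Suc m)" using step that(2) by (intro t(2)) simp
    then show ?case using step by simp
  qed simp
  have count: "(\<Sum>i<n. indicator (I i) c) \<le> 2 * (indicator {\<alpha>..\<beta>} c :: real)" for c
  proof -
    define J where "J = {i. i < n \<and> c \<in> I i}"
    have sumJ: "(\<Sum>i<n. indicator (I i) c) = real (card J)"
    proof -
      have "(\<Sum>i<n. indicator (I i) c) = (\<Sum>i\<in>J. (1::real))"
        unfolding J_def by (subst sum.mono_neutral_right[of "{..<n}" "J"]) (auto simp: J_def indicator_def)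
      then show ?thesis by simp
    qed
    have cross: "\<exists>s. t i < s \<and> s < t (Suc i) \<and> v s = c" if "i \<in> J" for i
    proof -
      have i: "i < n" "c \<in> I i" using that by (auto simp: J_def)
      have le: "t i \<le> t (Suc i)" by (rule t(2)[OF i(1)])
      have c: "continuous_on {t i..t (Suc i)} v"
        using t(1)[of i] t(1)[of "Suc i"] i(1) by (intro continuous_on_subset[OF cont]) auto
      have "\<exists>s\<ge>t i. s \<le> t (Suc i) \<and> v s = c"
      proof (cases "v (t i) \<le> v (t (Suc i))")
        case True
        then show ?thesis using i(2) by (intro IVT' le c) (auto simp: I_def)
      next
        case False
        then show ?thesis using i(2) by (intro IVT2' le c) (auto simp: I_def)
      qed
      then obtain s where s: "t i \<le> s" "s \<le> t (Suc i)" "v s = c" by blast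
      have "s \<noteq> t i" "s \<noteq> t (Suc i)" using s(3) i(2) by (auto simp: I_def min_def max_def split: if_splits)
      then show ?thesis using s by (intro exI[of _ s]) auto
    qed
    then obtain s where s: "\<And>i. i \<in> J \<Longrightarrow> t i < s i \<and> s i < t (Suc i) \<and> v (s i) = c" by metis
    \<comment> \<open>Strictness excludes the parameters 0 and 1, the only pair a simple path may
      identify.\<close>
    have s01: "0 < s i \<and> s i < 1" if "i \<in> J" for i
      using s[OF that] t(1)[of i] t(1)[of "Suc i"] that by (force simp: J_def)
    have inj: "inj_on (\<lambda>i. \<gamma> (s i)) J"
    proof (rule inj_onI)
      fix i j assume ij: "i \<in> J" "j \<in> J" "\<gamma> (s i) = \<gamma> (s j)"
      have "s i \<in> {0..1}" "s j \<in> {0..1}" using s01[OF ij(1)] s01[OF ij(2)] by auto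
      then have "s i = s j \<or> s i = 0 \<and> s j = 1 \<or> s i = 1 \<and> s j = 0"
        using \<gamma>(1) ij(3) unfolding simple_path_def loop_free_def by blast
      then have eq: "s i = s j" using s01[OF ij(1)] s01[OF ij(2)] by linarith
      show "i = j"
      proof (rule ccontr)
        assume "i \<noteq> j"
        then consider "Suc i \<le> j" | "Suc j \<le> i" by linarith
        then show False
        proof cases
          case 1
          then have "t (Suc i) \<le> t j" using ij by (intro tm) (auto simp: J_def)
          then show False using s[OF ij(1)] s[OF ij(2)] eq by simp
        next
          case 2
          then have "t (Suc j) \<le> t i" using ij by (intro tm) (auto simp: J_def)
          then show False using s[OF ij(1)] s[OF ij(2)] eq by simp
        qed
      qed
    qed
    show ?thesis
    proof (cases "J = {}")
      case False
      then obtain i where i: "i \<in> J" by blast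
      have in01: "t i \<in> {0..1}" "t (Suc i) \<in> {0..1}"
        using i t(1)[of i] t(1)[of "Suc i"] by (simp_all add: J_def)
      obtain x x' where x: "x \<in> frontier \<Omega>" "x' \<in> frontier \<Omega>" "x \<bullet> e < c" "c < x' \<bullet> e"
      proof (cases "v (t i) \<le> v (t (Suc i))")
        case True
        then show ?thesis using i fr[OF in01(1)] fr[OF in01(2)] that[of "\<gamma> (t i)" "\<gamma> (t (Suc i))"]
          by (auto simp: J_def I_def v_def)
      next
        case False
        then show ?thesis using i fr[OF in01(1)] fr[OF in01(2)] that[of "\<gamma> (t (Suc i))" "\<gamma> (t i)"]
          by (auto simp: J_def I_def v_def)
      qed
      have finJ: "finite J" by (simp add: J_def)
      have "card ((\<lambda>i. \<gamma> (s i)) ` J) \<le> 2"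
      proof (rule frontier_line_card[OF \<Omega> e x])
        show "(\<lambda>i. \<gamma> (s i)) ` J \<subseteq> frontier \<Omega>" using s01 by (force intro!: fr)
        show "y \<bullet> e = c" if "y \<in> (\<lambda>i. \<gamma> (s i)) ` J" for y using that s by (auto simp: v_def)
      qed (use finJ in simp)
      then have "card J \<le> 2" using inj by (simp add: card_image)
      moreover have "c \<in> {\<alpha>..\<beta>}" using x range[OF x(1)] range[OF x(2)] by auto
      ultimately show ?thesis unfolding sumJ by simp
    qed (simp add: sumJ)
  qed
  have fI: "emeasure lborel (I i) < \<infinity>" for i by (simp add: I_def)
  have "(\<Sum>i<n. \<bar>v (t i) - v (t (Suc i))\<bar>) = (\<Sum>i<n. (\<integral>c. indicator (I i) c \<partial>lborel))"
    by (intro sum.cong refl) (auto simp: I_def min_def max_def)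
  also have "\<dots> = (\<integral>c. (\<Sum>i<n. indicator (I i) c) \<partial>lborel)"
    by (rule Bochner_Integration.integral_sum[symmetric]) (use fI in \<open>auto simp: I_def\<close>)
  also have "\<dots> \<le> (\<integral>c. 2 * indicator {\<alpha>..\<beta>} c \<partial>lborel)"
    by (intro integral_mono count Bochner_Integration.integrable_sum integrable_mult_right integrable_real_indicator)
       (use fI \<alpha>\<beta> in \<open>auto simp: I_def\<close>)
  also have "\<dots> = 2 * (\<beta> - \<alpha>)" using \<alpha>\<beta> by simp
  finally show ?thesis by (simp add: v_def)
qed

lemma norm_le_orthonormal:
  assumes "norm m = 1"
  shows "norm z \<le> \<bar>z \<bullet> m\<bar> + \<bar>z \<bullet> (\<i> * m)\<bar>"
proof -
  have n: "(Re m)\<^sup>2 + (Im m)\<^sup>2 = 1" using assms cmod_power2[of m] by simp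
  have "(norm z)\<^sup>2 = (norm z)\<^sup>2 * ((Re m)\<^sup>2 + (Im m)\<^sup>2)" using n by simp
  also have "\<dots> = (z \<bullet> m)\<^sup>2 + (z \<bullet> (\<i> * m))\<^sup>2"
    unfolding cmod_power2 by (simp add: inner_complex_def power2_eq_square algebra_simps)
  also have "\<dots> \<le> (\<bar>z \<bullet> m\<bar> + \<bar>z \<bullet> (\<i> * m)\<bar>)\<^sup>2" by (simp add: power2_sum)
  finally show ?thesis by (rule power2_le_imp_le) simp
qed

text \<open>A side is no longer than the sum of its projections to two orthogonal axes. The result
  is the perimeter of the enclosing rectangle.\<close>

lemma convex_polygon_sum_le:
  fixes \<Omega> :: "complex set"
  assumes \<Omega>: "convex \<Omega>" "open \<Omega>" and m: "norm m = 1"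
    and \<gamma>: "simple_path \<gamma>" "path_image \<gamma> \<subseteq> frontier \<Omega>"
    and r1: "\<And>y. y \<in> frontier \<Omega> \<Longrightarrow> \<alpha> \<le> y \<bullet> m \<and> y \<bullet> m \<le> \<beta>"
    and r2: "\<And>y. y \<in> frontier \<Omega> \<Longrightarrow> \<alpha>' \<le> y \<bullet> (\<i> * m) \<and> y \<bullet> (\<i> * m) \<le> \<beta>'"
    and s: "s \<in> polygon_sums \<gamma>"
  shows "s \<le> 2 * (\<beta> - \<alpha>) + 2 * (\<beta>' - \<alpha>')"
proof -
  obtain n t where s: "s = (\<Sum>i<n. dist (\<gamma> (t i)) (\<gamma> (t (Suc i))))"
    and t: "\<And>i. i \<le> n \<Longrightarrow> t i \<in> {0..1}" "\<And>i. i < n \<Longrightarrow> t i \<le> t (Suc i)"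
    using s unfolding polygon_sums_def by blast
  have "s \<le> (\<Sum>i<n. \<bar>\<gamma> (t i) \<bullet> m - \<gamma> (t (Suc i)) \<bullet> m\<bar> + \<bar>\<gamma> (t i) \<bullet> (\<i> * m) - \<gamma> (t (Suc i)) \<bullet> (\<i> * m)\<bar>)"
    unfolding s dist_norm using norm_le_orthonormal[OF m] by (intro sum_mono) (metis inner_diff_left)
  also have "\<dots> \<le> 2 * (\<beta> - \<alpha>) + 2 * (\<beta>' - \<alpha>')"
    unfolding sum.distrib
  proof (rule add_mono)
    show "(\<Sum>i<n. \<bar>\<gamma> (t i) \<bullet> m - \<gamma> (t (Suc i)) \<bullet> m\<bar>) \<le> 2 * (\<beta> - \<alpha>)"
      using convex_boundary_variation[where t=t and n=n, OF \<Omega> m \<gamma> r1 t] by simp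
    have "norm (\<i> * m) = 1" using m by (simp add: norm_mult)
    then show "(\<Sum>i<n. \<bar>\<gamma> (t i) \<bullet> (\<i> * m) - \<gamma> (t (Suc i)) \<bullet> (\<i> * m)\<bar>) \<le> 2 * (\<beta>' - \<alpha>')"
      using convex_boundary_variation[where t=t and n=n, OF \<Omega> _ \<gamma> r2 t] by simp
  qed
  finally show ?thesis .
qed

lemma zero_in_polygon_sums: "0 \<in> polygon_sums \<gamma>"
  unfolding polygon_sums_def by (rule CollectI, rule exI[of _ 0], rule exI[of _ "\<lambda>_. 0"]) auto

text \<open>The frontier is homeomorphic to a circle, and the variation bound in an enclosing square
  gives rectifiability. This makes the choice in \<open>boundary_length\<close> meaningful.\<close>

lemma rectifiable_jordan_frontier_convex:
  fixes \<Omega> :: "complex set"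
  assumes \<Omega>: "convex \<Omega>" "open \<Omega>" "bounded \<Omega>" "\<Omega> \<noteq> {}"
  shows "\<exists>\<gamma>. rectifiable_jordan_curve \<gamma> \<and> path_image \<gamma> = frontier \<Omega>"
proof -
  have ne: "interior \<Omega> \<noteq> {}" using \<Omega> by (simp add: interior_open)
  have "aff_dim \<Omega> = aff_dim (ball (0::complex) 1)"
    using \<Omega> by (simp add: aff_dim_open)
  then have "rel_frontier (ball (0::complex) 1) homeomorphic rel_frontier \<Omega>"
    by (intro homeomorphic_rel_frontiers_convex_bounded_sets) (use \<Omega> in auto)
  then have "sphere (0::complex) 1 homeomorphic frontier \<Omega>"
    using rel_frontier_nonempty_interior[OF ne] by (simp add: rel_frontier_nonempty_interior)
  then obtain f f' where f: "homeomorphism (sphere (0::complex) 1) (frontier \<Omega>) f f'"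
    by (auto simp: homeomorphic_def)
  define \<gamma> where "\<gamma> = f \<circ> circlepath 0 1"
  have sp: "simple_path \<gamma>"
    unfolding \<gamma>_def
  proof (rule simple_path_continuous_image)
    show "simple_path (circlepath 0 1)" by (simp add: simple_path_circlepath)
    show "continuous_on (path_image (circlepath 0 1)) f" using f by (simp add: homeomorphism_def)
    show "inj_on f (path_image (circlepath 0 1))"
      using f by (intro inj_on_inverseI[of _ f']) (simp add: homeomorphism_def)
  qed
  have im: "path_image \<gamma> = frontier \<Omega>"
    using f by (simp add: \<gamma>_def path_image_compose homeomorphism_def)
  have loop: "pathfinish \<gamma> = pathstart \<gamma>"
    by (simp add: \<gamma>_def pathfinish_compose pathstart_compose)
  have "bounded (frontier \<Omega>)" using \<Omega>(3) by (auto simp: frontier_def intro: bounded_subset[OF bounded_closure])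
  then obtain R where R: "\<And>y. y \<in> frontier \<Omega> \<Longrightarrow> norm y \<le> R" by (auto simp: bounded_iff)
  have rR: "- R \<le> y \<bullet> k \<and> y \<bullet> k \<le> R" if "y \<in> frontier \<Omega>" "norm k = 1" for y k
    using Cauchy_Schwarz_ineq2[of y k] R[OF that(1)] that(2) by (auto simp: abs_le_iff)
  have "bdd_above (polygon_sums \<gamma>)"
  proof (rule bdd_aboveI)
    fix s assume s: "s \<in> polygon_sums \<gamma>"
    show "s \<le> 2 * (R - (- R)) + 2 * (R - (- R))"
      by (rule convex_polygon_sum_le[OF \<Omega>(1,2) norm_one sp _ rR rR s]) (use im in auto)
  qed
  then show ?thesis
    using sp im loop unfolding rectifiable_jordan_curve_def rectifiable_def by blast
qed

text \<open>The polygon bound holds for every simple path in the frontier, hence also for the one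
  chosen in \<open>boundary_length\<close>.\<close>

lemma boundary_length_convex_le:
  fixes \<Omega> :: "complex set"
  assumes \<Omega>: "convex \<Omega>" "open \<Omega>" "bounded \<Omega>" "\<Omega> \<noteq> {}" and m: "norm m = 1"
    and r1: "\<And>y. y \<in> frontier \<Omega> \<Longrightarrow> \<alpha> \<le> y \<bullet> m \<and> y \<bullet> m \<le> \<beta>"
    and r2: "\<And>y. y \<in> frontier \<Omega> \<Longrightarrow> \<alpha>' \<le> y \<bullet> (\<i> * m) \<and> y \<bullet> (\<i> * m) \<le> \<beta>'"
  shows "boundary_length \<Omega> \<le> 2 * (\<beta> - \<alpha>) + 2 * (\<beta>' - \<alpha>')" "0 \<le> boundary_length \<Omega>"
proof -
  define \<gamma> where "\<gamma> = (SOME \<gamma>. rectifiable_jordan_curve \<gamma> \<and> path_image \<gamma> = frontier \<Omega>)"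
  have \<gamma>: "rectifiable_jordan_curve \<gamma> \<and> path_image \<gamma> = frontier \<Omega>"
    unfolding \<gamma>_def by (rule someI_ex[OF rectifiable_jordan_frontier_convex[OF \<Omega>]])
  then have sp: "simple_path \<gamma>" "path_image \<gamma> \<subseteq> frontier \<Omega>" and bdd: "bdd_above (polygon_sums \<gamma>)"
    by (auto simp: rectifiable_jordan_curve_def rectifiable_def)
  have eq: "boundary_length \<Omega> = Sup (polygon_sums \<gamma>)"
    by (simp add: boundary_length_def curve_length_def \<gamma>_def)
  show "boundary_length \<Omega> \<le> 2 * (\<beta> - \<alpha>) + 2 * (\<beta>' - \<alpha>')"
    unfolding eq
  proof (rule cSup_least)
    show "polygon_sums \<gamma> \<noteq> {}" using zero_in_polygon_sums by blast
    show "s \<le> 2 * (\<beta> - \<alpha>) + 2 * (\<beta>' - \<alpha>')" if "s \<in> polygon_sums \<gamma>" for s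
      by (rule convex_polygon_sum_le[OF \<Omega>(1,2) m sp r1 r2 that])
  qed
  show "0 \<le> boundary_length \<Omega>"
    unfolding eq by (rule cSup_upper[OF zero_in_polygon_sums bdd])
qed

subsection \<open>Thin domains\<close>

text \<open>The outer ellipse lies in a strip of half-width bp and the inner one has area \<pi> bm^2
  / \<rho>. The reach of the positive branch thus contains the factor \<pi> / e > 1, which keeps the
  simpler bound strictly below it.\<close>

lemma mean_field_solutions_ellipse:
  fixes \<Omega> :: "complex set"
  assumes \<rho>: "\<rho> > 0" and b: "bm > 0" "bp > 0" and \<Omega>: "simple_domain \<Omega>"
    and sub: "ellipse \<rho> bm \<subseteq> \<Omega>" "\<Omega> \<subseteq> ellipse \<rho> bp" and \<mu>: "\<mu> \<le> 2 * (bm\<^sup>2 / bp\<^sup>2) / \<rho>"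
  shows "\<exists>u. mean_field_solution \<Omega> \<mu> u"
proof (rule exists_mean_field_solution_strip)
  show o: "open \<Omega>" and bd: "bounded \<Omega>" and "simply_connected \<Omega>" using \<Omega> by (auto simp: simple_domain_def)
  have "0 \<in> ellipse \<rho> bm" by (simp add: ellipse_def)
  then show "\<Omega> \<noteq> {}" using sub(1) by auto
  show "norm \<i> = 1" by simp
  show "\<bar>(z - 0) \<bullet> \<i>\<bar> \<le> bp" if "z \<in> \<Omega>" for z
  proof -
    have "z \<in> ellipse \<rho> bp" using that sub(2) by blast
    moreover have "0 \<le> \<rho>\<^sup>2 * (Re z)\<^sup>2" by simp
    ultimately have "(Im z)\<^sup>2 \<le> bp\<^sup>2" unfolding ellipse_def mem_Collect_eq by linarith
    then show ?thesis using b(2) by (simp add: inner_complex_def abs_le_square_iff[symmetric])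
  qed
  have "ennreal (pi * bm\<^sup>2 / \<rho>) \<le> emeasure lborel \<Omega>"
    unfolding emeasure_ellipse[OF \<rho> b(1), symmetric] using sub(1) o by (intro emeasure_mono) auto
  then have area: "pi * bm\<^sup>2 / \<rho> \<le> measure lebesgue \<Omega>"
    using o emeasure_bounded_finite[OF bd] by (simp add: emeasure_eq_ennreal_measure ennreal_le_iff)
  have "exp 1 < pi" using e_less_272 pi_gt3 by simp
  have "2 * (bm\<^sup>2 / bp\<^sup>2) / \<rho> = 2 * (exp 1 * (bm\<^sup>2 / \<rho>)) / (exp 1 * bp\<^sup>2)" using b \<rho> by (simp add: field_simps)
  also have "\<dots> < 2 * (pi * (bm\<^sup>2 / \<rho>)) / (exp 1 * bp\<^sup>2)"
    using \<open>exp 1 < pi\<close> b \<rho> by (intro divide_strict_right_mono mult_strict_left_mono mult_strict_right_mono) auto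
  also have "\<dots> \<le> 2 * measure lebesgue \<Omega> / (exp 1 * bp\<^sup>2)"
    using area by (intro divide_right_mono mult_left_mono) auto
  finally show "\<mu> < 2 * measure lebesgue \<Omega> / (exp 1 * bp\<^sup>2)" using \<mu> by simp
qed (rule b)

text \<open>The strip is centred at a diameter of length \<open>d\<close>, and \<open>w\<close> is the largest distance of a
  point of the region from it. The two span a triangle of area \<open>d w / 2\<close>.\<close>

lemma convex_thin_strip:
  fixes \<Omega> :: "complex set"
  assumes \<Omega>: "\<Omega> \<noteq> {}" "open \<Omega>" "bounded \<Omega>" "convex \<Omega>"
  obtains P n d w where "norm n = 1" "d > 0" "w > 0" "w \<le> d" "\<And>z. z \<in> \<Omega> \<Longrightarrow> \<bar>(z - P) \<bullet> n\<bar> \<le> w"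
    "area \<Omega> \<ge> d * w / 2" "0 \<le> boundary_length \<Omega>" "boundary_length \<Omega> \<le> 2 * d + 4 * w"
proof -
  define C where "C = closure \<Omega>"
  have C: "compact C" "C \<noteq> {}" "\<Omega> \<subseteq> C" "convex C" "bounded C"
    using \<Omega> closure_subset by (auto simp: C_def compact_closure convex_closure)
  obtain P Q where PQ: "P \<in> C" "Q \<in> C" "dist P Q = diameter C"
    using diameter_compact_attained[OF C(1,2)] by blast
  define d where "d = diameter C"
  have dle: "norm (x - y) \<le> d" if "x \<in> C" "y \<in> C" for x y
    using diameter_bounded_bound[OF C(5) that] by (simp add: d_def dist_norm)
  obtain x where "x \<in> \<Omega>" using \<Omega>(1) by blast
  with openE[OF \<Omega>(2)] obtain r where xr: "x \<in> \<Omega>" "r > 0" "ball x r \<subseteq> \<Omega>" by metis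
  have shift: "x + (r / 2) *\<^sub>R k \<in> \<Omega>" if "norm k = 1" for k
    using xr that by (intro subsetD[OF xr(3)]) (simp add: dist_norm)
  have d: "d > 0"
  proof -
    have "norm ((x + (r / 2) *\<^sub>R 1) - x) \<le> d" by (rule dle) (use shift[of 1] xr(1) C(3) in auto)
    then show ?thesis using xr(2) by simp
  qed
  define m where "m = (1 / d) *\<^sub>R (Q - P)"
  have QP: "Q - P = d *\<^sub>R m" using d by (simp add: m_def)
  have nQP: "norm (Q - P) = d" using PQ(3) by (simp add: d_def dist_norm norm_minus_commute)
  then have m1: "norm m = 1" using d by (simp add: m_def)
  define n where "n = \<i> * m"
  have n1: "norm n = 1" using m1 by (simp add: n_def norm_mult)
  have "continuous_on C (\<lambda>z. \<bar>(z - P) \<bullet> n\<bar>)" by (intro continuous_intros)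
  then obtain R where R: "R \<in> C" "\<And>z. z \<in> C \<Longrightarrow> \<bar>(z - P) \<bullet> n\<bar> \<le> \<bar>(R - P) \<bullet> n\<bar>"
    using continuous_attains_sup[OF C(1,2)] by blast
  define w where "w = \<bar>(R - P) \<bullet> n\<bar>"
  have wmax: "\<bar>(z - P) \<bullet> n\<bar> \<le> w" if "z \<in> C" for z using R(2)[OF that] by (simp add: w_def)
  have w: "w > 0"
  proof (rule ccontr)
    assume "\<not> w > 0"
    then have "(z - P) \<bullet> n = 0" if "z \<in> \<Omega>" for z using wmax[of z] that C(3) by auto
    from this[OF shift[OF n1]] this[OF xr(1)]
    have "(r / 2) * (n \<bullet> n) = 0" by (simp add: inner_add_left inner_diff_left)
    then show False using n1 xr(2) by (simp add: dot_square_norm)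
  qed
  have wd: "w \<le> d"
    using Cauchy_Schwarz_ineq2[of "R - P" n] n1 dle[OF R(1) PQ(1)] by (simp add: w_def)
  have along: "0 \<le> (y - P) \<bullet> m" "(y - P) \<bullet> m \<le> d" if y: "y \<in> C" for y
  proof -
    \<comment> \<open>Expanding |y - Q| \<le> d around P, with Q = P + d m, gives |y - P|^2 \<le> 2
      d (y - P) \<bullet> m. So the region projects onto the segment from P to Q.\<close>
    have "(norm (y - Q))\<^sup>2 \<le> d\<^sup>2" using dle[OF y PQ(2)] by (intro power_mono) auto
    moreover have "y - Q = (y - P) - d *\<^sub>R m" using QP by (simp add: algebra_simps)
    moreover have "(norm (a - d *\<^sub>R m))\<^sup>2 = (norm a)\<^sup>2 - 2 * d * (a \<bullet> m) + d\<^sup>2 * (m \<bullet> m)" for a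
      by (simp only: power2_norm_eq_inner) (simp add: inner_diff_left inner_diff_right inner_commute power2_eq_square)
    ultimately have "(norm (y - P))\<^sup>2 - 2 * d * ((y - P) \<bullet> m) + d\<^sup>2 * (m \<bullet> m) \<le> d\<^sup>2" by metis
    then have "(norm (y - P))\<^sup>2 \<le> 2 * d * ((y - P) \<bullet> m)" using m1 by (simp add: dot_square_norm)
    then have "0 \<le> 2 * d * ((y - P) \<bullet> m)" by (rule order_trans[rotated]) simp
    then show "0 \<le> (y - P) \<bullet> m" using d by (simp add: zero_le_mult_iff)
    show "(y - P) \<bullet> m \<le> d" using Cauchy_Schwarz_ineq2[of "y - P" m] m1 dle[OF y PQ(1)] by simp
  qed
  have frC: "y \<in> C" if "y \<in> frontier \<Omega>" for y using that by (simp add: frontier_def C_def)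
  \<comment> \<open>The enclosing rectangle has sides d and 2 w.\<close>
  have L: "boundary_length \<Omega> \<le> 2 * (P \<bullet> m + d - P \<bullet> m) + 2 * ((P \<bullet> n + w) - (P \<bullet> n - w))" "0 \<le> boundary_length \<Omega>"
  proof -
    have r1: "P \<bullet> m \<le> y \<bullet> m \<and> y \<bullet> m \<le> P \<bullet> m + d" if "y \<in> frontier \<Omega>" for y
      using along[OF frC[OF that]] by (simp add: inner_diff_left)
    have r2: "P \<bullet> n - w \<le> y \<bullet> (\<i> * m) \<and> y \<bullet> (\<i> * m) \<le> P \<bullet> n + w" if "y \<in> frontier \<Omega>" for y
      using wmax[OF frC[OF that]] by (simp add: inner_diff_left abs_le_iff flip: n_def)
    show "boundary_length \<Omega> \<le> 2 * (P \<bullet> m + d - P \<bullet> m) + 2 * ((P \<bullet> n + w) - (P \<bullet> n - w))"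
      by (rule boundary_length_convex_le(1)[OF \<Omega>(4,2,3,1) m1 r1 r2])
    show "0 \<le> boundary_length \<Omega>" by (rule boundary_length_convex_le(2)[OF \<Omega>(4,2,3,1) m1 r1 r2])
  qed
  have "d * w / 2 \<le> area \<Omega>"
  proof -
    have "convex hull {P, Q, R} \<subseteq> C" by (intro hull_minimal) (use PQ R C in auto)
    moreover have T: "compact (convex hull {P, Q, R})" by (intro finite_imp_compact_convex_hull) simp
    ultimately have "measure lebesgue (convex hull {P, Q, R}) \<le> measure lebesgue C"
      using C(1) by (intro measure_mono_fmeasurable) (auto simp: lmeasurable_compact compact_imp_closed intro: fmeasurableD)
    moreover have "measure lebesgue C = area \<Omega>"
      unfolding C_def area_def by (rule measure_closure[OF \<Omega>(3) negligible_convex_frontier[OF \<Omega>(4)]])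
    moreover have "measure lebesgue (convex hull {P, Q, R}) = d * w / 2"
    proof -
      have "measure lebesgue (convex hull {P, Q, R}) = measure lborel (convex hull {P, Q, R})"
        using T by (simp add: compact_imp_closed)
      also have "\<dots> = \<bar>(Re R - Re P) * (Im Q - Im P) - (Re Q - Re P) * (Im R - Im P)\<bar> / 2"
        by (rule measure_triangle_complex)
      also have "(Re R - Re P) * (Im Q - Im P) - (Re Q - Re P) * (Im R - Im P) = - (d * ((R - P) \<bullet> n))"
      proof -
        have "Im Q - Im P = d * Im m" "Re Q - Re P = d * Re m"
          using arg_cong[OF QP, of Im] arg_cong[OF QP, of Re] by simp_all
        then show ?thesis by (simp add: n_def inner_complex_def algebra_simps)
      qed
      also have "\<bar>- (d * ((R - P) \<bullet> n))\<bar> = d * w" using d by (simp add: w_def abs_mult)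
      finally show ?thesis .
    qed
    ultimately show ?thesis by simp
  qed
  then show ?thesis using that[OF n1 d w wd _ _ L(2)] wmax C(3) L(1) by auto
qed

lemma mean_field_solutions_convex:
  fixes \<Omega> :: "complex set"
  assumes \<Omega>: "\<Omega> \<noteq> {}" "open \<Omega>" "bounded \<Omega>" "convex \<Omega>" and N: "3968 / pi \<le> isoperimetric_ratio \<Omega>"
  shows "\<exists>lam. pi\<^sup>2 * isoperimetric_ratio \<Omega> / 496 < lam \<and> lam < 33 * sqrt 3 * isoperimetric_ratio \<Omega> / (16 * pi) \<and>
    (\<forall>\<mu>\<le>lam. \<exists>u. mean_field_solution \<Omega> \<mu> u)"
proof -
  obtain P n d w where n: "norm n = 1" and d: "d > 0" and w: "w > 0" "w \<le> d"
    and strip: "\<And>z. z \<in> \<Omega> \<Longrightarrow> \<bar>(z - P) \<bullet> n\<bar> \<le> w"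
    and A: "area \<Omega> \<ge> d * w / 2" and L: "0 \<le> boundary_length \<Omega>" "boundary_length \<Omega> \<le> 2 * d + 4 * w"
    using convex_thin_strip[OF \<Omega>] by metis
  let ?A = "area \<Omega>" and ?L = "boundary_length \<Omega>" and ?N = "isoperimetric_ratio \<Omega>"
  have dw: "d * w / 2 > 0" using d w by simp
  then have Ap: "?A > 0" using A by linarith
  have Neq: "?N * ?A = ?L\<^sup>2" using Ap by (simp add: isoperimetric_ratio_def)
  have Np: "?N > 0" by (rule less_le_trans[OF _ N]) simp
  \<comment> \<open>From L \<le> 6 d, |\<Omega>| \<ge> d w / 2 and N \<ge> 3968 / \<pi> \<ge> 992
    follows 496 w \<le> 36 d, and 36 / 496 < 0.073.\<close>
  have thin: "w \<le> 73 / 1000 * d"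
  proof -
    have "?L \<le> 6 * d" using L w(2) by linarith
    then have "?L\<^sup>2 \<le> (6 * d)\<^sup>2" using L(1) by (intro power_mono) auto
    moreover have "992 \<le> 3968 / pi" using pi_less_4 by (simp add: pos_le_divide_eq)
    then have "992 * (d * w / 2) \<le> ?N * ?A" using A dw N by (intro mult_mono) auto
    ultimately have "d * (496 * w) \<le> d * (36 * d)" unfolding Neq by (simp add: power2_eq_square)
    then have "496 * w \<le> 36 * d" using d by (simp only: mult_le_cancel_left_pos)
    then show ?thesis using d by linarith
  qed
  define up where "up = 2 * ?A / (exp 1 * w\<^sup>2)"
  \<comment> \<open>Multiplied by |\<Omega>|, the claim reads \<pi>^2 L^2 e w^2 < 992 |\<Omega>|^2,
    and the right side is at least 248 d^2 w^2. Thinness gives L \<le> 2.292 d, rounded to 2.3 d,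
    and 16 times 5.29 times 2.72 is below 231.\<close>
  have upp: "pi\<^sup>2 * ?N / 496 < up"
  proof -
    have "?L \<le> 23 / 10 * d" using L(2) thin d by linarith
    then have "?L\<^sup>2 \<le> (23 / 10 * d)\<^sup>2" using L(1) by (intro power_mono) auto
    then have L2: "?L\<^sup>2 \<le> 529 / 100 * d\<^sup>2" by (simp add: power_mult_distrib power2_eq_square)
    have "pi\<^sup>2 \<le> 4\<^sup>2" using pi_less_4 by (intro power_mono) auto
    then have "pi\<^sup>2 * ?L\<^sup>2 * exp 1 \<le> 16 * (529 / 100 * d\<^sup>2) * (272 / 100)"
      using L2 e_less_272 by (intro mult_mono) auto
    also have "\<dots> < 248 * d\<^sup>2" using d by simp
    finally have "pi\<^sup>2 * ?L\<^sup>2 * exp 1 * w\<^sup>2 < 248 * d\<^sup>2 * w\<^sup>2" using w by simp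
    also have "\<dots> = 992 * (d * w / 2)\<^sup>2" by (simp add: power_mult_distrib power_divide)
    also have "\<dots> \<le> 992 * ?A\<^sup>2" using A dw by (intro mult_left_mono power_mono) auto
    finally have "pi\<^sup>2 * ?N * exp 1 * w\<^sup>2 * ?A < 992 * ?A * ?A"
      unfolding Neq[symmetric] by (simp add: power2_eq_square mult_ac)
    then have "pi\<^sup>2 * ?N * (exp 1 * w\<^sup>2) < 992 * ?A" using Ap by (simp add: mult.assoc)
    then show ?thesis using w by (simp add: up_def field_simps)
  qed
  have lowup: "pi\<^sup>2 * ?N / 496 < 33 * sqrt 3 * ?N / (16 * pi)"
  proof -
    have "pi ^ 3 \<le> 4 ^ 3" using pi_less_4 by (intro power_mono) auto
    then have "pi\<^sup>2 * (16 * pi) < 496 * 33 * 1" by (simp add: power2_eq_square power3_eq_cube)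
    also have "\<dots> \<le> 496 * 33 * sqrt 3" by (intro mult_left_mono) auto
    finally have "pi\<^sup>2 / 496 < 33 * sqrt 3 / (16 * pi)" by (simp add: field_simps)
    then have "pi\<^sup>2 / 496 * ?N < 33 * sqrt 3 / (16 * pi) * ?N" using Np by (rule mult_strict_right_mono)
    then show ?thesis by simp
  qed
  obtain lam where lam: "pi\<^sup>2 * ?N / 496 < lam" "lam < min up (33 * sqrt 3 * ?N / (16 * pi))"
    using dense[of "pi\<^sup>2 * ?N / 496" "min up (33 * sqrt 3 * ?N / (16 * pi))"] upp lowup by auto
  have "\<exists>u. mean_field_solution \<Omega> \<mu> u" if "\<mu> \<le> lam" for \<mu>
  proof -
    have "\<mu> < 2 * measure lebesgue \<Omega> / (exp 1 * w\<^sup>2)"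
      using that lam(2) by (simp add: up_def area_def)
    from exists_mean_field_solution_strip[OF \<Omega>(2,3) convex_imp_simply_connected[OF \<Omega>(4)] \<Omega>(1) n strip w(1) this]
    show ?thesis .
  qed
  then show ?thesis using lam by auto
qed

lemma mean_field_solutions_thin:
  fixes \<Omega> :: "complex set"
  assumes c: "0 < c" "c \<le> 1" "c = bm\<^sup>2 / bp\<^sup>2" and \<rho>: "\<rho> > 0" and b: "bm > 0" "bp > 0"
    and \<Omega>: "simple_domain \<Omega>" "ellipse \<rho> bm \<subseteq> \<Omega>" "\<Omega> \<subseteq> ellipse \<rho> bp"
  shows "\<exists>lam. 4 * pi * c / ((8 - c) * \<rho>) < lam \<and> lam < 11 * pi / (16 * \<rho>) \<and>
    (\<forall>\<mu>\<le>lam. \<exists>u. mean_field_solution \<Omega> \<mu> u)"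
\<comment> \<open>The witness 2 c / \<rho> fits between the bounds: 4 \<pi> / (8 - c) \<le> 4 \<pi>
  / 7 < 2, and 2 c \<le> 2 < 11 \<pi> / 16.\<close>
proof (intro exI[of _ "2 * c / \<rho>"] conjI allI impI)
  have pi: "pi < 7 / 2" "pi > 3" using pi_approx pi_gt3 by auto
  have "4 * pi / (8 - c) < 2" using pi c(1,2) by (simp add: field_simps)
  then have "(c / \<rho>) * (4 * pi / (8 - c)) < (c / \<rho>) * 2" using c(1) \<rho> by (intro mult_strict_left_mono divide_pos_pos)
  then show "4 * pi * c / ((8 - c) * \<rho>) < 2 * c / \<rho>" by (simp add: mult_ac)
  have "2 * c < 11 * pi / 16" using c(2) pi by simp
  then have "2 * c / \<rho> < 11 * pi / 16 / \<rho>" using \<rho> by (rule divide_strict_right_mono)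
  then show "2 * c / \<rho> < 11 * pi / (16 * \<rho>)" by simp
  show "\<exists>u. mean_field_solution \<Omega> \<mu> u" if "\<mu> \<le> 2 * c / \<rho>" for \<mu>
    using that c(3) by (intro mean_field_solutions_ellipse[OF \<rho> b \<Omega>]) simp
qed

theorem theorem1p7:
  shows
    "(\<exists>(rho_up::real) (lam_up::real \<Rightarrow> real).
        strict_antimono_on {0<..rho_up} lam_up \<and>
        lam_up rho_up = 8 * pi \<and>
        lam_up \<sim>[at_right 0] (\<lambda>\<rho>. 11 * pi / (16 * \<rho>)) \<and>
        (\<forall>c::real. 0 < c \<and> c \<le> 1 \<longrightarrow>
          (\<exists>(rho_low::real) (lam_low::real \<Rightarrow> real).
             0 < rho_low \<and> rho_low < rho_up \<and>
             strict_antimono_on {0<..rho_low} lam_low \<and>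
             lam_low rho_low = 8 * pi \<and>
             lam_low \<sim>[at_right 0] (\<lambda>\<rho>. 4 * pi * c / ((8 - c) * \<rho>)) \<and>
             (\<forall>(\<rho>::real) (\<Omega>::complex set).
                0 < \<rho> \<and> \<rho> \<le> rho_low \<and> simple_domain \<Omega> \<and>
                (\<exists>(b_minus::real) (b_plus::real).
                   0 < b_minus \<and> 0 < b_plus \<and>
                   ellipse \<rho> b_minus \<subseteq> \<Omega> \<and> \<Omega> \<subseteq> ellipse \<rho> b_plus \<and>
                   c = b_minus\<^sup>2 / b_plus\<^sup>2) \<longrightarrow>
                (\<exists>lam::real. lam_low \<rho> < lam \<and> lam < lam_up \<rho> \<and>
                   (\<forall>\<mu>\<le>lam. \<exists>u. mean_field_solution \<Omega> \<mu> u))))))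
     \<and>
     (\<exists>(N_bar::real) (Lam_low::real \<Rightarrow> real) (Lam_up::real \<Rightarrow> real).
        4 * pi < N_bar \<and>
        strict_mono_on {N_bar..} Lam_low \<and>
        strict_mono_on {N_bar..} Lam_up \<and>
        Lam_low N_bar = 8 * pi \<and>
        (\<lambda>N. Lam_low N - pi\<^sup>2 * N / 496) \<in> O[at_top](\<lambda>_. 1) \<and>
        (\<lambda>N. Lam_up N - 33 * sqrt 3 * N / (16 * pi)) \<in> O[at_top](\<lambda>_. 1) \<and>
        (\<forall>\<Omega>::complex set.
           \<Omega> \<noteq> {} \<and> open \<Omega> \<and> bounded \<Omega> \<and> convex \<Omega> \<and> N_bar \<le> isoperimetric_ratio \<Omega> \<longrightarrow>
           (\<exists>lam::real. Lam_low (isoperimetric_ratio \<Omega>) < lam \<and>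
              lam < Lam_up (isoperimetric_ratio \<Omega>) \<and>
              (\<forall>\<mu>\<le>lam. \<exists>u. mean_field_solution \<Omega> \<mu> u))))"
proof (rule conjI, goal_cases)
  case 1
  have anti: "strict_antimono_on {0<..r} (\<lambda>\<rho>. a / (k * \<rho>))" if "a > 0" "k > 0" for a k r :: real
    using that by (auto simp: monotone_on_def intro!: divide_strict_left_mono)
  show ?case
  \<comment> \<open>11 / 128 solves 11 \<pi> / (16 \<rho>) = 8 \<pi>.\<close>
  proof (rule exI[of _ "11 / 128"], rule exI[of _ "\<lambda>\<rho>. 11 * pi / (16 * \<rho>)"], intro conjI allI impI, goal_cases)
    case 1
    show ?case by (rule anti) auto
  next
    case 2
    show ?case by simp
  next
    case 3
    show ?case by (rule asymp_equiv_refl)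
  next
    case (4 c)
    show ?case
    \<comment> \<open>The witness solves 4 \<pi> c / ((8 - c) \<rho>) = 8 \<pi>; it is at most 1 /
      14, below 11 / 128.\<close>
    proof (rule exI[of _ "c / (2 * (8 - c))"], rule exI[of _ "\<lambda>\<rho>. 4 * pi * c / ((8 - c) * \<rho>)"], intro conjI allI impI)
      show "0 < c / (2 * (8 - c))" "c / (2 * (8 - c)) < 11 / 128" using 4 by (auto simp: field_simps)
      show "strict_antimono_on {0<..c / (2 * (8 - c))} (\<lambda>\<rho>. 4 * pi * c / ((8 - c) * \<rho>))"
        by (rule anti) (use 4 in auto)
      show "4 * pi * c / ((8 - c) * (c / (2 * (8 - c)))) = 8 * pi" using 4 by (simp add: field_simps)
    qed (rule asymp_equiv_refl, use 4 mean_field_solutions_thin[of c] in blast)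
  qed
next
  case 2
  show ?case
  \<comment> \<open>3968 / \<pi> solves \<pi>^2 N / 496 = 8 \<pi>. With exact linear formulas the
    O(1) terms are 0.\<close>
  proof (rule exI[of _ "3968 / pi"], rule exI[of _ "\<lambda>N. pi\<^sup>2 * N / 496"],
      rule exI[of _ "\<lambda>N. 33 * sqrt 3 * N / (16 * pi)"], intro conjI)
    have "pi * pi \<le> 4 * 4" using pi_less_4 by (intro mult_mono) auto
    then show "4 * pi < 3968 / pi" by (simp add: field_simps)
    show "strict_mono_on {3968 / pi..} (\<lambda>N. pi\<^sup>2 * N / 496)"
      "strict_mono_on {3968 / pi..} (\<lambda>N. 33 * sqrt 3 * N / (16 * pi))"
      by (auto simp: monotone_on_def divide_strict_right_mono)
    show "pi\<^sup>2 * (3968 / pi) / 496 = 8 * pi" by (simp add: power2_eq_square)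
  qed (use mean_field_solutions_convex in auto)
qed

end
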